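(* Let $\mathcal{C}$ be a braided fusion category over $K$. Assume that $V$ is a simple object of $\mathcal{C}$ and that the Nichols algebra $\mathrm{B}(V)$ is finite dimensional. Then $\mathrm{B}(V)$ is rigid.
   Context: $K$ is an algebraically closed field of characteristic zero. A braided fusion category over $K$ is a $K$-linear semisimple abelian rigid monoidal category with finite dimensional Hom-spaces, finitely many isomorphism classes of simple objects, simple unit object $\mathbf{1}$, equipped with a braiding $\sigma$. A Hopf algebra in $\mathcal{C}$ is an object $R$ with structure morphisms $m:R\otimes R\to R$, $u:\mathbf{1}\to R$, $\Delta:R\to R\otimes R$, $\epsilon:R\to\mathbf{1}$, $S:R\to R$ satisfying the usual axioms, where multiplicativity of $\Delta$ reads $\Delta m=(m\otimes m)(\mathrm{id}\otimes\sigma_{R,R}\otimes \mathrm{id})(\Delta\otimes\Delta)$. Hopf algebras are also considered in $\mathrm{Ind}(\mathcal{C})$; "finite dimensional" means that the object lies in $\mathcal{C}$. An algebra $A$ in $\mathcal{C}$ is connected if $A/J(A)\cong\mathbf{1}$, where $J(A)$ is the largest nilpotent ideal of $A$. A coalgebra $C$ is coconnected if the dual algebra $C^*$ is connected. A Hopf algebra is connected coconnected (ccc) if it is connected as an algebra and coconnected as a coalgebra. $\mathrm{P}(R)=\mathrm{Ker}(\Delta-u\otimes \mathrm{id}-\mathrm{id}\otimes u)$ is the subobject of primitive elements. For $V\in\mathcal{C}$, the Nichols algebra $\mathrm{B}(V)$ is the unique Hopf algebra in $\mathrm{Ind}(\mathcal{C})$ graded by the non-negative integers as a Hopf algebra,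 with $\mathrm{B}(V)_0=\mathbf{1}$, $\mathrm{B}(V)_1=V$, generated by $V$, and with $\mathrm{P}(\mathrm{B}(V))=V$. If finite dimensional, it is ccc. For $B\in\mathcal{C}$, $X_B$ is the set of all tuples $(m,u,\Delta,\epsilon,S)$ in the affine space $\mathbb{A}^N=\mathrm{Hom}_{\mathcal{C}}(B\otimes B,B)\oplus\mathrm{Hom}_{\mathcal{C}}(\mathbf{1},B)\oplus\mathrm{Hom}_{\mathcal{C}}(B,B\otimes B)\oplus\mathrm{Hom}_{\mathcal{C}}(B,\mathbf{1})\oplus\mathrm{Hom}_{\mathcal{C}}(B,B)$ that define a ccc Hopf algebra structure on $B$; it is a Zariski closed subset of $\mathbb{A}^N$. The algebraic group $\Gamma_B=\mathrm{Aut}_{\mathcal{C}}(B)$ acts on $X_B$ by transport of structure (conjugation), and the orbit of $R$ is denoted $\mathcal{O}_R$; orbits correspond to isomorphism classes of ccc Hopf algebras with underlying object isomorphic to $B$. Rigidity: a Hopf algebra $R\in X_B$ is called rigid if, for every $R'\in X_B$, $R\in\overline{\mathcal{O}_{R'}}$ (Zariski closure) implies $R\cong R'$ as Hopf algebras. For $\mathrm{B}(V)$, one takes $B$ to be its underlying object. *)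

theory Defs
  imports "HOL-Computational_Algebra.Computational_Algebra"
begin

section \<open>Braided linear categories: data\<close>

text \<open>
  Objects have type \<^typ>\<open>'o\<close>, morphisms type \<^typ>\<open>'m\<close>; the ground field is the type \<^typ>\<open>'k\<close>.
  Every morphism determines its source and target (axiom \<open>Hom_disjoint\<close> below), so composition,
  addition etc. need no object arguments; their values outside the appropriate hom-sets are
  irrelevant. The monoidal structure is not assumed to be strict:
  \<open>\<alpha> a b c\<close> is the associator \<open>(a \<otimes> b) \<otimes> c \<rightarrow> a \<otimes> (b \<otimes> c)\<close>, \<open>\<ll> a\<close> and \<open>\<rr> a\<close> are the
  unit constraints \<open>\<one> \<otimes> a \<rightarrow> a\<close> and \<open>a \<otimes> \<one> \<rightarrow> a\<close>, and \<open>\<sigma> a b\<close> is the braiding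
  \<open>a \<otimes> b \<rightarrow> b \<otimes> a\<close>.
\<close>

record ('o, 'm, 'k) bcat =
  Ob :: "'o set" ("Ob\<index>")
  Hom :: "'o \<Rightarrow> 'o \<Rightarrow> 'm set" ("Hom\<index>")
  ident :: "'o \<Rightarrow> 'm" ("Id\<index>")
  comp :: "'m \<Rightarrow> 'm \<Rightarrow> 'm" (infixr "\<cdot>\<index>" 65)
  zero_mor :: "'o \<Rightarrow> 'o \<Rightarrow> 'm" ("\<zero>\<index>")
  add_mor :: "'m \<Rightarrow> 'm \<Rightarrow> 'm" (infixl "\<oplus>\<index>" 60)
  scale_mor :: "'k \<Rightarrow> 'm \<Rightarrow> 'm" (infixr "\<odot>\<index>" 70)
  unit_ob :: "'o" ("\<one>\<index>")
  tensor_ob :: "'o \<Rightarrow> 'o \<Rightarrow> 'o" (infixr "\<otimes>\<index>" 80)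
  tensor_mor :: "'m \<Rightarrow> 'm \<Rightarrow> 'm" (infixr "\<otimes>\<^sub>m\<index>" 75)
  assoc :: "'o \<Rightarrow> 'o \<Rightarrow> 'o \<Rightarrow> 'm" ("\<alpha>\<index>")
  lunit :: "'o \<Rightarrow> 'm" ("\<ll>\<index>")
  runit :: "'o \<Rightarrow> 'm" ("\<rr>\<index>")
  braid :: "'o \<Rightarrow> 'o \<Rightarrow> 'm" ("\<sigma>\<index>")

section \<open>Notions in linear and monoidal categories\<close>

context
  fixes C :: "('o, 'm, 'k::field) bcat" (structure)
begin

definition inverse_arrows :: "'o \<Rightarrow> 'o \<Rightarrow> 'm \<Rightarrow> 'm \<Rightarrow> bool" where
  "inverse_arrows a b f g \<longleftrightarrow>
     f \<in> Hom a b \<and> g \<in> Hom b a \<and> g \<cdot> f = Id a \<and> f \<cdot> g = Id b"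

definition iso :: "'o \<Rightarrow> 'o \<Rightarrow> 'm \<Rightarrow> bool" where
  "iso a b f \<longleftrightarrow> (\<exists>g. inverse_arrows a b f g)"

definition isomorphic :: "'o \<Rightarrow> 'o \<Rightarrow> bool" where
  "isomorphic a b \<longleftrightarrow> (\<exists>f. iso a b f)"

definition inv_arr :: "'m \<Rightarrow> 'm" where
  "inv_arr f = (THE g. \<exists>a b. inverse_arrows a b f g)"

definition mono_arr :: "'o \<Rightarrow> 'o \<Rightarrow> 'm \<Rightarrow> bool" where
  "mono_arr a b f \<longleftrightarrow> f \<in> Hom a b \<and>
     (\<forall>x g h. g \<in> Hom x a \<longrightarrow> h \<in> Hom x a \<longrightarrow> f \<cdot> g = f \<cdot> h \<longrightarrow> g = h)"

definition epi_arr :: "'o \<Rightarrow> 'o \<Rightarrow> 'm \<Rightarrow> bool" where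
  "epi_arr a b f \<longleftrightarrow> f \<in> Hom a b \<and>
     (\<forall>x g h. g \<in> Hom b x \<longrightarrow> h \<in> Hom b x \<longrightarrow> g \<cdot> f = h \<cdot> f \<longrightarrow> g = h)"

definition diff_mor :: "'m \<Rightarrow> 'm \<Rightarrow> 'm" where
  "diff_mor f g = f \<oplus> (- 1) \<odot> g"

definition zero_ob :: "'o \<Rightarrow> bool" where
  "zero_ob a \<longleftrightarrow> a \<in> Ob \<and> Id a = \<zero> a a"

definition kernel :: "'o \<Rightarrow> 'm \<Rightarrow> 'o \<Rightarrow> 'o \<Rightarrow> 'm \<Rightarrow> bool" where
  "kernel k i a b f \<longleftrightarrow> i \<in> Hom k a \<and> f \<in> Hom a b \<and> f \<cdot> i = \<zero> k b \<and>
     (\<forall>x g. g \<in> Hom x a \<longrightarrow> f \<cdot> g = \<zero> x b \<longrightarrow> (\<exists>!h. h \<in> Hom x k \<and> i \<cdot> h = g))"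

definition cokernel :: "'o \<Rightarrow> 'm \<Rightarrow> 'o \<Rightarrow> 'o \<Rightarrow> 'm \<Rightarrow> bool" where
  "cokernel q p a b f \<longleftrightarrow> p \<in> Hom b q \<and> f \<in> Hom a b \<and> p \<cdot> f = \<zero> a q \<and>
     (\<forall>x g. g \<in> Hom b x \<longrightarrow> g \<cdot> f = \<zero> a x \<longrightarrow> (\<exists>!h. h \<in> Hom q x \<and> h \<cdot> p = g))"

primrec sum_mor :: "'o \<Rightarrow> 'o \<Rightarrow> (nat \<Rightarrow> 'm) \<Rightarrow> nat \<Rightarrow> 'm" where
  "sum_mor a b f 0 = \<zero> a b"
| "sum_mor a b f (Suc n) = sum_mor a b f n \<oplus> f n"

text \<open>\<open>c\<close> is the direct sum of \<open>X 0, \<dots>, X (n - 1)\<close> with inclusions \<open>\<iota> k\<close> and projections \<open>\<pi> k\<close>.\<close>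

definition direct_sum ::
    "'o \<Rightarrow> nat \<Rightarrow> (nat \<Rightarrow> 'o) \<Rightarrow> (nat \<Rightarrow> 'm) \<Rightarrow> (nat \<Rightarrow> 'm) \<Rightarrow> bool" where
  "direct_sum c n X \<iota> \<pi> \<longleftrightarrow> c \<in> Ob \<and>
     (\<forall>k<n. \<iota> k \<in> Hom (X k) c \<and> \<pi> k \<in> Hom c (X k)) \<and>
     (\<forall>k<n. \<forall>l<n. \<pi> k \<cdot> \<iota> l = (if k = l then Id (X k) else \<zero> (X l) (X k))) \<and>
     sum_mor c c (\<lambda>k. \<iota> k \<cdot> \<pi> k) n = Id c"

definition simple :: "'o \<Rightarrow> bool" where
  "simple a \<longleftrightarrow> a \<in> Ob \<and> \<not> zero_ob a \<and>
     (\<forall>x i. mono_arr x a i \<longrightarrow> zero_ob x \<or> iso x a i)"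

text \<open>\<open>d\<close> is a left dual of \<open>v\<close>, and \<open>v\<close> is a right dual of \<open>d\<close>.\<close>

definition left_dual :: "'o \<Rightarrow> 'o \<Rightarrow> 'm \<Rightarrow> 'm \<Rightarrow> bool" where
  "left_dual d v ev coev \<longleftrightarrow> d \<in> Ob \<and> v \<in> Ob \<and>
     ev \<in> Hom (d \<otimes> v) \<one> \<and> coev \<in> Hom \<one> (v \<otimes> d) \<and>
     \<rr> v \<cdot> (Id v \<otimes>\<^sub>m ev) \<cdot> \<alpha> v d v \<cdot> (coev \<otimes>\<^sub>m Id v) = \<ll> v \<and>
     \<ll> d \<cdot> (ev \<otimes>\<^sub>m Id d) \<cdot> inv_arr (\<alpha> d v d) \<cdot> (Id d \<otimes>\<^sub>m coev) = \<rr> d"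

end

section \<open>Braided fusion categories\<close>

text \<open>The axiom \<open>Hom_Ob\<close> is a convention: only objects have nonempty hom-sets.\<close>

locale plain_category =
  fixes C :: "('o, 'm, 'k::field) bcat" (structure)
  assumes Hom_Ob: "f \<in> Hom a b \<Longrightarrow> a \<in> Ob \<and> b \<in> Ob"
    and Hom_disjoint: "f \<in> Hom a b \<Longrightarrow> f \<in> Hom a' b' \<Longrightarrow> a = a' \<and> b = b'"
    and Id_Hom: "a \<in> Ob \<Longrightarrow> Id a \<in> Hom a a"
    and comp_Hom: "f \<in> Hom a b \<Longrightarrow> g \<in> Hom b c \<Longrightarrow> g \<cdot> f \<in> Hom a c"
    and comp_Id_left: "f \<in> Hom a b \<Longrightarrow> Id b \<cdot> f = f"
    and comp_Id_right: "f \<in> Hom a b \<Longrightarrow> f \<cdot> Id a = f"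
    and comp_assoc: "f \<in> Hom a b \<Longrightarrow> g \<in> Hom b c \<Longrightarrow> h \<in> Hom c d \<Longrightarrow>
      (h \<cdot> g) \<cdot> f = h \<cdot> (g \<cdot> f)"

locale linear_category = plain_category +
  assumes zero_Hom: "a \<in> Ob \<Longrightarrow> b \<in> Ob \<Longrightarrow> \<zero> a b \<in> Hom a b"
    and add_Hom: "f \<in> Hom a b \<Longrightarrow> g \<in> Hom a b \<Longrightarrow> f \<oplus> g \<in> Hom a b"
    and scale_Hom: "f \<in> Hom a b \<Longrightarrow> s \<odot> f \<in> Hom a b"
    and add_assoc: "f \<in> Hom a b \<Longrightarrow> g \<in> Hom a b \<Longrightarrow> h \<in> Hom a b \<Longrightarrow>
      (f \<oplus> g) \<oplus> h = f \<oplus> (g \<oplus> h)"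
    and add_commute: "f \<in> Hom a b \<Longrightarrow> g \<in> Hom a b \<Longrightarrow> f \<oplus> g = g \<oplus> f"
    and add_zero: "f \<in> Hom a b \<Longrightarrow> f \<oplus> \<zero> a b = f"
    and add_inverse: "f \<in> Hom a b \<Longrightarrow> f \<oplus> (- 1) \<odot> f = \<zero> a b"
    and scale_one: "f \<in> Hom a b \<Longrightarrow> 1 \<odot> f = f"
    and scale_scale: "f \<in> Hom a b \<Longrightarrow> s \<odot> t \<odot> f = (s * t) \<odot> f"
    and scale_add_left: "f \<in> Hom a b \<Longrightarrow> (s + t) \<odot> f = s \<odot> f \<oplus> t \<odot> f"
    and scale_add_right: "f \<in> Hom a b \<Longrightarrow> g \<in> Hom a b \<Longrightarrow>
      s \<odot> (f \<oplus> g) = s \<odot> f \<oplus> s \<odot> g"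
    and comp_add_left: "f \<in> Hom a b \<Longrightarrow> g \<in> Hom b c \<Longrightarrow> h \<in> Hom b c \<Longrightarrow>
      (g \<oplus> h) \<cdot> f = g \<cdot> f \<oplus> h \<cdot> f"
    and comp_add_right: "f \<in> Hom a b \<Longrightarrow> g \<in> Hom a b \<Longrightarrow> h \<in> Hom b c \<Longrightarrow>
      h \<cdot> (f \<oplus> g) = h \<cdot> f \<oplus> h \<cdot> g"
    and comp_scale_left: "f \<in> Hom a b \<Longrightarrow> g \<in> Hom b c \<Longrightarrow> (s \<odot> g) \<cdot> f = s \<odot> (g \<cdot> f)"
    and comp_scale_right: "f \<in> Hom a b \<Longrightarrow> g \<in> Hom b c \<Longrightarrow> g \<cdot> (s \<odot> f) = s \<odot> (g \<cdot> f)"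

locale abelian_linear_category = linear_category +
  assumes direct_sum_exists: "(\<forall>k<n. X k \<in> Ob) \<Longrightarrow> \<exists>c \<iota> \<pi>. direct_sum C c n X \<iota> \<pi>"
    and kernel_exists: "f \<in> Hom a b \<Longrightarrow> \<exists>k i. kernel C k i a b f"
    and cokernel_exists: "f \<in> Hom a b \<Longrightarrow> \<exists>q p. cokernel C q p a b f"
    and mono_normal: "mono_arr C a b f \<Longrightarrow> \<exists>c g. kernel C a f b c g"
    and epi_conormal: "epi_arr C a b f \<Longrightarrow> \<exists>c g. cokernel C b f c a g"

locale monoidal_linear_category = linear_category +
  assumes unit_Ob: "\<one> \<in> Ob"
    and tensor_Ob: "a \<in> Ob \<Longrightarrow> b \<in> Ob \<Longrightarrow> a \<otimes> b \<in> Ob"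
    and tensor_Hom: "f \<in> Hom a b \<Longrightarrow> g \<in> Hom c d \<Longrightarrow> f \<otimes>\<^sub>m g \<in> Hom (a \<otimes> c) (b \<otimes> d)"
    and tensor_Id: "a \<in> Ob \<Longrightarrow> b \<in> Ob \<Longrightarrow> Id a \<otimes>\<^sub>m Id b = Id (a \<otimes> b)"
    and tensor_comp: "f \<in> Hom a b \<Longrightarrow> g \<in> Hom b c \<Longrightarrow> f' \<in> Hom a' b' \<Longrightarrow> g' \<in> Hom b' c' \<Longrightarrow>
      (g \<cdot> f) \<otimes>\<^sub>m (g' \<cdot> f') = (g \<otimes>\<^sub>m g') \<cdot> (f \<otimes>\<^sub>m f')"
    and tensor_add_left: "f \<in> Hom a b \<Longrightarrow> g \<in> Hom a b \<Longrightarrow> h \<in> Hom c d \<Longrightarrow>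
      (f \<oplus> g) \<otimes>\<^sub>m h = (f \<otimes>\<^sub>m h) \<oplus> (g \<otimes>\<^sub>m h)"
    and tensor_add_right: "f \<in> Hom a b \<Longrightarrow> g \<in> Hom a b \<Longrightarrow> h \<in> Hom c d \<Longrightarrow>
      h \<otimes>\<^sub>m (f \<oplus> g) = (h \<otimes>\<^sub>m f) \<oplus> (h \<otimes>\<^sub>m g)"
    and tensor_scale_left: "f \<in> Hom a b \<Longrightarrow> g \<in> Hom c d \<Longrightarrow>
      (s \<odot> f) \<otimes>\<^sub>m g = s \<odot> (f \<otimes>\<^sub>m g)"
    and tensor_scale_right: "f \<in> Hom a b \<Longrightarrow> g \<in> Hom c d \<Longrightarrow>
      f \<otimes>\<^sub>m (s \<odot> g) = s \<odot> (f \<otimes>\<^sub>m g)"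
    and assoc_iso: "a \<in> Ob \<Longrightarrow> b \<in> Ob \<Longrightarrow> c \<in> Ob \<Longrightarrow>
      iso C ((a \<otimes> b) \<otimes> c) (a \<otimes> (b \<otimes> c)) (\<alpha> a b c)"
    and assoc_natural: "f \<in> Hom a a' \<Longrightarrow> g \<in> Hom b b' \<Longrightarrow> h \<in> Hom c c' \<Longrightarrow>
      \<alpha> a' b' c' \<cdot> ((f \<otimes>\<^sub>m g) \<otimes>\<^sub>m h) = (f \<otimes>\<^sub>m (g \<otimes>\<^sub>m h)) \<cdot> \<alpha> a b c"
    and lunit_iso: "a \<in> Ob \<Longrightarrow> iso C (\<one> \<otimes> a) a (\<ll> a)"
    and lunit_natural: "f \<in> Hom a b \<Longrightarrow> \<ll> b \<cdot> (Id \<one> \<otimes>\<^sub>m f) = f \<cdot> \<ll> a"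
    and runit_iso: "a \<in> Ob \<Longrightarrow> iso C (a \<otimes> \<one>) a (\<rr> a)"
    and runit_natural: "f \<in> Hom a b \<Longrightarrow> \<rr> b \<cdot> (f \<otimes>\<^sub>m Id \<one>) = f \<cdot> \<rr> a"
    and pentagon: "a \<in> Ob \<Longrightarrow> b \<in> Ob \<Longrightarrow> c \<in> Ob \<Longrightarrow> d \<in> Ob \<Longrightarrow>
      (Id a \<otimes>\<^sub>m \<alpha> b c d) \<cdot> \<alpha> a (b \<otimes> c) d \<cdot> (\<alpha> a b c \<otimes>\<^sub>m Id d) =
      \<alpha> a b (c \<otimes> d) \<cdot> \<alpha> (a \<otimes> b) c d"
    and triangle: "a \<in> Ob \<Longrightarrow> b \<in> Ob \<Longrightarrow>
      (Id a \<otimes>\<^sub>m \<ll> b) \<cdot> \<alpha> a \<one> b = \<rr> a \<otimes>\<^sub>m Id b"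

locale braided_linear_category = monoidal_linear_category +
  assumes braid_iso: "a \<in> Ob \<Longrightarrow> b \<in> Ob \<Longrightarrow> iso C (a \<otimes> b) (b \<otimes> a) (\<sigma> a b)"
    and braid_natural: "f \<in> Hom a a' \<Longrightarrow> g \<in> Hom b b' \<Longrightarrow>
      \<sigma> a' b' \<cdot> (f \<otimes>\<^sub>m g) = (g \<otimes>\<^sub>m f) \<cdot> \<sigma> a b"
    and hexagon1: "a \<in> Ob \<Longrightarrow> b \<in> Ob \<Longrightarrow> c \<in> Ob \<Longrightarrow>
      \<alpha> b c a \<cdot> \<sigma> a (b \<otimes> c) \<cdot> \<alpha> a b c =
      (Id b \<otimes>\<^sub>m \<sigma> a c) \<cdot> \<alpha> b a c \<cdot> (\<sigma> a b \<otimes>\<^sub>m Id c)"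
    and hexagon2: "a \<in> Ob \<Longrightarrow> b \<in> Ob \<Longrightarrow> c \<in> Ob \<Longrightarrow>
      inv_arr C (\<alpha> c a b) \<cdot> \<sigma> (a \<otimes> b) c \<cdot> inv_arr C (\<alpha> a b c) =
      (\<sigma> a c \<otimes>\<^sub>m Id b) \<cdot> inv_arr C (\<alpha> a c b) \<cdot> (Id a \<otimes>\<^sub>m \<sigma> b c)"

locale braided_fusion_category = abelian_linear_category C + braided_linear_category C
  for C :: "('o, 'm, 'k::{alg_closed_field, field_char_0}) bcat" (structure) +
  assumes semisimple: "a \<in> Ob \<Longrightarrow>
      \<exists>n X \<iota> \<pi>. (\<forall>k<n. simple C (X k)) \<and> direct_sum C a n X \<iota> \<pi>"
    and left_dual_exists: "a \<in> Ob \<Longrightarrow> \<exists>d ev coev. left_dual C d a ev coev"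
    and right_dual_exists: "a \<in> Ob \<Longrightarrow> \<exists>d ev coev. left_dual C a d ev coev"
    and finite_dim_Hom: "a \<in> Ob \<Longrightarrow> b \<in> Ob \<Longrightarrow>
      \<exists>n e. (\<forall>k<n. e k \<in> Hom a b) \<and>
        (\<forall>f\<in>Hom a b. \<exists>s. f = sum_mor C a b (\<lambda>k. s k \<odot> e k) n)"
    and finitely_many_simples: "\<exists>S. finite S \<and> (\<forall>a. simple C a \<longrightarrow> (\<exists>x\<in>S. isomorphic C a x))"
    and unit_simple: "simple C \<one>"

section \<open>Algebras, coalgebras, Hopf algebras\<close>

record 'm hopf_data =
  mult :: 'm
  unt :: 'm
  comult :: 'm
  counit :: 'm
  antipode :: 'm

context
  fixes C :: "('o, 'm, 'k::field) bcat" (structure)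
begin

definition algebra :: "'o \<Rightarrow> 'm \<Rightarrow> 'm \<Rightarrow> bool" where
  "algebra a m u \<longleftrightarrow> a \<in> Ob \<and> m \<in> Hom (a \<otimes> a) a \<and> u \<in> Hom \<one> a \<and>
     m \<cdot> (m \<otimes>\<^sub>m Id a) = m \<cdot> (Id a \<otimes>\<^sub>m m) \<cdot> \<alpha> a a a \<and>
     m \<cdot> (u \<otimes>\<^sub>m Id a) = \<ll> a \<and>
     m \<cdot> (Id a \<otimes>\<^sub>m u) = \<rr> a"

definition coalgebra :: "'o \<Rightarrow> 'm \<Rightarrow> 'm \<Rightarrow> bool" where
  "coalgebra a \<Delta> \<epsilon> \<longleftrightarrow> a \<in> Ob \<and> \<Delta> \<in> Hom a (a \<otimes> a) \<and> \<epsilon> \<in> Hom a \<one> \<and>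
     \<alpha> a a a \<cdot> (\<Delta> \<otimes>\<^sub>m Id a) \<cdot> \<Delta> = (Id a \<otimes>\<^sub>m \<Delta>) \<cdot> \<Delta> \<and>
     \<ll> a \<cdot> (\<epsilon> \<otimes>\<^sub>m Id a) \<cdot> \<Delta> = Id a \<and>
     \<rr> a \<cdot> (Id a \<otimes>\<^sub>m \<epsilon>) \<cdot> \<Delta> = Id a"

text \<open>
  \<open>id \<otimes> \<sigma> \<otimes> id\<close> on \<open>(a \<otimes> a) \<otimes> (a \<otimes> a)\<close>, with the associators inserted.
\<close>

definition mid_braid :: "'o \<Rightarrow> 'm" where
  "mid_braid a =
     inv_arr C (\<alpha> a a (a \<otimes> a)) \<cdot> (Id a \<otimes>\<^sub>m \<alpha> a a a) \<cdot> (Id a \<otimes>\<^sub>m (\<sigma> a a \<otimes>\<^sub>m Id a)) \<cdot>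
     (Id a \<otimes>\<^sub>m inv_arr C (\<alpha> a a a)) \<cdot> \<alpha> a a (a \<otimes> a)"

definition hopf_algebra :: "'o \<Rightarrow> 'm hopf_data \<Rightarrow> bool" where
  "hopf_algebra a R \<longleftrightarrow>
     algebra a (mult R) (unt R) \<and> coalgebra a (comult R) (counit R) \<and>
     comult R \<cdot> mult R = (mult R \<otimes>\<^sub>m mult R) \<cdot> mid_braid a \<cdot> (comult R \<otimes>\<^sub>m comult R) \<and>
     comult R \<cdot> unt R \<cdot> \<ll> \<one> = unt R \<otimes>\<^sub>m unt R \<and>
     counit R \<cdot> mult R = \<ll> \<one> \<cdot> (counit R \<otimes>\<^sub>m counit R) \<and>
     counit R \<cdot> unt R = Id \<one> \<and>
     antipode R \<in> Hom a a \<and>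
     mult R \<cdot> (antipode R \<otimes>\<^sub>m Id a) \<cdot> comult R = unt R \<cdot> counit R \<and>
     mult R \<cdot> (Id a \<otimes>\<^sub>m antipode R) \<cdot> comult R = unt R \<cdot> counit R"

definition hopf_iso :: "'o \<Rightarrow> 'm hopf_data \<Rightarrow> 'o \<Rightarrow> 'm hopf_data \<Rightarrow> 'm \<Rightarrow> bool" where
  "hopf_iso a R b R' f \<longleftrightarrow> iso C a b f \<and>
     f \<cdot> mult R = mult R' \<cdot> (f \<otimes>\<^sub>m f) \<and>
     f \<cdot> unt R = unt R' \<and>
     (f \<otimes>\<^sub>m f) \<cdot> comult R = comult R' \<cdot> f \<and>
     counit R = counit R' \<cdot> f \<and>
     f \<cdot> antipode R = antipode R' \<cdot> f"

definition hopf_isomorphic :: "'o \<Rightarrow> 'm hopf_data \<Rightarrow> 'o \<Rightarrow> 'm hopf_data \<Rightarrow> bool" where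
  "hopf_isomorphic a R b R' \<longleftrightarrow> (\<exists>f. hopf_iso a R b R' f)"

subsection \<open>Connected algebras and coconnected coalgebras\<close>

definition ideal :: "'o \<Rightarrow> 'm \<Rightarrow> 'o \<Rightarrow> 'm \<Rightarrow> bool" where
  "ideal a m x j \<longleftrightarrow> mono_arr C x a j \<and>
     (\<exists>l \<in> Hom (a \<otimes> x) x. m \<cdot> (Id a \<otimes>\<^sub>m j) = j \<cdot> l) \<and>
     (\<exists>r \<in> Hom (x \<otimes> a) x. m \<cdot> (j \<otimes>\<^sub>m Id a) = j \<cdot> r)"

text \<open>
  \<open>tensor_power x n\<close> is the \<open>(n + 1)\<close>-fold tensor power, and \<open>mult_power m x j n\<close> is the
  \<open>(n + 1)\<close>-fold multiplication restricted to it; its image is the power \<open>J^(n + 1)\<close> of the ideal.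
\<close>

primrec tensor_power :: "'o \<Rightarrow> nat \<Rightarrow> 'o" where
  "tensor_power x 0 = x"
| "tensor_power x (Suc n) = tensor_power x n \<otimes> x"

primrec mult_power :: "'m \<Rightarrow> 'm \<Rightarrow> nat \<Rightarrow> 'm" where
  "mult_power m j 0 = j"
| "mult_power m j (Suc n) = m \<cdot> (mult_power m j n \<otimes>\<^sub>m j)"

definition nilpotent_ideal :: "'o \<Rightarrow> 'm \<Rightarrow> 'o \<Rightarrow> 'm \<Rightarrow> bool" where
  "nilpotent_ideal a m x j \<longleftrightarrow> ideal a m x j \<and>
     (\<exists>n. mult_power m j n = \<zero> (tensor_power x n) a)"

definition largest_nilpotent_ideal :: "'o \<Rightarrow> 'm \<Rightarrow> 'o \<Rightarrow> 'm \<Rightarrow> bool" where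
  "largest_nilpotent_ideal a m x j \<longleftrightarrow> nilpotent_ideal a m x j \<and>
     (\<forall>y i. nilpotent_ideal a m y i \<longrightarrow> (\<exists>h \<in> Hom y x. i = j \<cdot> h))"

text \<open>
  \<open>A/J(A) \<cong> \<one>\<close> as algebras, i.e. some algebra morphism \<open>A \<rightarrow> \<one>\<close> is a cokernel of \<open>J(A) \<rightarrow> A\<close>.
\<close>

definition connected_algebra :: "'o \<Rightarrow> 'm \<Rightarrow> 'm \<Rightarrow> bool" where
  "connected_algebra a m u \<longleftrightarrow> algebra a m u \<and>
     (\<exists>x j q. largest_nilpotent_ideal a m x j \<and> cokernel C \<one> q x a j \<and>
        q \<cdot> m = \<ll> \<one> \<cdot> (q \<otimes>\<^sub>m q) \<and> q \<cdot> u = Id \<one>)"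

text \<open>
  The nested pairing \<open>(d \<otimes> d) \<otimes> (a \<otimes> a) \<rightarrow> \<one>\<close> induced by \<open>ev : d \<otimes> a \<rightarrow> \<one>\<close>: the inner
  two factors are paired first. It identifies \<open>d \<otimes> d\<close> with the left dual of \<open>a \<otimes> a\<close>.
\<close>

definition nested_pairing :: "'o \<Rightarrow> 'o \<Rightarrow> 'm \<Rightarrow> 'm" where
  "nested_pairing d a ev =
     ev \<cdot> (Id d \<otimes>\<^sub>m \<ll> a) \<cdot> (Id d \<otimes>\<^sub>m (ev \<otimes>\<^sub>m Id a)) \<cdot>
     (Id d \<otimes>\<^sub>m inv_arr C (\<alpha> d a a)) \<cdot> \<alpha> d d (a \<otimes> a)"

text \<open>
  The dual algebra \<open>d = a\<^sup>*\<close>: its multiplication \<open>m\<close> and unit \<open>u\<close> are the transposes of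
  \<open>\<Delta>\<close> and \<open>\<epsilon>\<close>. The convention in the nested pairing is immaterial for coconnectedness: the other
  choices give isomorphic algebras or (braided) opposite ones, with the same nilpotent ideals.
\<close>

definition dual_algebra ::
    "'o \<Rightarrow> 'm \<Rightarrow> 'm \<Rightarrow> 'o \<Rightarrow> 'm \<Rightarrow> 'm \<Rightarrow> 'm \<Rightarrow> 'm \<Rightarrow> bool" where
  "dual_algebra a \<Delta> \<epsilon> d ev coev m u \<longleftrightarrow> left_dual C d a ev coev \<and>
     m \<in> Hom (d \<otimes> d) d \<and> u \<in> Hom \<one> d \<and>
     ev \<cdot> (m \<otimes>\<^sub>m Id a) = nested_pairing d a ev \<cdot> (Id (d \<otimes> d) \<otimes>\<^sub>m \<Delta>) \<and>
     ev \<cdot> (u \<otimes>\<^sub>m Id a) = \<epsilon> \<cdot> \<ll> a"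

definition coconnected_coalgebra :: "'o \<Rightarrow> 'm \<Rightarrow> 'm \<Rightarrow> bool" where
  "coconnected_coalgebra a \<Delta> \<epsilon> \<longleftrightarrow> coalgebra a \<Delta> \<epsilon> \<and>
     (\<exists>d ev coev m u. dual_algebra a \<Delta> \<epsilon> d ev coev m u \<and> connected_algebra d m u)"

definition ccc_hopf_algebra :: "'o \<Rightarrow> 'm hopf_data \<Rightarrow> bool" where
  "ccc_hopf_algebra a R \<longleftrightarrow> hopf_algebra a R \<and>
     connected_algebra a (mult R) (unt R) \<and> coconnected_coalgebra a (comult R) (counit R)"

subsection \<open>Nichols algebras\<close>

text \<open>The map \<open>\<Delta> - u \<otimes> id - id \<otimes> u : a \<rightarrow> a \<otimes> a\<close>, whose kernel is \<open>P(R)\<close>.\<close>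

definition primitive_map :: "'o \<Rightarrow> 'm hopf_data \<Rightarrow> 'm" where
  "primitive_map a R =
     diff_mor C (diff_mor C (comult R) ((unt R \<otimes>\<^sub>m Id a) \<cdot> inv_arr C (\<ll> a)))
       ((Id a \<otimes>\<^sub>m unt R) \<cdot> inv_arr C (\<rr> a))"

text \<open>
  A grading of \<open>R\<close> by the non-negative integers, \<open>a = \<Oplus>\<^sub>n X n\<close>. As \<open>a\<close> is an object of the
  fusion category itself, only finitely many components are nonzero.
\<close>

definition hopf_grading ::
    "'o \<Rightarrow> 'm hopf_data \<Rightarrow> (nat \<Rightarrow> 'o) \<Rightarrow> (nat \<Rightarrow> 'm) \<Rightarrow> (nat \<Rightarrow> 'm) \<Rightarrow> bool" where
  "hopf_grading a R X \<iota> \<pi> \<longleftrightarrow>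
     (\<forall>n. \<iota> n \<in> Hom (X n) a \<and> \<pi> n \<in> Hom a (X n)) \<and>
     (\<exists>N. direct_sum C a N X \<iota> \<pi> \<and> (\<forall>n\<ge>N. zero_ob C (X n))) \<and>
     (\<forall>i j k. k \<noteq> i + j \<longrightarrow>
        \<pi> k \<cdot> mult R \<cdot> (\<iota> i \<otimes>\<^sub>m \<iota> j) = \<zero> (X i \<otimes> X j) (X k)) \<and>
     (\<forall>k. k \<noteq> 0 \<longrightarrow> \<pi> k \<cdot> unt R = \<zero> \<one> (X k)) \<and>
     (\<forall>i j k. k \<noteq> i + j \<longrightarrow>
        (\<pi> i \<otimes>\<^sub>m \<pi> j) \<cdot> comult R \<cdot> \<iota> k = \<zero> (X k) (X i \<otimes> X j)) \<and>
     (\<forall>k. k \<noteq> 0 \<longrightarrow> counit R \<cdot> \<iota> k = \<zero> (X k) \<one>) \<and>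
     (\<forall>i k. k \<noteq> i \<longrightarrow> \<pi> k \<cdot> antipode R \<cdot> \<iota> i = \<zero> (X i) (X k))"

definition subalgebra :: "'o \<Rightarrow> 'm \<Rightarrow> 'm \<Rightarrow> 'o \<Rightarrow> 'm \<Rightarrow> bool" where
  "subalgebra a m u x j \<longleftrightarrow> mono_arr C x a j \<and>
     (\<exists>h \<in> Hom (x \<otimes> x) x. m \<cdot> (j \<otimes>\<^sub>m j) = j \<cdot> h) \<and>
     (\<exists>h \<in> Hom \<one> x. u = j \<cdot> h)"

definition generated_by :: "'o \<Rightarrow> 'm \<Rightarrow> 'm \<Rightarrow> 'o \<Rightarrow> 'm \<Rightarrow> bool" where
  "generated_by a m u v i \<longleftrightarrow>
     (\<forall>x j. subalgebra a m u x j \<longrightarrow> (\<exists>h \<in> Hom v x. i = j \<cdot> h) \<longrightarrow> iso C x a j)"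

text \<open>
  \<open>R\<close>, with underlying object \<open>b\<close>, is the Nichols algebra of \<open>v\<close>, and it is finite dimensional:
  the underlying object \<open>b\<close> lies in \<open>C\<close>, which is a full monoidal subcategory of \<open>Ind(C)\<close> closed
  under subobjects. The equality \<open>P(R) = v\<close> is one of subobjects of \<open>b\<close>.
\<close>

definition fd_nichols_algebra :: "'o \<Rightarrow> 'o \<Rightarrow> 'm hopf_data \<Rightarrow> bool" where
  "fd_nichols_algebra v b R \<longleftrightarrow> v \<in> Ob \<and> b \<in> Ob \<and> hopf_algebra b R \<and>
     (\<exists>X \<iota> \<pi>. hopf_grading b R X \<iota> \<pi> \<and> X 0 = \<one> \<and> X 1 = v \<and>
        generated_by b (mult R) (unt R) v (\<iota> 1) \<and>
        kernel C v (\<iota> 1) b (b \<otimes> b) (primitive_map b R))"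

section \<open>The variety of ccc Hopf algebra structures and rigidity\<close>

definition structure_space :: "'o \<Rightarrow> 'm hopf_data set" where
  "structure_space b = {R.
     mult R \<in> Hom (b \<otimes> b) b \<and> unt R \<in> Hom \<one> b \<and> comult R \<in> Hom b (b \<otimes> b) \<and>
     counit R \<in> Hom b \<one> \<and> antipode R \<in> Hom b b}"

definition add_data :: "'m hopf_data \<Rightarrow> 'm hopf_data \<Rightarrow> 'm hopf_data" where
  "add_data R R' =
     \<lparr>mult = mult R \<oplus> mult R', unt = unt R \<oplus> unt R', comult = comult R \<oplus> comult R',
      counit = counit R \<oplus> counit R', antipode = antipode R \<oplus> antipode R'\<rparr>"

definition scale_data :: "'k \<Rightarrow> 'm hopf_data \<Rightarrow> 'm hopf_data" where
  "scale_data s R =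
     \<lparr>mult = s \<odot> mult R, unt = s \<odot> unt R, comult = s \<odot> comult R,
      counit = s \<odot> counit R, antipode = s \<odot> antipode R\<rparr>"

definition linear_form :: "'o \<Rightarrow> ('m hopf_data \<Rightarrow> 'k) \<Rightarrow> bool" where
  "linear_form b p \<longleftrightarrow>
     (\<forall>R\<in>structure_space b. \<forall>R'\<in>structure_space b. p (add_data R R') = p R + p R') \<and>
     (\<forall>s. \<forall>R\<in>structure_space b. p (scale_data s R) = s * p R)"

text \<open>Polynomial functions on the affine space: the algebra generated by the linear forms.\<close>

inductive polynomial_function :: "'o \<Rightarrow> ('m hopf_data \<Rightarrow> 'k) \<Rightarrow> bool" for b where
  const: "polynomial_function b (\<lambda>R. s)"
| linear: "linear_form b p \<Longrightarrow> polynomial_function b p"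
| add: "polynomial_function b p \<Longrightarrow> polynomial_function b q \<Longrightarrow>
    polynomial_function b (\<lambda>R. p R + q R)"
| mult: "polynomial_function b p \<Longrightarrow> polynomial_function b q \<Longrightarrow>
    polynomial_function b (\<lambda>R. p R * q R)"

definition zariski_closure :: "'o \<Rightarrow> 'm hopf_data set \<Rightarrow> 'm hopf_data set" where
  "zariski_closure b S = {R \<in> structure_space b.
     \<forall>p. polynomial_function b p \<longrightarrow> (\<forall>Q\<in>S. p Q = 0) \<longrightarrow> p R = 0}"

definition ccc_structures :: "'o \<Rightarrow> 'm hopf_data set" where
  "ccc_structures b = {R \<in> structure_space b. ccc_hopf_algebra b R}"

definition transport :: "'m \<Rightarrow> 'm hopf_data \<Rightarrow> 'm hopf_data" where
  "transport g R = (let g' = inv_arr C g in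
     \<lparr>mult = g \<cdot> mult R \<cdot> (g' \<otimes>\<^sub>m g'), unt = g \<cdot> unt R,
      comult = (g \<otimes>\<^sub>m g) \<cdot> comult R \<cdot> g', counit = counit R \<cdot> g',
      antipode = g \<cdot> antipode R \<cdot> g'\<rparr>)"

definition hopf_orbit :: "'o \<Rightarrow> 'm hopf_data \<Rightarrow> 'm hopf_data set" where
  "hopf_orbit b R = {transport g R | g. iso C b b g}"

definition rigid_hopf_algebra :: "'o \<Rightarrow> 'm hopf_data \<Rightarrow> bool" where
  "rigid_hopf_algebra b R \<longleftrightarrow> R \<in> ccc_structures b \<and>
     (\<forall>R'\<in>ccc_structures b. R \<in> zariski_closure b (hopf_orbit b R') \<longrightarrow>
        hopf_isomorphic b R b R')"

end

end

theory Submission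
  imports Defs
begin

text \<open>
  Let \<open>R\<close> be the Nichols algebra of \<open>V\<close> and \<open>R'\<close> a ccc structure whose orbit closure contains \<open>R\<close>.
  Write \<open>J\<close> for the augmentation ideal. Three rank conditions hold at \<open>R\<close>: the unit, \<open>V\<close> and \<open>J\<^sup>2\<close> span;
  the primitives lie in \<open>V\<close>; and \<open>J\<^sup>2\<close> contains no primitives. Rank conditions are open, so they hold at
  some point of the orbit of \<open>R'\<close>, hence, up to a change of coordinates, for \<open>R'\<close> itself. As \<open>R'\<close> is
  coconnected it has nonzero primitives, and as it is connected \<open>J \<noteq> J\<^sup>2\<close>; since \<open>V\<close> is simple, this
  forces \<open>P(R') \<cong> V \<cong> J/J\<^sup>2\<close>, the composite being an isomorphism. By nilpotency of \<open>J\<close>, \<open>V\<close> generates \<open>R'\<close>.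

  Now consider the correspondence between \<open>R\<close> and \<open>R'\<close> generated by the two copies of \<open>V\<close>. It is stable
  under the skew derivation \<open>\<partial> = (id \<otimes> p) \<Delta>\<close>, where \<open>p\<close> projects onto \<open>V\<close>, because the braided Leibniz
  rule takes the same form on both sides. Hence the \<open>x\<close> in \<open>R\<close> related to \<open>0\<close> are stable under \<open>\<partial>\<close>
  and killed by \<open>\<epsilon>\<close>, and so vanish, since \<open>\<partial>\<close> is injective in positive degrees of a Nichols
  algebra. The correspondence is therefore a surjective Hopf algebra map \<open>R' \<rightarrow> R\<close>, and it is an
  isomorphism because both algebras live on the same object.
\<close>

section \<open>Total operations in a monoidal linear category\<close>

text \<open>Semicontinuity works in one direction only: \<open>R\<close> is a limit of copies of
  \<open>R'\<close>, so from \<open>R\<close> to \<open>R'\<close> the primitives can shrink and J^2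
  can grow, never the reverse. The ccc property gives the opposite bounds, and a simple V leaves no
  room between the two. The obstacle to a direct comparison is that \<open>R'\<close> has no
  grading, and its relations are unknown. A Nichols algebra has the most relations among Hopf
  algebras generated by V as primitives, so the map has to go from \<open>R'\<close> to
  \<open>R\<close>. Instead of checking relations, one works with a symmetric correspondence and
  shows only that it is single-valued towards \<open>R\<close>. The derivation is suited to this
  because the effect of right multiplication by V on it involves nothing but the braiding of V with
  itself. Every rank condition is encoded as invertibility of an endomorphism of B that depends
  polynomially on the structure and is the identity at \<open>R\<close>. Objects have no elements.
  Morphisms into B from arbitrary objects take their place, and predicates stable under
  precomposition play the role of subobjects.\<close>

context monoidal_linear_category
begin

definition arr :: "'b \<Rightarrow> bool" where
  "arr f \<longleftrightarrow> (\<exists>a b. f \<in> Hom a b)"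

text \<open>The default \<open>\<one>\<close> is an object, so that \<open>dm f \<in> Ob\<close>
  holds for every \<open>f\<close> and typing equations can be used unconditionally.\<close>

definition dm :: "'b \<Rightarrow> 'a" where
  "dm f = (if arr f then THE a. \<exists>b. f \<in> Hom a b else \<one>)"

definition cd :: "'b \<Rightarrow> 'a" where
  "cd f = (if arr f then THE b. \<exists>a. f \<in> Hom a b else \<one>)"

lemma dm_eq: "f \<in> Hom a b \<Longrightarrow> dm f = a"
  unfolding dm_def arr_def by (auto intro!: the_equality dest: Hom_disjoint)

lemma cd_eq: "f \<in> Hom a b \<Longrightarrow> cd f = b"
  unfolding cd_def arr_def by (auto intro!: the_equality dest: Hom_disjoint)

lemma Hom_iff: "f \<in> Hom a b \<longleftrightarrow> arr f \<and> dm f = a \<and> cd f = b"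
  by (metis arr_def cd_eq dm_eq)

lemma arr_Hom: "arr f \<Longrightarrow> f \<in> Hom (dm f) (cd f)"
  by (simp add: Hom_iff)

lemma dm_Ob [simp]: "dm f \<in> Ob"
  by (cases "arr f") (use arr_Hom Hom_Ob in \<open>auto simp: dm_def unit_Ob\<close>)

lemma cd_Ob [simp]: "cd f \<in> Ob"
  by (cases "arr f") (use arr_Hom Hom_Ob in \<open>auto simp: cd_def unit_Ob\<close>)

lemmas unit_Ob [simp] tensor_Ob [simp]

text \<open>
  The operations are extended to all arguments, with a zero morphism of the expected type as value
  where the original operation is meaningless. Then domains and codomains of composites are given by
  unconditional equations and composition is associative without side conditions.
\<close>

definition cmp :: "'b \<Rightarrow> 'b \<Rightarrow> 'b" (infixr "\<bullet>" 65) where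
  "g \<bullet> f = (if arr f \<and> arr g \<and> dm g = cd f then g \<cdot> f else \<zero> (dm f) (cd g))"

definition tns :: "'b \<Rightarrow> 'b \<Rightarrow> 'b" (infixr "\<star>" 75) where
  "f \<star> g = (if arr f \<and> arr g then f \<otimes>\<^sub>m g else \<zero> (dm f \<otimes> dm g) (cd f \<otimes> cd g))"

definition add :: "'b \<Rightarrow> 'b \<Rightarrow> 'b" (infixl "\<uplus>" 60) where
  "f \<uplus> g = (if arr f \<and> arr g \<and> dm f = dm g \<and> cd f = cd g then f \<oplus> g else \<zero> (dm f) (cd f))"

definition scl :: "'c \<Rightarrow> 'b \<Rightarrow> 'b" (infixr "\<triangleright>" 70) where
  "s \<triangleright> f = (if arr f then s \<odot> f else \<zero> (dm f) (cd f))"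

abbreviation ngt :: "'b \<Rightarrow> 'b" ("\<ominus> _" [71] 71) where
  "\<ominus> f \<equiv> (- 1) \<triangleright> f"

lemma zero_Hom' [simp]:
  assumes "a \<in> Ob" "b \<in> Ob"
  shows "arr (\<zero> a b)" "dm (\<zero> a b) = a" "cd (\<zero> a b) = b"
  using zero_Hom[OF assms] by (auto simp: Hom_iff)

lemma cmp_Hom [simp]: "arr (g \<bullet> f)" "dm (g \<bullet> f) = dm f" "cd (g \<bullet> f) = cd g"
  using comp_Hom[of f "dm f" "cd f" g "cd g"] by (auto simp: cmp_def Hom_iff)

lemma tns_Hom [simp]:
  "arr (f \<star> g)" "dm (f \<star> g) = dm f \<otimes> dm g" "cd (f \<star> g) = cd f \<otimes> cd g"
  using tensor_Hom[of f "dm f" "cd f" g "dm g" "cd g"] by (auto simp: tns_def Hom_iff)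

lemma add_Hom' [simp]: "arr (f \<uplus> g)" "dm (f \<uplus> g) = dm f" "cd (f \<uplus> g) = cd f"
  using add_Hom[of f "dm f" "cd f" g] by (auto simp: add_def Hom_iff)

lemma scl_Hom [simp]: "arr (s \<triangleright> f)" "dm (s \<triangleright> f) = dm f" "cd (s \<triangleright> f) = cd f"
  using scale_Hom[of f "dm f" "cd f" s] by (auto simp: scl_def Hom_iff)

lemma Id_Hom' [simp]:
  assumes "a \<in> Ob"
  shows "arr (Id a)" "dm (Id a) = a" "cd (Id a) = a"
  using Id_Hom[OF assms] by (auto simp: Hom_iff)

text \<open>The passage from the raw operations of the locales to the total ones, valid where the
  types match. The axioms are imported through it.\<close>

lemma tot:
  "arr f \<Longrightarrow> arr g \<Longrightarrow> dm g = cd f \<Longrightarrow> g \<cdot> f = g \<bullet> f"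
  "arr f \<Longrightarrow> arr g \<Longrightarrow> f \<otimes>\<^sub>m g = f \<star> g"
  "arr f \<Longrightarrow> arr g \<Longrightarrow> dm f = dm g \<Longrightarrow> cd f = cd g \<Longrightarrow> f \<oplus> g = f \<uplus> g"
  "arr f \<Longrightarrow> s \<odot> f = s \<triangleright> f"
  by (simp_all add: cmp_def tns_def add_def scl_def)

lemma diff_mor_tot:
  "arr f \<Longrightarrow> arr g \<Longrightarrow> dm f = dm g \<Longrightarrow> cd f = cd g \<Longrightarrow> diff_mor C f g = f \<uplus> \<ominus> g"
  by (simp add: diff_mor_def tot)

lemma not_arr:
  "\<not> arr f \<Longrightarrow> g \<bullet> f = \<zero> (dm f) (cd g)"
  "\<not> arr g \<Longrightarrow> g \<bullet> f = \<zero> (dm f) (cd g)"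
  "dm g \<noteq> cd f \<Longrightarrow> g \<bullet> f = \<zero> (dm f) (cd g)"
  "\<not> arr f \<Longrightarrow> f \<star> h = \<zero> (dm f \<otimes> dm h) (cd f \<otimes> cd h)"
  "\<not> arr h \<Longrightarrow> f \<star> h = \<zero> (dm f \<otimes> dm h) (cd f \<otimes> cd h)"
  "\<not> arr f \<Longrightarrow> f \<uplus> k = \<zero> (dm f) (cd f)"
  "\<not> arr k \<Longrightarrow> f \<uplus> k = \<zero> (dm f) (cd f)"
  "\<not> arr f \<Longrightarrow> s \<triangleright> f = \<zero> (dm f) (cd f)"
  by (simp_all add: cmp_def tns_def add_def scl_def)

lemma add_assoc': "dm f = dm g \<Longrightarrow> cd f = cd g \<Longrightarrow> dm g = dm h \<Longrightarrow> cd g = cd h \<Longrightarrow>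
   arr f \<Longrightarrow> arr g \<Longrightarrow> arr h \<Longrightarrow> (f \<uplus> g) \<uplus> h = f \<uplus> (g \<uplus> h)"
  using add_assoc[of f "dm f" "cd f" g h] by (simp add: Hom_iff tot)

lemma add_commute': "dm f = dm g \<Longrightarrow> cd f = cd g \<Longrightarrow> f \<uplus> g = g \<uplus> f"
  using add_commute[of f "dm f" "cd f" g] by (cases "arr f \<and> arr g") (auto simp: Hom_iff tot not_arr)

lemma add_left_commute': "dm f = dm g \<Longrightarrow> cd f = cd g \<Longrightarrow> dm g = dm h \<Longrightarrow> cd g = cd h \<Longrightarrow>
   arr f \<Longrightarrow> arr g \<Longrightarrow> arr h \<Longrightarrow> f \<uplus> (g \<uplus> h) = g \<uplus> (f \<uplus> h)"
  by (metis add_assoc' add_commute')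

lemmas add_ac' = add_assoc' add_commute' add_left_commute'

lemma add_zero_right [simp]: "arr f \<Longrightarrow> a = dm f \<Longrightarrow> b = cd f \<Longrightarrow> f \<uplus> \<zero> a b = f"
  using add_zero[of f "dm f" "cd f"] by (simp add: Hom_iff tot)

lemma add_zero_left [simp]: "arr f \<Longrightarrow> a = dm f \<Longrightarrow> b = cd f \<Longrightarrow> \<zero> a b \<uplus> f = f"
  using add_zero_right[of f a b] by (simp add: add_commute')

lemma add_ngt [simp]: "f \<uplus> \<ominus> f = \<zero> (dm f) (cd f)"
  using add_inverse[of f "dm f" "cd f"] by (cases "arr f") (auto simp: Hom_iff tot not_arr)

lemma ngt_add [simp]: "\<ominus> f \<uplus> f = \<zero> (dm f) (cd f)"
  using add_ngt[of f] by (simp add: add_commute' del: add_ngt)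

lemma add_ngt_cancel [simp]:
  assumes "dm f = dm g" "cd f = cd g" "arr f" "arr g"
  shows "f \<uplus> (\<ominus> f \<uplus> g) = g" "\<ominus> f \<uplus> (f \<uplus> g) = g"
  using assms by (simp_all add: add_assoc'[symmetric])

lemma add_left_imp_eq:
  assumes "f \<uplus> g = f \<uplus> h" "dm f = dm g" "cd f = cd g" "dm h = dm g" "cd h = cd g"
    "arr f" "arr g" "arr h"
  shows "g = h"
proof -
  have "g = \<ominus> f \<uplus> (f \<uplus> g)" using assms(2-) by (simp only: add_ngt_cancel)
  also have "\<dots> = h" unfolding assms(1) by (rule add_ngt_cancel(2)) (simp_all only: assms(2-))
  finally show ?thesis .
qed

lemma scl_one [simp]: "arr f \<Longrightarrow> 1 \<triangleright> f = f"
  using scale_one[of f "dm f" "cd f"] by (simp add: Hom_iff tot)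

lemma scl_add: "arr f \<Longrightarrow> arr g \<Longrightarrow> dm f = dm g \<Longrightarrow> cd f = cd g \<Longrightarrow>
    s \<triangleright> (f \<uplus> g) = s \<triangleright> f \<uplus> s \<triangleright> g"
  using scale_add_right[of f "dm f" "cd f" g s] by (simp add: Hom_iff tot)

lemma add_self_imp_zero: "f = f \<uplus> f \<Longrightarrow> arr f \<Longrightarrow> f = \<zero> (dm f) (cd f)"
  by (rule add_left_imp_eq[of f f]) simp_all

text \<open>Derived from the linear axioms: \<open>s \<triangleright> \<zero> a b\<close> equals its
  own double and therefore vanishes.\<close>

lemma scl_zero [simp]: "a \<in> Ob \<Longrightarrow> b \<in> Ob \<Longrightarrow> s \<triangleright> \<zero> a b = \<zero> a b"
  using add_self_imp_zero[OF trans[OF _ scl_add[of "\<zero> a b" "\<zero> a b" s]]] by simp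

lemma scl_scl [simp]: "s \<triangleright> t \<triangleright> f = (s * t) \<triangleright> f"
  using scale_scale[of f "dm f" "cd f" s t] by (cases "arr f") (auto simp: Hom_iff tot not_arr)

lemma scl_add_left: "(s + t) \<triangleright> f = s \<triangleright> f \<uplus> t \<triangleright> f"
  using scale_add_left[of f "dm f" "cd f" s t] by (cases "arr f") (auto simp: Hom_iff tot not_arr)

lemma scl_zero_left [simp]: "0 \<triangleright> f = \<zero> (dm f) (cd f)"
  using add_self_imp_zero[OF trans[OF _ scl_add_left[of 0 0 f]]] by simp

lemma cmp_add_left: "dm g = dm h \<Longrightarrow> cd g = cd h \<Longrightarrow> arr g \<Longrightarrow> arr h \<Longrightarrow>
    (g \<uplus> h) \<bullet> f = g \<bullet> f \<uplus> h \<bullet> f"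
  using comp_add_left[of f "dm f" "cd f" g "cd g" h]
  by (cases "arr f \<and> dm g = cd f") (auto simp: Hom_iff tot not_arr)

lemma cmp_add_right: "dm g = dm h \<Longrightarrow> cd g = cd h \<Longrightarrow> arr g \<Longrightarrow> arr h \<Longrightarrow>
    f \<bullet> (g \<uplus> h) = f \<bullet> g \<uplus> f \<bullet> h"
  using comp_add_right[of g "dm g" "cd g" h f "cd f"]
  by (cases "arr f \<and> dm f = cd g") (auto simp: Hom_iff tot not_arr)

text \<open>A zero morphism is 0 times itself, so compatibility of composition with the scalar 0
  gives the claim.\<close>

lemma cmp_zero_left [simp]: "a \<in> Ob \<Longrightarrow> b \<in> Ob \<Longrightarrow> \<zero> a b \<bullet> f = \<zero> (dm f) b"
  using comp_scale_left[of f "dm f" "cd f" "\<zero> a b" b 0]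
  by (cases "arr f \<and> a = cd f") (auto simp: Hom_iff tot not_arr)

lemma cmp_zero_right [simp]: "a \<in> Ob \<Longrightarrow> b \<in> Ob \<Longrightarrow> f \<bullet> \<zero> a b = \<zero> a (cd f)"
  using comp_scale_right[of "\<zero> a b" a b f "cd f" 0]
  by (cases "arr f \<and> b = dm f") (auto simp: Hom_iff tot not_arr)

lemma cmp_scl_left [simp]: "(s \<triangleright> g) \<bullet> f = s \<triangleright> (g \<bullet> f)"
  using comp_scale_left[of f "dm f" "cd f" g "cd g" s]
  by (cases "arr f \<and> arr g \<and> dm g = cd f") (auto simp: Hom_iff tot not_arr)

lemma cmp_scl_right [simp]: "g \<bullet> (s \<triangleright> f) = s \<triangleright> (g \<bullet> f)"
  using comp_scale_right[of f "dm f" "cd f" g "cd g" s]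
  by (cases "arr f \<and> arr g \<and> dm g = cd f") (auto simp: Hom_iff tot not_arr)

lemma tns_zero_left [simp]: "a \<in> Ob \<Longrightarrow> b \<in> Ob \<Longrightarrow> \<zero> a b \<star> f = \<zero> (a \<otimes> dm f) (b \<otimes> cd f)"
  using tensor_scale_left[of "\<zero> a b" a b f "dm f" "cd f" 0]
  by (cases "arr f") (auto simp: Hom_iff tot not_arr)

lemma tns_zero_right [simp]: "a \<in> Ob \<Longrightarrow> b \<in> Ob \<Longrightarrow> f \<star> \<zero> a b = \<zero> (dm f \<otimes> a) (cd f \<otimes> b)"
  using tensor_scale_right[of f "dm f" "cd f" "\<zero> a b" a b 0]
  by (cases "arr f") (auto simp: Hom_iff tot not_arr)

lemma tns_scl_left [simp]: "(s \<triangleright> f) \<star> g = s \<triangleright> (f \<star> g)"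
  using tensor_scale_left[of f "dm f" "cd f" g "dm g" "cd g" s]
  by (cases "arr f \<and> arr g") (auto simp: Hom_iff tot not_arr)

lemma tns_scl_right [simp]: "f \<star> (s \<triangleright> g) = s \<triangleright> (f \<star> g)"
  using tensor_scale_right[of f "dm f" "cd f" g "dm g" "cd g" s]
  by (cases "arr f \<and> arr g") (auto simp: Hom_iff tot not_arr)

lemma tns_add_left: "dm f = dm g \<Longrightarrow> cd f = cd g \<Longrightarrow> arr f \<Longrightarrow> arr g \<Longrightarrow>
    (f \<uplus> g) \<star> h = f \<star> h \<uplus> g \<star> h"
  using tensor_add_left[of f "dm f" "cd f" g h "dm h" "cd h"]
  by (cases "arr h") (auto simp: Hom_iff tot not_arr)

lemma tns_add_right: "dm f = dm g \<Longrightarrow> cd f = cd g \<Longrightarrow> arr f \<Longrightarrow> arr g \<Longrightarrow>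
    h \<star> (f \<uplus> g) = h \<star> f \<uplus> h \<star> g"
  using tensor_add_right[of f "dm f" "cd f" g h "dm h" "cd h"]
  by (cases "arr h") (auto simp: Hom_iff tot not_arr)

lemmas distribs = cmp_add_left cmp_add_right tns_add_left tns_add_right scl_add

text \<open>A type mismatch or a non-morphism anywhere turns both sides into the same zero morphism,
  which makes the law unconditional.\<close>

lemma cmp_assoc [simp]: "(h \<bullet> g) \<bullet> f = h \<bullet> g \<bullet> f"
proof -
  consider "arr f \<and> arr g \<and> arr h \<and> dm g = cd f \<and> dm h = cd g" | "\<not> arr f" | "\<not> arr g" | "\<not> arr h"
    | "dm g \<noteq> cd f" | "dm h \<noteq> cd g" by blast
  thus ?thesis
  proof cases
    case 1
    thus ?thesis using comp_assoc[of f "dm f" "cd f" g "cd g" h "cd h"] by (simp add: Hom_iff tot)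
  qed (simp_all add: not_arr)
qed

text \<open>Composites are kept nested to the right, so an equation about
  \<open>g \<bullet> f\<close> must also be available in front of a further factor
  \<open>x\<close>.\<close>

lemma cmp_reassoc: "g \<bullet> f = k \<Longrightarrow> g \<bullet> f \<bullet> x = k \<bullet> x"
  by (metis cmp_assoc)

lemma cmp_reassoc': "g \<bullet> f = k \<bullet> l \<Longrightarrow> g \<bullet> f \<bullet> x = k \<bullet> l \<bullet> x"
  by (metis cmp_assoc)

lemma cmp_Id [simp]:
  "arr f \<Longrightarrow> cd f = a \<Longrightarrow> Id a \<bullet> f = f"
  "arr f \<Longrightarrow> dm f = a \<Longrightarrow> f \<bullet> Id a = f"
  using comp_Id_left[of f "dm f" "cd f"] comp_Id_right[of f "dm f" "cd f"]
  by (auto simp: Hom_iff tot)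

lemma tns_Id [simp]: "a \<in> Ob \<Longrightarrow> b \<in> Ob \<Longrightarrow> Id a \<star> Id b = Id (a \<otimes> b)"
  using tensor_Id[of a b] by (simp add: tot)

lemma tns_cmp: "dm g = cd f \<Longrightarrow> dm k = cd h \<Longrightarrow> (g \<star> k) \<bullet> (f \<star> h) = (g \<bullet> f) \<star> (k \<bullet> h)"
proof -
  assume eq: "dm g = cd f" "dm k = cd h"
  consider "arr f \<and> arr g \<and> arr h \<and> arr k" | "\<not> arr f" | "\<not> arr g" | "\<not> arr h" | "\<not> arr k" by blast
  thus ?thesis
  proof cases
    case 1
    thus ?thesis using eq tensor_comp[of f "dm f" "cd f" g "cd g" h "dm h" "cd h" k "cd k"]
      by (simp add: Hom_iff tot)
  qed (use eq in \<open>simp_all add: not_arr\<close>)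
qed

lemma tns_cmp': "dm g = cd f \<Longrightarrow> dm k = cd h \<Longrightarrow> (g \<star> k) \<bullet> (f \<star> h) \<bullet> x = ((g \<bullet> f) \<star> (k \<bullet> h)) \<bullet> x"
  by (rule cmp_reassoc) (rule tns_cmp)

text \<open>The standard normalisation below: consecutive tensor products are fused factor by
  factor, after which both sides of an interchange law coincide.\<close>

lemmas merge = tns_cmp tns_cmp'

lemma inverse_arrows_tot: "inverse_arrows C a b f g \<longleftrightarrow>
  arr f \<and> dm f = a \<and> cd f = b \<and> arr g \<and> dm g = b \<and> cd g = a \<and> g \<bullet> f = Id a \<and> f \<bullet> g = Id b"
  by (auto simp: inverse_arrows_def Hom_iff tot)

lemma inv_arr_eq: "inverse_arrows C a b f g \<Longrightarrow> inv_arr C f = g"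
  unfolding inv_arr_def
proof (rule the_equality)
  fix h assume fg: "inverse_arrows C a b f g" and "\<exists>a b. inverse_arrows C a b f h"
  then obtain a' b' where fh: "inverse_arrows C a' b' f h" by blast
  have "h = h \<bullet> f \<bullet> g" using fg fh by (auto simp: inverse_arrows_tot)
  also have "\<dots> = (h \<bullet> f) \<bullet> g" by simp
  also have "\<dots> = g" using fg fh by (auto simp: inverse_arrows_tot simp del: cmp_assoc)
  finally show "h = g" .
qed blast

lemma iso_inv: "iso C a b f \<Longrightarrow> inverse_arrows C a b f (inv_arr C f)"
  using inv_arr_eq unfolding iso_def by blast

abbreviation \<alpha>i where "\<alpha>i a b c \<equiv> inv_arr C (\<alpha> a b c)"
abbreviation li where "li a \<equiv> inv_arr C (\<ll> a)"
abbreviation ri where "ri a \<equiv> inv_arr C (\<rr> a)"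

lemma assoc_simps [simp]:
  assumes [simp]: "a \<in> Ob" "b \<in> Ob" "c \<in> Ob"
  shows "arr (\<alpha> a b c)" "dm (\<alpha> a b c) = (a \<otimes> b) \<otimes> c" "cd (\<alpha> a b c) = a \<otimes> (b \<otimes> c)"
    "arr (\<alpha>i a b c)" "cd (\<alpha>i a b c) = (a \<otimes> b) \<otimes> c" "dm (\<alpha>i a b c) = a \<otimes> (b \<otimes> c)"
    "\<alpha> a b c \<bullet> \<alpha>i a b c = Id (a \<otimes> (b \<otimes> c))" "\<alpha>i a b c \<bullet> \<alpha> a b c = Id ((a \<otimes> b) \<otimes> c)"
  using iso_inv[OF assoc_iso[OF assms]] by (auto simp: inverse_arrows_tot)

lemma lunit_simps [simp]:
  assumes [simp]: "a \<in> Ob"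
  shows "arr (\<ll> a)" "dm (\<ll> a) = \<one> \<otimes> a" "cd (\<ll> a) = a"
    "arr (li a)" "cd (li a) = \<one> \<otimes> a" "dm (li a) = a"
    "\<ll> a \<bullet> li a = Id a" "li a \<bullet> \<ll> a = Id (\<one> \<otimes> a)"
  using iso_inv[OF lunit_iso[OF assms]] by (auto simp: inverse_arrows_tot)

lemma runit_simps [simp]:
  assumes [simp]: "a \<in> Ob"
  shows "arr (\<rr> a)" "dm (\<rr> a) = a \<otimes> \<one>" "cd (\<rr> a) = a"
    "arr (ri a)" "cd (ri a) = a \<otimes> \<one>" "dm (ri a) = a"
    "\<rr> a \<bullet> ri a = Id a" "ri a \<bullet> \<rr> a = Id (a \<otimes> \<one>)"
  using iso_inv[OF runit_iso[OF assms]] by (auto simp: inverse_arrows_tot)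

lemma unitor_cancel [simp]:
  assumes "a \<in> Ob" "arr x"
  shows "cd x = a \<Longrightarrow> \<ll> a \<bullet> li a \<bullet> x = x" "cd x = \<one> \<otimes> a \<Longrightarrow> li a \<bullet> \<ll> a \<bullet> x = x"
    "cd x = a \<Longrightarrow> \<rr> a \<bullet> ri a \<bullet> x = x" "cd x = a \<otimes> \<one> \<Longrightarrow> ri a \<bullet> \<rr> a \<bullet> x = x"
  using assms by (simp_all add: cmp_assoc[symmetric] del: cmp_assoc)

lemma associator_cancel [simp]:
  assumes "a \<in> Ob" "b \<in> Ob" "c \<in> Ob" "arr x"
  shows "cd x = a \<otimes> (b \<otimes> c) \<Longrightarrow> \<alpha> a b c \<bullet> \<alpha>i a b c \<bullet> x = x"
    "cd x = (a \<otimes> b) \<otimes> c \<Longrightarrow> \<alpha>i a b c \<bullet> \<alpha> a b c \<bullet> x = x"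
  using assms by (simp_all add: cmp_assoc[symmetric] del: cmp_assoc)

text \<open>The naturality squares, each oriented so that structure isomorphisms move to the right.\<close>

lemma \<alpha>_nat: "arr f \<Longrightarrow> arr g \<Longrightarrow> arr h \<Longrightarrow> cd f = a \<Longrightarrow> cd g = b \<Longrightarrow> cd h = c \<Longrightarrow>
    \<alpha> a b c \<bullet> ((f \<star> g) \<star> h) = (f \<star> (g \<star> h)) \<bullet> \<alpha> (dm f) (dm g) (dm h)"
  using assoc_natural[of f "dm f" a g "dm g" b h "dm h" c] by (auto simp: Hom_iff tot)

lemma \<alpha>i_nat: "arr f \<Longrightarrow> arr g \<Longrightarrow> arr h \<Longrightarrow> cd f = a \<Longrightarrow> cd g = b \<Longrightarrow> cd h = c \<Longrightarrow>
    \<alpha>i a b c \<bullet> (f \<star> (g \<star> h)) = ((f \<star> g) \<star> h) \<bullet> \<alpha>i (dm f) (dm g) (dm h)"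
proof -
  assume *: "arr f" "arr g" "arr h" "cd f = a" "cd g = b" "cd h = c"
  have "\<alpha>i a b c \<bullet> (\<alpha> a b c \<bullet> ((f \<star> g) \<star> h)) \<bullet> \<alpha>i (dm f) (dm g) (dm h) =
      \<alpha>i a b c \<bullet> ((f \<star> (g \<star> h)) \<bullet> \<alpha> (dm f) (dm g) (dm h)) \<bullet> \<alpha>i (dm f) (dm g) (dm h)"
    using * by (simp add: \<alpha>_nat)
  thus ?thesis using * by auto
qed

lemma l_nat: "arr f \<Longrightarrow> cd f = a \<Longrightarrow> \<ll> a \<bullet> (Id \<one> \<star> f) = f \<bullet> \<ll> (dm f)"
  using lunit_natural[of f "dm f" a] by (auto simp: Hom_iff tot)

lemma r_nat: "arr f \<Longrightarrow> cd f = a \<Longrightarrow> \<rr> a \<bullet> (f \<star> Id \<one>) = f \<bullet> \<rr> (dm f)"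
  using runit_natural[of f "dm f" a] by (auto simp: Hom_iff tot)

lemma li_nat: "arr f \<Longrightarrow> cd f = a \<Longrightarrow> li a \<bullet> f = (Id \<one> \<star> f) \<bullet> li (dm f)"
proof -
  assume *: "arr f" "cd f = a"
  have "li a \<bullet> (\<ll> a \<bullet> (Id \<one> \<star> f)) \<bullet> li (dm f) = li a \<bullet> (f \<bullet> \<ll> (dm f)) \<bullet> li (dm f)"
    using * by (simp add: l_nat)
  thus ?thesis using * by auto
qed

lemma ri_nat: "arr f \<Longrightarrow> cd f = a \<Longrightarrow> ri a \<bullet> f = (f \<star> Id \<one>) \<bullet> ri (dm f)"
proof -
  assume *: "arr f" "cd f = a"
  have "ri a \<bullet> (\<rr> a \<bullet> (f \<star> Id \<one>)) \<bullet> ri (dm f) = ri a \<bullet> (f \<bullet> \<rr> (dm f)) \<bullet> ri (dm f)"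
    using * by (simp add: r_nat)
  thus ?thesis using * by auto
qed

lemma pentagon': "a \<in> Ob \<Longrightarrow> b \<in> Ob \<Longrightarrow> c \<in> Ob \<Longrightarrow> d \<in> Ob \<Longrightarrow>
      (Id a \<star> \<alpha> b c d) \<bullet> \<alpha> a (b \<otimes> c) d \<bullet> (\<alpha> a b c \<star> Id d) = \<alpha> a b (c \<otimes> d) \<bullet> \<alpha> (a \<otimes> b) c d"
  using pentagon[of a b c d] by (simp add: tot)

lemma triangle': "a \<in> Ob \<Longrightarrow> b \<in> Ob \<Longrightarrow> (Id a \<star> \<ll> b) \<bullet> \<alpha> a \<one> b = \<rr> a \<star> Id b"
  using triangle[of a b] by (simp add: tot)

end

section \<open>Coherence\<close>

context monoidal_linear_category
begin

lemmas \<alpha>_nat' = \<alpha>_nat[THEN cmp_reassoc'] and \<alpha>i_nat' = \<alpha>i_nat[THEN cmp_reassoc']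
  and l_nat' = l_nat[THEN cmp_reassoc'] and r_nat' = r_nat[THEN cmp_reassoc']
  and li_nat' = li_nat[THEN cmp_reassoc'] and ri_nat' = ri_nat[THEN cmp_reassoc']

lemma right_cancel: "x \<bullet> k = y \<bullet> k \<Longrightarrow> k \<bullet> k' = Id a \<Longrightarrow> arr x \<Longrightarrow> arr y \<Longrightarrow> dm x = a \<Longrightarrow> dm y = a \<Longrightarrow> x = y"
  by (metis cmp_assoc cmp_Id(2))

lemma left_cancel: "k \<bullet> x = k \<bullet> y \<Longrightarrow> k' \<bullet> k = Id a \<Longrightarrow> arr x \<Longrightarrow> arr y \<Longrightarrow> cd x = a \<Longrightarrow> cd y = a \<Longrightarrow> x = y"
  by (metis cmp_assoc cmp_Id(1))

text \<open>Faithful because \<open>\<ll>\<close> is a natural isomorphism. The coherence arguments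
  below prove their equations only after tensoring with the unit.\<close>

lemma unit_tns_faithful:
  assumes "Id \<one> \<star> x = Id \<one> \<star> y" "arr x" "arr y" "dm x = dm y" "cd x = cd y"
  shows "x = y"
proof -
  have "x \<bullet> \<ll> (dm x) = y \<bullet> \<ll> (dm x)"
    using assms l_nat[of x "cd x"] l_nat[of y "cd y"] by simp
  thus ?thesis by (rule right_cancel[where k' = "li (dm x)"]) (use assms in simp_all)
qed

lemma tns_unit_faithful:
  assumes "x \<star> Id \<one> = y \<star> Id \<one>" "arr x" "arr y" "dm x = dm y" "cd x = cd y"
  shows "x = y"
proof -
  have "x \<bullet> \<rr> (dm x) = y \<bullet> \<rr> (dm x)"
    using assms r_nat[of x "cd x"] r_nat[of y "cd y"] by simp
  thus ?thesis by (rule right_cancel[where k' = "ri (dm x)"]) (use assms in simp_all)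
qed

lemma pentagon'': "a \<in> Ob \<Longrightarrow> b \<in> Ob \<Longrightarrow> c \<in> Ob \<Longrightarrow> d \<in> Ob \<Longrightarrow>
   \<alpha> a b (c \<otimes> d) \<bullet> \<alpha> (a \<otimes> b) c d \<bullet> x = (Id a \<star> \<alpha> b c d) \<bullet> \<alpha> a (b \<otimes> c) d \<bullet> (\<alpha> a b c \<star> Id d) \<bullet> x"
  using pentagon'[of a b c d] by (metis cmp_assoc)

lemmas triangle'' = triangle'[THEN cmp_reassoc]

text \<open>Kelly's argument: tensored with \<open>\<one>\<close> on the left, the equation follows
  from the pentagon at \<open>\<one>\<close>, \<open>\<one>\<close>, \<open>a\<close>,
  \<open>b\<close> and two triangles, and tensoring with the unit is faithful.\<close>

lemma lunit_tensor:
  assumes [simp]: "a \<in> Ob" "b \<in> Ob"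
  shows "\<ll> (a \<otimes> b) \<bullet> \<alpha> \<one> a b = \<ll> a \<star> Id b"
proof -
  let ?k = "\<alpha> \<one> (\<one> \<otimes> a) b \<bullet> (\<alpha> \<one> \<one> a \<star> Id b)"
  have "(Id \<one> \<star> (\<ll> (a \<otimes> b) \<bullet> \<alpha> \<one> a b)) \<bullet> ?k =
      (Id \<one> \<star> \<ll> (a \<otimes> b)) \<bullet> (Id \<one> \<star> \<alpha> \<one> a b) \<bullet> ?k"
    by (simp add: merge)
  also have "\<dots> = (Id \<one> \<star> \<ll> (a \<otimes> b)) \<bullet> \<alpha> \<one> \<one> (a \<otimes> b) \<bullet> \<alpha> (\<one> \<otimes> \<one>) a b"
    by (simp add: pentagon')
  also have "\<dots> = (\<rr> \<one> \<star> (Id a \<star> Id b)) \<bullet> \<alpha> (\<one> \<otimes> \<one>) a b"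
    by (simp add: triangle'')
  also have "\<dots> = \<alpha> \<one> a b \<bullet> ((\<rr> \<one> \<star> Id a) \<star> Id b)"
    by (simp add: \<alpha>_nat del: tns_Id)
  also have "\<dots> = \<alpha> \<one> a b \<bullet> ((Id \<one> \<star> \<ll> a) \<star> Id b) \<bullet> (\<alpha> \<one> \<one> a \<star> Id b)"
    by (simp add: merge triangle')
  also have "\<dots> = (Id \<one> \<star> (\<ll> a \<star> Id b)) \<bullet> ?k"
    by (simp add: \<alpha>_nat' )
  finally have "Id \<one> \<star> (\<ll> (a \<otimes> b) \<bullet> \<alpha> \<one> a b) = Id \<one> \<star> (\<ll> a \<star> Id b)"
    by (rule right_cancel[where k' = "(\<alpha>i \<one> \<one> a \<star> Id b) \<bullet> \<alpha>i \<one> (\<one> \<otimes> a) b"]) (simp_all add: merge)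
  thus ?thesis by (rule unit_tns_faithful) simp_all
qed

text \<open>The mirror image of \<open>lunit_tensor\<close>, with the pentagon at \<open>a\<close>,
  \<open>b\<close>, \<open>\<one>\<close>, \<open>\<one>\<close>.\<close>

lemma runit_tensor:
  assumes [simp]: "a \<in> Ob" "b \<in> Ob"
  shows "(Id a \<star> \<rr> b) \<bullet> \<alpha> a b \<one> = \<rr> (a \<otimes> b)"
proof -
  have "\<alpha> a b \<one> \<bullet> (((Id a \<star> \<rr> b) \<bullet> \<alpha> a b \<one>) \<star> Id \<one>) = \<alpha> a b \<one> \<bullet> ((Id a \<star> \<rr> b) \<star> Id \<one>) \<bullet> (\<alpha> a b \<one> \<star> Id \<one>)"
    by (simp add: merge)
  also have "\<dots> = (Id a \<star> (\<rr> b \<star> Id \<one>)) \<bullet> \<alpha> a (b \<otimes> \<one>) \<one> \<bullet> (\<alpha> a b \<one> \<star> Id \<one>)"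
    by (simp add: \<alpha>_nat')
  also have "\<dots> = (Id a \<star> (Id b \<star> \<ll> \<one>)) \<bullet> (Id a \<star> \<alpha> b \<one> \<one>) \<bullet> \<alpha> a (b \<otimes> \<one>) \<one> \<bullet> (\<alpha> a b \<one> \<star> Id \<one>)"
    by (simp add: merge triangle')
  also have "\<dots> = (Id a \<star> (Id b \<star> \<ll> \<one>)) \<bullet> \<alpha> a b (\<one> \<otimes> \<one>) \<bullet> \<alpha> (a \<otimes> b) \<one> \<one>"
    by (simp add: pentagon')
  also have "\<dots> = (Id a \<star> (Id b \<star> \<ll> \<one>)) \<bullet> \<alpha> a b (dm (\<ll> \<one>)) \<bullet> \<alpha> (a \<otimes> b) \<one> \<one>"
    by simp
  also have "\<dots> = \<alpha> a b \<one> \<bullet> ((Id a \<star> Id b) \<star> \<ll> \<one>) \<bullet> \<alpha> (a \<otimes> b) \<one> \<one>"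
    by (simp add: \<alpha>_nat' del: tns_Id)
  also have "\<dots> = \<alpha> a b \<one> \<bullet> (\<rr> (a \<otimes> b) \<star> Id \<one>)"
    by (simp add: triangle')
  finally have "((Id a \<star> \<rr> b) \<bullet> \<alpha> a b \<one>) \<star> Id \<one> = \<rr> (a \<otimes> b) \<star> Id \<one>"
    by (rule left_cancel[where k' = "\<alpha>i a b \<one>"]) simp_all
  thus ?thesis by (rule tns_unit_faithful) simp_all
qed

text \<open>Naturality of \<open>\<ll>\<close> along \<open>\<ll> \<one>\<close> identifies
  \<open>Id \<one> \<star> \<ll> \<one>\<close> with \<open>\<ll> (\<one> \<otimes> \<one>)\<close>;
  then the triangle and \<open>lunit_tensor\<close> have the same left-hand side.\<close>

lemma runit_unit: "\<rr> \<one> = \<ll> \<one>"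
proof -
  have "\<ll> \<one> \<bullet> (Id \<one> \<star> \<ll> \<one>) = \<ll> \<one> \<bullet> \<ll> (\<one> \<otimes> \<one>)" by (simp add: l_nat)
  hence "Id \<one> \<star> \<ll> \<one> = \<ll> (\<one> \<otimes> \<one>)"
    by (rule left_cancel[where k' = "li \<one>"]) simp_all
  hence "\<rr> \<one> \<star> Id \<one> = \<ll> \<one> \<star> Id \<one>"
    using triangle'[of \<one> \<one>] lunit_tensor[of \<one> \<one>] by simp
  thus ?thesis by (rule tns_unit_faithful) simp_all
qed

lemma li_ri_unit: "ri \<one> = li \<one>"
  by (simp add: runit_unit)

lemma lunit_tensor_inv:
  assumes [simp]: "a \<in> Ob" "b \<in> Ob"
  shows "(\<ll> a \<star> Id b) \<bullet> \<alpha>i \<one> a b = \<ll> (a \<otimes> b)"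
    "\<alpha> \<one> a b \<bullet> (li a \<star> Id b) = li (a \<otimes> b)"
    "(\<rr> a \<star> Id b) \<bullet> \<alpha>i a \<one> b = Id a \<star> \<ll> b"
    "\<rr> (a \<otimes> b) \<bullet> \<alpha>i a b \<one> = Id a \<star> \<rr> b"
    "\<alpha> a \<one> b \<bullet> (ri a \<star> Id b) = Id a \<star> li b"
    "\<alpha>i a \<one> b \<bullet> (Id a \<star> li b) = ri a \<star> Id b"
    "\<alpha>i a b \<one> \<bullet> (Id a \<star> ri b) = ri (a \<otimes> b)"
proof -
  show 1: "(\<ll> a \<star> Id b) \<bullet> \<alpha>i \<one> a b = \<ll> (a \<otimes> b)"
    by (simp add: lunit_tensor[symmetric])
  show "\<alpha> \<one> a b \<bullet> (li a \<star> Id b) = li (a \<otimes> b)"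
    by (rule left_cancel[where k = "\<ll> (a \<otimes> b)" and k' = "li (a \<otimes> b)"])
       (simp_all add: lunit_tensor[THEN cmp_reassoc] merge)
  show 3: "(\<rr> a \<star> Id b) \<bullet> \<alpha>i a \<one> b = Id a \<star> \<ll> b"
    by (simp add: triangle'[symmetric])
  show 4: "\<rr> (a \<otimes> b) \<bullet> \<alpha>i a b \<one> = Id a \<star> \<rr> b"
    by (simp add: runit_tensor[symmetric])
  show "\<alpha> a \<one> b \<bullet> (ri a \<star> Id b) = Id a \<star> li b"
    by (rule left_cancel[where k = "Id a \<star> \<ll> b" and k' = "Id a \<star> li b"])
       (simp_all add: triangle'[THEN cmp_reassoc] merge)
  show "\<alpha>i a \<one> b \<bullet> (Id a \<star> li b) = ri a \<star> Id b"
    by (rule left_cancel[where k = "\<rr> a \<star> Id b" and k' = "ri a \<star> Id b"])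
       (simp_all add: 3[THEN cmp_reassoc] merge)
  show "\<alpha>i a b \<one> \<bullet> (Id a \<star> ri b) = ri (a \<otimes> b)"
    by (rule left_cancel[where k = "\<rr> (a \<otimes> b)" and k' = "ri (a \<otimes> b)"])
       (simp_all add: merge 4[THEN cmp_reassoc])
qed

end

section \<open>The braiding, its compatibility with the unit, and the interchange of the two middle
  factors\<close>

context braided_linear_category
begin

lemma braid_simps [simp]:
  assumes [simp]: "a \<in> Ob" "b \<in> Ob"
  shows "arr (\<sigma> a b)" "dm (\<sigma> a b) = a \<otimes> b" "cd (\<sigma> a b) = b \<otimes> a"
  using iso_inv[OF braid_iso[OF assms]] by (auto simp: inverse_arrows_tot)

lemma \<sigma>_nat: "arr f \<Longrightarrow> arr g \<Longrightarrow> cd f = a \<Longrightarrow> cd g = b \<Longrightarrow> \<sigma> a b \<bullet> (f \<star> g) = (g \<star> f) \<bullet> \<sigma> (dm f) (dm g)"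
  using braid_natural[of f "dm f" a g "dm g" b] by (auto simp: Hom_iff tot)

lemmas \<sigma>_nat' = \<sigma>_nat[THEN cmp_reassoc']

lemma hexagon1': "a \<in> Ob \<Longrightarrow> b \<in> Ob \<Longrightarrow> c \<in> Ob \<Longrightarrow>
      \<alpha> b c a \<bullet> \<sigma> a (b \<otimes> c) \<bullet> \<alpha> a b c = (Id b \<star> \<sigma> a c) \<bullet> \<alpha> b a c \<bullet> (\<sigma> a b \<star> Id c)"
  using hexagon1[of a b c] by (simp add: tot)

text \<open>For s = \<open>\<ll> a \<bullet> \<sigma> a \<one>\<close>, the hexagon with two unit
  objects shows that \<open>\<rr> a \<star> Id \<one>\<close> and \<open>s \<star> Id \<one>\<close>
  agree after composition with s. As s is invertible and tensoring with the unit is faithful, s is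
  \<open>\<rr> a\<close>.\<close>

lemma lunit_braid:
  assumes [simp]: "a \<in> Ob"
  shows "\<ll> a \<bullet> \<sigma> a \<one> = \<rr> a"
proof -
  have "(Id \<one> \<star> (\<ll> a \<bullet> \<sigma> a \<one>)) \<bullet> \<alpha> \<one> a \<one> \<bullet> (\<sigma> a \<one> \<star> Id \<one>) =
    (Id \<one> \<star> \<ll> a) \<bullet> \<alpha> \<one> \<one> a \<bullet> \<sigma> a (\<one> \<otimes> \<one>) \<bullet> \<alpha> a \<one> \<one>"
    by (simp add: hexagon1' merge)
  also have "\<dots> = (\<ll> \<one> \<star> Id a) \<bullet> \<sigma> a (\<one> \<otimes> \<one>) \<bullet> \<alpha> a \<one> \<one>"
    by (simp add: triangle'' runit_unit)
  also have "\<dots> = \<sigma> a \<one> \<bullet> (Id a \<star> \<ll> \<one>) \<bullet> \<alpha> a \<one> \<one>"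
    by (simp add: \<sigma>_nat')
  also have "\<dots> = \<sigma> a \<one> \<bullet> (\<rr> a \<star> Id \<one>)"
    by (simp add: triangle')
  finally have *: "(Id \<one> \<star> (\<ll> a \<bullet> \<sigma> a \<one>)) \<bullet> \<alpha> \<one> a \<one> \<bullet> (\<sigma> a \<one> \<star> Id \<one>) = \<sigma> a \<one> \<bullet> (\<rr> a \<star> Id \<one>)" .
  let ?s = "\<ll> a \<bullet> \<sigma> a \<one>"
  have "?s \<bullet> (\<rr> a \<star> Id \<one>) = \<ll> a \<bullet> (Id \<one> \<star> ?s) \<bullet> \<alpha> \<one> a \<one> \<bullet> (\<sigma> a \<one> \<star> Id \<one>)"
    by (simp add: *)
  also have "\<dots> = ?s \<bullet> \<ll> (a \<otimes> \<one>) \<bullet> \<alpha> \<one> a \<one> \<bullet> (\<sigma> a \<one> \<star> Id \<one>)"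
    by (simp add: l_nat')
  also have "\<dots> = ?s \<bullet> (?s \<star> Id \<one>)"
    by (simp add: lunit_tensor[THEN cmp_reassoc] merge)
  finally have "?s \<bullet> (\<rr> a \<star> Id \<one>) = ?s \<bullet> (?s \<star> Id \<one>)" .
  moreover have "(inv_arr C (\<sigma> a \<one>) \<bullet> li a) \<bullet> ?s = Id (a \<otimes> \<one>)"
    using iso_inv[OF braid_iso[OF assms unit_Ob]] by (auto simp: inverse_arrows_tot)
  ultimately have "\<rr> a \<star> Id \<one> = ?s \<star> Id \<one>" by (rule left_cancel) simp_all
  thus ?thesis by (rule sym[OF tns_unit_faithful]) simp_all
qed

lemma braid_unit_unit [simp]: "\<sigma> \<one> \<one> = Id (\<one> \<otimes> \<one>)"
proof (rule left_cancel)
  show "\<ll> \<one> \<bullet> \<sigma> \<one> \<one> = \<ll> \<one> \<bullet> Id (\<one> \<otimes> \<one>)" by (simp add: lunit_braid runit_unit)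
  show "li \<one> \<bullet> \<ll> \<one> = Id (\<one> \<otimes> \<one>)" by simp
qed simp_all

text \<open>The map \<open>mid_braid\<close> with four independent objects. Only in this generality
  can naturality be stated and single factors be specialised to the unit.\<close>

definition mid :: "'a \<Rightarrow> 'a \<Rightarrow> 'a \<Rightarrow> 'a \<Rightarrow> 'b" where
  "mid a b c d = \<alpha>i a c (b \<otimes> d) \<bullet> (Id a \<star> \<alpha> c b d) \<bullet> (Id a \<star> (\<sigma> b c \<star> Id d)) \<bullet>
     (Id a \<star> \<alpha>i b c d) \<bullet> \<alpha> a b (c \<otimes> d)"

lemma mid_simps [simp]:
  assumes [simp]: "a \<in> Ob" "b \<in> Ob" "c \<in> Ob" "d \<in> Ob"
  shows "arr (mid a b c d)" "dm (mid a b c d) = (a \<otimes> b) \<otimes> (c \<otimes> d)"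
    "cd (mid a b c d) = (a \<otimes> c) \<otimes> (b \<otimes> d)"
  by (simp_all add: mid_def)

lemma mid_braid_eq: "a \<in> Ob \<Longrightarrow> mid_braid C a = mid a a a a"
  by (simp add: mid_braid_def mid_def tot)

lemma mid_nat:
  assumes [simp]: "arr f" "arr g" "arr h" "arr k" "cd f = a" "cd g = b" "cd h = c" "cd k = d"
  shows "mid a b c d \<bullet> ((f \<star> g) \<star> (h \<star> k)) = ((f \<star> h) \<star> (g \<star> k)) \<bullet> mid (dm f) (dm g) (dm h) (dm k)"
proof -
  have [simp]: "a \<in> Ob" "b \<in> Ob" "c \<in> Ob" "d \<in> Ob" using assms cd_Ob by metis+
  \<comment> \<open>Naturality of the associator, restated for the shape it has once the braiding
    has been fused into the tensor product.\<close>
  have 1: "\<alpha> c b d \<bullet> ((h \<star> g \<bullet> \<sigma> (dm g) (dm h)) \<star> k) =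
      (h \<star> (g \<star> k)) \<bullet> \<alpha> (dm h) (dm g) (dm k) \<bullet> (\<sigma> (dm g) (dm h) \<star> Id (dm k))"
    using \<alpha>_nat'[of h g k c b d "\<sigma> (dm g) (dm h) \<star> Id (dm k)"] by (simp add: merge)
  have "mid a b c d \<bullet> ((f \<star> g) \<star> (h \<star> k)) =
      \<alpha>i a c (b \<otimes> d) \<bullet> (f \<star> (h \<star> (g \<star> k))) \<bullet> (Id (dm f) \<star> \<alpha> (dm h) (dm g) (dm k)) \<bullet>
      (Id (dm f) \<star> (\<sigma> (dm g) (dm h) \<star> Id (dm k))) \<bullet> (Id (dm f) \<star> \<alpha>i (dm g) (dm h) (dm k)) \<bullet>
      \<alpha> (dm f) (dm g) (dm h \<otimes> dm k)"
    by (simp add: mid_def \<alpha>_nat \<alpha>_nat' merge \<alpha>i_nat \<sigma>_nat' \<sigma>_nat 1[THEN cmp_reassoc])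
  also have "\<dots> = ((f \<star> h) \<star> (g \<star> k)) \<bullet> mid (dm f) (dm g) (dm h) (dm k)"
    by (simp add: mid_def \<alpha>i_nat')
  finally show ?thesis .
qed

lemmas mid_nat' = mid_nat[THEN cmp_reassoc']

text \<open>Two middle factors equal to \<open>\<one>\<close> are exchanged by the identity, so the
  associators cancel.\<close>

lemma mid_unit_unit:
  assumes [simp]: "a \<in> Ob" "d \<in> Ob"
  shows "(\<rr> a \<star> \<ll> d) \<bullet> mid a \<one> \<one> d = \<rr> a \<star> \<ll> d"
proof -
  have "(\<rr> a \<star> \<ll> d) \<bullet> mid a \<one> \<one> d = (\<rr> a \<star> Id d) \<bullet> ((Id a \<star> Id \<one>) \<star> \<ll> d) \<bullet> \<alpha>i a \<one> (\<one> \<otimes> d) \<bullet> \<alpha> a \<one> (\<one> \<otimes> d)"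
    by (simp add: mid_def merge)
  thus ?thesis by (simp add: merge)
qed

text \<open>With the unit in the fourth place only the braiding of the second and third factors
  remains. This is the origin of \<open>twist\<close> in the Leibniz rule.\<close>

lemma mid_unit_right:
  assumes [simp]: "a \<in> Ob" "b \<in> Ob" "c \<in> Ob"
  shows "(Id (a \<otimes> c) \<star> \<rr> b) \<bullet> mid a b c \<one> =
    \<alpha>i a c b \<bullet> (Id a \<star> \<sigma> b c) \<bullet> \<alpha> a b c \<bullet> (Id (a \<otimes> b) \<star> \<rr> c)"
proof -
  have "(Id (a \<otimes> c) \<star> \<rr> b) \<bullet> mid a b c \<one> =
     (Id (a \<otimes> c) \<star> \<rr> b) \<bullet> \<alpha>i a c (b \<otimes> \<one>) \<bullet> (Id a \<star> \<alpha> c b \<one>) \<bullet>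
      (Id a \<star> (\<sigma> b c \<star> Id \<one>)) \<bullet> (Id a \<star> \<alpha>i b c \<one>) \<bullet> \<alpha> a b (c \<otimes> \<one>)"
    by (simp add: mid_def)
  also have "(Id (a \<otimes> c) \<star> \<rr> b) \<bullet> \<alpha>i a c (b \<otimes> \<one>) \<bullet> x = \<alpha>i a c b \<bullet> (Id a \<star> (Id c \<star> \<rr> b)) \<bullet> x" for x
    using \<alpha>i_nat'[of "Id a" "Id c" "\<rr> b" a c b x] by simp
  also have "(Id a \<star> (Id c \<star> \<rr> b)) \<bullet> (Id a \<star> \<alpha> c b \<one>) \<bullet>
      (Id a \<star> (\<sigma> b c \<star> Id \<one>)) \<bullet> (Id a \<star> \<alpha>i b c \<one>) \<bullet> \<alpha> a b (c \<otimes> \<one>)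
     = (Id a \<star> (\<rr> (c \<otimes> b) \<bullet> (\<sigma> b c \<star> Id \<one>) \<bullet> \<alpha>i b c \<one>)) \<bullet> \<alpha> a b (c \<otimes> \<one>)"
    by (simp add: merge runit_tensor runit_tensor[THEN cmp_reassoc])
  also have "\<rr> (c \<otimes> b) \<bullet> (\<sigma> b c \<star> Id \<one>) \<bullet> \<alpha>i b c \<one> = \<sigma> b c \<bullet> (Id b \<star> \<rr> c)"
    by (simp add: r_nat' lunit_tensor_inv)
  also have "(Id a \<star> (\<sigma> b c \<bullet> (Id b \<star> \<rr> c))) \<bullet> \<alpha> a b (c \<otimes> \<one>)
    = (Id a \<star> \<sigma> b c) \<bullet> (Id a \<star> (Id b \<star> \<rr> c)) \<bullet> \<alpha> a b (c \<otimes> \<one>)"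
    by (simp add: merge)
  also have "(Id a \<star> (Id b \<star> \<rr> c)) \<bullet> \<alpha> a b (c \<otimes> \<one>) = \<alpha> a b c \<bullet> (Id (a \<otimes> b) \<star> \<rr> c)"
    using \<alpha>_nat[of "Id a" "Id b" "\<rr> c" a b c] by simp
  finally show ?thesis .
qed

end

section \<open>Linear algebra in spaces of morphisms\<close>

text \<open>Induction on the number of equations, the last one being used to eliminate an unknown.
  It yields the polynomial equation satisfied by an endomorphism.\<close>

lemma homogeneous_system_nontrivial:
  fixes A :: "nat \<Rightarrow> nat \<Rightarrow> 'k::field"
  assumes "finite J" "card J = Suc n"
  shows "\<exists>v. (\<exists>j\<in>J. v j \<noteq> 0) \<and> (\<forall>i<n. (\<Sum>j\<in>J. A i j * v j) = 0)"
  using assms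
proof (induction n arbitrary: A J)
  case 0
  then obtain j where "J = {j}" by (auto simp: card_Suc_eq)
  thus ?case by (intro exI[of _ "\<lambda>_. 1"]) auto
next
  case (Suc n)
  have "J \<noteq> {}" using Suc.prems by auto
  \<comment> \<open>Either \<open>p\<close> is a pivot of the last equation, or that equation is
    identically zero and any \<open>p\<close> will do.\<close>
  hence "\<exists>p\<in>J. A n p \<noteq> 0 \<or> (\<forall>j\<in>J. A n j = 0)" by auto
  then obtain p where p: "p \<in> J" "A n p \<noteq> 0 \<or> (\<forall>j\<in>J. A n j = 0)" by blast
  let ?J = "J - {p}"
  have J: "finite ?J" "card ?J = Suc n" using Suc.prems p by auto
  define A' where "A' = (\<lambda>i j. if A n p = 0 then A i j else A i j * A n p - A i p * A n j)"
  obtain v where v: "\<exists>j\<in>?J. v j \<noteq> 0" "\<And>i. i < n \<Longrightarrow> (\<Sum>j\<in>?J. A' i j * v j) = 0"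
    using Suc.IH[OF J, of A'] by blast
  \<comment> \<open>The value at \<open>p\<close> solves the last equation. If that equation is
    identically zero, division by zero makes \<open>w p\<close> equal to 0, which is
    harmless.\<close>
  define w where "w = v(p := - (\<Sum>j\<in>?J. A n j * v j) / A n p)"
  have sp: "(\<Sum>j\<in>J. A i j * w j) = A i p * w p + (\<Sum>j\<in>?J. A i j * v j)" for i
    using Suc.prems(1) p(1) by (subst sum.remove[of J p]) (auto simp: w_def intro!: sum.cong)
  have "(\<Sum>j\<in>J. A i j * w j) = 0" if "i < Suc n" for i
  proof (cases "A n p = 0")
    case True
    hence z: "\<forall>j\<in>J. A n j = 0" using p by blast
    have "w p = 0" using True by (simp add: w_def)
    with sp[of i] v(2)[of i] that z show ?thesis
      by (cases "i = n") (auto simp: A'_def True intro!: sum.neutral)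
  next
    case False
    have "A n p * (\<Sum>j\<in>J. A i j * w j) = (\<Sum>j\<in>?J. (A i j * A n p - A i p * A n j) * v j)"
      unfolding sp using False
      by (simp add: w_def field_simps sum_distrib_left sum_subtractf sum_negf)
    also have "\<dots> = 0"
      using v(2)[of i] that False by (cases "i = n") (auto simp: A'_def)
    finally show ?thesis using False by simp
  qed
  moreover have "\<exists>j\<in>J. w j \<noteq> 0" using v(1) by (auto simp: w_def)
  ultimately show ?case by blast
qed

text \<open>Gaussian elimination without division, so that the pivots stay in the algebra \<open>P\<close>.\<close>

lemma solvability_open:
  fixes A :: "nat \<Rightarrow> nat \<Rightarrow> 'r \<Rightarrow> 'k::field"
  assumes one: "P (\<lambda>_. 1)" and mult: "\<And>p q. P p \<Longrightarrow> P q \<Longrightarrow> P (\<lambda>x. p x * q x)"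
    and diff: "\<And>p q. P p \<Longrightarrow> P q \<Longrightarrow> P (\<lambda>x. p x - q x)"
    and A: "\<And>i j. P (A i j)" and J: "finite J"
    and x: "\<And>b. \<exists>z. \<forall>i<n. (\<Sum>j\<in>J. A i j x * z j) = b i"
  shows "\<exists>p. P p \<and> p x \<noteq> 0 \<and> (\<forall>y. p y \<noteq> 0 \<longrightarrow> (\<forall>b. \<exists>z. \<forall>i<n. (\<Sum>j\<in>J. A i j y * z j) = b i))"
  using A x
proof (induction n arbitrary: A)
  case 0
  show ?case by (intro exI[of _ "\<lambda>_. 1"]) (use one in auto)
next
  case (Suc n)
  \<comment> \<open>Solvability with a nonzero right-hand side forces a nonzero entry in the last
    row at \<open>x\<close>; it becomes the pivot.\<close>
  obtain z where "\<forall>i<Suc n. (\<Sum>j\<in>J. A i j x * z j) = 1" using Suc.prems(2)[of "\<lambda>_. 1"] by blast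
  hence "(\<Sum>j\<in>J. A n j x * z j) \<noteq> 0" by simp
  then obtain p where "p \<in> J" "A n p x * z p \<noteq> 0"
    by (rule sum.not_neutral_contains_not_neutral)
  hence p: "p \<in> J" "A n p x \<noteq> 0" by auto
  \<comment> \<open>Rows are combined by cross-multiplication, so the entries stay in
    \<open>P\<close> and column \<open>p\<close> of the reduced system vanishes.\<close>
  define A' where "A' = (\<lambda>i j y. A i j y * A n p y - A i p y * A n j y)"
  have A': "(\<Sum>j\<in>J. A' i j y * z j) = A n p y * (\<Sum>j\<in>J. A i j y * z j) - A i p y * (\<Sum>j\<in>J. A n j y * z j)" for i y z
    by (simp add: A'_def algebra_simps sum_distrib_left sum_subtractf)
  have "\<exists>q. P q \<and> q x \<noteq> 0 \<and> (\<forall>y. q y \<noteq> 0 \<longrightarrow> (\<forall>b. \<exists>z. \<forall>i<n. (\<Sum>j\<in>J. A' i j y * z j) = b i))"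
  proof (rule Suc.IH)
    show "P (A' i j)" for i j unfolding A'_def by (intro diff mult Suc.prems(1))
    show "\<exists>z. \<forall>i<n. (\<Sum>j\<in>J. A' i j x * z j) = b i" for b
    proof -
      obtain z where "\<forall>i<Suc n. (\<Sum>j\<in>J. A i j x * z j) = (if i < n then b i / A n p x else 0)"
        using Suc.prems(2)[of "\<lambda>i. if i < n then b i / A n p x else 0"] by blast
      thus ?thesis using p by (intro exI[of _ z]) (simp add: A')
    qed
  qed
  then obtain q where q: "P q" "q x \<noteq> 0"
    "\<And>y b. q y \<noteq> 0 \<Longrightarrow> \<exists>z. \<forall>i<n. (\<Sum>j\<in>J. A' i j y * z j) = b i" by blast
  show ?case
  \<comment> \<open>The polynomial is the product of the pivots. It is nonzero at \<open>x\<close>,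
    and wherever it is nonzero the elimination can be reversed.\<close>
  proof (intro exI[of _ "\<lambda>y. A n p y * q y"] conjI allI impI)
    show "P (\<lambda>y. A n p y * q y)" by (intro mult Suc.prems q)
    show "A n p x * q x \<noteq> 0" using p q by simp
    fix y b assume y: "A n p y * q y \<noteq> 0"
    obtain z where z: "\<And>i. i < n \<Longrightarrow> (\<Sum>j\<in>J. A' i j y * z j) = A n p y * b i - A i p y * b n"
      using q(3)[of y "\<lambda>i. A n p y * b i - A i p y * b n"] y by auto
    \<comment> \<open>Since column \<open>p\<close> of \<open>A'\<close> is zero, the unknown
      \<open>p\<close> is free in the reduced system and can be chosen to satisfy the last
      row.\<close>
    define w where "w = z(p := (b n - (\<Sum>j\<in>J - {p}. A n j y * z j)) / A n p y)"
    have wn: "(\<Sum>j\<in>J. A n j y * w j) = b n"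
    proof -
      have "(\<Sum>j\<in>J. A n j y * w j) = A n p y * w p + (\<Sum>j\<in>J - {p}. A n j y * z j)"
        using J p(1) by (subst sum.remove[of J p]) (auto simp: w_def intro!: sum.cong)
      thus ?thesis using y by (simp add: w_def)
    qed
    have "(\<Sum>j\<in>J. A i j y * w j) = b i" if "i < n" for i
    proof -
      have "(\<Sum>j\<in>J. A' i j y * w j) = (\<Sum>j\<in>J. A' i j y * z j)"
        by (intro sum.cong) (auto simp: w_def A'_def)
      hence "A n p y * (\<Sum>j\<in>J. A i j y * w j) - A i p y * b n = A n p y * b i - A i p y * b n"
        by (simp only: A'[of i y w, symmetric] wn[symmetric] z[OF that])
      hence "A n p y * (\<Sum>j\<in>J. A i j y * w j) = A n p y * b i" by (simp only: diff_eq_eq diff_add_cancel)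
      thus ?thesis using y by simp
    qed
    with wn show "\<exists>z. \<forall>i<Suc n. (\<Sum>j\<in>J. A i j y * z j) = b i"
      by (intro exI[of _ w]) (auto simp: less_Suc_eq)
  qed
qed

section \<open>Finite sums of morphisms and linear coordinates with respect to a spanning
  family\<close>

context monoidal_linear_category
begin

primrec tsum :: "'a \<Rightarrow> 'a \<Rightarrow> (nat \<Rightarrow> 'b) \<Rightarrow> nat \<Rightarrow> 'b" where
  "tsum a b f 0 = \<zero> a b"
| "tsum a b f (Suc n) = tsum a b f n \<uplus> f n"

lemma tsum_simps [simp]:
  assumes "a \<in> Ob" "b \<in> Ob"
  shows "arr (tsum a b f n)" "dm (tsum a b f n) = a" "cd (tsum a b f n) = b"
  using assms by (induction n) simp_all

lemma sum_mor_tsum: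
  assumes "a \<in> Ob" "b \<in> Ob" "\<And>k. k < n \<Longrightarrow> arr (f k) \<and> dm (f k) = a \<and> cd (f k) = b"
  shows "sum_mor C a b f n = tsum a b f n"
  using assms by (induction n) (auto simp: tot)

lemma tsum_zero:
  assumes "a \<in> Ob" "b \<in> Ob" "\<And>k. k < n \<Longrightarrow> f k = \<zero> a b"
  shows "tsum a b f n = \<zero> a b"
  using assms by (induction n) simp_all

lemma tsum_cong: "(\<And>k. k < n \<Longrightarrow> f k = g k) \<Longrightarrow> tsum a b f n = tsum a b g n"
  by (induction n) simp_all

lemma cmp_tsum:
  assumes "a \<in> Ob" "b \<in> Ob" "\<And>k. k < n \<Longrightarrow> arr (f k) \<and> dm (f k) = a \<and> cd (f k) = b"
  shows "g \<bullet> tsum a b f n = tsum a (cd g) (\<lambda>k. g \<bullet> f k) n"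
    "tsum a b f n \<bullet> g = tsum (dm g) b (\<lambda>k. f k \<bullet> g) n"
  using assms by (induction n) (simp_all add: distribs)

lemma tns_tsum:
  assumes "a \<in> Ob" "b \<in> Ob" "\<And>k. k < n \<Longrightarrow> arr (f k) \<and> dm (f k) = a \<and> cd (f k) = b"
  shows "g \<star> tsum a b f n = tsum (dm g \<otimes> a) (cd g \<otimes> b) (\<lambda>k. g \<star> f k) n"
    "tsum a b f n \<star> g = tsum (a \<otimes> dm g) (b \<otimes> cd g) (\<lambda>k. f k \<star> g) n"
  using assms by (induction n) (simp_all add: distribs)

lemma add_interchange:
  assumes "arr f" "arr g" "arr h" "arr k" "dm g = dm f" "dm h = dm f" "dm k = dm f"
    "cd g = cd f" "cd h = cd f" "cd k = cd f"
  shows "(f \<uplus> g) \<uplus> (h \<uplus> k) = (f \<uplus> h) \<uplus> (g \<uplus> k)"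
  using assms by (simp add: add_assoc' add_left_commute'[of g h k])

lemma tsum_add:
  assumes "a \<in> Ob" "b \<in> Ob" "\<And>k. k < n \<Longrightarrow> arr (f k) \<and> dm (f k) = a \<and> cd (f k) = b"
    "\<And>k. k < n \<Longrightarrow> arr (g k) \<and> dm (g k) = a \<and> cd (g k) = b"
  shows "tsum a b (\<lambda>k. f k \<uplus> g k) n = tsum a b f n \<uplus> tsum a b g n"
  using assms by (induction n) (simp_all add: add_interchange)

lemma scl_tsum:
  assumes "a \<in> Ob" "b \<in> Ob" "\<And>k. k < n \<Longrightarrow> arr (f k) \<and> dm (f k) = a \<and> cd (f k) = b"
  shows "s \<triangleright> tsum a b f n = tsum a b (\<lambda>k. s \<triangleright> f k) n"
  using assms by (induction n) (simp_all add: scl_add)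

lemma tsum_Suc_front:
  assumes "a \<in> Ob" "b \<in> Ob" "\<And>k. k \<le> n \<Longrightarrow> arr (f k) \<and> dm (f k) = a \<and> cd (f k) = b"
  shows "tsum a b f (Suc n) = f 0 \<uplus> tsum a b (\<lambda>k. f (Suc k)) n"
  using assms by (induction n) (simp_all add: add_assoc')

lemma eq_if_diff_zero:
  assumes "f \<uplus> \<ominus> g = \<zero> a b" "arr f" "arr g" "dm f = dm g" "cd f = cd g" "a = dm f" "b = cd f"
  shows "f = g"
proof -
  have "f = (f \<uplus> \<ominus> g) \<uplus> g" using assms(2-5) by (simp add: add_assoc')
  also have "\<dots> = g" unfolding assms(1) using assms(2-) by simp
  finally show ?thesis .
qed

definition lincomb :: "'a \<Rightarrow> 'a \<Rightarrow> (nat \<Rightarrow> 'b) \<Rightarrow> nat \<Rightarrow> (nat \<Rightarrow> 'c) \<Rightarrow> 'b" where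
  "lincomb a b e n s = tsum a b (\<lambda>k. s k \<triangleright> e k) n"

lemma lincomb_simps [simp]:
  assumes "a \<in> Ob" "b \<in> Ob"
  shows "arr (lincomb a b e n s)" "dm (lincomb a b e n s) = a" "cd (lincomb a b e n s) = b"
  using assms by (simp_all add: lincomb_def)

definition family :: "'a \<Rightarrow> 'a \<Rightarrow> (nat \<Rightarrow> 'b) \<Rightarrow> nat \<Rightarrow> bool" where
  "family a b e n \<longleftrightarrow> a \<in> Ob \<and> b \<in> Ob \<and> (\<forall>k<n. arr (e k) \<and> dm (e k) = a \<and> cd (e k) = b)"

lemma lincomb_add:
  assumes "family a b e n"
  shows "lincomb a b e n (\<lambda>k. s k + t k) = lincomb a b e n s \<uplus> lincomb a b e n t"
  using assms by (simp add: lincomb_def family_def scl_add_left tsum_add[symmetric])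

lemma lincomb_scl:
  assumes "family a b e n"
  shows "lincomb a b e n (\<lambda>k. r * s k) = r \<triangleright> lincomb a b e n s"
  using assms by (simp add: lincomb_def family_def scl_tsum)

lemma lincomb_zero: "family a b e n \<Longrightarrow> (\<And>k. k < n \<Longrightarrow> s k = 0) \<Longrightarrow> lincomb a b e n s = \<zero> a b"
  unfolding lincomb_def family_def by (intro tsum_zero) auto

lemma lincomb_cong: "(\<And>k. k < n \<Longrightarrow> s k = t k) \<Longrightarrow> lincomb a b e n s = lincomb a b e n t"
  unfolding lincomb_def by (intro tsum_cong) auto

lemma tsum_lincomb:
  assumes "family a b e n"
  shows "tsum a b (\<lambda>j. v j \<triangleright> lincomb a b e n (A j)) m = lincomb a b e n (\<lambda>i. \<Sum>j<m. A j i * v j)"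
proof (induction m)
  case 0
  show ?case using assms by (simp add: lincomb_zero)
next
  case (Suc m)
  have "lincomb a b e n (\<lambda>i. \<Sum>j<Suc m. A j i * v j) =
     lincomb a b e n (\<lambda>i. (\<Sum>j<m. A j i * v j) + v m * A m i)"
    by (intro lincomb_cong) simp
  thus ?case using Suc assms by (simp add: lincomb_add lincomb_scl)
qed

text \<open>Redundant vectors are discarded one at a time: their coordinate is \<open>0\<close>.\<close>

lemma linear_coordinates:
  assumes "family a b e n"
  shows "\<exists>c. (\<forall>s. lincomb a b e n (c (lincomb a b e n s)) = lincomb a b e n s) \<and>
     (\<forall>s t i. c (lincomb a b e n s \<uplus> lincomb a b e n t) i = c (lincomb a b e n s) i + c (lincomb a b e n t) i) \<and>
     (\<forall>r s i. c (r \<triangleright> lincomb a b e n s) i = r * c (lincomb a b e n s) i)"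
  using assms
proof (induction n)
  case 0
  show ?case by (intro exI[of _ "\<lambda>_ _. 0"]) (simp add: lincomb_def)
next
  case (Suc n)
  let ?L = "lincomb a b e"
  have fn: "family a b e n" and [simp]: "a \<in> Ob" "b \<in> Ob" "arr (e n)" "dm (e n) = a" "cd (e n) = b"
    using Suc.prems by (auto simp: family_def)
  obtain c where c: "\<And>s. ?L n (c (?L n s)) = ?L n s"
     "\<And>s t i. c (?L n s \<uplus> ?L n t) i = c (?L n s) i + c (?L n t) i"
     "\<And>r s i. c (r \<triangleright> ?L n s) i = r * c (?L n s) i"
    using Suc.IH[OF fn] by blast
  have LS: "?L (Suc n) s = ?L n s \<uplus> s n \<triangleright> e n" for s by (simp add: lincomb_def)
  show ?case
  proof (cases "\<exists>s0. e n = ?L n s0")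
    case True
    then obtain s0 where s0: "e n = ?L n s0" by blast
    have LS': "\<exists>t. ?L (Suc n) s = ?L n t" for s
      by (rule exI[of _ "\<lambda>k. s k + s n * s0 k"]) (simp add: LS s0 lincomb_add[OF fn] lincomb_scl[OF fn])
    let ?c = "\<lambda>f. (c f)(n := 0)"
    have "?L (Suc n) (?c (?L n t)) = ?L n t" for t
    proof -
      have "?L n (?c (?L n t)) = ?L n (c (?L n t))" by (rule lincomb_cong) simp
      thus ?thesis by (simp add: LS c)
    qed
    hence "?L (Suc n) (?c (?L (Suc n) s)) = ?L (Suc n) s" for s using LS'[of s] by metis
    moreover have "?c (?L (Suc n) s \<uplus> ?L (Suc n) t) i = ?c (?L (Suc n) s) i + ?c (?L (Suc n) t) i" for s t i
      using LS'[of s] LS'[of t] c(2) by (auto simp del: fun_upd_apply) (auto simp: fun_upd_def)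
    moreover have "?c (r \<triangleright> ?L (Suc n) s) i = r * ?c (?L (Suc n) s) i" for s r i
      using LS'[of s] c(3) by (auto simp del: fun_upd_apply) (auto simp: fun_upd_def)
    ultimately show ?thesis by (intro exI[of _ ?c] conjI allI)
  next
    case False
    \<comment> \<open>\<open>D f t\<close> says that \<open>t\<close> can serve as the last
      coordinate of \<open>f\<close>. Two different values would exhibit \<open>e n\<close> as a
      combination of the earlier vectors.\<close>
    define D where "D f t \<longleftrightarrow> (\<exists>s. f = ?L n s \<uplus> t \<triangleright> e n)" for f t
    have uniq: "t = t'" if t: "D f t" and t': "D f t'" for f t t'
    proof (rule ccontr)
      assume ne: "t \<noteq> t'"
      obtain s s' where s: "f = ?L n s \<uplus> t \<triangleright> e n" "f = ?L n s' \<uplus> t' \<triangleright> e n" using t t' unfolding D_def by blast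
      have "?L n s \<uplus> (t - t') \<triangleright> e n = (?L n s \<uplus> t \<triangleright> e n) \<uplus> (- t') \<triangleright> e n"
        using scl_add_left[of t "- t'" "e n"] by (simp add: add_assoc')
      also have "\<dots> = ?L n s'"
        unfolding s(1)[symmetric] unfolding s(2) by (simp add: add_assoc' scl_add_left[of t' "-t'", symmetric])
      finally have "(t - t') \<triangleright> e n = ?L n s' \<uplus> \<ominus> ?L n s"
        using add_ngt_cancel(2)[of "?L n s" "(t - t') \<triangleright> e n"] add_commute'[of "?L n s'" "\<ominus> ?L n s"]
        by (simp del: add_ngt_cancel)
      also have "\<dots> = ?L n (\<lambda>k. s' k + (-1) * s k)"
        unfolding lincomb_add[OF fn] lincomb_scl[OF fn] ..
      finally have *: "(t - t') \<triangleright> e n = ?L n (\<lambda>k. s' k + (-1) * s k)" .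
      have "e n = (inverse (t - t') * (t - t')) \<triangleright> e n" using ne by simp
      also have "\<dots> = inverse (t - t') \<triangleright> (t - t') \<triangleright> e n" by (simp only: scl_scl)
      finally have "e n = inverse (t - t') \<triangleright> ?L n (\<lambda>k. s' k + (-1) * s k)"
        unfolding * .
      thus False using False unfolding lincomb_scl[OF fn, symmetric] by blast
    qed
    define T where "T f = (THE t. D f t)" for f
    have T: "T f = t" if "D f t" for f t using that uniq unfolding T_def by blast
    define c' where "c' f = (c (f \<uplus> (- T f) \<triangleright> e n))(n := T f)" for f
    have c': "c' (?L n s \<uplus> t \<triangleright> e n) = (c (?L n s))(n := t)" for s t
    proof -
      have "T (?L n s \<uplus> t \<triangleright> e n) = t" by (rule T) (auto simp: D_def)
      thus ?thesis unfolding c'_def by (simp add: add_assoc' scl_add_left[of t "-t", symmetric])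
    qed
    have cL: "c' (?L (Suc n) s) = (c (?L n s))(n := s n)" for s by (simp add: LS c')
    have "?L (Suc n) (c' (?L (Suc n) s)) = ?L (Suc n) s" for s
    proof -
      have "?L n ((c (?L n s))(n := s n)) = ?L n (c (?L n s))" by (rule lincomb_cong) simp
      thus ?thesis unfolding cL by (simp add: LS c)
    qed
    moreover have "c' (?L (Suc n) s \<uplus> ?L (Suc n) t) i = c' (?L (Suc n) s) i + c' (?L (Suc n) t) i" for s t i
    proof -
      have "?L (Suc n) s \<uplus> ?L (Suc n) t = ?L n (\<lambda>k. s k + t k) \<uplus> (s n + t n) \<triangleright> e n"
        using lincomb_add[OF Suc.prems, of s t] by (simp add: LS)
      hence "c' (?L (Suc n) s \<uplus> ?L (Suc n) t) = (c (?L n (\<lambda>k. s k + t k)))(n := s n + t n)"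
        by (simp only: c')
      thus ?thesis by (simp add: cL c(2) lincomb_add[OF fn])
    qed
    moreover have "c' (r \<triangleright> ?L (Suc n) s) i = r * c' (?L (Suc n) s) i" for s r i
    proof -
      have "r \<triangleright> ?L (Suc n) s = ?L n (\<lambda>k. r * s k) \<uplus> (r * s n) \<triangleright> e n"
        using lincomb_scl[OF Suc.prems, of r s] by (simp add: LS)
      hence "c' (r \<triangleright> ?L (Suc n) s) = (c (?L n (\<lambda>k. r * s k)))(n := r * s n)"
        by (simp only: c')
      thus ?thesis by (simp add: cL c(3) lincomb_scl[OF fn])
    qed
    ultimately show ?thesis by (intro exI[of _ c'] conjI allI)
  qed
qed

end

section \<open>Semisimplicity\<close>

context braided_fusion_category
begin

definition hom :: "'o \<Rightarrow> 'o \<Rightarrow> 'm \<Rightarrow> bool" where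
  "hom a b f \<longleftrightarrow> arr f \<and> dm f = a \<and> cd f = b"

lemma homD: "hom a b f \<Longrightarrow> arr f" "hom a b f \<Longrightarrow> dm f = a" "hom a b f \<Longrightarrow> cd f = b"
  by (simp_all add: hom_def)

lemma Hom_hom: "f \<in> Hom a b \<longleftrightarrow> hom a b f"
  by (simp add: hom_def Hom_iff)

text \<open>The family spans and may be linearly dependent. What matters is that the choice
  \<open>c\<close> of coordinates is linear, so that a morphism depending polynomially on parameters
  has polynomial coordinates.\<close>

lemma Hom_basis:
  assumes [simp]: "a \<in> Ob" "b \<in> Ob"
  obtains n e c where "family a b e n"
    "\<And>f. hom a b f \<Longrightarrow> f = lincomb a b e n (c f)"
    "\<And>f g i. hom a b f \<Longrightarrow> hom a b g \<Longrightarrow> c (f \<uplus> g) i = c f i + c g i"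
    "\<And>f r i. hom a b f \<Longrightarrow> c (r \<triangleright> f) i = r * c f i"
proof -
  obtain n e where e: "\<forall>k<n. e k \<in> Hom a b"
    and s: "\<forall>f\<in>Hom a b. \<exists>s. f = sum_mor C a b (\<lambda>k. s k \<odot> e k) n"
    using finite_dim_Hom[OF assms] by blast
  have fam: "family a b e n" using e by (auto simp: family_def Hom_iff)
  have L: "sum_mor C a b (\<lambda>k. s k \<odot> e k) n = lincomb a b e n s" for s
  proof -
    have "sum_mor C a b (\<lambda>k. s k \<odot> e k) n = tsum a b (\<lambda>k. s k \<odot> e k) n"
      by (rule sum_mor_tsum) (use e in \<open>auto simp: Hom_iff tot\<close>)
    also have "\<dots> = lincomb a b e n s"
      unfolding lincomb_def by (rule tsum_cong) (use e in \<open>auto simp: Hom_iff tot\<close>)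
    finally show ?thesis .
  qed
  have s': "\<exists>s. f = lincomb a b e n s" if "hom a b f" for f
    using s that by (auto simp: L Hom_hom)
  obtain c where c: "\<And>s. lincomb a b e n (c (lincomb a b e n s)) = lincomb a b e n s"
     "\<And>s t i. c (lincomb a b e n s \<uplus> lincomb a b e n t) i = c (lincomb a b e n s) i + c (lincomb a b e n t) i"
     "\<And>r s i. c (r \<triangleright> lincomb a b e n s) i = r * c (lincomb a b e n s) i"
    using linear_coordinates[OF fam] by blast
  show ?thesis
    by (rule that[OF fam, of c]) (metis s' c)+
qed

text \<open>\<open>x\<close> satisfies a polynomial equation, whose lowest nonzero coefficient
  can be made the constant one by cancelling powers of \<open>x\<close>.\<close>

lemma left_inverse_imp_right_inverse:
  assumes x: "hom a a x" and y: "hom a a y" and yx: "y \<bullet> x = Id a"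
  shows "x \<bullet> y = Id a"
proof -
  have [simp]: "a \<in> Ob" "arr x" "arr y" "dm x = a" "cd x = a" "dm y = a" "cd y = a"
    using x y dm_Ob[of x] by (auto simp: hom_def)
  have yx' [simp]: "y \<bullet> x \<bullet> f = f" if "arr f" "cd f = a" for f
    using yx[THEN cmp_reassoc, of f] that by simp
  define pw where "pw = (\<lambda>k. ((\<lambda>f. x \<bullet> f) ^^ k) (Id a))"
  have pw0: "pw 0 = Id a" and pwS: "pw (Suc k) = x \<bullet> pw k" for k by (simp_all add: pw_def)
  have pw [simp]: "arr (pw k) \<and> dm (pw k) = a \<and> cd (pw k) = a" for k
    by (induction k) (simp_all add: pw0 pwS)
  have main: "\<exists>z. hom a a z \<and> x \<bullet> z = Id a"
    if "\<exists>j<n. v j \<noteq> 0" "tsum a a (\<lambda>k. v k \<triangleright> pw k) n = \<zero> a a" for n v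
    using that
  proof (induction n arbitrary: v)
    case (Suc n)
    let ?t = "tsum a a (\<lambda>k. v (Suc k) \<triangleright> pw k) n"
    have "tsum a a (\<lambda>k. v k \<triangleright> pw k) (Suc n) = v 0 \<triangleright> Id a \<uplus> tsum a a (\<lambda>k. v (Suc k) \<triangleright> pw (Suc k)) n"
      using tsum_Suc_front[of a a n "\<lambda>k. v k \<triangleright> pw k"] by (simp add: pw0)
    also have "tsum a a (\<lambda>k. v (Suc k) \<triangleright> pw (Suc k)) n = x \<bullet> ?t"
      by (simp add: cmp_tsum pwS)
    finally have eq: "v 0 \<triangleright> Id a \<uplus> x \<bullet> ?t = \<zero> a a" using Suc.prems by simp
    show ?case
    proof (cases "v 0 = 0")
      case True
      hence "x \<bullet> ?t = \<zero> a a" using eq by simp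
      hence "y \<bullet> x \<bullet> ?t = \<zero> a a" by simp
      hence "?t = \<zero> a a" by simp
      moreover have "\<exists>j<n. v (Suc j) \<noteq> 0" using Suc.prems(1) True by (metis less_Suc_eq_0_disj)
      ultimately show ?thesis using Suc.IH[of "\<lambda>k. v (Suc k)"] by blast
    next
      case False
      have "v 0 \<triangleright> Id a = \<ominus> (x \<bullet> ?t)"
        by (rule eq_if_diff_zero[where a = a and b = a]) (simp_all add: eq)
      hence "inverse (v 0) \<triangleright> v 0 \<triangleright> Id a = inverse (v 0) \<triangleright> \<ominus> (x \<bullet> ?t)" by (simp only:)
      hence "x \<bullet> (- inverse (v 0)) \<triangleright> ?t = Id a" using False by simp
      moreover have "hom a a ((- inverse (v 0)) \<triangleright> ?t)" by (simp add: hom_def)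
      ultimately show ?thesis by blast
    qed
  qed simp
  obtain n e c where fam: "family a a e n" and c: "\<And>f. hom a a f \<Longrightarrow> f = lincomb a a e n (c f)"
    by (rule Hom_basis[of a a]) auto
  \<comment> \<open>There are \<open>Suc n\<close> powers of \<open>x\<close> but only
    \<open>n\<close> coordinates, so the powers satisfy a nontrivial linear relation.\<close>
  obtain v where v: "\<exists>j\<in>{..<Suc n}. v j \<noteq> 0" "\<And>i. i < n \<Longrightarrow> (\<Sum>j<Suc n. c (pw j) i * v j) = 0"
    using homogeneous_system_nontrivial[of "{..<Suc n}" n "\<lambda>i j. c (pw j) i"] by auto
  have "tsum a a (\<lambda>k. v k \<triangleright> pw k) (Suc n) = tsum a a (\<lambda>k. v k \<triangleright> lincomb a a e n (c (pw k))) (Suc n)"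
    by (rule tsum_cong) (use c[of "pw _"] in \<open>simp add: hom_def\<close>)
  also have "\<dots> = lincomb a a e n (\<lambda>i. \<Sum>j<Suc n. c (pw j) i * v j)"
    by (rule tsum_lincomb[OF fam])
  also have "\<dots> = \<zero> a a" by (rule lincomb_zero[OF fam v(2)])
  finally obtain z where z: "hom a a z" "x \<bullet> z = Id a" using main[of "Suc n" v] v(1) by blast
  have "y = y \<bullet> x \<bullet> z" using z by simp
  also have "\<dots> = z" using z(1) by (auto simp: hom_def)
  finally show ?thesis using z by simp
qed

section \<open>Kernels, simple objects and the splitting of morphisms\<close>

lemma zero_ob_zero:
  assumes "zero_ob C a" "arr f"
  shows "dm f = a \<Longrightarrow> f = \<zero> a (cd f)" "cd f = a \<Longrightarrow> f = \<zero> (dm f) a"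
  using assms cmp_Id(1)[of f a] cmp_Id(2)[of f a] by (auto simp: zero_ob_def)

lemma zero_ob_iff: "a \<in> Ob \<Longrightarrow> zero_ob C a \<longleftrightarrow> Id a = \<zero> a a"
  by (simp add: zero_ob_def)

lemma mono_arrI:
  assumes "arr f" "dm f = a" "cd f = b"
    "\<And>g. arr g \<Longrightarrow> cd g = a \<Longrightarrow> f \<bullet> g = \<zero> (dm g) b \<Longrightarrow> g = \<zero> (dm g) a"
  shows "mono_arr C a b f"
  unfolding mono_arr_def
proof (intro conjI allI impI)
  show "f \<in> Hom a b" using assms by (simp add: Hom_iff)
  fix x g h assume g: "g \<in> Hom x a" "h \<in> Hom x a" "f \<cdot> g = f \<cdot> h"
  hence [simp]: "arr g" "arr h" "dm g = x" "dm h = x" "cd g = a" "cd h = a" by (auto simp: Hom_iff)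
  have "x \<in> Ob" using dm_Ob[of g] by simp
  have "f \<bullet> g = f \<bullet> h" using g assms by (simp add: tot)
  hence "f \<bullet> (g \<uplus> \<ominus> h) = \<zero> x b" using assms by (simp add: distribs)
  hence "g \<uplus> \<ominus> h = \<zero> x a" using assms(4)[of "g \<uplus> \<ominus> h"] by simp
  thus "g = h" by (rule eq_if_diff_zero) simp_all
qed

lemma mono_arr_hom: "mono_arr C a b f \<Longrightarrow> hom a b f"
  by (simp add: mono_arr_def Hom_hom)

lemma kernelD:
  assumes "kernel C k i a b f"
  shows "hom k a i" "hom a b f" "f \<bullet> i = \<zero> k b"
    "arr g \<Longrightarrow> cd g = a \<Longrightarrow> f \<bullet> g = \<zero> (dm g) b \<Longrightarrow> \<exists>h. hom (dm g) k h \<and> i \<bullet> h = g"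
    "mono_arr C k a i"
proof -
  show 1: "hom k a i" "hom a b f" using assms by (simp_all add: kernel_def Hom_hom)
  show 2: "f \<bullet> i = \<zero> k b" using assms 1 by (simp add: kernel_def hom_def tot)
  have univ: "\<exists>!h. h \<in> Hom (dm g) k \<and> i \<cdot> h = g" if "arr g" "cd g = a" "f \<bullet> g = \<zero> (dm g) b" for g
  proof -
    have "g \<in> Hom (dm g) a" using that by (simp add: Hom_iff)
    moreover have "f \<cdot> g = \<zero> (dm g) b" using that 1 by (simp add: hom_def tot)
    ultimately show ?thesis using assms unfolding kernel_def by blast
  qed
  have tr: "i \<cdot> h = i \<bullet> h" if "hom x k h" for h x using that 1 by (simp add: hom_def tot)
  show "\<exists>h. hom (dm g) k h \<and> i \<bullet> h = g" if g: "arr g" "cd g = a" "f \<bullet> g = \<zero> (dm g) b"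
  proof -
    obtain h where "h \<in> Hom (dm g) k" "i \<cdot> h = g" using univ[OF g] by blast
    thus ?thesis using tr[of "dm g" h] by (intro exI[of _ h]) (simp add: Hom_hom)
  qed
  have [simp]: "arr i" "dm i = k" "cd i = a" "arr f" "dm f = a" "cd f = b" using 1 by (simp_all add: hom_def)
  have [simp]: "k \<in> Ob" "a \<in> Ob" "b \<in> Ob" using dm_Ob[of i] cd_Ob[of i] cd_Ob[of f] by simp_all
  show "mono_arr C k a i"
  proof (rule mono_arrI)
    fix g assume g: "arr g" "cd g = k" "i \<bullet> g = \<zero> (dm g) a"
    have "g \<in> Hom (dm g) k" "i \<cdot> g = \<zero> (dm g) a" using g by (simp_all add: Hom_iff tot)
    moreover have "\<zero> (dm g) k \<in> Hom (dm g) k" "i \<cdot> \<zero> (dm g) k = \<zero> (dm g) a"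
      by (simp_all add: Hom_iff tot)
    ultimately show "g = \<zero> (dm g) k" using univ[of "\<zero> (dm g) a"] by auto
  qed simp_all
qed

text \<open>The kernel of \<open>f\<close> is a subobject of a simple object. If it were everything,
  \<open>f\<close> would be zero; so it is zero, and \<open>g\<close> factors through it.\<close>

lemma simple_mono:
  assumes "simple C a" "arr f" "dm f = a" "f \<noteq> \<zero> a (cd f)" "arr g" "cd g = a" "f \<bullet> g = \<zero> (dm g) (cd f)"
  shows "g = \<zero> (dm g) a"
proof -
  obtain k i where ki: "kernel C k i a (cd f) f"
    using kernel_exists[of f a "cd f"] assms by (auto simp: Hom_iff)
  hence hi: "hom k a i" "f \<bullet> i = \<zero> k (cd f)" using kernelD by blast+
  have "a \<in> Ob" using assms by (auto simp: simple_def)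
  obtain h where h: "hom (dm g) k h" "i \<bullet> h = g" using kernelD(4)[OF ki] assms by blast
  from kernelD(5)[OF ki] assms(1) consider "zero_ob C k" | "iso C k a i" by (auto simp: simple_def)
  thus ?thesis
  proof cases
    case 1
    have "h = \<zero> (dm g) k" using zero_ob_zero(2)[OF 1, of h] h by (auto simp: hom_def)
    thus ?thesis using h hi by (metis cmp_zero_right dm_Ob homD(2,3))
  next
    case 2
    then obtain j where j: "inverse_arrows C k a i j" by (auto simp: iso_def)
    hence "f = (f \<bullet> i) \<bullet> j" using assms by (auto simp: inverse_arrows_tot)
    also have "\<dots> = \<zero> a (cd f)" unfolding hi(2) using j \<open>a \<in> Ob\<close> by (auto simp: inverse_arrows_tot)
    finally show ?thesis using assms by simp
  qed
qed

text \<open>A nonzero morphism out of a simple object is mono, and a mono from a nonzero object into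
  the simple object \<open>b\<close> is an isomorphism.\<close>

lemma schur:
  assumes "simple C a" "simple C b" "hom a b f" "f \<noteq> \<zero> a b"
  obtains g where "hom b a g" "g \<bullet> f = Id a" "f \<bullet> g = Id b"
proof -
  have "mono_arr C a b f"
    by (rule mono_arrI) (use assms simple_mono[of a f] in \<open>auto simp: hom_def\<close>)
  hence "iso C a b f" using assms by (auto simp: simple_def)
  thus ?thesis using that by (auto simp: iso_def inverse_arrows_tot hom_def)
qed

lemma direct_sum_tot:
  assumes "direct_sum C c n X \<iota> \<pi>"
  shows "c \<in> Ob" "k < n \<Longrightarrow> hom (X k) c (\<iota> k)" "k < n \<Longrightarrow> hom c (X k) (\<pi> k)"
    "k < n \<Longrightarrow> l < n \<Longrightarrow> \<pi> k \<bullet> \<iota> l = (if k = l then Id (X k) else \<zero> (X l) (X k))"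
    "tsum c c (\<lambda>k. \<iota> k \<bullet> \<pi> k) n = Id c"
proof -
  show c: "c \<in> Ob" and 1: "\<And>k. k < n \<Longrightarrow> hom (X k) c (\<iota> k)" and 2: "\<And>k. k < n \<Longrightarrow> hom c (X k) (\<pi> k)"
    using assms by (auto simp: direct_sum_def Hom_hom)
  have "\<pi> k \<cdot> \<iota> l = \<pi> k \<bullet> \<iota> l" if "k < n" "l < n" for k l
    using 1[OF that(2)] 2[OF that(1)] by (auto simp: hom_def tot)
  thus "k < n \<Longrightarrow> l < n \<Longrightarrow> \<pi> k \<bullet> \<iota> l = (if k = l then Id (X k) else \<zero> (X l) (X k))"
    using assms by (auto simp: direct_sum_def)
  have "Id c = sum_mor C c c (\<lambda>k. \<iota> k \<cdot> \<pi> k) n" using assms by (simp add: direct_sum_def)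
  also have "\<dots> = tsum c c (\<lambda>k. \<iota> k \<cdot> \<pi> k) n"
    by (rule sum_mor_tsum) (use c 1 2 in \<open>auto simp: hom_def tot\<close>)
  also have "\<dots> = tsum c c (\<lambda>k. \<iota> k \<bullet> \<pi> k) n"
    by (rule tsum_cong) (use 1 2 in \<open>auto simp: hom_def tot\<close>)
  finally show "tsum c c (\<lambda>k. \<iota> k \<bullet> \<pi> k) n = Id c" by simp
qed

lemma direct_sum_eqI:
  assumes ds: "direct_sum C c n X \<iota> \<pi>" and "arr f" "arr g"
  shows "dm f = c \<Longrightarrow> dm g = c \<Longrightarrow> (\<And>k. k < n \<Longrightarrow> f \<bullet> \<iota> k = g \<bullet> \<iota> k) \<Longrightarrow> cd f = cd g \<Longrightarrow> f = g"
    "cd f = c \<Longrightarrow> cd g = c \<Longrightarrow> (\<And>k. k < n \<Longrightarrow> \<pi> k \<bullet> f = \<pi> k \<bullet> g) \<Longrightarrow> dm f = dm g \<Longrightarrow> f = g"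
proof -
  note d = direct_sum_tot[OF ds]
  have 1: "arr (\<iota> k \<bullet> \<pi> k) \<and> dm (\<iota> k \<bullet> \<pi> k) = c \<and> cd (\<iota> k \<bullet> \<pi> k) = c" if "k < n" for k
    using d(2,3)[OF that] by (auto simp: hom_def)
  show "f = g" if *: "dm f = c" "dm g = c" "\<And>k. k < n \<Longrightarrow> f \<bullet> \<iota> k = g \<bullet> \<iota> k" "cd f = cd g"
  proof -
    have "f = f \<bullet> tsum c c (\<lambda>k. \<iota> k \<bullet> \<pi> k) n" using d(5) * assms by simp
    also have "\<dots> = tsum c (cd f) (\<lambda>k. f \<bullet> \<iota> k \<bullet> \<pi> k) n" using d(1) 1 by (simp add: cmp_tsum)
    also have "\<dots> = tsum c (cd g) (\<lambda>k. g \<bullet> \<iota> k \<bullet> \<pi> k) n" unfolding *(4)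
      by (rule tsum_cong) (metis *(3) cmp_assoc)
    also have "\<dots> = g \<bullet> tsum c c (\<lambda>k. \<iota> k \<bullet> \<pi> k) n" using d(1) 1 by (simp add: cmp_tsum)
    also have "\<dots> = g" using d(5) * assms by simp
    finally show ?thesis .
  qed
  show "f = g" if *: "cd f = c" "cd g = c" "\<And>k. k < n \<Longrightarrow> \<pi> k \<bullet> f = \<pi> k \<bullet> g" "dm f = dm g"
  proof -
    have "f = tsum c c (\<lambda>k. \<iota> k \<bullet> \<pi> k) n \<bullet> f" using d(5) * assms by simp
    also have "\<dots> = tsum (dm f) c (\<lambda>k. \<iota> k \<bullet> \<pi> k \<bullet> f) n" using d(1) 1 by (simp add: cmp_tsum)
    also have "\<dots> = tsum (dm g) c (\<lambda>k. \<iota> k \<bullet> \<pi> k \<bullet> g) n" unfolding *(4)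
      by (rule tsum_cong) (metis *(3))
    also have "\<dots> = tsum c c (\<lambda>k. \<iota> k \<bullet> \<pi> k) n \<bullet> g" using d(1) 1 by (simp add: cmp_tsum)
    also have "\<dots> = g" using d(5) * assms by simp
    finally show ?thesis .
  qed
qed

text \<open>Some component of \<open>f\<close> into a simple summand of its target is nonzero and
  can be inverted by Schur's lemma.\<close>

lemma simple_retract:
  assumes "simple C a" "arr f" "dm f = a" "f \<noteq> \<zero> a (cd f)"
  obtains r where "hom (cd f) a r" "r \<bullet> f = Id a"
proof -
  obtain n X \<iota> \<pi> where X: "\<forall>k<n. simple C (X k)" and ds: "direct_sum C (cd f) n X \<iota> \<pi>"
    using semisimple[of "cd f"] by auto
  have a: "a \<in> Ob" using assms by (auto simp: simple_def)
  have "\<exists>k<n. \<pi> k \<bullet> f \<noteq> \<zero> a (X k)"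
  proof (rule ccontr)
    assume "\<not> ?thesis"
    hence *: "\<pi> k \<bullet> f = \<zero> a (X k)" if "k < n" for k using that by blast
    have **: "\<pi> k \<bullet> f = \<pi> k \<bullet> \<zero> a (cd f)" if "k < n" for k
      unfolding *[OF that] using a homD(3)[OF direct_sum_tot(3)[OF ds that]] by simp
    have "f = \<zero> a (cd f)"
    proof (rule direct_sum_eqI(2)[OF ds])
      show "k < n \<Longrightarrow> \<pi> k \<bullet> f = \<pi> k \<bullet> \<zero> a (cd f)" for k by (rule **)
    qed (simp_all add: assms(2,3) a)
    thus False using assms by simp
  qed
  then obtain k where k: "k < n" "\<pi> k \<bullet> f \<noteq> \<zero> a (X k)" by blast
  note p = direct_sum_tot(3)[OF ds k(1)]
  have pf: "hom a (X k) (\<pi> k \<bullet> f)" using assms(2,3) p by (simp add: hom_def)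
  have "simple C (X k)" using X k(1) by blast
  from schur[OF assms(1) this pf k(2)]
  obtain g where "hom (X k) a g" "g \<bullet> \<pi> k \<bullet> f = Id a" by blast
  thus ?thesis using that[of "g \<bullet> \<pi> k"] p by (simp add: hom_def)
qed

text \<open>Semisimplicity in the form in which it is used everywhere: all morphisms are von Neumann
  regular. From \<open>g\<close> one reads off the idempotents \<open>g \<bullet> f\<close> and
  \<open>f \<bullet> g\<close>, hence kernels, images and complements.\<close>

lemma pseudo_inverse:
  assumes "arr f"
  obtains g where "hom (cd f) (dm f) g" "f \<bullet> g \<bullet> f = f"
proof -
  obtain n X \<iota> \<pi> where X: "\<forall>k<n. simple C (X k)" and ds: "direct_sum C (dm f) n X \<iota> \<pi>"
    using semisimple[of "dm f"] by auto
  have "\<exists>g. hom (cd f) (dm f) g \<and> (\<forall>k<m. f \<bullet> g \<bullet> f \<bullet> \<iota> k = f \<bullet> \<iota> k)" if "m \<le> n" for m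
    using that
  proof (induction m)
    case 0
    show ?case by (rule exI[of _ "\<zero> (cd f) (dm f)"]) (simp add: hom_def)
  next
    case (Suc m)
    then obtain g where g: "hom (cd f) (dm f) g" "\<And>k. k < m \<Longrightarrow> f \<bullet> g \<bullet> f \<bullet> \<iota> k = f \<bullet> \<iota> k" by auto
    have \<iota>m: "hom (X m) (dm f) (\<iota> m)" using direct_sum_tot(2)[OF ds] Suc.prems by simp
    have [simp]: "arr g" "dm g = cd f" "cd g = dm f" "arr (\<iota> m)" "dm (\<iota> m) = X m" "cd (\<iota> m) = dm f"
      using g \<iota>m by (auto simp: hom_def)
    have [simp]: "X m \<in> Ob" using dm_Ob[of "\<iota> m"] by simp
    \<comment> \<open>The defect of \<open>g\<close> on the next simple summand. If it is nonzero,
      it has a retraction \<open>r\<close>, because its source is simple.\<close>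
    define v where "v = f \<bullet> \<iota> m \<uplus> \<ominus> (f \<bullet> g \<bullet> f \<bullet> \<iota> m)"
    have [simp]: "arr v" "dm v = X m" "cd v = cd f" by (simp_all add: v_def)
    show ?case
    proof (cases "v = \<zero> (X m) (cd f)")
      case True
      hence "f \<bullet> \<iota> m = f \<bullet> g \<bullet> f \<bullet> \<iota> m"
        unfolding v_def by (rule eq_if_diff_zero) simp_all
      thus ?thesis using g by (intro exI[of _ g]) (auto simp: less_Suc_eq)
    next
      case False
      then obtain r where r: "hom (cd f) (X m) r" "r \<bullet> v = Id (X m)"
        using simple_retract[of "X m" v] X Suc.prems by auto
      hence [simp]: "arr r" "dm r = cd f" "cd r = X m" by (auto simp: hom_def)
      \<comment> \<open>\<open>w\<close> kills the image of the summands treated so far and inverts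
        the defect on the new one, so the correction of \<open>g\<close> built from it leaves the
        earlier summands alone.\<close>
      define w where "w = r \<bullet> (Id (cd f) \<uplus> \<ominus> (f \<bullet> g))"
      define g' where "g' = g \<uplus> (\<iota> m \<uplus> \<ominus> (g \<bullet> f \<bullet> \<iota> m)) \<bullet> w"
      have [simp]: "arr w" "dm w = cd f" "cd w = X m" by (simp_all add: w_def)
      have fg: "f \<bullet> g' \<bullet> x = f \<bullet> g \<bullet> x \<uplus> v \<bullet> w \<bullet> x" for x
        unfolding g'_def v_def by (simp add: distribs)
      have "f \<bullet> g' \<bullet> f \<bullet> \<iota> k = f \<bullet> \<iota> k" if k: "k < Suc m" for k
      proof (cases "k = m")
        case True
        have "w \<bullet> f \<bullet> \<iota> m = r \<bullet> v" using assms unfolding w_def v_def by (simp add: distribs)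
        hence "w \<bullet> f \<bullet> \<iota> m = Id (X m)" using r by simp
        hence "f \<bullet> g' \<bullet> f \<bullet> \<iota> m = f \<bullet> g \<bullet> f \<bullet> \<iota> m \<uplus> v" unfolding fg by simp
        also have "\<dots> = f \<bullet> \<iota> m" unfolding v_def by (simp add: add_ac')
        finally show ?thesis using True by simp
      next
        case False
        hence km: "k < m" using k by simp
        have \<iota>k: "hom (X k) (dm f) (\<iota> k)" using direct_sum_tot(2)[OF ds] Suc.prems km by simp
        hence [simp]: "X k \<in> Ob" using dm_Ob[of "\<iota> k"] by (simp add: hom_def)
        have "w \<bullet> f \<bullet> \<iota> k = \<zero> (X k) (X m)"
          unfolding w_def using g(2)[OF km] \<iota>k by (simp add: distribs hom_def)
        thus ?thesis unfolding fg using g(2)[OF km] \<iota>k by (simp add: hom_def)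
      qed
      thus ?thesis by (intro exI[of _ g']) (simp add: hom_def g'_def)
    qed
  qed
  then obtain g where g: "hom (cd f) (dm f) g" "\<And>k. k < n \<Longrightarrow> f \<bullet> g \<bullet> f \<bullet> \<iota> k = f \<bullet> \<iota> k" by blast
  have "f \<bullet> g \<bullet> f = f"
    by (rule direct_sum_eqI(1)[OF ds]) (use assms g in \<open>auto simp: hom_def\<close>)
  thus ?thesis using that g by blast
qed

text \<open>Injectivity has to be tested on a single endomorphism of the source, the idempotent
  complementary to \<open>g \<bullet> f\<close> for a pseudo-inverse \<open>g\<close>.\<close>

lemma mono_split:
  assumes "arr f" "\<And>g. hom (dm f) (dm f) g \<Longrightarrow> f \<bullet> g = \<zero> (dm f) (cd f) \<Longrightarrow> g = \<zero> (dm f) (dm f)"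
  obtains g where "hom (cd f) (dm f) g" "g \<bullet> f = Id (dm f)"
proof -
  obtain g where g: "hom (cd f) (dm f) g" "f \<bullet> g \<bullet> f = f" using pseudo_inverse[OF assms(1)] .
  hence [simp]: "arr g" "dm g = cd f" "cd g = dm f" by (auto simp: hom_def)
  have "f \<bullet> (Id (dm f) \<uplus> \<ominus> (g \<bullet> f)) = \<zero> (dm f) (cd f)" using g assms(1) by (simp add: distribs)
  hence "Id (dm f) \<uplus> \<ominus> (g \<bullet> f) = \<zero> (dm f) (dm f)"
    by (intro assms(2)) (simp_all add: hom_def)
  hence "Id (dm f) = g \<bullet> f" by (rule eq_if_diff_zero) simp_all
  thus ?thesis using that g by metis
qed

lemma binary_direct_sum:
  assumes "a \<in> Ob" "b \<in> Ob"
  obtains c i j p q where "hom a c i" "hom b c j" "hom c a p" "hom c b q"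
    "p \<bullet> i = Id a" "q \<bullet> j = Id b" "p \<bullet> j = \<zero> b a" "q \<bullet> i = \<zero> a b" "i \<bullet> p \<uplus> j \<bullet> q = Id c"
proof -
  define X where "X = (\<lambda>k::nat. if k = 0 then a else b)"
  obtain c \<iota> \<pi> where ds: "direct_sum C c 2 X \<iota> \<pi>"
    using direct_sum_exists[of 2 X] assms by (force simp: X_def)
  note d = direct_sum_tot[OF ds]
  have X: "X 0 = a" "X 1 = b" by (auto simp: X_def)
  have "\<iota> 0 \<bullet> \<pi> 0 \<uplus> \<iota> 1 \<bullet> \<pi> 1 = Id c"
    using d(5) d(1) d(2)[of 0] d(3)[of 0] by (simp add: numeral_2_eq_2 hom_def)
  thus ?thesis
    using d(2)[of 0] d(2)[of 1] d(3)[of 0] d(3)[of 1] d(4)[of 0 0] d(4)[of 0 1] d(4)[of 1 0] d(4)[of 1 1]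
    unfolding X by (intro that) auto
qed

end

section \<open>Augmented algebras\<close>

context braided_fusion_category
begin

text \<open>For a pseudo-inverse \<open>g\<close>, the endomorphism \<open>f \<bullet> g\<close> of
  a simple object is nonzero, since otherwise \<open>f\<close> =
  \<open>f \<bullet> g \<bullet> f\<close> would vanish; hence it is invertible.\<close>

lemma simple_epi_split:
  assumes "simple C b" "hom a b f" "f \<noteq> \<zero> a b"
  obtains s where "hom b a s" "f \<bullet> s = Id b"
proof -
  have [simp]: "arr f" "dm f = a" "cd f = b" using assms(2) by (simp_all add: hom_def)
  obtain g where g: "hom b a g" "f \<bullet> g \<bullet> f = f" using pseudo_inverse[of f] by auto
  have [simp]: "arr g" "dm g = b" "cd g = a" using g by (simp_all add: hom_def)
  have ob: "a \<in> Ob" "b \<in> Ob" using dm_Ob[of f] cd_Ob[of f] by simp_all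
  have "f \<bullet> g \<noteq> \<zero> b b"
  proof
    assume "f \<bullet> g = \<zero> b b"
    hence "f \<bullet> g \<bullet> f = \<zero> a b" using ob by (simp add: cmp_assoc[symmetric] del: cmp_assoc)
    thus False using g(2) assms(3) by simp
  qed
  then obtain h where h: "hom b b h" "(f \<bullet> g) \<bullet> h = Id b"
    using schur[of b b "f \<bullet> g"] assms(1) by (auto simp: hom_def)
  show ?thesis by (rule that[of "g \<bullet> h"]) (use h in \<open>auto simp: hom_def\<close>)
qed

text \<open>The counterpart of \<open>mult_power\<close> for the total operations. The index is
  shifted: \<open>mpow m j n\<close> has \<open>n + 1\<close> factors.\<close>

primrec mpow :: "'m \<Rightarrow> 'm \<Rightarrow> nat \<Rightarrow> 'm" where
  "mpow m j 0 = j"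
| "mpow m j (Suc n) = m \<bullet> (mpow m j n \<star> j)"

primrec tpow :: "'m \<Rightarrow> nat \<Rightarrow> 'm" where
  "tpow k 0 = k"
| "tpow k (Suc n) = tpow k n \<star> k"

lemma mpow_simps [simp]:
  assumes "arr j" "cd j = cd m"
  shows "arr (mpow m j n)" "dm (mpow m j n) = tensor_power C (dm j) n" "cd (mpow m j n) = cd m"
  using assms by (induction n) simp_all

lemma tpow_simps [simp]:
  assumes "arr k"
  shows "arr (tpow k n)" "dm (tpow k n) = tensor_power C (dm k) n" "cd (tpow k n) = tensor_power C (cd k) n"
  using assms by (induction n) simp_all

lemma tensor_power_Ob [simp]: "a \<in> Ob \<Longrightarrow> tensor_power C a n \<in> Ob"
  by (induction n) simp_all

lemma mult_power_mpow: "hom (a \<otimes> a) a m \<Longrightarrow> hom x a j \<Longrightarrow> mult_power C m j n = mpow m j n"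
  by (induction n) (simp_all add: hom_def tot)

lemma mpow_cmp:
  assumes "arr j" "cd j = cd m" "arr k" "cd k = dm j"
  shows "mpow m (j \<bullet> k) n = mpow m j n \<bullet> tpow k n"
  using assms by (induction n) (simp_all add: merge)

end

text \<open>An algebra with a character. The Hopf algebra itself and its dual algebra are both
  instances, so facts about augmentation ideals are proved only once.\<close>

locale augmented_algebra = braided_fusion_category C
  for C :: "('o, 'm, 'k::{alg_closed_field, field_char_0}) bcat" (structure) +
  fixes B :: 'o and m u \<epsilon> :: 'm
  assumes B_Ob [simp]: "B \<in> Ob"
    and m_hom: "hom (B \<otimes> B) B m" and u_hom: "hom \<one> B u" and \<epsilon>_hom: "hom B \<one> \<epsilon>"
    and m_assoc: "m \<bullet> (m \<star> Id B) = m \<bullet> (Id B \<star> m) \<bullet> \<alpha> B B B"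
    and m_unit_left: "m \<bullet> (u \<star> Id B) = \<ll> B"
    and m_unit_right: "m \<bullet> (Id B \<star> u) = \<rr> B"
    and \<epsilon>_m: "\<epsilon> \<bullet> m = \<ll> \<one> \<bullet> (\<epsilon> \<star> \<epsilon>)"
    and \<epsilon>_u: "\<epsilon> \<bullet> u = Id \<one>"
begin

lemma structure_simps [simp]:
  "arr m" "dm m = B \<otimes> B" "cd m = B" "arr u" "dm u = \<one>" "cd u = B" "arr \<epsilon>" "dm \<epsilon> = B" "cd \<epsilon> = \<one>"
  using m_hom u_hom \<epsilon>_hom by (simp_all add: hom_def)

lemma algebra: "algebra C B m u"
  using m_assoc m_unit_left m_unit_right by (simp add: algebra_def Hom_iff tot)

lemma \<epsilon>_u' [simp]: "arr x \<Longrightarrow> cd x = \<one> \<Longrightarrow> \<epsilon> \<bullet> u \<bullet> x = x" and \<epsilon>_u'' [simp]: "\<epsilon> \<bullet> u = Id \<one>"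
  using \<epsilon>_u[THEN cmp_reassoc, of x] by (simp_all add: \<epsilon>_u)

text \<open>\<open>aug\<close> projects onto the augmentation ideal; the image of \<open>m2\<close> below is the square of that ideal.\<close>

definition aug :: 'm where "aug = Id B \<uplus> \<ominus> (u \<bullet> \<epsilon>)"

lemma aug_simps [simp]: "arr aug" "dm aug = B" "cd aug = B"
  by (simp_all add: aug_def)

lemma \<epsilon>_aug [simp]: "\<epsilon> \<bullet> aug = \<zero> B \<one>"
  by (simp add: aug_def distribs)

lemma aug_u [simp]: "aug \<bullet> u = \<zero> \<one> B"
  by (simp add: aug_def distribs)

lemma Id_aug: "Id B = aug \<uplus> u \<bullet> \<epsilon>"
  by (simp add: aug_def add_assoc')

lemma aug_fix: "arr x \<Longrightarrow> cd x = B \<Longrightarrow> \<epsilon> \<bullet> x = \<zero> (dm x) \<one> \<Longrightarrow> aug \<bullet> x = x"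
  by (simp add: aug_def distribs)

lemma aug_idem [simp]: "aug \<bullet> aug = aug"
  by (rule aug_fix) simp_all

lemma aug_fix_right: "arr x \<Longrightarrow> dm x = B \<Longrightarrow> x \<bullet> u = \<zero> \<one> (cd x) \<Longrightarrow> x \<bullet> aug = x"
  by (simp add: aug_def distribs cmp_reassoc[of x u])

definition m2 :: 'm where "m2 = m \<bullet> (aug \<star> aug)"

lemma m2_simps [simp]: "arr m2" "dm m2 = B \<otimes> B" "cd m2 = B"
  by (simp_all add: m2_def)

lemma \<epsilon>_m2 [simp]: "\<epsilon> \<bullet> m2 = \<zero> (B \<otimes> B) \<one>"
  using \<epsilon>_m[THEN cmp_reassoc', of "aug \<star> aug"] by (simp add: m2_def merge)

lemma \<epsilon>_m2' [simp]: "\<epsilon> \<bullet> m2 \<bullet> x = \<zero> (dm x) \<one>"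
  using \<epsilon>_m2[THEN cmp_reassoc, of x] by simp

lemma aug_m2 [simp]: "aug \<bullet> m2 = m2"
  by (rule aug_fix) simp_all

text \<open>A character cannot be nonzero on something nilpotent: a point \<open>s\<close> of
  \<open>x\<close> with \<epsilon>-value 1 would have powers of \<epsilon>-value 1, as
  \<open>\<epsilon>\<close> is multiplicative.\<close>

lemma mpow_zero_imp_\<epsilon>_zero:
  assumes "hom x B j" "mpow m j n = \<zero> (tensor_power C x n) B"
  shows "\<epsilon> \<bullet> j = \<zero> x \<one>"
proof (rule ccontr)
  assume ne: "\<epsilon> \<bullet> j \<noteq> \<zero> x \<one>"
  have [simp]: "arr j" "dm j = x" "cd j = B" using assms(1) by (simp_all add: hom_def)
  have [simp]: "x \<in> Ob" using dm_Ob[of j] by simp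
  obtain s where s: "hom \<one> x s" "(\<epsilon> \<bullet> j) \<bullet> s = Id \<one>"
    using simple_epi_split[OF unit_simple _ ne] by (auto simp: hom_def)
  have [simp]: "arr s" "dm s = \<one>" "cd s = x" using s(1) by (simp_all add: hom_def)
  have "\<exists>t. hom \<one> (tensor_power C x n) t \<and> \<epsilon> \<bullet> mpow m j n \<bullet> t = Id \<one>" for n
  proof (induction n)
    case 0
    show ?case using s by (intro exI[of _ s]) simp
  next
    case (Suc n)
    then obtain t where t: "hom \<one> (tensor_power C x n) t" "\<epsilon> \<bullet> mpow m j n \<bullet> t = Id \<one>" by blast
    have [simp]: "arr t" "dm t = \<one>" "cd t = tensor_power C x n" using t(1) by (simp_all add: hom_def)
    have "\<epsilon> \<bullet> mpow m j (Suc n) \<bullet> (t \<star> s) \<bullet> li \<one> =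
       \<ll> \<one> \<bullet> ((\<epsilon> \<bullet> mpow m j n \<bullet> t) \<star> (\<epsilon> \<bullet> j \<bullet> s)) \<bullet> li \<one>"
      using \<epsilon>_m[THEN cmp_reassoc', of "(mpow m j n \<star> j) \<bullet> (t \<star> s) \<bullet> li \<one>"] by (simp add: merge)
    also have "\<dots> = Id \<one>" using s(2) t(2) by simp
    finally show ?case by (intro exI[of _ "(t \<star> s) \<bullet> li \<one>"]) (simp add: hom_def)
  qed
  then obtain t where t: "hom \<one> (tensor_power C x n) t" "\<epsilon> \<bullet> mpow m j n \<bullet> t = Id \<one>" by blast
  hence "Id \<one> = \<zero> \<one> \<one>" using assms(2) by (simp add: hom_def)
  thus False using unit_simple by (simp add: simple_def zero_ob_iff)
qed

text \<open>The definition of connectedness provides some character \<open>q\<close> with kernel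
  J(A). Uniqueness of the character identifies it with \<open>\<epsilon>\<close>, so the
  augmentation ideal is J(A) and inherits its nilpotency.\<close>

lemma nilpotent_aug_if_connected:
  assumes "connected_algebra C B m u"
  obtains n where "mpow m aug n = \<zero> (tensor_power C B n) B"
proof -
  obtain x j q where j: "largest_nilpotent_ideal C B m x j" and ck: "cokernel C \<one> q x B j"
    and qu: "q \<cdot> u = Id \<one>" using assms unfolding connected_algebra_def by blast
  have "mono_arr C x B j" using j
    by (simp add: largest_nilpotent_ideal_def nilpotent_ideal_def ideal_def)
  note jh = mono_arr_hom[OF this]
  have [simp]: "arr j" "dm j = x" "cd j = B" using jh by (simp_all add: hom_def)
  have [simp]: "x \<in> Ob" using dm_Ob[of j] by simp
  obtain n where n: "mpow m j n = \<zero> (tensor_power C x n) B"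
    using j unfolding largest_nilpotent_ideal_def nilpotent_ideal_def
    by (auto simp: mult_power_mpow[OF m_hom jh])
  have \<epsilon>j: "\<epsilon> \<bullet> j = \<zero> x \<one>" by (rule mpow_zero_imp_\<epsilon>_zero[OF jh n])
  have [simp]: "arr q" "dm q = B" "cd q = \<one>" using ck by (auto simp: cokernel_def Hom_iff)
  have fac: "\<exists>h. hom \<one> y h \<and> h \<bullet> q = g" if "hom B y g" "g \<bullet> j = \<zero> x y" for g y
  proof -
    have "g \<in> Hom B y" "g \<cdot> j = \<zero> x y" using that by (simp_all add: Hom_hom) (simp add: hom_def tot)
    then obtain h where "h \<in> Hom \<one> y" "h \<cdot> q = g" using ck unfolding cokernel_def by blast
    thus ?thesis by (intro exI[of _ h]) (auto simp: Hom_iff hom_def tot)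
  qed
  \<comment> \<open>\<open>\<epsilon>\<close> kills the nilpotent ideal and so factors through
    \<open>q\<close>; the factor is 1 because both maps are normalised on the unit.\<close>
  obtain h where h: "hom \<one> \<one> h" "h \<bullet> q = \<epsilon>" using fac[OF \<epsilon>_hom \<epsilon>j] by blast
  have "q \<bullet> u = Id \<one>" using qu by (simp add: tot)
  hence "h = (h \<bullet> q) \<bullet> u" using h(1) by (simp add: hom_def)
  also have "\<dots> = Id \<one>" using h(2) by simp
  finally have q: "q = \<epsilon>" using h(2) by simp
  obtain g where g: "hom B x g" "j \<bullet> g \<bullet> j = j" using pseudo_inverse[of j] by auto
  have [simp]: "arr g" "dm g = B" "cd g = x" using g(1) by (simp_all add: hom_def)
  \<comment> \<open>The idempotent complementary to the image of \<open>j\<close> kills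
    \<open>j\<close>, so it factors through \<open>\<epsilon>\<close> and vanishes on
    \<open>aug\<close>. Thus \<open>aug\<close> factors through \<open>j\<close>.\<close>
  obtain k where k: "hom \<one> B k" "k \<bullet> q = Id B \<uplus> \<ominus> (j \<bullet> g)"
    using fac[of B "Id B \<uplus> \<ominus> (j \<bullet> g)"] g by (auto simp: hom_def distribs)
  have "(Id B \<uplus> \<ominus> (j \<bullet> g)) \<bullet> aug = \<zero> B B"
    unfolding k(2)[symmetric] q using k(1) by (simp add: hom_def)
  hence "aug \<uplus> \<ominus> (j \<bullet> g \<bullet> aug) = \<zero> B B" by (simp add: distribs)
  hence "aug = j \<bullet> g \<bullet> aug" by (rule eq_if_diff_zero) simp_all
  hence "mpow m aug n = mpow m j n \<bullet> tpow (g \<bullet> aug) n" using mpow_cmp[of j m "g \<bullet> aug" n] by simp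
  also have "\<dots> = \<zero> (tensor_power C B n) B" unfolding n by simp
  finally show ?thesis by (rule that)
qed

text \<open>The kernel of \<open>\<epsilon>\<close> is an ideal, it is nilpotent by assumption, and
  it contains every nilpotent ideal because characters kill those.\<close>

lemma connected_if_nilpotent_aug:
  assumes n: "mpow m aug n = \<zero> (tensor_power C B n) B"
  shows "connected_algebra C B m u"
proof -
  obtain x j where ker: "kernel C x j B \<one> \<epsilon>"
    using kernel_exists[of \<epsilon> B \<one>] \<epsilon>_hom by (auto simp: Hom_hom)
  note kd = kernelD[OF ker]
  have [simp]: "arr j" "dm j = x" "cd j = B" using kd(1) by (simp_all add: hom_def)
  have [simp]: "x \<in> Ob" using dm_Ob[of j] by simp
  have \<epsilon>j: "\<epsilon> \<bullet> j = \<zero> x \<one>" by (rule kd(3))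
  obtain k where k: "hom B x k" "j \<bullet> k = aug" using kd(4)[of aug] by auto
  have jfix: "aug \<bullet> j = j" by (rule aug_fix) (simp_all add: \<epsilon>j)
  have ideal: "ideal C B m x j"
    unfolding ideal_def
  proof (intro conjI)
    show "mono_arr C x B j" by (rule kd(5))
    have "\<epsilon> \<bullet> m \<bullet> (Id B \<star> j) = \<zero> (B \<otimes> x) \<one>"
      using \<epsilon>_m[THEN cmp_reassoc', of "Id B \<star> j"] by (simp add: merge \<epsilon>j)
    then obtain l where "hom (B \<otimes> x) x l" "j \<bullet> l = m \<bullet> (Id B \<star> j)"
      using kd(4)[of "m \<bullet> (Id B \<star> j)"] by auto
    thus "\<exists>l\<in>Hom (B \<otimes> x) x. m \<cdot> (Id B \<otimes>\<^sub>m j) = j \<cdot> l"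
      by (intro bexI[of _ l]) (auto simp: Hom_hom hom_def tot)
    have "\<epsilon> \<bullet> m \<bullet> (j \<star> Id B) = \<zero> (x \<otimes> B) \<one>"
      using \<epsilon>_m[THEN cmp_reassoc', of "j \<star> Id B"] by (simp add: merge \<epsilon>j)
    then obtain l where "hom (x \<otimes> B) x l" "j \<bullet> l = m \<bullet> (j \<star> Id B)"
      using kd(4)[of "m \<bullet> (j \<star> Id B)"] by auto
    thus "\<exists>r\<in>Hom (x \<otimes> B) x. m \<cdot> (j \<otimes>\<^sub>m Id B) = j \<cdot> r"
      by (intro bexI[of _ l]) (auto simp: Hom_hom hom_def tot)
  qed
  have "mpow m j n = mpow m aug n \<bullet> tpow j n" using mpow_cmp[of aug m j n] by (simp add: jfix)
  hence nil: "nilpotent_ideal C B m x j"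
    unfolding nilpotent_ideal_def using ideal n
    by (intro conjI exI[of _ n]) (simp_all add: mult_power_mpow[OF m_hom kd(1)])
  have largest: "largest_nilpotent_ideal C B m x j"
    unfolding largest_nilpotent_ideal_def
  proof (intro conjI allI impI nil)
    fix y i assume i: "nilpotent_ideal C B m y i"
    hence ih: "hom y B i" using mono_arr_hom unfolding nilpotent_ideal_def ideal_def by blast
    then obtain n where "mpow m i n = \<zero> (tensor_power C y n) B"
      using i unfolding nilpotent_ideal_def by (auto simp: mult_power_mpow[OF m_hom])
    hence "\<epsilon> \<bullet> i = \<zero> y \<one>" by (rule mpow_zero_imp_\<epsilon>_zero[OF ih])
    then obtain h where "hom y x h" "j \<bullet> h = i" using kd(4)[of i] ih by (auto simp: hom_def)
    thus "\<exists>h\<in>Hom y x. i = j \<cdot> h" by (intro bexI[of _ h]) (auto simp: Hom_hom hom_def tot)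
  qed
  have coker: "cokernel C \<one> \<epsilon> x B j"
    unfolding cokernel_def
  proof (intro conjI allI impI)
    show "\<epsilon> \<in> Hom B \<one>" "j \<in> Hom x B" "\<epsilon> \<cdot> j = \<zero> x \<one>"
      by (simp_all add: Hom_iff \<epsilon>j tot)
    fix y g assume g: "g \<in> Hom B y" "g \<cdot> j = \<zero> x y"
    hence [simp]: "arr g" "dm g = B" "cd g = y" by (simp_all add: Hom_iff)
    have [simp]: "y \<in> Ob" using cd_Ob[of g] by simp
    have "g \<bullet> j = \<zero> x y" using g by (simp add: tot)
    hence "(g \<bullet> j) \<bullet> k = \<zero> B y" using k(1) by (simp add: hom_def del: cmp_assoc)
    hence ga: "g \<bullet> aug = \<zero> B y" using k(2) by simp
    have "g = g \<bullet> (aug \<uplus> u \<bullet> \<epsilon>)" unfolding Id_aug[symmetric] by simp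
    also have "\<dots> = g \<bullet> u \<bullet> \<epsilon>" by (simp add: distribs ga)
    finally have gu: "g \<bullet> u \<bullet> \<epsilon> = g" ..
    show "\<exists>!h. h \<in> Hom \<one> y \<and> h \<cdot> \<epsilon> = g"
    proof (rule ex1I[of _ "g \<bullet> u"])
      show "g \<bullet> u \<in> Hom \<one> y \<and> (g \<bullet> u) \<cdot> \<epsilon> = g" by (simp add: Hom_iff tot gu)
      fix h assume "h \<in> Hom \<one> y \<and> h \<cdot> \<epsilon> = g"
      hence [simp]: "arr h" "dm h = \<one>" "cd h = y" and he: "h \<bullet> \<epsilon> = g" by (auto simp: Hom_iff tot)
      have "g \<bullet> u = (h \<bullet> \<epsilon>) \<bullet> u" by (simp only: he)
      thus "h = g \<bullet> u" by simp
    qed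
  qed
  have "\<epsilon> \<cdot> m = \<ll> \<one> \<cdot> (\<epsilon> \<otimes>\<^sub>m \<epsilon>)" "\<epsilon> \<cdot> u = Id \<one>" using \<epsilon>_m \<epsilon>_u by (simp_all add: tot)
  thus ?thesis unfolding connected_algebra_def using algebra largest coker by blast
qed

text \<open>If J = V + J^2 and J is nilpotent, then V generates. The predicate \<open>P\<close>
  stands for membership in what V generates. Leaving it abstract serves the two projections of the
  correspondence as well as Nakayama's lemma, where V contributes zero.\<close>

lemma generated_by_complement:
  assumes i: "hom V B i" and q: "hom B V q" and y: "hom B (B \<otimes> B) y" and dec: "aug = i \<bullet> q \<uplus> m2 \<bullet> y"
    and n: "mpow m aug n = \<zero> (tensor_power C B n) B"
    and P_u: "P u" and P_hom: "\<And>x. P x \<Longrightarrow> arr x \<and> cd x = B"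
    and P_cmp: "\<And>x t. P x \<Longrightarrow> arr t \<Longrightarrow> cd t = dm x \<Longrightarrow> P (x \<bullet> t)"
    and P_add: "\<And>x y. P x \<Longrightarrow> P y \<Longrightarrow> dm x = dm y \<Longrightarrow> P (x \<uplus> y)"
    and P_mult: "\<And>x. P x \<Longrightarrow> P (m \<bullet> (x \<star> i))"
  shows "P (Id B)"
proof -
  have [simp]: "arr i" "dm i = V" "cd i = B" "arr q" "dm q = B" "cd q = V" "arr y" "dm y = B" "cd y = B \<otimes> B"
    using i q y by (simp_all add: hom_def)
  have [simp]: "V \<in> Ob" using dm_Ob[of i] by simp
  let ?T = "tensor_power C B" and ?M = "mpow m aug"
  have P_hom' [simp]: "arr t \<and> cd t = B" if "P t" for t using that by (rule P_hom)
  have iq: "i \<bullet> q = aug \<uplus> \<ominus> (m2 \<bullet> y)" unfolding dec by (simp add: add_ac')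
  have aiq: "aug \<bullet> i \<bullet> q = i \<bullet> q" unfolding iq by (simp add: distribs cmp_reassoc)
  have "i = m \<bullet> (u \<star> i) \<bullet> li V"
    using m_unit_left[THEN cmp_reassoc, of "(Id \<one> \<star> i) \<bullet> li V"] by (simp add: merge l_nat')
  hence Pi: "P i" using P_cmp[OF P_mult[OF P_u], of "li V"] by simp
  \<comment> \<open>Every product of \<open>k + 1\<close> factors from J lies in \<open>P\<close> up
    to products of \<open>k + 2\<close> factors.\<close>
  have descent: "\<exists>t z. P t \<and> dm t = ?T k \<and> hom (?T k) (?T (Suc k)) z \<and> ?M k = t \<uplus> ?M (Suc k) \<bullet> z" for k
  proof (induction k)
    case 0
    have "P (i \<bullet> q)" by (rule P_cmp[OF Pi]) simp_all
    thus ?case using dec by (intro exI[of _ "i \<bullet> q"] exI[of _ y]) (simp add: hom_def m2_def)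
  next
    case (Suc k)
    then obtain t z where t: "P t" "dm t = ?T k" and z: "hom (?T k) (?T (Suc k)) z"
      and M: "?M k = t \<uplus> ?M (Suc k) \<bullet> z" by blast
    have [simp]: "arr t" "cd t = B" "dm t = ?T k" using t P_hom by auto
    have [simp]: "arr z" "dm z = ?T k" "cd z = ?T k \<otimes> B" using z by (simp_all add: hom_def)
    \<comment> \<open>The last factor is split as \<open>i \<bullet> q\<close> plus a product.
      \<open>w\<close> collects the two contributions of higher length: the old remainder times
      \<open>V\<close>, and the reassociated product.\<close>
    define w where "w = z \<star> (i \<bullet> q) \<uplus> \<alpha>i (?T k) B B \<bullet> (Id (?T k) \<star> y)"
    have 1: "m \<bullet> (?M k \<star> (m2 \<bullet> y)) = ?M (Suc (Suc k)) \<bullet> \<alpha>i (?T k) B B \<bullet> (Id (?T k) \<star> y)"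
    proof -
      have "m \<bullet> (?M k \<star> (m2 \<bullet> y)) = m \<bullet> (Id B \<star> m) \<bullet> \<alpha> B B B \<bullet> \<alpha>i B B B \<bullet> (?M k \<star> (aug \<star> aug)) \<bullet> (Id (?T k) \<star> y)"
        by (simp add: m2_def merge)
      also have "\<dots> = m \<bullet> (m \<star> Id B) \<bullet> \<alpha>i B B B \<bullet> (?M k \<star> (aug \<star> aug)) \<bullet> (Id (?T k) \<star> y)"
        using m_assoc[THEN cmp_reassoc, of "\<alpha>i B B B \<bullet> (?M k \<star> (aug \<star> aug)) \<bullet> (Id (?T k) \<star> y)"]
        by simp
      also have "\<dots> = m \<bullet> (m \<star> Id B) \<bullet> ((?M k \<star> aug) \<star> aug) \<bullet> \<alpha>i (?T k) B B \<bullet> (Id (?T k) \<star> y)"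
        by (simp add: \<alpha>i_nat')
      also have "\<dots> = ?M (Suc (Suc k)) \<bullet> \<alpha>i (?T k) B B \<bullet> (Id (?T k) \<star> y)"
        by (simp add: merge)
      finally show ?thesis .
    qed
    have "?M (Suc k) = m \<bullet> (?M k \<star> (i \<bullet> q \<uplus> m2 \<bullet> y))" using dec by simp
    also have "\<dots> = m \<bullet> (?M k \<star> (i \<bullet> q)) \<uplus> m \<bullet> (?M k \<star> (m2 \<bullet> y))"
      by (simp add: distribs)
    also have "m \<bullet> (?M k \<star> (i \<bullet> q)) = m \<bullet> ((t \<uplus> ?M (Suc k) \<bullet> z) \<star> (i \<bullet> q))"
      unfolding M ..
    also have "\<dots> = m \<bullet> (t \<star> (i \<bullet> q)) \<uplus> m \<bullet> ((?M (Suc k) \<bullet> z) \<star> (i \<bullet> q))"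
      by (simp add: distribs del: mpow.simps)
    also have "m \<bullet> ((?M (Suc k) \<bullet> z) \<star> (i \<bullet> q)) = ?M (Suc (Suc k)) \<bullet> (z \<star> (i \<bullet> q))"
      by (simp add: merge aiq)
    also note 1
    finally have "?M (Suc k) = m \<bullet> (t \<star> (i \<bullet> q)) \<uplus> ?M (Suc (Suc k)) \<bullet> w"
      by (simp add: w_def distribs add_assoc' del: mpow.simps)
    moreover have "m \<bullet> (t \<star> (i \<bullet> q)) = (m \<bullet> (t \<star> i)) \<bullet> (Id (?T k) \<star> q)" by (simp add: merge)
    moreover have "P ((m \<bullet> (t \<star> i)) \<bullet> (Id (?T k) \<star> q))"
      by (rule P_cmp[OF P_mult[OF t(1)]]) simp_all
    ultimately show ?case
      by (intro exI[of _ "m \<bullet> (t \<star> (i \<bullet> q))"] exI[of _ w]) (simp add: hom_def w_def del: mpow.simps)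
  qed
  have "P (?M k)" if "k \<le> n" for k
    using that
  proof (induction rule: inc_induct)
    case base
    \<comment> \<open>The top power vanishes, and a zero morphism satisfies \<open>P\<close> as a
      multiple of the unit; from there the descent is run backwards.\<close>
    have "P (u \<bullet> \<zero> (?T n) \<one>)" by (rule P_cmp[OF P_u]) simp_all
    thus ?case using n by simp
  next
    case (step k)
    obtain t z where t: "P t" "dm t = ?T k" and z: "hom (?T k) (?T (Suc k)) z"
      and M: "?M k = t \<uplus> ?M (Suc k) \<bullet> z" using descent[of k] by blast
    show ?case unfolding M
      by (rule P_add[OF t(1) P_cmp[OF step.IH]]) (use t z in \<open>simp_all add: hom_def\<close>)
  qed
  from this[of 0] have "P aug" by simp
  moreover have "P (u \<bullet> \<epsilon>)" by (rule P_cmp[OF P_u]) simp_all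
  ultimately show ?thesis unfolding Id_aug by (rule P_add) simp
qed

end

section \<open>Primitive elements and derivations\<close>

lemma (in monoidal_linear_category) add_diff_cancel':
  assumes "arr f" "arr g" "dm f = dm g" "cd f = cd g"
  shows "(f \<uplus> g) \<uplus> \<ominus> f = g" "(f \<uplus> g) \<uplus> \<ominus> g = f"
proof -
  show "(f \<uplus> g) \<uplus> \<ominus> f = g" using assms add_assoc'[of g f "\<ominus> f"] by (simp add: add_commute'[of f g])
  show "(f \<uplus> g) \<uplus> \<ominus> g = f" using assms by (simp add: add_assoc')
qed

locale hopf = augmented_algebra C B m u \<epsilon>
  for C :: "('o, 'm, 'k::{alg_closed_field, field_char_0}) bcat" (structure) and B m u \<epsilon> +
  fixes \<Delta> S :: 'm
  assumes \<Delta>_hom: "hom B (B \<otimes> B) \<Delta>" and S_hom: "hom B B S"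
    and coassoc: "\<alpha> B B B \<bullet> (\<Delta> \<star> Id B) \<bullet> \<Delta> = (Id B \<star> \<Delta>) \<bullet> \<Delta>"
    and counit_left: "\<ll> B \<bullet> (\<epsilon> \<star> Id B) \<bullet> \<Delta> = Id B"
    and counit_right: "\<rr> B \<bullet> (Id B \<star> \<epsilon>) \<bullet> \<Delta> = Id B"
    and \<Delta>_m: "\<Delta> \<bullet> m = (m \<star> m) \<bullet> mid B B B B \<bullet> (\<Delta> \<star> \<Delta>)"
    and \<Delta>_u: "\<Delta> \<bullet> u \<bullet> \<ll> \<one> = u \<star> u"
    and antipode_left: "m \<bullet> (S \<star> Id B) \<bullet> \<Delta> = u \<bullet> \<epsilon>"
    and antipode_right: "m \<bullet> (Id B \<star> S) \<bullet> \<Delta> = u \<bullet> \<epsilon>"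
begin

lemma comult_simps [simp]:
  "arr \<Delta>" "dm \<Delta> = B" "cd \<Delta> = B \<otimes> B" "arr S" "dm S = B" "cd S = B"
  using \<Delta>_hom S_hom by (simp_all add: hom_def)

lemma \<Delta>_u_li: "\<Delta> \<bullet> u = (u \<star> u) \<bullet> li \<one>"
  by (rule right_cancel[where k = "\<ll> \<one>" and k' = "li \<one>"]) (simp_all add: \<Delta>_u)

lemma counit_li: "(\<epsilon> \<star> Id B) \<bullet> \<Delta> = li B" and counit_ri: "(Id B \<star> \<epsilon>) \<bullet> \<Delta> = ri B"
proof -
  show "(\<epsilon> \<star> Id B) \<bullet> \<Delta> = li B"
    by (rule left_cancel[where k = "\<ll> B" and k' = "li B"]) (simp_all add: counit_left)
  show "(Id B \<star> \<epsilon>) \<bullet> \<Delta> = ri B"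
    by (rule left_cancel[where k = "\<rr> B" and k' = "ri B"]) (simp_all add: counit_right)
qed

definition prm :: 'm where
  "prm = (\<Delta> \<uplus> \<ominus> ((u \<star> Id B) \<bullet> li B)) \<uplus> \<ominus> ((Id B \<star> u) \<bullet> ri B)"

lemma prm_simps [simp]: "arr prm" "dm prm = B" "cd prm = B \<otimes> B"
  by (simp_all add: prm_def)

lemma prm_cmp:
  assumes "arr x" "cd x = B"
  shows "prm \<bullet> x = (\<Delta> \<bullet> x \<uplus> \<ominus> ((u \<star> x) \<bullet> li (dm x))) \<uplus> \<ominus> ((x \<star> u) \<bullet> ri (dm x))"
  using assms by (simp add: prm_def distribs li_nat[of x] ri_nat[of x] merge)

lemma prm_zero_iff:
  assumes "arr x" "cd x = B"
  shows "prm \<bullet> x = \<zero> (dm x) (B \<otimes> B) \<longleftrightarrow> \<Delta> \<bullet> x = (u \<star> x) \<bullet> li (dm x) \<uplus> (x \<star> u) \<bullet> ri (dm x)"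
proof
  assume "prm \<bullet> x = \<zero> (dm x) (B \<otimes> B)"
  hence "\<Delta> \<bullet> x \<uplus> \<ominus> ((u \<star> x) \<bullet> li (dm x)) = (x \<star> u) \<bullet> ri (dm x)"
    unfolding prm_cmp[OF assms] by (rule eq_if_diff_zero) (use assms in simp_all)
  moreover have "\<Delta> \<bullet> x = (\<Delta> \<bullet> x \<uplus> \<ominus> ((u \<star> x) \<bullet> li (dm x))) \<uplus> (u \<star> x) \<bullet> li (dm x)"
    using assms by (simp add: add_assoc')
  ultimately show "\<Delta> \<bullet> x = (u \<star> x) \<bullet> li (dm x) \<uplus> (x \<star> u) \<bullet> ri (dm x)"
    using assms by (simp add: add_commute')
next
  assume "\<Delta> \<bullet> x = (u \<star> x) \<bullet> li (dm x) \<uplus> (x \<star> u) \<bullet> ri (dm x)"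
  thus "prm \<bullet> x = \<zero> (dm x) (B \<otimes> B)"
    unfolding prm_cmp[OF assms] using assms by (simp add: add_diff_cancel')
qed

text \<open>Applying the counit law to \<open>\<Delta>\<close> of a primitive \<open>x\<close> gives
  x = x + u(\<epsilon>(x)), so u(\<epsilon>(x)) vanishes, and \<open>u\<close> is split by
  \<open>\<epsilon>\<close>.\<close>

lemma primitive_counit:
  assumes x: "arr x" "cd x = B" and prim: "prm \<bullet> x = \<zero> (dm x) (B \<otimes> B)"
  shows "\<epsilon> \<bullet> x = \<zero> (dm x) \<one>"
proof -
  have prim: "\<Delta> \<bullet> x = (u \<star> x) \<bullet> li (dm x) \<uplus> (x \<star> u) \<bullet> ri (dm x)"
    using prm_zero_iff[OF x] prim by simp
  have "x = \<ll> B \<bullet> (\<epsilon> \<star> Id B) \<bullet> \<Delta> \<bullet> x"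
    using counit_left[THEN cmp_reassoc, of x] x by simp
  also have "\<dots> = x \<uplus> \<ll> B \<bullet> ((\<epsilon> \<bullet> x) \<star> u) \<bullet> ri (dm x)"
    unfolding prim using x by (simp add: distribs merge l_nat')
  also have "((\<epsilon> \<bullet> x) \<star> u) \<bullet> ri (dm x) = (Id \<one> \<star> u) \<bullet> ri \<one> \<bullet> \<epsilon> \<bullet> x"
    using ri_nat[of "\<epsilon> \<bullet> x" \<one>] x by (simp add: merge)
  also have "\<ll> B \<bullet> (Id \<one> \<star> u) \<bullet> ri \<one> \<bullet> \<epsilon> \<bullet> x = u \<bullet> \<epsilon> \<bullet> x"
    using x by (simp add: l_nat' runit_unit)
  finally have *: "x = x \<uplus> u \<bullet> \<epsilon> \<bullet> x" .
  have "x \<uplus> u \<bullet> \<epsilon> \<bullet> x = x \<uplus> \<zero> (dm x) B"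
    unfolding *[symmetric] using x by simp
  hence "u \<bullet> \<epsilon> \<bullet> x = \<zero> (dm x) B"
    by (rule add_left_imp_eq) (use x in simp_all)
  hence "\<epsilon> \<bullet> u \<bullet> \<epsilon> \<bullet> x = \<epsilon> \<bullet> \<zero> (dm x) B" by (simp only:)
  thus ?thesis using x by simp
qed

end

lemma (in braided_fusion_category) hopf_algebra_hopf:
  assumes "hopf_algebra C a R"
  shows "hopf C a (mult R) (unt R) (counit R) (comult R) (antipode R)"
proof unfold_locales
  have *: "a \<in> Ob" "hom (a \<otimes> a) a (mult R)" "hom \<one> a (unt R)" "hom a (a \<otimes> a) (comult R)"
    "hom a \<one> (counit R)" "hom a a (antipode R)"
    using assms by (auto simp: hopf_algebra_def algebra_def coalgebra_def Hom_hom)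
  hence [simp]: "a \<in> Ob" "arr (mult R)" "dm (mult R) = a \<otimes> a" "cd (mult R) = a"
    "arr (unt R)" "dm (unt R) = \<one>" "cd (unt R) = a" "arr (comult R)" "dm (comult R) = a"
    "cd (comult R) = a \<otimes> a" "arr (counit R)" "dm (counit R) = a" "cd (counit R) = \<one>"
    "arr (antipode R)" "dm (antipode R) = a" "cd (antipode R) = a"
    by (simp_all add: hom_def)
  note a = assms[unfolded hopf_algebra_def algebra_def coalgebra_def]
  show "a \<in> Ob" "hom (a \<otimes> a) a (mult R)" "hom \<one> a (unt R)" "hom a (a \<otimes> a) (comult R)"
    "hom a \<one> (counit R)" "hom a a (antipode R)" by (fact *)+
  show "mult R \<bullet> (mult R \<star> Id a) = mult R \<bullet> (Id a \<star> mult R) \<bullet> \<alpha> a a a"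
    "mult R \<bullet> (unt R \<star> Id a) = \<ll> a" "mult R \<bullet> (Id a \<star> unt R) = \<rr> a"
    "counit R \<bullet> mult R = \<ll> \<one> \<bullet> (counit R \<star> counit R)" "counit R \<bullet> unt R = Id \<one>"
    "\<alpha> a a a \<bullet> (comult R \<star> Id a) \<bullet> comult R = (Id a \<star> comult R) \<bullet> comult R"
    "\<ll> a \<bullet> (counit R \<star> Id a) \<bullet> comult R = Id a" "\<rr> a \<bullet> (Id a \<star> counit R) \<bullet> comult R = Id a"
    "comult R \<bullet> unt R \<bullet> \<ll> \<one> = unt R \<star> unt R"
    "mult R \<bullet> (antipode R \<star> Id a) \<bullet> comult R = unt R \<bullet> counit R"
    "mult R \<bullet> (Id a \<star> antipode R) \<bullet> comult R = unt R \<bullet> counit R"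
    using a by (simp_all add: tot)
  show "comult R \<bullet> mult R = (mult R \<star> mult R) \<bullet> mid a a a a \<bullet> (comult R \<star> comult R)"
    using a by (simp add: tot mid_braid_eq)
qed

text \<open>\<open>p\<close> kills the unit and J^2, and \<open>i\<close> is a section of it with
  primitive values. So V is a summand of J/J^2 represented by primitives, which is the situation in
  which the skew derivation is defined.\<close>

locale hopf_primitive = hopf C B m u \<epsilon> \<Delta> S
  for C :: "('o, 'm, 'k::{alg_closed_field, field_char_0}) bcat" (structure) and B m u \<epsilon> \<Delta> S +
  fixes V :: 'o and i p :: 'm
  assumes i_hom: "hom V B i" and p_hom: "hom B V p"
    and i_prim: "prm \<bullet> i = \<zero> V (B \<otimes> B)"
    and p_m2: "p \<bullet> m2 = \<zero> (B \<otimes> B) V" and p_u: "p \<bullet> u = \<zero> \<one> V" and p_i: "p \<bullet> i = Id V"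
begin

lemma ip_simps [simp]: "arr i" "dm i = V" "cd i = B" "arr p" "dm p = B" "cd p = V"
  using i_hom p_hom by (simp_all add: hom_def)

lemma V_Ob [simp]: "V \<in> Ob"
  using dm_Ob[of i] by simp

lemma p_i' [simp]: "arr x \<Longrightarrow> cd x = V \<Longrightarrow> p \<bullet> i \<bullet> x = x" and p_u' [simp]: "p \<bullet> u \<bullet> x = \<zero> (dm x) V"
  and p_m2' [simp]: "p \<bullet> m2 \<bullet> x = \<zero> (dm x) V"
  using p_i[THEN cmp_reassoc, of x] p_u[THEN cmp_reassoc, of x] p_m2[THEN cmp_reassoc, of x] by simp_all

lemmas [simp] = p_i p_u p_m2

lemma \<Delta>_i: "\<Delta> \<bullet> i = (u \<star> i) \<bullet> li V \<uplus> (i \<star> u) \<bullet> ri V"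
  using prm_zero_iff[of i] i_prim by simp

lemma \<epsilon>_i [simp]: "\<epsilon> \<bullet> i = \<zero> V \<one>"
  using primitive_counit[of i] i_prim by simp

lemma p_aug [simp]: "p \<bullet> aug = p"
  by (rule aug_fix_right) simp_all

text \<open>Both factors are written as augmentation part plus scalar part. The product of the
  augmentation parts dies, so \<open>p\<close> is a derivation with respect to
  \<open>\<epsilon>\<close>.\<close>

lemma p_m: "p \<bullet> m = \<rr> V \<bullet> (p \<star> \<epsilon>) \<uplus> \<ll> V \<bullet> (\<epsilon> \<star> p)"
proof -
  have 1: "p \<bullet> m \<bullet> (x \<star> (u \<bullet> \<epsilon>)) = \<rr> V \<bullet> ((p \<bullet> x) \<star> \<epsilon>)" if "arr x" "cd x = B" for x
    using m_unit_right[THEN cmp_reassoc, of "x \<star> \<epsilon>"] that r_nat'[of p V "x \<star> \<epsilon>"] by (simp add: merge)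
  have 2: "p \<bullet> m \<bullet> ((u \<bullet> \<epsilon>) \<star> x) = \<ll> V \<bullet> (\<epsilon> \<star> (p \<bullet> x))" if "arr x" "cd x = B" for x
    using m_unit_left[THEN cmp_reassoc, of "\<epsilon> \<star> x"] that l_nat'[of p V "\<epsilon> \<star> x"] by (simp add: merge)
  have "p \<bullet> m = p \<bullet> m \<bullet> (Id B \<star> Id B)" by simp
  also have "\<dots> = p \<bullet> m \<bullet> ((aug \<uplus> u \<bullet> \<epsilon>) \<star> (aug \<uplus> u \<bullet> \<epsilon>))" unfolding Id_aug[symmetric] ..
  also have "\<dots> = (p \<bullet> m \<bullet> (aug \<star> aug) \<uplus> p \<bullet> m \<bullet> (aug \<star> (u \<bullet> \<epsilon>))) \<uplus>
      (p \<bullet> m \<bullet> ((u \<bullet> \<epsilon>) \<star> aug) \<uplus> p \<bullet> m \<bullet> ((u \<bullet> \<epsilon>) \<star> (u \<bullet> \<epsilon>)))"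
    by (simp add: distribs add_ac')
  also have "p \<bullet> m \<bullet> (aug \<star> aug) = \<zero> (B \<otimes> B) V" using p_m2 by (simp only: m2_def)
  finally show ?thesis by (simp add: 1 2)
qed

definition der :: 'm where "der = (Id B \<star> p) \<bullet> \<Delta>"

lemma der_simps [simp]: "arr der" "dm der = B" "cd der = B \<otimes> V"
  by (simp_all add: der_def)

lemma der_u: "der \<bullet> u = \<zero> \<one> (B \<otimes> V)"
  by (simp add: der_def \<Delta>_u_li merge)

text \<open>Exchanges the two copies of V in (B \<otimes> V) \<otimes> V. It depends on
  \<open>B\<close>, \<open>V\<close> and the braiding but not on the Hopf structure, which is what
  makes two algebras comparable.\<close>

definition twist :: 'm where
  "twist = \<alpha>i B V V \<bullet> (Id B \<star> \<sigma> V V) \<bullet> \<alpha> B V V"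

lemma twist_simps [simp]: "arr twist" "dm twist = (B \<otimes> V) \<otimes> V" "cd twist = (B \<otimes> V) \<otimes> V"
  by (simp_all add: twist_def)

text \<open>The braided Leibniz rule for a product xv with v in V. Both \<Delta>(v) and
  \<open>p \<bullet> m\<close> have two terms; of the four combinations two vanish.\<close>

lemma leibniz: "der \<bullet> m \<bullet> (Id B \<star> i) =
    Id (B \<otimes> V) \<uplus> ((m \<bullet> (Id B \<star> i)) \<star> Id V) \<bullet> twist \<bullet> (der \<star> Id V)"
proof -
  let ?M = "mid B B B B"
  have "der \<bullet> m \<bullet> (Id B \<star> i) = (m \<star> (p \<bullet> m)) \<bullet> ?M \<bullet> (\<Delta> \<star> (\<Delta> \<bullet> i))"
    using \<Delta>_m[THEN cmp_reassoc', of "Id B \<star> i"] by (simp add: der_def merge)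
  also have "\<dots> = ((m \<star> (\<rr> V \<bullet> (p \<star> \<epsilon>))) \<bullet> ?M \<bullet> (\<Delta> \<star> ((u \<star> i) \<bullet> li V)) \<uplus>
      (m \<star> (\<ll> V \<bullet> (\<epsilon> \<star> p))) \<bullet> ?M \<bullet> (\<Delta> \<star> ((u \<star> i) \<bullet> li V))) \<uplus>
      ((m \<star> (\<rr> V \<bullet> (p \<star> \<epsilon>))) \<bullet> ?M \<bullet> (\<Delta> \<star> ((i \<star> u) \<bullet> ri V)) \<uplus>
      (m \<star> (\<ll> V \<bullet> (\<epsilon> \<star> p))) \<bullet> ?M \<bullet> (\<Delta> \<star> ((i \<star> u) \<bullet> ri V)))"
    unfolding p_m \<Delta>_i by (simp add: distribs add_ac')
  \<comment> \<open>This combination vanishes because \<open>\<epsilon> \<bullet> i\<close> is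
    zero.\<close>
  also have "(m \<star> (\<rr> V \<bullet> (p \<star> \<epsilon>))) \<bullet> ?M \<bullet> (\<Delta> \<star> ((u \<star> i) \<bullet> li V)) =
      (m \<star> \<rr> V) \<bullet> ((Id B \<star> Id B) \<star> (p \<star> \<epsilon>)) \<bullet> ?M \<bullet> (\<Delta> \<star> ((u \<star> i) \<bullet> li V))"
    by (simp add: merge)
  also have "\<dots> = (m \<star> \<rr> V) \<bullet> mid B V B \<one> \<bullet> ((Id B \<star> p) \<star> (Id B \<star> \<epsilon>)) \<bullet> (\<Delta> \<star> ((u \<star> i) \<bullet> li V))"
    using mid_nat'[of "Id B" p "Id B" \<epsilon> B V B \<one> "\<Delta> \<star> ((u \<star> i) \<bullet> li V)"] by simp
  also have "\<dots> = \<zero> (B \<otimes> V) (B \<otimes> V)" by (simp add: merge)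
  \<comment> \<open>This one vanishes because \<open>p \<bullet> u\<close> is zero.\<close>
  also have "(m \<star> (\<ll> V \<bullet> (\<epsilon> \<star> p))) \<bullet> ?M \<bullet> (\<Delta> \<star> ((i \<star> u) \<bullet> ri V)) =
      (m \<star> \<ll> V) \<bullet> ((Id B \<star> Id B) \<star> (\<epsilon> \<star> p)) \<bullet> ?M \<bullet> (\<Delta> \<star> ((i \<star> u) \<bullet> ri V))"
    by (simp add: merge)
  also have "\<dots> = (m \<star> \<ll> V) \<bullet> mid B \<one> B V \<bullet> ((Id B \<star> \<epsilon>) \<star> (Id B \<star> p)) \<bullet> (\<Delta> \<star> ((i \<star> u) \<bullet> ri V))"
    using mid_nat'[of "Id B" \<epsilon> "Id B" p B \<one> B V "\<Delta> \<star> ((i \<star> u) \<bullet> ri V)"] by simp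
  also have "\<dots> = \<zero> (B \<otimes> V) (B \<otimes> V)" by (simp add: merge)
  \<comment> \<open>This one contributes x \<otimes> v: the two exchanged factors are units, so no
    braiding survives.\<close>
  also have "(m \<star> (\<ll> V \<bullet> (\<epsilon> \<star> p))) \<bullet> ?M \<bullet> (\<Delta> \<star> ((u \<star> i) \<bullet> li V)) =
      (m \<star> \<ll> V) \<bullet> ((Id B \<star> Id B) \<star> (\<epsilon> \<star> p)) \<bullet> ?M \<bullet> (\<Delta> \<star> ((u \<star> i) \<bullet> li V))"
    by (simp add: merge)
  also have "\<dots> = (m \<star> \<ll> V) \<bullet> mid B \<one> B V \<bullet> ((Id B \<star> \<epsilon>) \<star> (Id B \<star> p)) \<bullet> (\<Delta> \<star> ((u \<star> i) \<bullet> li V))"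
    using mid_nat'[of "Id B" \<epsilon> "Id B" p B \<one> B V "\<Delta> \<star> ((u \<star> i) \<bullet> li V)"] by simp
  also have "\<dots> = (m \<star> \<ll> V) \<bullet> mid B \<one> B V \<bullet> ((Id B \<star> Id \<one>) \<star> (u \<star> Id V)) \<bullet> (((Id B \<star> \<epsilon>) \<bullet> \<Delta>) \<star> li V)"
    by (simp add: merge)
  also have "\<dots> = (m \<star> \<ll> V) \<bullet> ((Id B \<star> u) \<star> (Id \<one> \<star> Id V)) \<bullet> mid B \<one> \<one> V \<bullet> (((Id B \<star> \<epsilon>) \<bullet> \<Delta>) \<star> li V)"
    using mid_nat'[of "Id B" "Id \<one>" u "Id V" B \<one> B V "((Id B \<star> \<epsilon>) \<bullet> \<Delta>) \<star> li V"] by simp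
  also have "\<dots> = (\<rr> B \<star> \<ll> V) \<bullet> mid B \<one> \<one> V \<bullet> (((Id B \<star> \<epsilon>) \<bullet> \<Delta>) \<star> li V)"
    by (simp add: merge m_unit_right)
  also have "\<dots> = Id (B \<otimes> V)"
    by (simp add: mid_unit_unit[THEN cmp_reassoc] merge counit_right)
  \<comment> \<open>The remaining one differentiates x and carries the coefficient past v, with the
    unit in the fourth place of \<open>mid\<close>.\<close>
  also have "(m \<star> (\<rr> V \<bullet> (p \<star> \<epsilon>))) \<bullet> ?M \<bullet> (\<Delta> \<star> ((i \<star> u) \<bullet> ri V)) =
      (m \<star> \<rr> V) \<bullet> ((Id B \<star> Id B) \<star> (p \<star> \<epsilon>)) \<bullet> ?M \<bullet> (\<Delta> \<star> ((i \<star> u) \<bullet> ri V))"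
    by (simp add: merge)
  also have "\<dots> = (m \<star> \<rr> V) \<bullet> mid B V B \<one> \<bullet> ((Id B \<star> p) \<star> (Id B \<star> \<epsilon>)) \<bullet> (\<Delta> \<star> ((i \<star> u) \<bullet> ri V))"
    using mid_nat'[of "Id B" p "Id B" \<epsilon> B V B \<one> "\<Delta> \<star> ((i \<star> u) \<bullet> ri V)"] by simp
  also have "\<dots> = (m \<star> \<rr> V) \<bullet> mid B V B \<one> \<bullet> ((Id B \<star> Id V) \<star> (i \<star> Id \<one>)) \<bullet> (der \<star> ri V)"
    by (simp add: merge der_def)
  also have "\<dots> = (m \<star> \<rr> V) \<bullet> ((Id B \<star> i) \<star> (Id V \<star> Id \<one>)) \<bullet> mid B V V \<one> \<bullet> (der \<star> ri V)"
    using mid_nat'[of "Id B" "Id V" i "Id \<one>" B V B \<one> "der \<star> ri V"] by simp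
  also have "\<dots> = ((m \<bullet> (Id B \<star> i)) \<star> Id V) \<bullet> (Id (B \<otimes> V) \<star> \<rr> V) \<bullet> mid B V V \<one> \<bullet> (der \<star> ri V)"
    by (simp add: merge)
  also have "\<dots> = ((m \<bullet> (Id B \<star> i)) \<star> Id V) \<bullet> twist \<bullet> (Id (B \<otimes> V) \<star> \<rr> V) \<bullet> (der \<star> ri V)"
    using mid_unit_right[of B V V, THEN cmp_reassoc] by (simp add: twist_def)
  also have "(Id (B \<otimes> V) \<star> \<rr> V) \<bullet> (der \<star> ri V) = der \<star> Id V" by (simp add: merge)
  finally show ?thesis by simp
qed

end

section \<open>Comparison of two generated Hopf algebras\<close>

locale hopf_pair = braided_fusion_category C +
  H: hopf_primitive C B m u \<epsilon> \<Delta> S V i p + H': hopf_primitive C B m' u' \<epsilon>' \<Delta>' S' V i' p'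
  for C :: "('o, 'm, 'k::{alg_closed_field, field_char_0}) bcat" (structure)
    and B m u \<epsilon> \<Delta> S V i p m' u' \<epsilon>' \<Delta>' S' i' p'
begin

text \<open>The correspondence between the two algebras generated by \<open>(i, i')\<close>, as a relation between
  generalized elements.\<close>

inductive cor :: "'m \<Rightarrow> 'm \<Rightarrow> bool" where
  unit: "cor u u'"
| cmp: "cor x x' \<Longrightarrow> arr t \<Longrightarrow> cd t = dm x \<Longrightarrow> cor (x \<bullet> t) (x' \<bullet> t)"
| add: "cor x x' \<Longrightarrow> cor y y' \<Longrightarrow> dm x = dm y \<Longrightarrow> cor (x \<uplus> y) (x' \<uplus> y')"
| mult: "cor x x' \<Longrightarrow> cor (m \<bullet> (x \<star> i)) (m' \<bullet> (x' \<star> i'))"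

lemma cor_hom: "cor x x' \<Longrightarrow> arr x \<and> arr x' \<and> cd x = B \<and> cd x' = B \<and> dm x' = dm x"
  by (induction rule: cor.induct) simp_all

lemma cor_simps:
  assumes "cor x x'"
  shows "arr x" "arr x'" "cd x = B" "cd x' = B" "dm x' = dm x"
  using cor_hom[OF assms] by simp_all

lemma cor_counit: "cor x x' \<Longrightarrow> \<epsilon> \<bullet> x = \<epsilon>' \<bullet> x'"
proof (induction rule: cor.induct)
  case (cmp x x' t)
  thus ?case by (simp add: cmp_assoc[symmetric] del: cmp_assoc)
next
  case (add x x' y y')
  thus ?case using cor_simps[OF add.hyps(1)] cor_simps[OF add.hyps(2)] by (simp add: distribs)
next
  case (mult x x')
  note [simp] = cor_simps[OF mult.hyps]
  show ?case
    using H.\<epsilon>_m[THEN cmp_reassoc', of "x \<star> i"] H'.\<epsilon>_m[THEN cmp_reassoc', of "x' \<star> i'"]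
    by (simp add: merge)
qed simp

lemma cor_zero: "a \<in> Ob \<Longrightarrow> cor (\<zero> a B) (\<zero> a B)"
  using cor.cmp[OF cor.unit, of "\<zero> a \<one>"] by simp

text \<open>Relatedness for elements of B \<otimes> V: both come from one related pair and the same
  tensor \<open>t\<close>. Several pairs can be merged into one over a direct sum.\<close>

definition cor_der :: "'m \<Rightarrow> 'm \<Rightarrow> bool" where
  "cor_der d d' \<longleftrightarrow> (\<exists>y y' t. cor y y' \<and> arr t \<and> cd t = dm y \<otimes> V \<and>
     d = (y \<star> Id V) \<bullet> t \<and> d' = (y' \<star> Id V) \<bullet> t)"

lemma cor_derI: "cor y y' \<Longrightarrow> arr t \<Longrightarrow> cd t = dm y \<otimes> V \<Longrightarrow> cor_der ((y \<star> Id V) \<bullet> t) ((y' \<star> Id V) \<bullet> t)"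
  unfolding cor_der_def by blast

lemma cor_der_add:
  assumes "cor_der d d'" "cor_der e e'" "dm d = dm e"
  shows "cor_der (d \<uplus> e) (d' \<uplus> e')"
proof -
  obtain y y' t where y: "cor y y'" "arr t" "cd t = dm y \<otimes> V" "d = (y \<star> Id V) \<bullet> t" "d' = (y' \<star> Id V) \<bullet> t"
    using assms(1) unfolding cor_der_def by blast
  obtain z z' s where z: "cor z z'" "arr s" "cd s = dm z \<otimes> V" "e = (z \<star> Id V) \<bullet> s" "e' = (z' \<star> Id V) \<bullet> s"
    using assms(2) unfolding cor_der_def by blast
  note [simp] = cor_simps[OF y(1)] cor_simps[OF z(1)] y(2,3) z(2,3)
  have [simp]: "dm s = dm t" using assms(3) y z by simp
  obtain c a b f g where c: "hom (dm y) c a" "hom (dm z) c b" "hom c (dm y) f" "hom c (dm z) g"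
    "f \<bullet> a = Id (dm y)" "g \<bullet> b = Id (dm z)" "f \<bullet> b = \<zero> (dm z) (dm y)" "g \<bullet> a = \<zero> (dm y) (dm z)"
    by (rule binary_direct_sum[of "dm y" "dm z"]) auto
  have [simp]: "arr a" "dm a = dm y" "cd a = c" "arr b" "dm b = dm z" "cd b = c"
    "arr f" "dm f = c" "cd f = dm y" "arr g" "dm g = c" "cd g = dm z"
    using c by (simp_all add: hom_def)
  \<comment> \<open>One pair defined on the direct sum of the two domains, and one tensor with the
    two given components.\<close>
  let ?w = "y \<bullet> f \<uplus> z \<bullet> g" and ?w' = "y' \<bullet> f \<uplus> z' \<bullet> g" and ?r = "(a \<star> Id V) \<bullet> t \<uplus> (b \<star> Id V) \<bullet> s"
  have "cor ?w ?w'" by (intro cor.add cor.cmp y z) simp_all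
  hence "cor_der ((?w \<star> Id V) \<bullet> ?r) ((?w' \<star> Id V) \<bullet> ?r)" by (rule cor_derI) simp_all
  moreover have "(?w \<star> Id V) \<bullet> ?r = d \<uplus> e" "(?w' \<star> Id V) \<bullet> ?r = d' \<uplus> e'"
    by (simp_all add: distribs merge y z c)
  ultimately show ?thesis by simp
qed

text \<open>In the multiplicative step the Leibniz rules of the two algebras have the same shape and
  the same twist, so the related coefficients of x and x' produce related coefficients for the
  products.\<close>

lemma cor_der: "cor x x' \<Longrightarrow> cor_der (H.der \<bullet> x) (H'.der \<bullet> x')"
proof (induction rule: cor.induct)
  case unit
  show ?case using cor_derI[OF cor_zero[of \<one>], of "\<zero> \<one> (\<one> \<otimes> V)"] by (simp add: H.der_u H'.der_u)
next
  case (cmp x x' t)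
  then obtain y y' s where y: "cor y y'" "arr s" "cd s = dm y \<otimes> V" "H.der \<bullet> x = (y \<star> Id V) \<bullet> s"
    "H'.der \<bullet> x' = (y' \<star> Id V) \<bullet> s" unfolding cor_der_def by blast
  have "cor_der ((y \<star> Id V) \<bullet> s \<bullet> t) ((y' \<star> Id V) \<bullet> s \<bullet> t)"
    by (rule cor_derI[OF y(1)]) (use y in simp_all)
  thus ?case using y(4)[THEN cmp_reassoc', of t] y(5)[THEN cmp_reassoc', of t] by simp
next
  case (add x x' y y')
  note [simp] = cor_simps[OF add.hyps(1)] cor_simps[OF add.hyps(2)]
  have "cor_der (H.der \<bullet> x \<uplus> H.der \<bullet> y) (H'.der \<bullet> x' \<uplus> H'.der \<bullet> y')"
    by (rule cor_der_add) (use add in simp_all)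
  thus ?case using add.hyps(3) by (simp add: distribs)
next
  case (mult x x')
  then obtain y y' s where y: "cor y y'" "arr s" "cd s = dm y \<otimes> V" "H.der \<bullet> x = (y \<star> Id V) \<bullet> s"
    "H'.der \<bullet> x' = (y' \<star> Id V) \<bullet> s" unfolding cor_der_def by blast
  note [simp] = cor_simps[OF mult.hyps] cor_simps[OF y(1)] y(2,3)
  have ds: "dm s = dm x" using arg_cong[OF y(4), of dm] by simp
  note [simp] = ds
  \<comment> \<open>The common tensor \<open>s\<close>, extended by the new factor V and twisted
    before \<open>y\<close> or \<open>y'\<close> is applied.\<close>
  define w where "w = \<alpha>i (dm y) V V \<bullet> (Id (dm y) \<star> \<sigma> V V) \<bullet> \<alpha> (dm y) V V \<bullet> (s \<star> Id V)"
  \<comment> \<open>Naturality of the twist in its first factor. \<open>H.twist\<close> serves both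
    algebras, since its definition mentions neither structure.\<close>
  have tw: "H.twist \<bullet> ((z \<star> Id V) \<star> Id V) = ((z \<star> Id V) \<star> Id V) \<bullet> \<alpha>i (dm z) V V \<bullet> (Id (dm z) \<star> \<sigma> V V) \<bullet> \<alpha> (dm z) V V"
    if [simp]: "arr z" "cd z = B" for z
  proof -
    have "H.twist \<bullet> ((z \<star> Id V) \<star> Id V) = \<alpha>i B V V \<bullet> (z \<star> (Id V \<star> Id V)) \<bullet> (Id (dm z) \<star> \<sigma> V V) \<bullet> \<alpha> (dm z) V V"
      by (simp add: H.twist_def \<alpha>_nat merge)
    also have "\<dots> = ((z \<star> Id V) \<star> Id V) \<bullet> \<alpha>i (dm z) V V \<bullet> (Id (dm z) \<star> \<sigma> V V) \<bullet> \<alpha> (dm z) V V"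
      by (simp add: \<alpha>i_nat' del: tns_Id)
    finally show ?thesis .
  qed
  have 1: "H.der \<bullet> m \<bullet> (x \<star> i) = (x \<star> Id V) \<uplus> ((m \<bullet> (y \<star> i)) \<star> Id V) \<bullet> w"
  proof -
    have "H.der \<bullet> m \<bullet> (x \<star> i) = (H.der \<bullet> m \<bullet> (Id B \<star> i)) \<bullet> (x \<star> Id V)" by (simp add: merge)
    also have "\<dots> = (x \<star> Id V) \<uplus> ((m \<bullet> (Id B \<star> i)) \<star> Id V) \<bullet> H.twist \<bullet> ((H.der \<bullet> x) \<star> Id V)"
      unfolding H.leibniz by (simp add: distribs merge)
    also have "H.twist \<bullet> ((H.der \<bullet> x) \<star> Id V) = H.twist \<bullet> ((y \<star> Id V) \<star> Id V) \<bullet> (s \<star> Id V)"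
      unfolding y(4) by (simp add: merge)
    also have "\<dots> = ((y \<star> Id V) \<star> Id V) \<bullet> w"
      using tw[of y, THEN cmp_reassoc, of "s \<star> Id V"] by (simp add: w_def)
    finally show ?thesis by (simp add: merge)
  qed
  have 2: "H'.der \<bullet> m' \<bullet> (x' \<star> i') = (x' \<star> Id V) \<uplus> ((m' \<bullet> (y' \<star> i')) \<star> Id V) \<bullet> w"
  proof -
    have "H'.der \<bullet> m' \<bullet> (x' \<star> i') = (H'.der \<bullet> m' \<bullet> (Id B \<star> i')) \<bullet> (x' \<star> Id V)" by (simp add: merge)
    also have "\<dots> = (x' \<star> Id V) \<uplus> ((m' \<bullet> (Id B \<star> i')) \<star> Id V) \<bullet> H.twist \<bullet> ((H'.der \<bullet> x') \<star> Id V)"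
      unfolding H'.leibniz by (simp add: distribs merge)
    also have "H.twist \<bullet> ((H'.der \<bullet> x') \<star> Id V) = H.twist \<bullet> ((y' \<star> Id V) \<star> Id V) \<bullet> (s \<star> Id V)"
      unfolding y(5) by (simp add: merge)
    also have "\<dots> = ((y' \<star> Id V) \<star> Id V) \<bullet> w"
      using tw[of y', THEN cmp_reassoc, of "s \<star> Id V"] by (simp add: w_def)
    finally show ?thesis by (simp add: merge)
  qed
  have [simp]: "arr w" "dm w = dm x \<otimes> V" "cd w = (dm y \<otimes> V) \<otimes> V" by (simp_all add: w_def)
  have "cor_der ((x \<star> Id V) \<bullet> Id (dm x \<otimes> V)) ((x' \<star> Id V) \<bullet> Id (dm x \<otimes> V))"
    by (rule cor_derI[OF mult.hyps]) simp_all
  moreover have "cor_der (((m \<bullet> (y \<star> i)) \<star> Id V) \<bullet> w) (((m' \<bullet> (y' \<star> i')) \<star> Id V) \<bullet> w)"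
    by (rule cor_derI[OF cor.mult[OF y(1)]]) simp_all
  ultimately have "cor_der ((x \<star> Id V) \<bullet> Id (dm x \<otimes> V) \<uplus> ((m \<bullet> (y \<star> i)) \<star> Id V) \<bullet> w)
      ((x' \<star> Id V) \<bullet> Id (dm x \<otimes> V) \<uplus> ((m' \<bullet> (y' \<star> i')) \<star> Id V) \<bullet> w)"
    by (rule cor_der_add) simp
  thus ?case unfolding 1 2 by simp
qed

end

text \<open>Generation is required on both sides and cogeneration on the first: a family
  \<open>Q\<close> of elements killed by \<open>\<epsilon>\<close> and stable under the derivation
  is zero. The existence of \<open>z\<close> and \<open>t\<close> expresses that the derivative lies
  in Q \<otimes> V.\<close>

locale generated_hopf_pair = hopf_pair +
  fixes q y n q' y' n'
  assumes gen: "hom B V q" "hom B (B \<otimes> B) y" "H.aug = i \<bullet> q \<uplus> H.m2 \<bullet> y"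
      "mpow m H.aug n = \<zero> (tensor_power C B n) B"
    and gen': "hom B V q'" "hom B (B \<otimes> B) y'" "H'.aug = i' \<bullet> q' \<uplus> H'.m2 \<bullet> y'"
      "mpow m' H'.aug n' = \<zero> (tensor_power C B n') B"
    and cogen: "\<And>Q x. (\<And>x. Q x \<Longrightarrow> arr x \<and> cd x = B \<and> \<epsilon> \<bullet> x = \<zero> (dm x) \<one> \<and>
        (\<exists>z t. Q z \<and> arr t \<and> cd t = dm z \<otimes> V \<and> H.der \<bullet> x = (z \<star> Id V) \<bullet> t)) \<Longrightarrow>
      Q x \<Longrightarrow> x = \<zero> (dm x) B"
begin

text \<open>The elements related to 0 form a family as in \<open>cogen\<close>: related elements
  have equal counits and related derivatives.\<close>

lemma cor_zero_imp_zero: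
  assumes "cor x (\<zero> (dm x) B)"
  shows "x = \<zero> (dm x) B"
proof (rule cogen[of "\<lambda>x. cor x (\<zero> (dm x) B)"])
  fix x assume x: "cor x (\<zero> (dm x) B)"
  note [simp] = cor_simps[OF x]
  obtain y y' t where y: "cor y y'" "arr t" "cd t = dm y \<otimes> V" "H.der \<bullet> x = (y \<star> Id V) \<bullet> t"
    "H'.der \<bullet> \<zero> (dm x) B = (y' \<star> Id V) \<bullet> t"
    using cor_der[OF x] unfolding cor_der_def by blast
  note [simp] = cor_simps[OF y(1)] y(2,3)
  have dt [simp]: "dm t = dm x" using arg_cong[OF y(4), of dm] by simp
  obtain g where g: "hom B (dm y) g" "y' \<bullet> g \<bullet> y' = y'" using pseudo_inverse[of y'] by auto
  have [simp]: "arr g" "dm g = B" "cd g = dm y" using g(1) by (simp_all add: hom_def)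
  \<comment> \<open>The idempotent onto the kernel of \<open>y'\<close>. The tensor \<open>t\<close>
    is killed by \<open>y'\<close> and hence fixed by it, so \<open>y\<close> can be replaced by
    \<open>y \<bullet> ?e\<close>, which is related to 0.\<close>
  let ?e = "Id (dm y) \<uplus> \<ominus> (g \<bullet> y')"
  have "cor (y \<bullet> ?e) (y' \<bullet> ?e)" by (rule cor.cmp[OF y(1)]) simp_all
  moreover have "y' \<bullet> ?e = \<zero> (dm y) B" using g(2) by (simp add: distribs)
  moreover have "((y \<bullet> ?e) \<star> Id V) \<bullet> t = H.der \<bullet> x"
  proof -
    have "(?e \<star> Id V) \<bullet> t = t \<uplus> \<ominus> ((g \<star> Id V) \<bullet> (y' \<star> Id V) \<bullet> t)"
      by (simp add: distribs merge)
    also have "\<dots> = t" unfolding y(5)[symmetric] by simp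
    finally have et: "(?e \<star> Id V) \<bullet> t = t" .
    have "((y \<bullet> ?e) \<star> Id V) \<bullet> t = (y \<star> Id V) \<bullet> (?e \<star> Id V) \<bullet> t" by (simp add: merge)
    thus ?thesis unfolding et y(4) .
  qed
  ultimately have "cor (y \<bullet> ?e) (\<zero> (dm (y \<bullet> ?e)) B) \<and> arr t \<and> cd t = dm (y \<bullet> ?e) \<otimes> V \<and>
     H.der \<bullet> x = ((y \<bullet> ?e) \<star> Id V) \<bullet> t" by simp
  moreover have "\<epsilon> \<bullet> x = \<zero> (dm x) \<one>" using cor_counit[OF x] by simp
  moreover have "arr x" "cd x = B" by simp_all
  ultimately show "arr x \<and> cd x = B \<and> \<epsilon> \<bullet> x = \<zero> (dm x) \<one> \<and> (\<exists>z t. cor z (\<zero> (dm z) B) \<and> arr t \<and>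
     cd t = dm z \<otimes> V \<and> H.der \<bullet> x = (z \<star> Id V) \<bullet> t)"
    by blast
qed (rule assms)

text \<open>Since the second algebra is generated by its copy of V, each of its elements has a
  partner. For the universal element \<open>Id B\<close> the partner \<open>h\<close> is the
  candidate for the map.\<close>

lemma cor_surj': "\<exists>h. cor h (Id B)"
proof (rule H'.generated_by_complement[OF H'.i_hom gen', of "\<lambda>x'. \<exists>x. cor x x'"])
  show "\<exists>x. cor x u'" using cor.unit by blast
  show "\<exists>x. cor x x' \<Longrightarrow> arr x' \<and> cd x' = B" for x' using cor_simps by blast
  show "\<exists>x. cor x (x' \<bullet> t)" if "\<exists>x. cor x x'" "arr t" "cd t = dm x'" for x' t
    using that cor.cmp cor_simps(5) by metis
  show "\<exists>x. cor x (x' \<uplus> y')" if "\<exists>x. cor x x'" "\<exists>x. cor x y'" "dm x' = dm y'" for x' y'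
    using that cor.add cor_simps(5) by metis
  show "\<exists>x. cor x (m' \<bullet> (x' \<star> i'))" if "\<exists>x. cor x x'" for x' using that cor.mult by blast
qed

lemma cor_surj: "\<exists>k. cor (Id B) k"
proof (rule H.generated_by_complement[OF H.i_hom gen, of "\<lambda>x. \<exists>x'. cor x x'"])
  show "\<exists>x'. cor u x'" using cor.unit by blast
  show "\<exists>x'. cor x x' \<Longrightarrow> arr x \<and> cd x = B" for x using cor_simps by blast
  show "\<exists>x'. cor (x \<bullet> t) x'" if "\<exists>x'. cor x x'" "arr t" "cd t = dm x" for x t
    using that cor.cmp by blast
  show "\<exists>x'. cor (x \<uplus> y) x'" if "\<exists>x'. cor x x'" "\<exists>x'. cor y x'" "dm x = dm y" for x y
    using that cor.add by blast
  show "\<exists>x'. cor (m \<bullet> (x \<star> i)) x'" if "\<exists>x'. cor x x'" for x using that cor.mult by blast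
qed

text \<open>\<open>S \<bullet> h\<close> and \<open>h \<bullet> S'\<close> are a left and a right
  convolution inverse of \<open>h\<close>, hence equal. The chain evaluates the triple convolution
  in its two bracketings.\<close>

lemma bialgebra_map_antipode:
  assumes h: "hom B B h" and hm: "h \<bullet> m' = m \<bullet> (h \<star> h)" and hu: "h \<bullet> u' = u"
    and h\<Delta>: "(h \<star> h) \<bullet> \<Delta>' = \<Delta> \<bullet> h" and h\<epsilon>: "\<epsilon>' = \<epsilon> \<bullet> h"
  shows "h \<bullet> S' = S \<bullet> h"
proof -
  have [simp]: "arr h" "dm h = B" "cd h = B" using h by (simp_all add: hom_def)
  have 1: "m \<bullet> ((S \<bullet> h) \<star> h) \<bullet> \<Delta>' = u \<bullet> \<epsilon>'"
  proof -
    have "m \<bullet> ((S \<bullet> h) \<star> h) \<bullet> \<Delta>' = m \<bullet> (S \<star> Id B) \<bullet> (h \<star> h) \<bullet> \<Delta>'" by (simp add: merge)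
    also have "\<dots> = u \<bullet> \<epsilon> \<bullet> h" unfolding h\<Delta> using H.antipode_left by (metis cmp_assoc)
    finally show ?thesis using h\<epsilon> by simp
  qed
  have 2: "m \<bullet> (h \<star> (h \<bullet> S')) \<bullet> \<Delta>' = u \<bullet> \<epsilon>'"
  proof -
    have "m \<bullet> (h \<star> (h \<bullet> S')) \<bullet> \<Delta>' = (m \<bullet> (h \<star> h)) \<bullet> (Id B \<star> S') \<bullet> \<Delta>'" by (simp add: merge)
    also have "\<dots> = u \<bullet> \<epsilon>'" unfolding hm[symmetric] using H'.antipode_right hu by (metis cmp_assoc)
    finally show ?thesis .
  qed
  have "S \<bullet> h = (S \<bullet> h) \<bullet> \<rr> B \<bullet> (Id B \<star> \<epsilon>') \<bullet> \<Delta>'" using H'.counit_right by simp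
  also have "\<dots> = \<rr> B \<bullet> ((S \<bullet> h) \<star> Id \<one>) \<bullet> (Id B \<star> \<epsilon>') \<bullet> \<Delta>'" by (simp add: r_nat')
  also have "\<dots> = m \<bullet> ((S \<bullet> h) \<star> (u \<bullet> \<epsilon>')) \<bullet> \<Delta>'"
    using H.m_unit_right[THEN cmp_reassoc, of "((S \<bullet> h) \<star> \<epsilon>') \<bullet> \<Delta>'"] by (simp add: merge)
  also have "\<dots> = m \<bullet> ((S \<bullet> h) \<star> (m \<bullet> (h \<star> (h \<bullet> S')) \<bullet> \<Delta>')) \<bullet> \<Delta>'" unfolding 2 ..
  also have "\<dots> = m \<bullet> (Id B \<star> m) \<bullet> ((S \<bullet> h) \<star> (h \<star> (h \<bullet> S'))) \<bullet> (Id B \<star> \<Delta>') \<bullet> \<Delta>'" by (simp add: merge)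
  also have "\<dots> = m \<bullet> (Id B \<star> m) \<bullet> ((S \<bullet> h) \<star> (h \<star> (h \<bullet> S'))) \<bullet> \<alpha> B B B \<bullet> (\<Delta>' \<star> Id B) \<bullet> \<Delta>'"
    by (simp only: H'.coassoc)
  also have "\<dots> = m \<bullet> (Id B \<star> m) \<bullet> \<alpha> B B B \<bullet> (((S \<bullet> h) \<star> h) \<star> (h \<bullet> S')) \<bullet> (\<Delta>' \<star> Id B) \<bullet> \<Delta>'"
    using \<alpha>_nat'[of "S \<bullet> h" h "h \<bullet> S'" B B B "(\<Delta>' \<star> Id B) \<bullet> \<Delta>'"] by simp
  also have "\<dots> = m \<bullet> (m \<star> Id B) \<bullet> (((S \<bullet> h) \<star> h) \<star> (h \<bullet> S')) \<bullet> (\<Delta>' \<star> Id B) \<bullet> \<Delta>'"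
    using H.m_assoc[THEN cmp_reassoc, of "(((S \<bullet> h) \<star> h) \<star> (h \<bullet> S')) \<bullet> (\<Delta>' \<star> Id B) \<bullet> \<Delta>'"] by simp
  also have "\<dots> = m \<bullet> ((m \<bullet> ((S \<bullet> h) \<star> h) \<bullet> \<Delta>') \<star> (h \<bullet> S')) \<bullet> \<Delta>'" by (simp add: merge)
  also have "\<dots> = m \<bullet> (u \<star> Id B) \<bullet> (\<epsilon>' \<star> (h \<bullet> S')) \<bullet> \<Delta>'" unfolding 1 by (simp add: merge)
  also have "\<dots> = \<ll> B \<bullet> (\<epsilon>' \<star> (h \<bullet> S')) \<bullet> \<Delta>'"
    using H.m_unit_left[THEN cmp_reassoc] by simp
  also have "\<dots> = \<ll> B \<bullet> (Id \<one> \<star> (h \<bullet> S')) \<bullet> (\<epsilon>' \<star> Id B) \<bullet> \<Delta>'" by (simp add: merge)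
  also have "\<dots> = (h \<bullet> S') \<bullet> \<ll> B \<bullet> (\<epsilon>' \<star> Id B) \<bullet> \<Delta>'" by (simp add: l_nat')
  also have "\<dots> = h \<bullet> S'" using H'.counit_left by simp
  finally show ?thesis ..
qed

theorem exists_hopf_iso:
  obtains h k where "hom B B h" "hom B B k" "h \<bullet> k = Id B" "k \<bullet> h = Id B"
    "h \<bullet> m' = m \<bullet> (h \<star> h)" "h \<bullet> u' = u" "(h \<star> h) \<bullet> \<Delta>' = \<Delta> \<bullet> h" "\<epsilon>' = \<epsilon> \<bullet> h" "h \<bullet> S' = S \<bullet> h"
proof -
  obtain h where h: "cor h (Id B)" using cor_surj' by blast
  obtain k where k: "cor (Id B) k" using cor_surj by blast
  have [simp]: "arr h" "cd h = B" "dm h = B" using cor_simps[OF h] by simp_all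
  have [simp]: "arr k" "cd k = B" "dm k = B" using cor_simps[OF k] by simp_all
  \<comment> \<open>The pair (h x', x') is also related; subtracting it leaves an element related to
    0. So the correspondence is the graph of \<open>h\<close>.\<close>
  have cor_h: "x = h \<bullet> x'" if x: "cor x x'" for x x'
  proof -
    note [simp] = cor_simps[OF x]
    have "cor (h \<bullet> \<ominus> x') (Id B \<bullet> \<ominus> x')" by (rule cor.cmp[OF h]) simp_all
    hence "cor (x \<uplus> h \<bullet> \<ominus> x') (x' \<uplus> Id B \<bullet> \<ominus> x')" by (intro cor.add x) simp_all
    hence "cor (x \<uplus> \<ominus> (h \<bullet> x')) (\<zero> (dm (x \<uplus> \<ominus> (h \<bullet> x'))) B)" by simp
    hence "x \<uplus> \<ominus> (h \<bullet> x') = \<zero> (dm x) B" using cor_zero_imp_zero by fastforce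
    thus ?thesis by (rule eq_if_diff_zero) simp_all
  qed
  have hk: "h \<bullet> k = Id B" using cor_h[OF k] by simp
  \<comment> \<open>Both algebras live on \<open>B\<close>, and one-sided inverses of endomorphisms
    of \<open>B\<close> are two-sided.\<close>
  have kh: "k \<bullet> h = Id B" by (rule left_inverse_imp_right_inverse[OF _ _ hk]) (simp_all add: hom_def)
  have hu: "h \<bullet> u' = u" using cor_h[OF cor.unit] by simp
  have hi: "h \<bullet> i' = i"
  proof -
    have "cor (m \<bullet> (u \<star> i) \<bullet> li V) (m' \<bullet> (u' \<star> i') \<bullet> li V)"
      using cor.cmp[OF cor.mult[OF cor.unit], of "li V"] by simp
    moreover have "m \<bullet> (u \<star> i) \<bullet> li V = i"
      using H.m_unit_left[THEN cmp_reassoc, of "(Id \<one> \<star> i) \<bullet> li V"] by (simp add: merge l_nat')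
    moreover have "m' \<bullet> (u' \<star> i') \<bullet> li V = i'"
      using H'.m_unit_left[THEN cmp_reassoc, of "(Id \<one> \<star> i') \<bullet> li V"] by (simp add: merge l_nat')
    ultimately show ?thesis using cor_h[of i i'] by simp
  qed
  have h\<epsilon>: "\<epsilon>' = \<epsilon> \<bullet> h" using cor_counit[OF h] by simp
  \<comment> \<open>The correspondence was closed only under right multiplication by V; closure
    under all products follows by induction on the second factor and associativity.\<close>
  have mult: "cor (m \<bullet> (x \<star> y)) (m' \<bullet> (x' \<star> y'))" if x: "cor x x'" and "cor y y'" for x x' y y'
    using that(2)
  proof (induction rule: cor.induct)
    case unit
    note [simp] = cor_simps[OF x]
    have "cor (x \<bullet> \<rr> (dm x)) (x' \<bullet> \<rr> (dm x))" by (rule cor.cmp[OF x]) simp_all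
    moreover have "m \<bullet> (x \<star> u) = x \<bullet> \<rr> (dm x)"
      using H.m_unit_right[THEN cmp_reassoc, of "x \<star> Id \<one>"] by (simp add: merge r_nat)
    moreover have "m' \<bullet> (x' \<star> u') = x' \<bullet> \<rr> (dm x)"
      using H'.m_unit_right[THEN cmp_reassoc, of "x' \<star> Id \<one>"] by (simp add: merge r_nat)
    ultimately show ?case by simp
  next
    case (cmp y y' t)
    note [simp] = cor_simps[OF x] cor_simps[OF cmp.hyps(1)]
    have "cor ((m \<bullet> (x \<star> y)) \<bullet> (Id (dm x) \<star> t)) ((m' \<bullet> (x' \<star> y')) \<bullet> (Id (dm x) \<star> t))"
      by (rule cor.cmp[OF cmp.IH]) (simp_all add: cmp)
    thus ?case using cmp by (simp add: merge)
  next
    case (add y y' z z')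
    note [simp] = cor_simps[OF x] cor_simps[OF add.hyps(1)] cor_simps[OF add.hyps(2)]
    show ?case using cor.add[OF add.IH] add.hyps(3) by (simp add: distribs)
  next
    case (mult y y')
    note [simp] = cor_simps[OF x] cor_simps[OF mult.hyps(1)]
    have "m \<bullet> (x \<star> (m \<bullet> (y \<star> i))) = (m \<bullet> ((m \<bullet> (x \<star> y)) \<star> i)) \<bullet> \<alpha>i (dm x) (dm y) V"
    proof -
      have "m \<bullet> (x \<star> (m \<bullet> (y \<star> i))) = (m \<bullet> (Id B \<star> m) \<bullet> \<alpha> B B B) \<bullet> \<alpha>i B B B \<bullet> (x \<star> (y \<star> i))"
        by (simp add: merge)
      also have "\<dots> = m \<bullet> (m \<star> Id B) \<bullet> ((x \<star> y) \<star> i) \<bullet> \<alpha>i (dm x) (dm y) V"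
        unfolding H.m_assoc[symmetric] by (simp add: \<alpha>i_nat)
      finally show ?thesis by (simp add: merge)
    qed
    moreover have "m' \<bullet> (x' \<star> (m' \<bullet> (y' \<star> i'))) = (m' \<bullet> ((m' \<bullet> (x' \<star> y')) \<star> i')) \<bullet> \<alpha>i (dm x) (dm y) V"
    proof -
      have "m' \<bullet> (x' \<star> (m' \<bullet> (y' \<star> i'))) = (m' \<bullet> (Id B \<star> m') \<bullet> \<alpha> B B B) \<bullet> \<alpha>i B B B \<bullet> (x' \<star> (y' \<star> i'))"
        by (simp add: merge)
      also have "\<dots> = m' \<bullet> (m' \<star> Id B) \<bullet> ((x' \<star> y') \<star> i') \<bullet> \<alpha>i (dm x) (dm y) V"
        unfolding H'.m_assoc[symmetric] by (simp add: \<alpha>i_nat)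
      finally show ?thesis by (simp add: merge)
    qed
    ultimately show ?case using cor.cmp[OF cor.mult[OF mult.IH], of "\<alpha>i (dm x) (dm y) V"] by simp
  qed
  have hm: "h \<bullet> m' = m \<bullet> (h \<star> h)" using cor_h[OF mult[OF h h]] by simp
  have comult: "\<Delta> \<bullet> x = (h \<star> h) \<bullet> \<Delta>' \<bullet> x'" if "cor x x'" for x x'
    using that
  proof (induction rule: cor.induct)
    case unit
    show ?case by (simp add: H.\<Delta>_u_li H'.\<Delta>_u_li merge hu)
  next
    case (cmp x x' t)
    show ?case using cmp.IH[THEN cmp_reassoc, of t] by simp
  next
    case (add x x' y y')
    note [simp] = cor_simps[OF add.hyps(1)] cor_simps[OF add.hyps(2)]
    show ?case using add.hyps(3) add.IH by (simp add: distribs)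
  next
    case (mult x x')
    note [simp] = cor_simps[OF mult.hyps(1)]
    have \<Delta>i: "\<Delta> \<bullet> i = (h \<star> h) \<bullet> \<Delta>' \<bullet> i'"
      unfolding H.\<Delta>_i H'.\<Delta>_i by (simp add: distribs merge hi hu)
    have "\<Delta> \<bullet> m \<bullet> (x \<star> i) = (m \<star> m) \<bullet> mid B B B B \<bullet> ((\<Delta> \<bullet> x) \<star> (\<Delta> \<bullet> i))"
      using H.\<Delta>_m[THEN cmp_reassoc, of "x \<star> i"] by (simp add: merge)
    also have "\<dots> = (m \<star> m) \<bullet> mid B B B B \<bullet> ((h \<star> h) \<star> (h \<star> h)) \<bullet> ((\<Delta>' \<bullet> x') \<star> (\<Delta>' \<bullet> i'))"
      unfolding mult.IH \<Delta>i by (simp add: merge)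
    also have "\<dots> = (m \<star> m) \<bullet> ((h \<star> h) \<star> (h \<star> h)) \<bullet> mid B B B B \<bullet> ((\<Delta>' \<bullet> x') \<star> (\<Delta>' \<bullet> i'))"
      by (simp add: mid_nat')
    also have "\<dots> = (h \<star> h) \<bullet> (m' \<star> m') \<bullet> mid B B B B \<bullet> (\<Delta>' \<star> \<Delta>') \<bullet> (x' \<star> i')"
      by (simp add: merge hm)
    also have "\<dots> = (h \<star> h) \<bullet> \<Delta>' \<bullet> m' \<bullet> (x' \<star> i')"
      using H'.\<Delta>_m[THEN cmp_reassoc, of "x' \<star> i'"] by simp
    finally show ?case .
  qed
  have h\<Delta>: "(h \<star> h) \<bullet> \<Delta>' = \<Delta> \<bullet> h" using comult[OF h] by simp
  show ?thesis
    by (rule that[of h k]) (use hk kh hm hu h\<Delta> h\<epsilon> bialgebra_map_antipode[of h] in \<open>simp_all add: hom_def\<close>)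
qed

end

section \<open>Nichols algebras\<close>

lemma (in braided_fusion_category) direct_sum_tns_zeroI:
  assumes ds: "direct_sum C c n X \<iota> \<pi>" and z: "arr z" and [simp]: "y \<in> Ob"
  shows "dm z = c \<otimes> y \<Longrightarrow> (\<And>k. k < n \<Longrightarrow> z \<bullet> (\<iota> k \<star> Id y) = \<zero> (X k \<otimes> y) (cd z)) \<Longrightarrow> z = \<zero> (c \<otimes> y) (cd z)"
    "dm z = y \<otimes> c \<Longrightarrow> (\<And>k. k < n \<Longrightarrow> z \<bullet> (Id y \<star> \<iota> k) = \<zero> (y \<otimes> X k) (cd z)) \<Longrightarrow> z = \<zero> (y \<otimes> c) (cd z)"
    "cd z = c \<otimes> y \<Longrightarrow> (\<And>k. k < n \<Longrightarrow> (\<pi> k \<star> Id y) \<bullet> z = \<zero> (dm z) (X k \<otimes> y)) \<Longrightarrow> z = \<zero> (dm z) (c \<otimes> y)"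
    "cd z = y \<otimes> c \<Longrightarrow> (\<And>k. k < n \<Longrightarrow> (Id y \<star> \<pi> k) \<bullet> z = \<zero> (dm z) (y \<otimes> X k)) \<Longrightarrow> z = \<zero> (dm z) (y \<otimes> c)"
proof -
  note d = direct_sum_tot[OF ds]
  have i: "arr (\<iota> k)" "dm (\<iota> k) = X k" "cd (\<iota> k) = c" "arr (\<pi> k)" "dm (\<pi> k) = c" "cd (\<pi> k) = X k"
     "X k \<in> Ob" if "k < n" for k
    using d(2)[OF that] d(3)[OF that] dm_Ob[of "\<iota> k"] by (simp_all add: hom_def)
  have [simp]: "c \<in> Ob" by (rule d(1))
  have l: "Id (c \<otimes> y) = tsum (c \<otimes> y) (c \<otimes> y) (\<lambda>k. (\<iota> k \<star> Id y) \<bullet> (\<pi> k \<star> Id y)) n"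
  proof -
    have "Id (c \<otimes> y) = tsum c c (\<lambda>k. \<iota> k \<bullet> \<pi> k) n \<star> Id y" using d(5) by simp
    also have "\<dots> = tsum (c \<otimes> y) (c \<otimes> y) (\<lambda>k. (\<iota> k \<bullet> \<pi> k) \<star> Id y) n"
      by (subst tns_tsum) (simp_all add: i)
    also have "\<dots> = tsum (c \<otimes> y) (c \<otimes> y) (\<lambda>k. (\<iota> k \<star> Id y) \<bullet> (\<pi> k \<star> Id y)) n"
      by (rule tsum_cong) (simp add: merge i)
    finally show ?thesis .
  qed
  have r: "Id (y \<otimes> c) = tsum (y \<otimes> c) (y \<otimes> c) (\<lambda>k. (Id y \<star> \<iota> k) \<bullet> (Id y \<star> \<pi> k)) n"
  proof -
    have "Id (y \<otimes> c) = Id y \<star> tsum c c (\<lambda>k. \<iota> k \<bullet> \<pi> k) n" using d(5) by simp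
    also have "\<dots> = tsum (y \<otimes> c) (y \<otimes> c) (\<lambda>k. Id y \<star> (\<iota> k \<bullet> \<pi> k)) n"
      by (subst tns_tsum) (simp_all add: i)
    also have "\<dots> = tsum (y \<otimes> c) (y \<otimes> c) (\<lambda>k. (Id y \<star> \<iota> k) \<bullet> (Id y \<star> \<pi> k)) n"
      by (rule tsum_cong) (simp add: merge i)
    finally show ?thesis .
  qed
  show "z = \<zero> (c \<otimes> y) (cd z)"
    if [simp]: "dm z = c \<otimes> y" and *: "\<And>k. k < n \<Longrightarrow> z \<bullet> (\<iota> k \<star> Id y) = \<zero> (X k \<otimes> y) (cd z)"
  proof -
    have "z = z \<bullet> Id (c \<otimes> y)" using z by simp
    also have "\<dots> = tsum (c \<otimes> y) (cd z) (\<lambda>k. z \<bullet> (\<iota> k \<star> Id y) \<bullet> (\<pi> k \<star> Id y)) n"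
      unfolding l by (subst cmp_tsum) (simp_all add: i)
    also have "\<dots> = \<zero> (c \<otimes> y) (cd z)"
      by (rule tsum_zero) (simp_all add: *[THEN cmp_reassoc] i)
    finally show ?thesis .
  qed
  show "z = \<zero> (y \<otimes> c) (cd z)"
    if [simp]: "dm z = y \<otimes> c" and *: "\<And>k. k < n \<Longrightarrow> z \<bullet> (Id y \<star> \<iota> k) = \<zero> (y \<otimes> X k) (cd z)"
  proof -
    have "z = z \<bullet> Id (y \<otimes> c)" using z by simp
    also have "\<dots> = tsum (y \<otimes> c) (cd z) (\<lambda>k. z \<bullet> (Id y \<star> \<iota> k) \<bullet> (Id y \<star> \<pi> k)) n"
      unfolding r by (subst cmp_tsum) (simp_all add: i)
    also have "\<dots> = \<zero> (y \<otimes> c) (cd z)"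
      by (rule tsum_zero) (simp_all add: *[THEN cmp_reassoc] i)
    finally show ?thesis .
  qed
  show "z = \<zero> (dm z) (c \<otimes> y)"
    if [simp]: "cd z = c \<otimes> y" and *: "\<And>k. k < n \<Longrightarrow> (\<pi> k \<star> Id y) \<bullet> z = \<zero> (dm z) (X k \<otimes> y)"
  proof -
    have "z = Id (c \<otimes> y) \<bullet> z" using z by simp
    also have "\<dots> = tsum (dm z) (c \<otimes> y) (\<lambda>k. (\<iota> k \<star> Id y) \<bullet> (\<pi> k \<star> Id y) \<bullet> z) n"
      unfolding l by (subst cmp_tsum) (simp_all add: i)
    also have "\<dots> = \<zero> (dm z) (c \<otimes> y)"
      by (rule tsum_zero) (simp_all add: * i)
    finally show ?thesis .
  qed
  show "z = \<zero> (dm z) (y \<otimes> c)"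
    if [simp]: "cd z = y \<otimes> c" and *: "\<And>k. k < n \<Longrightarrow> (Id y \<star> \<pi> k) \<bullet> z = \<zero> (dm z) (y \<otimes> X k)"
  proof -
    have "z = Id (y \<otimes> c) \<bullet> z" using z by simp
    also have "\<dots> = tsum (dm z) (y \<otimes> c) (\<lambda>k. (Id y \<star> \<iota> k) \<bullet> (Id y \<star> \<pi> k) \<bullet> z) n"
      unfolding r by (subst cmp_tsum) (simp_all add: i)
    also have "\<dots> = \<zero> (dm z) (y \<otimes> c)"
      by (rule tsum_zero) (simp_all add: * i)
    finally show ?thesis .
  qed
qed

text \<open>A product of n + 1 factors of positive degree has no component in degrees up to n. The
  grading enters only through its projections \<open>E k\<close>, so the statement also covers the
  dual algebra.\<close>

lemma (in augmented_algebra) graded_imp_nilpotent_aug: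
  assumes E: "\<And>k. k < N \<Longrightarrow> hom B B (E k)" and sum: "tsum B B E N = Id B"
    and graded: "\<And>i j k. i < N \<Longrightarrow> j < N \<Longrightarrow> k < N \<Longrightarrow> k \<noteq> i + j \<Longrightarrow>
      E k \<bullet> m \<bullet> (E i \<star> E j) = \<zero> (B \<otimes> B) B"
    and aug0: "E 0 \<bullet> aug = \<zero> B B"
  shows "mpow m aug N = \<zero> (tensor_power C B N) B"
proof -
  have [simp]: "arr (E k)" "dm (E k) = B" "cd (E k) = B" if "k < N" for k
    using E[OF that] by (simp_all add: hom_def)
  let ?M = "mpow m aug"
  have expand: "x = tsum (dm x) B (\<lambda>k. E k \<bullet> x) N" if "arr x" "cd x = B" for x
  proof -
    have "x = tsum B B E N \<bullet> x" using sum that by simp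
    also have "\<dots> = tsum (dm x) B (\<lambda>k. E k \<bullet> x) N" by (subst cmp_tsum) simp_all
    finally show ?thesis .
  qed
  have "E k \<bullet> ?M n = \<zero> (tensor_power C B n) B" if "k \<le> n" "k < N" for k n
    using that
  proof (induction n arbitrary: k)
    case 0
    thus ?case using aug0 by simp
  next
    case (Suc n)
    have "E k \<bullet> m \<bullet> ((E i \<bullet> ?M n) \<star> aug) = \<zero> (tensor_power C B n \<otimes> B) B" if i: "i < N" for i
    proof (cases "i \<le> n")
      case True
      thus ?thesis using Suc.IH[of i] Suc.prems(2) i by simp
    next
      case False
      have "E k \<bullet> m \<bullet> ((E i \<bullet> ?M n) \<star> (E j \<bullet> aug)) = \<zero> (tensor_power C B n \<otimes> B) B" if j: "j < N" for j
      proof (cases "j = 0")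
        case True
        thus ?thesis using aug0 Suc.prems(2) i by simp
      next
        case False
        hence "k \<noteq> i + j" using \<open>\<not> i \<le> n\<close> Suc.prems(1) by simp
        hence "(E k \<bullet> m \<bullet> (E i \<star> E j)) \<bullet> (?M n \<star> aug) = \<zero> (tensor_power C B n \<otimes> B) B"
          using graded[of i j k] i j Suc.prems(2) by simp
        thus ?thesis using i j by (simp add: merge)
      qed
      moreover have "E k \<bullet> m \<bullet> ((E i \<bullet> ?M n) \<star> aug) =
          tsum (tensor_power C B n \<otimes> B) B (\<lambda>j. E k \<bullet> m \<bullet> ((E i \<bullet> ?M n) \<star> (E j \<bullet> aug))) N"
      proof -
        have "E k \<bullet> m \<bullet> ((E i \<bullet> ?M n) \<star> aug) = E k \<bullet> m \<bullet> ((E i \<bullet> ?M n) \<star> tsum B B (\<lambda>j. E j \<bullet> aug) N)"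
          using expand[of aug] by simp
        also have "\<dots> = tsum (tensor_power C B n \<otimes> B) B (\<lambda>j. E k \<bullet> m \<bullet> ((E i \<bullet> ?M n) \<star> (E j \<bullet> aug))) N"
          using i Suc.prems(2) by (simp add: tns_tsum cmp_tsum)
        finally show ?thesis .
      qed
      ultimately show ?thesis by (simp add: tsum_zero)
    qed
    moreover have "E k \<bullet> ?M (Suc n) =
        tsum (tensor_power C B n \<otimes> B) B (\<lambda>i. E k \<bullet> m \<bullet> ((E i \<bullet> ?M n) \<star> aug)) N"
    proof -
      have "E k \<bullet> ?M (Suc n) = E k \<bullet> m \<bullet> (tsum (tensor_power C B n) B (\<lambda>j. E j \<bullet> ?M n) N \<star> aug)"
        using expand[of "?M n"] by simp
      also have "\<dots> = tsum (tensor_power C B n \<otimes> B) B (\<lambda>i. E k \<bullet> m \<bullet> ((E i \<bullet> ?M n) \<star> aug)) N"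
        using Suc.prems(2) by (simp add: tns_tsum cmp_tsum)
      finally show ?thesis .
    qed
    ultimately show ?case by (simp add: tsum_zero)
  qed
  thus ?thesis using expand[of "?M N"] by (simp add: tsum_zero)
qed

text \<open>The inclusions and projections exist in all degrees, with zero objects from
  \<open>N\<close> on. So the grading conditions can be stated without bounds.\<close>

locale nichols = hopf C B m u \<epsilon> \<Delta> S
  for C :: "('o, 'm, 'k::{alg_closed_field, field_char_0}) bcat" (structure) and B m u \<epsilon> \<Delta> S +
  fixes V :: 'o and X :: "nat \<Rightarrow> 'o" and \<iota> \<pi> :: "nat \<Rightarrow> 'm" and N :: nat
  assumes \<iota>_hom: "hom (X n) B (\<iota> n)" and \<pi>_hom: "hom B (X n) (\<pi> n)"
    and ds: "direct_sum C B N X \<iota> \<pi>" and X_zero: "n \<ge> N \<Longrightarrow> zero_ob C (X n)"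
    and gr_m: "k \<noteq> a + b \<Longrightarrow> \<pi> k \<bullet> m \<bullet> (\<iota> a \<star> \<iota> b) = \<zero> (X a \<otimes> X b) (X k)"
    and gr_u: "k \<noteq> 0 \<Longrightarrow> \<pi> k \<bullet> u = \<zero> \<one> (X k)"
    and gr_\<Delta>: "k \<noteq> a + b \<Longrightarrow> (\<pi> a \<star> \<pi> b) \<bullet> \<Delta> \<bullet> \<iota> k = \<zero> (X k) (X a \<otimes> X b)"
    and gr_\<epsilon>: "k \<noteq> 0 \<Longrightarrow> \<epsilon> \<bullet> \<iota> k = \<zero> (X k) \<one>"
    and X0: "X 0 = \<one>" and X1: "X 1 = V"
    and gen: "generated_by C B m u V (\<iota> 1)"
    and ker: "kernel C V (\<iota> 1) B (B \<otimes> B) prm"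
begin

lemma \<iota>\<pi>_simps [simp]: "arr (\<iota> n)" "dm (\<iota> n) = X n" "cd (\<iota> n) = B" "arr (\<pi> n)" "dm (\<pi> n) = B" "cd (\<pi> n) = X n"
  using \<iota>_hom \<pi>_hom by (simp_all add: hom_def)

lemma X_Ob [simp]: "X n \<in> Ob"
  using dm_Ob[of "\<iota> n"] by simp

lemma V_Ob [simp]: "V \<in> Ob"
  using X_Ob[of 1] unfolding X1 .

lemmas X_units [simp] = X0 X1

declare One_nat_def [simp del]

lemma \<pi>\<iota>: "\<pi> k \<bullet> \<iota> l = (if k = l then Id (X k) else \<zero> (X l) (X k))"
proof (cases "k < N \<and> l < N")
  case True
  thus ?thesis using direct_sum_tot(4)[OF ds] by simp
next
  case False
  hence "zero_ob C (X k) \<or> zero_ob C (X l)" using X_zero by auto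
  hence "\<pi> k \<bullet> \<iota> l = \<zero> (X l) (X k)"
    using zero_ob_zero[of "X k" "\<pi> k \<bullet> \<iota> l"] zero_ob_zero[of "X l" "\<pi> k \<bullet> \<iota> l"] by auto
  moreover have "Id (X k) = \<zero> (X k) (X k)" if "k = l"
    using that False X_zero by (auto simp: zero_ob_iff)
  ultimately show ?thesis by auto
qed

lemma \<pi>\<iota>' [simp]: "arr x \<Longrightarrow> cd x = X l \<Longrightarrow> \<pi> k \<bullet> \<iota> l \<bullet> x = (if k = l then x else \<zero> (dm x) (X k))"
  using \<pi>\<iota>[THEN cmp_reassoc, of k l x] by auto

lemmas [simp] = \<pi>\<iota>

text \<open>\<open>u\<close> and \<open>\<epsilon>\<close> are concentrated in degree 0, where the
  component is \<open>\<one>\<close>. There they are inverse to each other, since a one-sided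
  inverse of an endomorphism is two-sided.\<close>

lemma unit_counit: "u \<bullet> \<epsilon> = \<iota> 0 \<bullet> \<pi> 0"
proof -
  have u: "u = \<iota> 0 \<bullet> \<pi> 0 \<bullet> u"
    by (rule direct_sum_eqI(2)[OF ds]) (auto simp: gr_u)
  have \<epsilon>: "\<epsilon> = \<epsilon> \<bullet> \<iota> 0 \<bullet> \<pi> 0"
    by (rule direct_sum_eqI(1)[OF ds]) (auto simp: gr_\<epsilon>)
  have "(\<epsilon> \<bullet> \<iota> 0) \<bullet> (\<pi> 0 \<bullet> u) = Id \<one>" using u by simp
  hence "(\<pi> 0 \<bullet> u) \<bullet> (\<epsilon> \<bullet> \<iota> 0) = Id \<one>"
    by (rule left_inverse_imp_right_inverse[rotated 2]) (simp_all add: hom_def)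
  hence *: "\<pi> 0 \<bullet> u \<bullet> \<epsilon> \<bullet> \<iota> 0 = Id \<one>" by simp
  have "u \<bullet> \<epsilon> = (\<iota> 0 \<bullet> \<pi> 0 \<bullet> u) \<bullet> (\<epsilon> \<bullet> \<iota> 0 \<bullet> \<pi> 0)"
    unfolding u[symmetric] \<epsilon>[symmetric] ..
  also have "\<dots> = \<iota> 0 \<bullet> (\<pi> 0 \<bullet> u \<bullet> \<epsilon> \<bullet> \<iota> 0) \<bullet> \<pi> 0" by (simp del: \<pi>\<iota>)
  also have "\<dots> = \<iota> 0 \<bullet> \<pi> 0" unfolding * by simp
  finally show ?thesis .
qed

lemma \<pi>0_unit_counit: "\<pi> 0 \<bullet> u \<bullet> \<epsilon> = \<pi> 0"
  by (simp add: unit_counit)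

lemma \<pi>_aug: "\<pi> k \<bullet> aug = (if k = 0 then \<zero> B \<one> else \<pi> k)"
  by (simp add: aug_def distribs unit_counit)

lemma aug_\<iota>: "aug \<bullet> \<iota> k = (if k = 0 then \<zero> \<one> B else \<iota> k)"
  by (simp add: aug_def distribs unit_counit)

text \<open>Two factors of positive degree have a product of degree at least 2.\<close>

lemma \<pi>1_m2: "\<pi> 1 \<bullet> m2 = \<zero> (B \<otimes> B) V"
proof -
  have 1: "\<pi> 1 \<bullet> m2 \<bullet> (\<iota> a \<star> \<iota> b) = \<zero> (X a \<otimes> X b) V" for a b
    using gr_m[of 1 a b] by (cases "a = 0"; cases "b = 0") (auto simp: m2_def merge aug_\<iota>)
  have "\<pi> 1 \<bullet> m2 \<bullet> (\<iota> a \<star> Id B) = \<zero> (X a \<otimes> B) V" for a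
    using direct_sum_tns_zeroI(2)[OF ds, of "\<pi> 1 \<bullet> m2 \<bullet> (\<iota> a \<star> Id B)" "X a"] 1[of a] by (simp add: merge)
  thus ?thesis
    using direct_sum_tns_zeroI(1)[OF ds, of "\<pi> 1 \<bullet> m2" B] by simp
qed

lemma prm_\<iota>1: "prm \<bullet> \<iota> 1 = \<zero> V (B \<otimes> B)"
  using kernelD(3)[OF ker] .

sublocale hopf_primitive C B m u \<epsilon> \<Delta> S V "\<iota> 1" "\<pi> 1"
proof unfold_locales
  show "hom V B (\<iota> 1)" "hom B V (\<pi> 1)" using \<iota>_hom[of 1] \<pi>_hom[of 1] by simp_all
  show "\<pi> 1 \<bullet> u = \<zero> \<one> V" using gr_u[of 1] by simp
  show "\<pi> 1 \<bullet> \<iota> 1 = Id V" by simp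
qed (fact prm_\<iota>1 \<pi>1_m2)+

text \<open>The unit, V and J^2 together form a subalgebra containing V, so it is everything. The
  map \<open>a\<close> chooses preimages in J^2 and is normalised to vanish on the unit and on
  V.\<close>

lemma generation:
  obtains a where "hom B (B \<otimes> B) a" "aug = \<iota> 1 \<bullet> \<pi> 1 \<uplus> m2 \<bullet> a" "a \<bullet> u = \<zero> \<one> (B \<otimes> B)"
    "a \<bullet> \<iota> 1 = \<zero> V (B \<otimes> B)"
proof -
  obtain r where r: "hom B (B \<otimes> B) r" "m2 \<bullet> r \<bullet> m2 = m2" using pseudo_inverse[of m2] by auto
  have [simp]: "arr r" "dm r = B" "cd r = B \<otimes> B" using r(1) by (simp_all add: hom_def)
  \<comment> \<open>\<open>e\<close> removes degrees 0 and 1 and fixes J^2. Applying it before the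
    pseudo-inverse \<open>r\<close> gives the normalisation of \<open>a\<close>.\<close>
  define e where "e = aug \<uplus> \<ominus> (\<iota> 1 \<bullet> \<pi> 1)"
  let ?a = "r \<bullet> e"
  have [simp]: "arr e" "dm e = B" "cd e = B" by (simp_all add: e_def)
  \<comment> \<open>The projection onto the span of the unit, V and J^2; the claim is that
    \<open>E\<close> is the identity.\<close>
  define E where "E = u \<bullet> \<epsilon> \<uplus> (\<iota> 1 \<bullet> \<pi> 1 \<uplus> m2 \<bullet> ?a)"
  have [simp]: "arr E" "dm E = B" "cd E = B" by (simp_all add: E_def)
  have eu: "e \<bullet> u = \<zero> \<one> B" and ei: "e \<bullet> \<iota> 1 = \<zero> V B" and em: "e \<bullet> m2 = m2"
    by (simp_all add: e_def distribs aug_\<iota>)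
  have Eu: "E \<bullet> u = u" unfolding E_def using eu by (simp add: distribs)
  have Ei: "E \<bullet> \<iota> 1 = \<iota> 1" unfolding E_def using ei by (simp add: distribs)
  have Em: "E \<bullet> m2 = m2" unfolding E_def using em r(2) by (simp add: distribs)
  have EE: "E \<bullet> E = E"
  proof -
    have "E \<bullet> E = (E \<bullet> u) \<bullet> \<epsilon> \<uplus> ((E \<bullet> \<iota> 1) \<bullet> \<pi> 1 \<uplus> (E \<bullet> m2) \<bullet> ?a)"
      by (subst (2) E_def) (simp add: cmp_add_right)
    thus ?thesis unfolding Eu Ei Em E_def[symmetric] .
  qed
  obtain x j where k: "kernel C x j B B (Id B \<uplus> \<ominus> E)"
    using kernel_exists[of "Id B \<uplus> \<ominus> E" B B] by (auto simp: Hom_iff)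
  note kd = kernelD[OF k]
  have [simp]: "arr j" "dm j = x" "cd j = B" using kd(1) by (simp_all add: hom_def)
  have [simp]: "x \<in> Ob" using dm_Ob[of j] by simp
  have "j \<uplus> \<ominus> (E \<bullet> j) = \<zero> x B" using kd(3) by (simp add: distribs)
  hence Ej: "E \<bullet> j = j" by (rule eq_if_diff_zero[symmetric]) simp_all
  have fac: "\<exists>h\<in>Hom y x. f = j \<cdot> h" if f: "hom y B f" "E \<bullet> f = f" for f y
  proof -
    have "(Id B \<uplus> \<ominus> E) \<bullet> f = \<zero> (dm f) B" using f by (simp add: distribs hom_def)
    then obtain h where "hom (dm f) x h" "j \<bullet> h = f" using kd(4)[of f] f by (auto simp: hom_def)
    thus ?thesis using f by (intro bexI[of _ h]) (auto simp: Hom_hom hom_def tot)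
  qed
  have "subalgebra C B m u x j"
    unfolding subalgebra_def
  proof (intro conjI)
    show "mono_arr C x B j" by (rule kd(5))
    show "\<exists>h\<in>Hom \<one> x. u = j \<cdot> h" by (rule fac) (simp_all add: u_hom Eu)
    \<comment> \<open>To see that the image of \<open>E\<close> is closed under products, each
      factor is split into augmentation part and scalar part. A scalar times a factor stays in the
      image, and the rest lies in J^2.\<close>
    have 1: "m \<bullet> ((u \<bullet> \<epsilon> \<bullet> j) \<star> j) = j \<bullet> \<ll> x \<bullet> ((\<epsilon> \<bullet> j) \<star> Id x)"
    proof -
      have "m \<bullet> ((u \<bullet> \<epsilon> \<bullet> j) \<star> j) = m \<bullet> (u \<star> Id B) \<bullet> (Id \<one> \<star> j) \<bullet> ((\<epsilon> \<bullet> j) \<star> Id x)" by (simp add: merge)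
      thus ?thesis using m_unit_left[THEN cmp_reassoc, of "(Id \<one> \<star> j) \<bullet> ((\<epsilon> \<bullet> j) \<star> Id x)"]
        l_nat'[of j B "(\<epsilon> \<bullet> j) \<star> Id x"] by simp
    qed
    have 2: "m \<bullet> ((aug \<bullet> j) \<star> (u \<bullet> \<epsilon> \<bullet> j)) = aug \<bullet> j \<bullet> \<rr> x \<bullet> (Id x \<star> (\<epsilon> \<bullet> j))"
    proof -
      have "m \<bullet> ((aug \<bullet> j) \<star> (u \<bullet> \<epsilon> \<bullet> j)) = m \<bullet> (Id B \<star> u) \<bullet> ((aug \<bullet> j) \<star> Id \<one>) \<bullet> (Id x \<star> (\<epsilon> \<bullet> j))" by (simp add: merge)
      thus ?thesis using m_unit_right[THEN cmp_reassoc, of "((aug \<bullet> j) \<star> Id \<one>) \<bullet> (Id x \<star> (\<epsilon> \<bullet> j))"]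
        r_nat'[of "aug \<bullet> j" B "Id x \<star> (\<epsilon> \<bullet> j)"] by simp
    qed
    have j: "j = aug \<bullet> j \<uplus> u \<bullet> \<epsilon> \<bullet> j"
      using arg_cong[OF Id_aug, of "\<lambda>z. z \<bullet> j"] by (simp add: cmp_add_left)
    have "m \<bullet> (j \<star> j) = m \<bullet> ((u \<bullet> \<epsilon> \<bullet> j) \<star> j) \<uplus> (m \<bullet> ((aug \<bullet> j) \<star> (u \<bullet> \<epsilon> \<bullet> j)) \<uplus> m \<bullet> ((aug \<bullet> j) \<star> (aug \<bullet> j)))"
    proof -
      have "m \<bullet> (j \<star> j) = m \<bullet> ((aug \<bullet> j \<uplus> u \<bullet> \<epsilon> \<bullet> j) \<star> j)" unfolding j[symmetric] ..
      also have "\<dots> = m \<bullet> ((u \<bullet> \<epsilon> \<bullet> j) \<star> j) \<uplus> m \<bullet> ((aug \<bullet> j) \<star> j)" by (simp add: distribs add_commute')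
      also have "m \<bullet> ((aug \<bullet> j) \<star> j) = m \<bullet> ((aug \<bullet> j) \<star> (aug \<bullet> j \<uplus> u \<bullet> \<epsilon> \<bullet> j))" unfolding j[symmetric] ..
      also have "\<dots> = m \<bullet> ((aug \<bullet> j) \<star> (u \<bullet> \<epsilon> \<bullet> j)) \<uplus> m \<bullet> ((aug \<bullet> j) \<star> (aug \<bullet> j))" by (simp add: distribs add_commute')
      finally show ?thesis .
    qed
    also have "m \<bullet> ((aug \<bullet> j) \<star> (aug \<bullet> j)) = m2 \<bullet> (j \<star> j)" by (simp add: m2_def merge)
    also note 1
    also note 2
    finally have mj: "m \<bullet> (j \<star> j) = j \<bullet> \<ll> x \<bullet> ((\<epsilon> \<bullet> j) \<star> Id x) \<uplus> (aug \<bullet> j \<bullet> \<rr> x \<bullet> (Id x \<star> (\<epsilon> \<bullet> j)) \<uplus> m2 \<bullet> (j \<star> j))" .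
    have Ea: "E \<bullet> aug \<bullet> j = aug \<bullet> j"
      using Eu[THEN cmp_reassoc] by (simp add: aug_def distribs Ej)
    have "E \<bullet> m \<bullet> (j \<star> j) = m \<bullet> (j \<star> j)"
      unfolding mj by (simp add: distribs Ej[THEN cmp_reassoc] Em[THEN cmp_reassoc]
        Ea[unfolded cmp_assoc[symmetric], THEN cmp_reassoc, simplified])
    hence "\<exists>h\<in>Hom (x \<otimes> x) x. m \<bullet> (j \<star> j) = j \<cdot> h" by (intro fac) (simp_all add: hom_def)
    thus "\<exists>h\<in>Hom (x \<otimes> x) x. m \<cdot> (j \<otimes>\<^sub>m j) = j \<cdot> h" by (simp add: tot)
  qed
  moreover have "\<exists>h\<in>Hom V x. \<iota> 1 = j \<cdot> h" by (rule fac) (use \<iota>_hom[of 1] Ei in simp_all)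
  ultimately have "iso C x B j" using gen unfolding generated_by_def by blast
  then obtain k where k: "hom B x k" "j \<bullet> k = Id B" by (auto simp: iso_def inverse_arrows_tot hom_def)
  have "E = E \<bullet> j \<bullet> k" using k(2) by simp
  also have "\<dots> = Id B" using Ej[THEN cmp_reassoc, of k] k(2) by simp
  finally have "u \<bullet> \<epsilon> \<uplus> (\<iota> 1 \<bullet> \<pi> 1 \<uplus> m2 \<bullet> ?a) = u \<bullet> \<epsilon> \<uplus> aug"
    unfolding E_def Id_aug by (simp add: add_commute')
  hence "\<iota> 1 \<bullet> \<pi> 1 \<uplus> m2 \<bullet> ?a = aug" by (rule add_left_imp_eq) simp_all
  thus ?thesis using that[of ?a] eu ei by (simp add: hom_def)
qed

lemma nilpotent_aug: "mpow m aug N = \<zero> (tensor_power C B N) B"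
proof (rule graded_imp_nilpotent_aug[of N "\<lambda>k. \<iota> k \<bullet> \<pi> k"])
  show "tsum B B (\<lambda>k. \<iota> k \<bullet> \<pi> k) N = Id B" by (rule direct_sum_tot(5)[OF ds])
  fix a b k :: nat assume "k \<noteq> a + b"
  hence z: "\<pi> k \<bullet> m \<bullet> (\<iota> a \<star> \<iota> b) = \<zero> (X a \<otimes> X b) (X k)" by (rule gr_m)
  have "(\<iota> k \<bullet> \<pi> k) \<bullet> m \<bullet> ((\<iota> a \<bullet> \<pi> a) \<star> (\<iota> b \<bullet> \<pi> b)) =
      \<iota> k \<bullet> (\<pi> k \<bullet> m \<bullet> (\<iota> a \<star> \<iota> b)) \<bullet> (\<pi> a \<star> \<pi> b)" by (simp add: merge)
  thus "(\<iota> k \<bullet> \<pi> k) \<bullet> m \<bullet> ((\<iota> a \<bullet> \<pi> a) \<star> (\<iota> b \<bullet> \<pi> b)) = \<zero> (B \<otimes> B) B" unfolding z by simp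
qed (simp_all add: hom_def \<pi>_aug)

lemma connected: "connected_algebra C B m u"
  by (rule connected_if_nilpotent_aug[OF nilpotent_aug])

text \<open>As the kernel of \<open>prm\<close> is exactly V, \<open>prm\<close> can be inverted
  from the left on the complement of V. The map \<open>b\<close> turns statements about primitives
  into statements about endomorphisms of B.\<close>

lemma primitive_retract:
  obtains b where "hom (B \<otimes> B) B b" "b \<bullet> prm = Id B \<uplus> \<ominus> (\<iota> 1 \<bullet> \<pi> 1)"
proof -
  obtain g where g: "hom (B \<otimes> B) B g" "prm \<bullet> g \<bullet> prm = prm" using pseudo_inverse[of prm] by auto
  have [simp]: "arr g" "dm g = B \<otimes> B" "cd g = B" using g(1) by (simp_all add: hom_def)
  obtain c where c: "hom B V c" "\<iota> 1 \<bullet> c = Id B \<uplus> \<ominus> (g \<bullet> prm)"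
    using kernelD(4)[OF ker, of "Id B \<uplus> \<ominus> (g \<bullet> prm)"] g(2) by (auto simp: distribs)
  have [simp]: "arr c" "dm c = B" "cd c = V" using c(1) by (simp_all add: hom_def)
  let ?e = "Id B \<uplus> \<ominus> (\<iota> 1 \<bullet> \<pi> 1)"
  have "?e \<bullet> (Id B \<uplus> \<ominus> (g \<bullet> prm)) = \<zero> B B" unfolding c(2)[symmetric] by (simp add: distribs)
  hence "?e \<uplus> \<ominus> (?e \<bullet> g \<bullet> prm) = \<zero> B B" by (simp add: cmp_add_right)
  hence "?e = ?e \<bullet> g \<bullet> prm" by (rule eq_if_diff_zero) simp_all
  thus ?thesis using that[of "?e \<bullet> g"] by (simp add: hom_def)
qed

lemma \<Delta>_component: "(\<pi> a \<star> \<pi> b) \<bullet> \<Delta> \<bullet> \<iota> (a + b) \<bullet> \<pi> (a + b) = (\<pi> a \<star> \<pi> b) \<bullet> \<Delta>"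
  by (rule direct_sum_eqI(1)[OF ds]) (auto simp: gr_\<Delta>)

lemma \<Delta>_component': "arr x \<Longrightarrow> cd x = B \<Longrightarrow> (\<pi> a \<star> \<pi> b) \<bullet> \<Delta> \<bullet> \<iota> (a + b) \<bullet> \<pi> (a + b) \<bullet> x = (\<pi> a \<star> \<pi> b) \<bullet> \<Delta> \<bullet> x"
  using arg_cong[OF \<Delta>_component[of a b], of "\<lambda>y. y \<bullet> x"] by simp

lemma \<Delta>_component_Suc: "arr x \<Longrightarrow> cd x = B \<Longrightarrow> (\<pi> a \<star> \<pi> 1) \<bullet> \<Delta> \<bullet> \<iota> (Suc a) \<bullet> \<pi> (Suc a) \<bullet> x = (\<pi> a \<star> \<pi> 1) \<bullet> \<Delta> \<bullet> x"
  using \<Delta>_component'[of x a 1] by (simp only: Suc_eq_plus1)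

text \<open>In degree 0 the projection is \<open>\<pi> 0 \<bullet> u \<bullet> \<epsilon>\<close>,
  so the counit law determines this component of \<open>\<Delta>\<close>.\<close>

lemma \<Delta>_left_zero:
  assumes "arr x" "cd x = B"
  shows "(\<pi> 0 \<star> \<pi> b) \<bullet> \<Delta> \<bullet> x = ((\<pi> 0 \<bullet> u) \<star> (\<pi> b \<bullet> x)) \<bullet> li (dm x)"
proof -
  have "(\<pi> 0 \<star> \<pi> b) \<bullet> \<Delta> \<bullet> x = ((\<pi> 0 \<bullet> u) \<star> \<pi> b) \<bullet> (\<epsilon> \<star> Id B) \<bullet> \<Delta> \<bullet> x"
    by (simp add: merge \<pi>0_unit_counit)
  also have "\<dots> = ((\<pi> 0 \<bullet> u) \<star> \<pi> b) \<bullet> li B \<bullet> x" using counit_li[THEN cmp_reassoc, of x] by simp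
  finally show ?thesis using assms by (simp add: li_nat merge)
qed

lemma \<Delta>_right_zero:
  assumes "arr x" "cd x = B"
  shows "(\<pi> a \<star> \<pi> 0) \<bullet> \<Delta> \<bullet> x = ((\<pi> a \<bullet> x) \<star> (\<pi> 0 \<bullet> u)) \<bullet> ri (dm x)"
proof -
  have "(\<pi> a \<star> \<pi> 0) \<bullet> \<Delta> \<bullet> x = (\<pi> a \<star> (\<pi> 0 \<bullet> u)) \<bullet> (Id B \<star> \<epsilon>) \<bullet> \<Delta> \<bullet> x"
    by (simp add: merge \<pi>0_unit_counit)
  also have "\<dots> = (\<pi> a \<star> (\<pi> 0 \<bullet> u)) \<bullet> ri B \<bullet> x" using counit_ri[THEN cmp_reassoc, of x] by simp
  finally show ?thesis using assms by (simp add: ri_nat merge)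
qed

text \<open>The characteristic property of Nichols algebras: the component of
  \<open>\<Delta>\<close> of bidegree (n, 1) is injective in degree n + 1. An element of its kernel
  has all inner components zero by coassociativity and induction; it is then primitive of degree
  above 1, hence zero.\<close>

lemma \<Delta>_last_mono:
  assumes "arr y" "cd y = X (Suc n)" "(\<pi> n \<star> \<pi> 1) \<bullet> \<Delta> \<bullet> \<iota> (Suc n) \<bullet> y = \<zero> (dm y) (X n \<otimes> V)"
  shows "y = \<zero> (dm y) (X (Suc n))"
  using assms
proof (induction n arbitrary: y rule: less_induct)
  case (less n)
  note [simp] = less.prems(1,2)
  have [simp]: "X (Suc 0) = V" using X1 by (simp add: One_nat_def)
  let ?x = "\<iota> (Suc n) \<bullet> y"
  show ?case
  proof (cases "n = 0")
    case True
    \<comment> \<open>For \<open>n\<close> = 0 the component is \<open>li V\<close> up to the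
      invertible factor \<open>\<pi> 0 \<bullet> u\<close>.\<close>
    have "(\<epsilon> \<bullet> \<iota> 0) \<bullet> (\<pi> 0 \<bullet> u) = Id \<one>"
      using \<epsilon>_u unit_counit \<pi>0_unit_counit by (metis cmp_Id(2) cmp_assoc structure_simps(4,5) unit_counit \<epsilon>_u')
    hence eu: "\<epsilon> \<bullet> \<iota> 0 \<bullet> \<pi> 0 \<bullet> u = Id \<one>" by simp
    have "((\<pi> 0 \<bullet> u) \<star> y) \<bullet> li (dm y) = \<zero> (dm y) (\<one> \<otimes> V)"
      using less.prems(3) \<Delta>_left_zero[of ?x 1] True by simp
    hence "((\<epsilon> \<bullet> \<iota> 0) \<star> Id V) \<bullet> ((\<pi> 0 \<bullet> u) \<star> y) \<bullet> li (dm y) = \<zero> (dm y) (\<one> \<otimes> V)" by simp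
    hence "(Id \<one> \<star> y) \<bullet> li (dm y) = \<zero> (dm y) (\<one> \<otimes> V)" using True by (simp add: merge eu)
    hence "li V \<bullet> y = li V \<bullet> \<zero> (dm y) V" using li_nat[of y V] True by simp
    hence "y = \<zero> (dm y) V" by (rule left_cancel[where k' = "\<ll> V"]) (use True in simp_all)
    thus ?thesis using True by simp
  next
    case False
    have inner: "(\<pi> a \<star> \<pi> (Suc b)) \<bullet> \<Delta> \<bullet> ?x = \<zero> (dm y) (X a \<otimes> X (Suc b))" if ab: "a + b = n" "b < n" for a b
    proof -
      let ?D = "(\<pi> b \<star> \<pi> 1) \<bullet> \<Delta> \<bullet> \<iota> (Suc b)"
      have "g = \<zero> (dm ?D) (dm ?D)" if "hom (dm ?D) (dm ?D) g" "?D \<bullet> g = \<zero> (dm ?D) (cd ?D)" for g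
        using less.IH[OF ab(2), of g] that by (simp add: hom_def)
      \<comment> \<open>By induction the component of bidegree (b, 1) is injective, so it has a
        retraction \<open>r\<close>. Vanishing can then be tested after applying it, where
        coassociativity brings in the component (n, 1).\<close>
      from mono_split[OF _ this]
      obtain r where "hom (cd ?D) (dm ?D) r" "r \<bullet> ?D = Id (dm ?D)" by auto
      hence r: "hom (X b \<otimes> V) (X (Suc b)) r" "r \<bullet> ?D = Id (X (Suc b))" by simp_all
      have "(Id (X a) \<star> ?D) \<bullet> (\<pi> a \<star> \<pi> (Suc b)) \<bullet> \<Delta> \<bullet> ?x
          = (\<pi> a \<star> ((\<pi> b \<star> \<pi> 1) \<bullet> \<Delta>)) \<bullet> \<Delta> \<bullet> ?x"
        using \<Delta>_component_Suc[of "Id B" b] by (simp add: merge)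
      also have "\<dots> = (\<pi> a \<star> (\<pi> b \<star> \<pi> 1)) \<bullet> ((Id B \<star> \<Delta>) \<bullet> \<Delta>) \<bullet> ?x" by (simp add: merge)
      also have "\<dots> = (\<pi> a \<star> (\<pi> b \<star> \<pi> 1)) \<bullet> \<alpha> B B B \<bullet> (\<Delta> \<star> Id B) \<bullet> \<Delta> \<bullet> ?x"
        unfolding coassoc[symmetric] by simp
      also have "\<dots> = \<alpha> (X a) (X b) V \<bullet> ((\<pi> a \<star> \<pi> b) \<star> \<pi> 1) \<bullet> (\<Delta> \<star> Id B) \<bullet> \<Delta> \<bullet> ?x"
        using \<alpha>_nat'[of "\<pi> a" "\<pi> b" "\<pi> 1" "X a" "X b" V "(\<Delta> \<star> Id B) \<bullet> \<Delta> \<bullet> ?x"] by simp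
      also have "\<dots> = \<alpha> (X a) (X b) V \<bullet> (((\<pi> a \<star> \<pi> b) \<bullet> \<Delta>) \<star> \<pi> 1) \<bullet> \<Delta> \<bullet> ?x" by (simp add: merge)
      also have "\<dots> = \<alpha> (X a) (X b) V \<bullet> (((\<pi> a \<star> \<pi> b) \<bullet> \<Delta> \<bullet> \<iota> n) \<star> Id V) \<bullet> (\<pi> n \<star> \<pi> 1) \<bullet> \<Delta> \<bullet> ?x"
        using \<Delta>_component[of a b] ab(1) by (simp add: merge)
      also have "\<dots> = \<zero> (dm y) (X a \<otimes> (X b \<otimes> V))" using less.prems(3) by simp
      finally have z: "(Id (X a) \<star> ?D) \<bullet> (\<pi> a \<star> \<pi> (Suc b)) \<bullet> \<Delta> \<bullet> ?x = \<zero> (dm y) (X a \<otimes> (X b \<otimes> V))" .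
      have "(\<pi> a \<star> \<pi> (Suc b)) \<bullet> \<Delta> \<bullet> ?x = (Id (X a) \<star> r) \<bullet> (Id (X a) \<star> ?D) \<bullet> (\<pi> a \<star> \<pi> (Suc b)) \<bullet> \<Delta> \<bullet> ?x"
        using r(1) r(2)[THEN cmp_reassoc, of "\<pi> (Suc b)"] by (simp add: merge hom_def)
      also have "\<dots> = \<zero> (dm y) (X a \<otimes> X (Suc b))" unfolding z using r(1) by (simp add: hom_def)
      finally show ?thesis .
    qed
    have "(\<pi> a \<star> \<pi> b) \<bullet> prm \<bullet> ?x = \<zero> (dm y) (X a \<otimes> X b)" for a b
    proof -
      have "(\<pi> a \<star> \<pi> b) \<bullet> prm \<bullet> ?x = ((\<pi> a \<star> \<pi> b) \<bullet> \<Delta> \<bullet> ?x \<uplus> \<ominus> (((\<pi> a \<bullet> u) \<star> (\<pi> b \<bullet> ?x)) \<bullet> li (dm y)))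
          \<uplus> \<ominus> (((\<pi> a \<bullet> ?x) \<star> (\<pi> b \<bullet> u)) \<bullet> ri (dm y))"
        using prm_cmp[of ?x] by (simp add: distribs merge del: \<pi>\<iota> \<pi>\<iota>')
      \<comment> \<open>Off the degree \<open>Suc n\<close> everything vanishes by grading; for a
        factor of degree 0 the unit term cancels the component of \<open>\<Delta>\<close>; the other
        components are the inner ones.\<close>
      moreover consider "a + b \<noteq> Suc n" | "a = 0" "b = Suc n" | "a = Suc n" "b = 0"
        | b' where "a \<noteq> 0" "b = Suc b'" "a + b' = n" "b' < n"
        by (cases a; cases b) auto
      hence "((\<pi> a \<star> \<pi> b) \<bullet> \<Delta> \<bullet> ?x \<uplus> \<ominus> (((\<pi> a \<bullet> u) \<star> (\<pi> b \<bullet> ?x)) \<bullet> li (dm y)))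
          \<uplus> \<ominus> (((\<pi> a \<bullet> ?x) \<star> (\<pi> b \<bullet> u)) \<bullet> ri (dm y)) = \<zero> (dm y) (X a \<otimes> X b)"
      proof cases
        case 1
        have "(\<pi> a \<star> \<pi> b) \<bullet> \<Delta> \<bullet> ?x = \<zero> (dm y) (X a \<otimes> X b)"
          using gr_\<Delta>[of "Suc n" a b] 1 cmp_assoc[of "(\<pi> a \<star> \<pi> b) \<bullet> \<Delta>" "\<iota> (Suc n)" y, symmetric] by simp
        thus ?thesis using 1 by (cases "a = 0"; cases "b = 0") (auto simp: gr_u)
      next
        case 2
        thus ?thesis using \<Delta>_left_zero[of ?x "Suc n"] by (simp add: gr_u)
      next
        case 3
        thus ?thesis using \<Delta>_right_zero[of ?x "Suc n"] by (simp add: gr_u)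
      next
        case (4 b')
        thus ?thesis using inner[of a b'] by (simp add: gr_u)
      qed
      ultimately show ?thesis by simp
    qed
    hence "(\<pi> a \<star> Id B) \<bullet> prm \<bullet> ?x = \<zero> (dm y) (X a \<otimes> B)" for a
      using direct_sum_tns_zeroI(4)[OF ds, of "(\<pi> a \<star> Id B) \<bullet> prm \<bullet> ?x" "X a"] by (simp add: merge)
    hence "prm \<bullet> ?x = \<zero> (dm y) (B \<otimes> B)"
      using direct_sum_tns_zeroI(3)[OF ds, of "prm \<bullet> ?x" B] by simp
    then obtain c where c: "hom (dm y) V c" "\<iota> 1 \<bullet> c = ?x" using kernelD(4)[OF ker, of ?x] by auto
    \<comment> \<open>A primitive lies in V, that is in degree 1, and so has no component in degree
      \<open>Suc n\<close> when \<open>n \<noteq> 0\<close>.\<close>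
    have "y = \<pi> (Suc n) \<bullet> \<iota> 1 \<bullet> c" unfolding c(2) by simp
    also have "\<dots> = \<zero> (dm y) (X (Suc n))" using False c(1) by (simp add: hom_def)
    finally show ?thesis .
  qed
qed

text \<open>By induction on n, the degree n components of all members of \<open>Q\<close> vanish at
  once: the derivative of x lies in Q \<otimes> V, and its component over degree n determines the
  one of x in degree n + 1.\<close>

lemma cogeneration:
  assumes Q: "\<And>x. Q x \<Longrightarrow> arr x \<and> cd x = B \<and> \<epsilon> \<bullet> x = \<zero> (dm x) \<one> \<and>
        (\<exists>z t. Q z \<and> arr t \<and> cd t = dm z \<otimes> V \<and> der \<bullet> x = (z \<star> Id V) \<bullet> t)" and x: "Q x"
  shows "x = \<zero> (dm x) B"
proof -
  have \<pi>x: "\<pi> n \<bullet> x = \<zero> (dm x) (X n)" if "Q x" for n x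
    using that
  proof (induction n arbitrary: x)
    case 0
    hence *: "\<epsilon> \<bullet> x = \<zero> (dm x) \<one>" using Q by blast
    have "\<pi> 0 \<bullet> x = \<pi> 0 \<bullet> u \<bullet> \<epsilon> \<bullet> x" using \<pi>0_unit_counit by (metis cmp_assoc)
    thus ?case unfolding * by simp
  next
    case (Suc n)
    from Q[OF Suc.prems] obtain z t where z: "Q z" "arr t" "cd t = dm z \<otimes> V" "der \<bullet> x = (z \<star> Id V) \<bullet> t"
      and [simp]: "arr x" "cd x = B" by blast
    have [simp]: "arr z" "cd z = B" using Q[OF z(1)] by blast+
    have dt: "dm t = dm x" using arg_cong[OF z(4), of dm] by simp
    have "(\<pi> n \<star> \<pi> 1) \<bullet> \<Delta> \<bullet> \<iota> (Suc n) \<bullet> \<pi> (Suc n) \<bullet> x = (\<pi> n \<star> \<pi> 1) \<bullet> \<Delta> \<bullet> x"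
      by (rule \<Delta>_component_Suc) simp_all
    also have "\<dots> = (\<pi> n \<star> Id V) \<bullet> der \<bullet> x" by (simp add: der_def merge)
    also have "\<dots> = \<zero> (dm x) (X n \<otimes> V)"
      unfolding z(4) using Suc.IH[OF z(1)] z(2,3) dt by (simp add: merge)
    finally show ?case using \<Delta>_last_mono[of "\<pi> (Suc n) \<bullet> x" n] by simp
  qed
  have [simp]: "arr x" "cd x = B" using Q[OF x] by blast+
  show ?thesis by (rule direct_sum_eqI(2)[OF ds]) (simp_all add: \<pi>x[OF x])
qed

end

section \<open>Duality\<close>

context monoidal_linear_category
begin

lemma pentagon_inv1:
  assumes [simp]: "a \<in> Ob" "b \<in> Ob" "c \<in> Ob" "d \<in> Ob"
  shows "\<alpha> (a \<otimes> b) c d \<bullet> (\<alpha>i a b c \<star> Id d) \<bullet> \<alpha>i a (b \<otimes> c) d = \<alpha>i a b (c \<otimes> d) \<bullet> (Id a \<star> \<alpha> b c d)"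
proof (rule left_cancel[where k = "\<alpha> a b (c \<otimes> d)" and k' = "\<alpha>i a b (c \<otimes> d)"])
  show "\<alpha> a b (c \<otimes> d) \<bullet> \<alpha> (a \<otimes> b) c d \<bullet> (\<alpha>i a b c \<star> Id d) \<bullet> \<alpha>i a (b \<otimes> c) d =
      \<alpha> a b (c \<otimes> d) \<bullet> \<alpha>i a b (c \<otimes> d) \<bullet> (Id a \<star> \<alpha> b c d)"
    by (simp add: pentagon'' merge)
qed simp_all

lemma pentagon_inv2:
  assumes [simp]: "a \<in> Ob" "b \<in> Ob" "c \<in> Ob" "d \<in> Ob"
  shows "(\<alpha> a b c \<star> Id d) \<bullet> \<alpha>i (a \<otimes> b) c d = \<alpha>i a (b \<otimes> c) d \<bullet> (Id a \<star> \<alpha>i b c d) \<bullet> \<alpha> a b (c \<otimes> d)"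
proof (rule left_cancel[where k = "(Id a \<star> \<alpha> b c d) \<bullet> \<alpha> a (b \<otimes> c) d" and k' = "\<alpha>i a (b \<otimes> c) d \<bullet> (Id a \<star> \<alpha>i b c d)"])
  show "((Id a \<star> \<alpha> b c d) \<bullet> \<alpha> a (b \<otimes> c) d) \<bullet> (\<alpha> a b c \<star> Id d) \<bullet> \<alpha>i (a \<otimes> b) c d =
     ((Id a \<star> \<alpha> b c d) \<bullet> \<alpha> a (b \<otimes> c) d) \<bullet> \<alpha>i a (b \<otimes> c) d \<bullet> (Id a \<star> \<alpha>i b c d) \<bullet> \<alpha> a b (c \<otimes> d)"
    using pentagon''[of a b c d "\<alpha>i (a \<otimes> b) c d", symmetric] by (simp add: merge)
qed (simp_all add: merge)

end

locale dual_pair = braided_fusion_category C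
  for C :: "('o, 'm, 'k::{alg_closed_field, field_char_0}) bcat" (structure) +
  fixes d B :: 'o and ev cv :: 'm
  assumes ld: "left_dual C d B ev cv"
begin

lemma dual_simps [simp]:
  "d \<in> Ob" "B \<in> Ob" "arr ev" "dm ev = d \<otimes> B" "cd ev = \<one>" "arr cv" "dm cv = \<one>" "cd cv = B \<otimes> d"
  using ld by (auto simp: left_dual_def Hom_iff)

lemma zigzag: "\<rr> B \<bullet> (Id B \<star> ev) \<bullet> \<alpha> B d B \<bullet> (cv \<star> Id B) = \<ll> B"
  "\<ll> d \<bullet> (ev \<star> Id d) \<bullet> \<alpha>i d B d \<bullet> (Id d \<star> cv) = \<rr> d"
  using ld by (simp_all add: left_dual_def tot)

text \<open>The zigzag identity recovers \<open>x\<close> from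
  \<open>ev \<bullet> (x \<star> Id B)\<close>. Identities in the dual are proved after pairing with
  \<open>B\<close>.\<close>

lemma ev_faithful_left:
  assumes eq: "ev \<bullet> (x \<star> Id B) = ev \<bullet> (y \<star> Id B)" and [simp]: "arr x" "arr y" "cd x = d" "cd y = d" "dm x = dm y"
  shows "x = y"
proof -
  have rec: "z = \<ll> d \<bullet> ((ev \<bullet> (z \<star> Id B)) \<star> Id d) \<bullet> \<alpha>i (dm z) B d \<bullet> (Id (dm z) \<star> cv) \<bullet> ri (dm z)"
    if [simp]: "arr z" "cd z = d" for z
  proof -
    have "z = \<rr> d \<bullet> (z \<star> Id \<one>) \<bullet> ri (dm z)" by (simp add: r_nat')
    also have "\<dots> = \<ll> d \<bullet> (ev \<star> Id d) \<bullet> \<alpha>i d B d \<bullet> (Id d \<star> cv) \<bullet> (z \<star> Id \<one>) \<bullet> ri (dm z)"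
      unfolding zigzag(2)[symmetric] by simp
    also have "\<dots> = \<ll> d \<bullet> (ev \<star> Id d) \<bullet> \<alpha>i d B d \<bullet> (z \<star> (Id B \<star> Id d)) \<bullet> (Id (dm z) \<star> cv) \<bullet> ri (dm z)"
      by (simp add: merge)
    also have "\<dots> = \<ll> d \<bullet> (ev \<star> Id d) \<bullet> ((z \<star> Id B) \<star> Id d) \<bullet> \<alpha>i (dm z) B d \<bullet> (Id (dm z) \<star> cv) \<bullet> ri (dm z)"
      by (simp add: \<alpha>i_nat' del: tns_Id)
    finally show ?thesis by (simp add: merge)
  qed
  show ?thesis using rec[of x] rec[of y] eq by simp
qed

lemma ev_faithful_right:
  assumes eq: "ev \<bullet> (Id d \<star> x) = ev \<bullet> (Id d \<star> y)" and [simp]: "arr x" "arr y" "cd x = B" "cd y = B" "dm x = dm y"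
  shows "x = y"
proof -
  have rec: "z = \<rr> B \<bullet> (Id B \<star> (ev \<bullet> (Id d \<star> z))) \<bullet> \<alpha> B d (dm z) \<bullet> (cv \<star> Id (dm z)) \<bullet> li (dm z)"
    if [simp]: "arr z" "cd z = B" for z
  proof -
    have "z = \<ll> B \<bullet> (Id \<one> \<star> z) \<bullet> li (dm z)" by (simp add: l_nat')
    also have "\<dots> = \<rr> B \<bullet> (Id B \<star> ev) \<bullet> \<alpha> B d B \<bullet> (cv \<star> Id B) \<bullet> (Id \<one> \<star> z) \<bullet> li (dm z)"
      unfolding zigzag(1)[symmetric] by simp
    also have "\<dots> = \<rr> B \<bullet> (Id B \<star> ev) \<bullet> \<alpha> B d B \<bullet> ((Id B \<star> Id d) \<star> z) \<bullet> (cv \<star> Id (dm z)) \<bullet> li (dm z)"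
      by (simp add: merge)
    also have "\<dots> = \<rr> B \<bullet> (Id B \<star> ev) \<bullet> (Id B \<star> (Id d \<star> z)) \<bullet> \<alpha> B d (dm z) \<bullet> (cv \<star> Id (dm z)) \<bullet> li (dm z)"
      by (simp add: \<alpha>_nat' del: tns_Id)
    finally show ?thesis by (simp add: merge)
  qed
  show ?thesis using rec[of x] rec[of y] eq by simp
qed

text \<open>One half of the adjunction between tensoring with \<open>B\<close> and tensoring with
  its dual \<open>d\<close>: every morphism on x \<otimes> B arises from one on x.\<close>

lemma uncurry_surj:
  assumes \<phi>: "hom (x \<otimes> B) z \<phi>" and [simp]: "x \<in> Ob"
  obtains y where "hom x (z \<otimes> d) y" "\<rr> z \<bullet> (Id z \<star> ev) \<bullet> \<alpha> z d B \<bullet> (y \<star> Id B) = \<phi>"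
proof -
  have [simp]: "arr \<phi>" "dm \<phi> = x \<otimes> B" "cd \<phi> = z" using \<phi> by (simp_all add: hom_def)
  have [simp]: "z \<in> Ob" using cd_Ob[of \<phi>] by simp
  \<comment> \<open>The preimage is obtained by inserting the coevaluation to the right of x and
    applying \<open>\<phi>\<close>.\<close>
  let ?k = "\<alpha>i x B d \<bullet> (Id x \<star> cv) \<bullet> ri x"
  have "\<rr> z \<bullet> (Id z \<star> ev) \<bullet> \<alpha> z d B \<bullet> (((\<phi> \<star> Id d) \<bullet> ?k) \<star> Id B)
      = \<rr> z \<bullet> (Id z \<star> ev) \<bullet> \<alpha> z d B \<bullet> ((\<phi> \<star> Id d) \<star> Id B) \<bullet> (?k \<star> Id B)"
    by (simp add: merge)
  also have "\<dots> = \<rr> z \<bullet> (Id z \<star> ev) \<bullet> (\<phi> \<star> (Id d \<star> Id B)) \<bullet> \<alpha> (x \<otimes> B) d B \<bullet> (?k \<star> Id B)"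
    by (simp add: \<alpha>_nat' del: tns_Id)
  also have "\<dots> = \<rr> z \<bullet> (\<phi> \<star> Id \<one>) \<bullet> (Id (x \<otimes> B) \<star> ev) \<bullet> \<alpha> (x \<otimes> B) d B \<bullet> (?k \<star> Id B)"
    by (simp add: merge)
  also have "\<dots> = \<phi> \<bullet> \<rr> (x \<otimes> B) \<bullet> ((Id x \<star> Id B) \<star> ev) \<bullet> \<alpha> (x \<otimes> B) d B \<bullet> (?k \<star> Id B)"
    by (simp add: r_nat')
  also have "\<dots> = \<phi> \<bullet> (Id x \<star> \<rr> B) \<bullet> \<alpha> x B \<one> \<bullet> ((Id x \<star> Id B) \<star> ev) \<bullet> \<alpha> (x \<otimes> B) d B \<bullet> (?k \<star> Id B)"
    by (simp add: runit_tensor[symmetric])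
  also have "\<dots> = \<phi> \<bullet> (Id x \<star> \<rr> B) \<bullet> (Id x \<star> (Id B \<star> ev)) \<bullet> \<alpha> x B (d \<otimes> B) \<bullet> \<alpha> (x \<otimes> B) d B \<bullet> (?k \<star> Id B)"
    by (simp add: \<alpha>_nat' del: tns_Id)
  also have "\<dots> = \<phi> \<bullet> (Id x \<star> \<rr> B) \<bullet> (Id x \<star> (Id B \<star> ev)) \<bullet> (Id x \<star> \<alpha> B d B) \<bullet> \<alpha> x (B \<otimes> d) B \<bullet>
      ((Id x \<star> cv) \<star> Id B) \<bullet> (ri x \<star> Id B)"
    by (simp add: pentagon'' merge)
  also have "\<dots> = \<phi> \<bullet> (Id x \<star> \<rr> B) \<bullet> (Id x \<star> (Id B \<star> ev)) \<bullet> (Id x \<star> \<alpha> B d B) \<bullet> (Id x \<star> (cv \<star> Id B)) \<bullet>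
      \<alpha> x \<one> B \<bullet> (ri x \<star> Id B)"
    by (simp add: \<alpha>_nat')
  also have "\<dots> = \<phi> \<bullet> (Id x \<star> (\<rr> B \<bullet> (Id B \<star> ev) \<bullet> \<alpha> B d B \<bullet> (cv \<star> Id B))) \<bullet> \<alpha> x \<one> B \<bullet> (ri x \<star> Id B)"
    by (simp add: merge)
  also have "\<dots> = \<phi>" unfolding zigzag by (simp add: lunit_tensor_inv merge)
  finally show ?thesis by (intro that) (simp_all add: hom_def)
qed

lemma ev_surj:
  assumes \<phi>: "hom (x \<otimes> B) \<one> \<phi>" and [simp]: "x \<in> Ob"
  obtains y where "hom x d y" "ev \<bullet> (y \<star> Id B) = \<phi>"
proof -
  obtain y where y: "hom x (\<one> \<otimes> d) y" "\<rr> \<one> \<bullet> (Id \<one> \<star> ev) \<bullet> \<alpha> \<one> d B \<bullet> (y \<star> Id B) = \<phi>"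
    using uncurry_surj[OF assms] .
  have [simp]: "arr y" "dm y = x" "cd y = \<one> \<otimes> d" using y(1) by (simp_all add: hom_def)
  have "ev \<bullet> ((\<ll> d \<bullet> y) \<star> Id B) = ev \<bullet> (\<ll> d \<star> Id B) \<bullet> (y \<star> Id B)" by (simp add: merge)
  also have "\<dots> = ev \<bullet> \<ll> (d \<otimes> B) \<bullet> \<alpha> \<one> d B \<bullet> (y \<star> Id B)"
    by (simp add: lunit_tensor[symmetric])
  also have "\<dots> = \<phi>" unfolding y(2)[symmetric] by (simp add: l_nat' runit_unit)
  finally show ?thesis by (intro that) (simp_all add: hom_def)
qed

definition np :: 'm where
  "np = ev \<bullet> (Id d \<star> \<ll> B) \<bullet> (Id d \<star> (ev \<star> Id B)) \<bullet> (Id d \<star> \<alpha>i d B B) \<bullet> \<alpha> d d (B \<otimes> B)"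

lemma np_simps [simp]: "arr np" "dm np = (d \<otimes> d) \<otimes> (B \<otimes> B)" "cd np = \<one>"
  by (simp_all add: np_def)

lemma nested_pairing_np: "nested_pairing C d B ev = np"
  by (simp add: nested_pairing_def np_def tot)

lemma np_assoc: "np \<bullet> \<alpha> (d \<otimes> d) B B = ev \<bullet> ((\<rr> d \<bullet> (Id d \<star> ev) \<bullet> \<alpha> d d B) \<star> Id B)"
proof -
  have "np \<bullet> \<alpha> (d \<otimes> d) B B = ev \<bullet> (Id d \<star> \<ll> B) \<bullet> (Id d \<star> (ev \<star> Id B)) \<bullet> \<alpha> d (d \<otimes> B) B \<bullet> (\<alpha> d d B \<star> Id B)"
    by (simp add: np_def pentagon'[symmetric] merge)
       (simp add: merge tns_cmp'[symmetric])?
  also have "\<dots> = ev \<bullet> (Id d \<star> \<ll> B) \<bullet> \<alpha> d \<one> B \<bullet> ((Id d \<star> ev) \<star> Id B) \<bullet> (\<alpha> d d B \<star> Id B)"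
    by (simp add: \<alpha>_nat')
  also have "\<dots> = ev \<bullet> (\<rr> d \<star> Id B) \<bullet> ((Id d \<star> ev) \<star> Id B) \<bullet> (\<alpha> d d B \<star> Id B)"
    by (simp add: triangle'')
  finally show ?thesis by (simp add: merge)
qed

text \<open>By \<open>np_assoc\<close> the nested pairing is two successive evaluations, so the
  adjunction is applied once for each copy of \<open>B\<close>.\<close>

lemma np_surj:
  assumes \<psi>: "hom (x \<otimes> (B \<otimes> B)) \<one> \<psi>" and [simp]: "x \<in> Ob"
  obtains y where "hom x (d \<otimes> d) y" "np \<bullet> (y \<star> Id (B \<otimes> B)) = \<psi>"
proof -
  have [simp]: "arr \<psi>" "dm \<psi> = x \<otimes> (B \<otimes> B)" "cd \<psi> = \<one>" using \<psi> by (simp_all add: hom_def)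
  obtain w where w: "hom (x \<otimes> B) d w" "ev \<bullet> (w \<star> Id B) = \<psi> \<bullet> \<alpha> x B B"
    using ev_surj[of "x \<otimes> B" "\<psi> \<bullet> \<alpha> x B B"] by (auto simp: hom_def)
  obtain y where y: "hom x (d \<otimes> d) y" "\<rr> d \<bullet> (Id d \<star> ev) \<bullet> \<alpha> d d B \<bullet> (y \<star> Id B) = w"
    using uncurry_surj[OF w(1)] by auto
  have [simp]: "arr y" "dm y = x" "cd y = d \<otimes> d" using y(1) by (simp_all add: hom_def)
  have "np \<bullet> (y \<star> (Id B \<star> Id B)) \<bullet> \<alpha> x B B = np \<bullet> \<alpha> (d \<otimes> d) B B \<bullet> ((y \<star> Id B) \<star> Id B)"
    by (simp add: \<alpha>_nat del: tns_Id)
  also have "\<dots> = ev \<bullet> (w \<star> Id B)"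
    unfolding y(2)[symmetric] using np_assoc[THEN cmp_reassoc] by (simp add: merge)
  finally have "(np \<bullet> (y \<star> Id (B \<otimes> B))) \<bullet> \<alpha> x B B = \<psi> \<bullet> \<alpha> x B B" using w(2) by simp
  hence "np \<bullet> (y \<star> Id (B \<otimes> B)) = \<psi>" by (rule right_cancel[where k' = "\<alpha>i x B B"]) simp_all
  thus ?thesis using that y(1) by blast
qed

text \<open>The nested pairing matches the inner factors first, which is why transposes pass across
  it with their order reversed.\<close>

lemma np_transpose:
  assumes [simp]: "hom d d f'" "hom d d g'" "hom B B f" "hom B B g"
    and f: "ev \<bullet> (f' \<star> Id B) = ev \<bullet> (Id d \<star> f)" and g: "ev \<bullet> (g' \<star> Id B) = ev \<bullet> (Id d \<star> g)"
  shows "np \<bullet> ((f' \<star> g') \<star> Id (B \<otimes> B)) = np \<bullet> (Id (d \<otimes> d) \<star> (g \<star> f))"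
proof -
  have [simp]: "arr f'" "dm f' = d" "cd f' = d" "arr g'" "dm g' = d" "cd g' = d"
    "arr f" "dm f = B" "cd f = B" "arr g" "dm g = B" "cd g = B"
    using assms by (simp_all add: hom_def)
  let ?w = "\<ll> B \<bullet> ((ev \<bullet> (Id d \<star> g)) \<star> Id B) \<bullet> \<alpha>i d B B"
  have "np \<bullet> ((f' \<star> g') \<star> (Id B \<star> Id B)) =
      ev \<bullet> (Id d \<star> \<ll> B) \<bullet> (Id d \<star> (ev \<star> Id B)) \<bullet> (Id d \<star> \<alpha>i d B B) \<bullet> (f' \<star> (g' \<star> (Id B \<star> Id B))) \<bullet> \<alpha> d d (B \<otimes> B)"
    using \<alpha>_nat[of f' g' "Id B \<star> Id B" d d "B \<otimes> B"] by (simp add: np_def)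
  also have "\<dots> = ev \<bullet> (f' \<star> (\<ll> B \<bullet> (ev \<star> Id B) \<bullet> \<alpha>i d B B \<bullet> (g' \<star> (Id B \<star> Id B)))) \<bullet> \<alpha> d d (B \<otimes> B)"
    by (simp add: merge del: tns_Id)
  also have "\<alpha>i d B B \<bullet> (g' \<star> (Id B \<star> Id B)) = ((g' \<star> Id B) \<star> Id B) \<bullet> \<alpha>i d B B"
    by (simp add: \<alpha>i_nat del: tns_Id)
  also have "\<ll> B \<bullet> (ev \<star> Id B) \<bullet> ((g' \<star> Id B) \<star> Id B) \<bullet> \<alpha>i d B B = ?w"
    by (simp add: merge g)
  also have "ev \<bullet> (f' \<star> ?w) \<bullet> \<alpha> d d (B \<otimes> B) = (ev \<bullet> (f' \<star> Id B)) \<bullet> (Id d \<star> ?w) \<bullet> \<alpha> d d (B \<otimes> B)"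
    by (simp add: merge)
  also have "\<dots> = ev \<bullet> (Id d \<star> (f \<bullet> ?w)) \<bullet> \<alpha> d d (B \<otimes> B)" unfolding f by (simp add: merge)
  also have "f \<bullet> ?w = \<ll> B \<bullet> (Id \<one> \<star> f) \<bullet> ((ev \<bullet> (Id d \<star> g)) \<star> Id B) \<bullet> \<alpha>i d B B"
    by (simp add: l_nat')
  also have "\<dots> = \<ll> B \<bullet> (ev \<star> Id B) \<bullet> ((Id d \<star> g) \<star> f) \<bullet> \<alpha>i d B B" by (simp add: merge)
  also have "\<dots> = \<ll> B \<bullet> (ev \<star> Id B) \<bullet> \<alpha>i d B B \<bullet> (Id d \<star> (g \<star> f))" by (simp add: \<alpha>i_nat)
  also have "ev \<bullet> (Id d \<star> (\<ll> B \<bullet> (ev \<star> Id B) \<bullet> \<alpha>i d B B \<bullet> (Id d \<star> (g \<star> f)))) \<bullet> \<alpha> d d (B \<otimes> B)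
     = ev \<bullet> (Id d \<star> \<ll> B) \<bullet> (Id d \<star> (ev \<star> Id B)) \<bullet> (Id d \<star> \<alpha>i d B B) \<bullet> (Id d \<star> (Id d \<star> (g \<star> f))) \<bullet> \<alpha> d d (B \<otimes> B)"
    by (simp add: merge)
  also have "\<dots> = np \<bullet> ((Id d \<star> Id d) \<star> (g \<star> f))"
    unfolding np_def by (simp add: \<alpha>_nat del: tns_Id)
  finally show ?thesis by simp
qed

end

locale dual_hopf = hopf C B m u \<epsilon> \<Delta> S + dual_pair C d B ev cv
  for C :: "('o, 'm, 'k::{alg_closed_field, field_char_0}) bcat" (structure) and B m u \<epsilon> \<Delta> S d ev cv +
  fixes md ud :: 'm
  assumes md_hom: "hom (d \<otimes> d) d md" and ud_hom: "hom \<one> d ud"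
    and ev_md: "ev \<bullet> (md \<star> Id B) = np \<bullet> (Id (d \<otimes> d) \<star> \<Delta>)" and ev_ud: "ev \<bullet> (ud \<star> Id B) = \<epsilon> \<bullet> \<ll> B"
begin

lemma mdud_simps [simp]: "arr md" "dm md = d \<otimes> d" "cd md = d" "arr ud" "dm ud = \<one>" "cd ud = d"
  using md_hom ud_hom by (simp_all add: hom_def)

text \<open>\<open>B\<^sup>*\<close> acts on \<open>B\<close> by contraction with \<open>\<Delta>\<close>; this turns identities of \<open>B\<^sup>*\<close> into ones of composites.\<close>

definition act :: 'm where "act = \<ll> B \<bullet> (ev \<star> Id B) \<bullet> \<alpha>i d B B \<bullet> (Id d \<star> \<Delta>)"

lemma act_simps [simp]: "arr act" "dm act = d \<otimes> B" "cd act = B"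
  by (simp_all add: act_def)

text \<open>A product of functionals is evaluated by letting the second one act and evaluating the
  first on the result.\<close>

lemma ev_md_act: "ev \<bullet> (md \<star> Id B) = ev \<bullet> (Id d \<star> act) \<bullet> \<alpha> d d B"
proof -
  have "ev \<bullet> (md \<star> Id B) = ev \<bullet> (Id d \<star> \<ll> B) \<bullet> (Id d \<star> (ev \<star> Id B)) \<bullet> (Id d \<star> \<alpha>i d B B) \<bullet>
     \<alpha> d d (B \<otimes> B) \<bullet> ((Id d \<star> Id d) \<star> \<Delta>)"
    by (simp add: ev_md np_def)
  also have "\<alpha> d d (B \<otimes> B) \<bullet> ((Id d \<star> Id d) \<star> \<Delta>) = (Id d \<star> (Id d \<star> \<Delta>)) \<bullet> \<alpha> d d B"
    by (simp add: \<alpha>_nat del: tns_Id)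
  finally show ?thesis by (simp add: act_def merge)
qed

lemma \<epsilon>_act: "\<epsilon> \<bullet> act = ev"
proof -
  have "\<epsilon> \<bullet> act = \<ll> \<one> \<bullet> (Id \<one> \<star> \<epsilon>) \<bullet> (ev \<star> Id B) \<bullet> \<alpha>i d B B \<bullet> (Id d \<star> \<Delta>)"
    by (simp add: act_def l_nat')
  also have "\<dots> = \<rr> \<one> \<bullet> (ev \<star> Id \<one>) \<bullet> ((Id d \<star> Id B) \<star> \<epsilon>) \<bullet> \<alpha>i d B B \<bullet> (Id d \<star> \<Delta>)"
    by (simp add: merge runit_unit)
  also have "((Id d \<star> Id B) \<star> \<epsilon>) \<bullet> \<alpha>i d B B \<bullet> (Id d \<star> \<Delta>) = \<alpha>i d B \<one> \<bullet> (Id d \<star> (Id B \<star> \<epsilon>)) \<bullet> (Id d \<star> \<Delta>)"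
    by (simp add: \<alpha>i_nat' del: tns_Id)
  also have "\<dots> = \<alpha>i d B \<one> \<bullet> (Id d \<star> ri B)" by (simp add: merge counit_ri)
  finally show ?thesis by (simp add: lunit_tensor_inv r_nat')
qed

text \<open>Coassociativity: contracting the first tensor factor of \<Delta>(x) commutes with
  comultiplying the rest.\<close>

lemma \<Delta>_act: "\<Delta> \<bullet> act = (act \<star> Id B) \<bullet> \<alpha>i d B B \<bullet> (Id d \<star> \<Delta>)"
proof -
  have "\<Delta> \<bullet> act = \<ll> (B \<otimes> B) \<bullet> (Id \<one> \<star> \<Delta>) \<bullet> (ev \<star> Id B) \<bullet> \<alpha>i d B B \<bullet> (Id d \<star> \<Delta>)"
    by (simp add: act_def l_nat')
  also have "\<dots> = \<ll> (B \<otimes> B) \<bullet> (ev \<star> Id (B \<otimes> B)) \<bullet> ((Id d \<star> Id B) \<star> \<Delta>) \<bullet> \<alpha>i d B B \<bullet> (Id d \<star> \<Delta>)"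
    by (simp add: merge)
  also have "((Id d \<star> Id B) \<star> \<Delta>) \<bullet> \<alpha>i d B B \<bullet> (Id d \<star> \<Delta>) = \<alpha>i d B (B \<otimes> B) \<bullet> (Id d \<star> (Id B \<star> \<Delta>)) \<bullet> (Id d \<star> \<Delta>)"
    by (simp add: \<alpha>i_nat' del: tns_Id)
  also have "(Id d \<star> (Id B \<star> \<Delta>)) \<bullet> (Id d \<star> \<Delta>) = Id d \<star> ((Id B \<star> \<Delta>) \<bullet> \<Delta>)" by (simp add: merge)
  also have "\<dots> = (Id d \<star> \<alpha> B B B) \<bullet> (Id d \<star> (\<Delta> \<star> Id B)) \<bullet> (Id d \<star> \<Delta>)"
    unfolding coassoc[symmetric] by (simp add: merge)
  also have "\<alpha>i d B (B \<otimes> B) \<bullet> (Id d \<star> \<alpha> B B B) \<bullet> (Id d \<star> (\<Delta> \<star> Id B)) \<bullet> (Id d \<star> \<Delta>) =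
      \<alpha> (d \<otimes> B) B B \<bullet> (\<alpha>i d B B \<star> Id B) \<bullet> \<alpha>i d (B \<otimes> B) B \<bullet> (Id d \<star> (\<Delta> \<star> Id B)) \<bullet> (Id d \<star> \<Delta>)"
    using pentagon_inv1[of d B B B, THEN arg_cong, of "\<lambda>x. x \<bullet> (Id d \<star> (\<Delta> \<star> Id B)) \<bullet> (Id d \<star> \<Delta>)"] by simp
  also have "\<alpha>i d (B \<otimes> B) B \<bullet> (Id d \<star> (\<Delta> \<star> Id B)) \<bullet> (Id d \<star> \<Delta>) = ((Id d \<star> \<Delta>) \<star> Id B) \<bullet> \<alpha>i d B B \<bullet> (Id d \<star> \<Delta>)"
    by (simp add: \<alpha>i_nat')
  also have "\<ll> (B \<otimes> B) \<bullet> (ev \<star> Id (B \<otimes> B)) \<bullet> \<alpha> (d \<otimes> B) B B \<bullet> x = (\<ll> B \<star> Id B) \<bullet> ((ev \<star> Id B) \<star> Id B) \<bullet> x" for x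
    using \<alpha>_nat'[of ev "Id B" "Id B" \<one> B B x, symmetric] lunit_tensor[of B B, THEN cmp_reassoc] by simp
  finally show ?thesis by (simp add: act_def merge)
qed

lemma act_md: "act \<bullet> (md \<star> Id B) = act \<bullet> (Id d \<star> act) \<bullet> \<alpha> d d B"
proof -
  have "act \<bullet> (md \<star> Id B) = \<ll> B \<bullet> (ev \<star> Id B) \<bullet> \<alpha>i d B B \<bullet> (md \<star> (Id B \<star> Id B)) \<bullet> (Id (d \<otimes> d) \<star> \<Delta>)"
    by (simp add: act_def merge)
  also have "\<dots> = \<ll> B \<bullet> (ev \<star> Id B) \<bullet> ((md \<star> Id B) \<star> Id B) \<bullet> \<alpha>i (d \<otimes> d) B B \<bullet> (Id (d \<otimes> d) \<star> \<Delta>)"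
    by (simp add: \<alpha>i_nat' del: tns_Id)
  also have "\<dots> = \<ll> B \<bullet> ((ev \<bullet> (md \<star> Id B)) \<star> Id B) \<bullet> \<alpha>i (d \<otimes> d) B B \<bullet> (Id (d \<otimes> d) \<star> \<Delta>)"
    by (simp add: merge)
  also have "\<dots> = \<ll> B \<bullet> (ev \<star> Id B) \<bullet> ((Id d \<star> act) \<star> Id B) \<bullet> (\<alpha> d d B \<star> Id B) \<bullet> \<alpha>i (d \<otimes> d) B B \<bullet> (Id (d \<otimes> d) \<star> \<Delta>)"
    unfolding ev_md_act by (simp add: merge)
  also have "(\<alpha> d d B \<star> Id B) \<bullet> \<alpha>i (d \<otimes> d) B B \<bullet> (Id (d \<otimes> d) \<star> \<Delta>) =
      \<alpha>i d (d \<otimes> B) B \<bullet> (Id d \<star> \<alpha>i d B B) \<bullet> \<alpha> d d (B \<otimes> B) \<bullet> ((Id d \<star> Id d) \<star> \<Delta>)"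
    using pentagon_inv2[of d d B B, THEN arg_cong, of "\<lambda>x. x \<bullet> (Id (d \<otimes> d) \<star> \<Delta>)"] by simp
  also have "\<dots> = \<alpha>i d (d \<otimes> B) B \<bullet> (Id d \<star> \<alpha>i d B B) \<bullet> (Id d \<star> (Id d \<star> \<Delta>)) \<bullet> \<alpha> d d B"
    by (simp add: \<alpha>_nat del: tns_Id)
  also have "((Id d \<star> act) \<star> Id B) \<bullet> \<alpha>i d (d \<otimes> B) B \<bullet> x = \<alpha>i d B B \<bullet> (Id d \<star> (act \<star> Id B)) \<bullet> x" for x
    using \<alpha>i_nat'[of "Id d" act "Id B" d B B x] by simp
  also have "(Id d \<star> (act \<star> Id B)) \<bullet> (Id d \<star> \<alpha>i d B B) \<bullet> (Id d \<star> (Id d \<star> \<Delta>)) \<bullet> \<alpha> d d B =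
      (Id d \<star> (\<Delta> \<bullet> act)) \<bullet> \<alpha> d d B"
    unfolding \<Delta>_act by (simp add: merge)
  finally show ?thesis by (simp add: act_def merge)
qed

text \<open>The character of the dual algebra: evaluation of a functional at the unit of
  \<open>B\<close>.\<close>

definition \<epsilon>d :: 'm where "\<epsilon>d = ev \<bullet> (Id d \<star> u) \<bullet> ri d"

lemma \<epsilon>d_simps [simp]: "arr \<epsilon>d" "dm \<epsilon>d = d" "cd \<epsilon>d = \<one>"
  by (simp_all add: \<epsilon>d_def)

lemma ev_u: "ev \<bullet> (Id d \<star> u) = \<epsilon>d \<bullet> \<rr> d"
  by (simp add: \<epsilon>d_def)

lemma act_u: "act \<bullet> (Id d \<star> u) = u \<bullet> \<epsilon>d \<bullet> \<rr> d"
proof -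
  have "act \<bullet> (Id d \<star> u) = \<ll> B \<bullet> (ev \<star> Id B) \<bullet> \<alpha>i d B B \<bullet> (Id d \<star> (u \<star> u)) \<bullet> (Id d \<star> li \<one>)"
    by (simp add: act_def merge \<Delta>_u_li)
  also have "\<dots> = \<ll> B \<bullet> (ev \<star> Id B) \<bullet> ((Id d \<star> u) \<star> u) \<bullet> \<alpha>i d \<one> \<one> \<bullet> (Id d \<star> li \<one>)"
    by (simp add: \<alpha>i_nat')
  also have "\<dots> = \<ll> B \<bullet> ((ev \<bullet> (Id d \<star> u)) \<star> u) \<bullet> \<alpha>i d \<one> \<one> \<bullet> (Id d \<star> li \<one>)"
    by (simp add: merge)
  also have "\<dots> = \<ll> B \<bullet> (\<epsilon>d \<star> u)" unfolding ev_u by (simp add: lunit_tensor_inv merge)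
  also have "\<dots> = \<ll> B \<bullet> (Id \<one> \<star> u) \<bullet> (\<epsilon>d \<star> Id \<one>)" by (simp add: merge)
  also have "\<dots> = u \<bullet> \<rr> \<one> \<bullet> (\<epsilon>d \<star> Id \<one>)" by (simp add: l_nat' runit_unit)
  finally show ?thesis by (simp add: r_nat)
qed

lemma \<epsilon>d_md: "\<epsilon>d \<bullet> md = \<ll> \<one> \<bullet> (\<epsilon>d \<star> \<epsilon>d)"
proof -
  have "\<epsilon>d \<bullet> md = ev \<bullet> (Id d \<star> u) \<bullet> (md \<star> Id \<one>) \<bullet> ri (d \<otimes> d)" by (simp add: \<epsilon>d_def ri_nat)
  also have "\<dots> = (ev \<bullet> (md \<star> Id B)) \<bullet> ((Id d \<star> Id d) \<star> u) \<bullet> ri (d \<otimes> d)" by (simp add: merge)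
  also have "\<dots> = ev \<bullet> (Id d \<star> act) \<bullet> (Id d \<star> (Id d \<star> u)) \<bullet> \<alpha> d d \<one> \<bullet> ri (d \<otimes> d)"
    unfolding ev_md_act by (simp add: \<alpha>_nat' del: tns_Id)
  also have "\<dots> = (ev \<bullet> (Id d \<star> u)) \<bullet> (Id d \<star> \<epsilon>d) \<bullet> (Id d \<star> \<rr> d) \<bullet> \<alpha> d d \<one> \<bullet> ri (d \<otimes> d)"
    by (simp add: merge act_u)
  also have "\<dots> = \<epsilon>d \<bullet> \<rr> d \<bullet> (Id d \<star> \<epsilon>d)"
    unfolding ev_u by (simp add: runit_tensor[THEN cmp_reassoc])
  also have "\<dots> = \<rr> \<one> \<bullet> (\<epsilon>d \<star> Id \<one>) \<bullet> (Id d \<star> \<epsilon>d)" by (simp add: r_nat')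
  finally show ?thesis by (simp add: merge runit_unit)
qed

lemma \<epsilon>d_ud: "\<epsilon>d \<bullet> ud = Id \<one>"
proof -
  have "\<epsilon>d \<bullet> ud = (ev \<bullet> (ud \<star> Id B)) \<bullet> (Id \<one> \<star> u) \<bullet> ri \<one>" by (simp add: \<epsilon>d_def ri_nat merge)
  thus ?thesis unfolding ev_ud by (simp add: l_nat' li_ri_unit)
qed

text \<open>After pairing with \<open>B\<close>, associativity of the dual product reduces to
  \<open>act_md\<close>, which says that the contraction is an action.\<close>

lemma md_assoc: "md \<bullet> (md \<star> Id d) = md \<bullet> (Id d \<star> md) \<bullet> \<alpha> d d d"
proof (rule ev_faithful_left)
  have "ev \<bullet> ((md \<bullet> (md \<star> Id d)) \<star> Id B) = (ev \<bullet> (md \<star> Id B)) \<bullet> ((md \<star> Id d) \<star> Id B)" by (simp add: merge)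
  also have "\<dots> = ev \<bullet> (Id d \<star> act) \<bullet> \<alpha> d d B \<bullet> ((md \<star> Id d) \<star> Id B)" unfolding ev_md_act by simp
  also have "\<dots> = ev \<bullet> (Id d \<star> act) \<bullet> (md \<star> (Id d \<star> Id B)) \<bullet> \<alpha> (d \<otimes> d) d B" by (simp add: \<alpha>_nat del: tns_Id)
  also have "\<dots> = (ev \<bullet> (md \<star> Id B)) \<bullet> (Id (d \<otimes> d) \<star> act) \<bullet> \<alpha> (d \<otimes> d) d B" by (simp add: merge)
  also have "\<dots> = ev \<bullet> (Id d \<star> act) \<bullet> \<alpha> d d B \<bullet> ((Id d \<star> Id d) \<star> act) \<bullet> \<alpha> (d \<otimes> d) d B"
    unfolding ev_md_act by simp
  also have "\<dots> = ev \<bullet> (Id d \<star> act) \<bullet> (Id d \<star> (Id d \<star> act)) \<bullet> \<alpha> d d (d \<otimes> B) \<bullet> \<alpha> (d \<otimes> d) d B"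
    by (simp add: \<alpha>_nat' del: tns_Id)
  also have "\<dots> = ev \<bullet> (Id d \<star> (act \<bullet> (Id d \<star> act) \<bullet> \<alpha> d d B)) \<bullet> \<alpha> d (d \<otimes> d) B \<bullet> (\<alpha> d d d \<star> Id B)"
    by (simp add: pentagon'[symmetric] merge)
  also have "\<dots> = ev \<bullet> (Id d \<star> act) \<bullet> (Id d \<star> (md \<star> Id B)) \<bullet> \<alpha> d (d \<otimes> d) B \<bullet> (\<alpha> d d d \<star> Id B)"
    unfolding act_md[symmetric] by (simp add: merge)
  also have "\<dots> = (ev \<bullet> (Id d \<star> act) \<bullet> \<alpha> d d B) \<bullet> ((Id d \<star> md) \<star> Id B) \<bullet> (\<alpha> d d d \<star> Id B)"
    by (simp add: \<alpha>_nat')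
  also have "\<dots> = ev \<bullet> ((md \<bullet> (Id d \<star> md) \<bullet> \<alpha> d d d) \<star> Id B)"
    unfolding ev_md_act[symmetric] by (simp add: merge)
  finally show "ev \<bullet> ((md \<bullet> (md \<star> Id d)) \<star> Id B) = ev \<bullet> ((md \<bullet> (Id d \<star> md) \<bullet> \<alpha> d d d) \<star> Id B)" .
qed simp_all

lemma md_unit_left: "md \<bullet> (ud \<star> Id d) = \<ll> d"
proof (rule ev_faithful_left)
  have "ev \<bullet> ((md \<bullet> (ud \<star> Id d)) \<star> Id B) = (ev \<bullet> (md \<star> Id B)) \<bullet> ((ud \<star> Id d) \<star> Id B)" by (simp add: merge)
  also have "\<dots> = ev \<bullet> (Id d \<star> act) \<bullet> (ud \<star> (Id d \<star> Id B)) \<bullet> \<alpha> \<one> d B"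
    unfolding ev_md_act by (simp add: \<alpha>_nat del: tns_Id)
  also have "\<dots> = (ev \<bullet> (ud \<star> Id B)) \<bullet> (Id \<one> \<star> act) \<bullet> \<alpha> \<one> d B" by (simp add: merge)
  also have "\<dots> = ev \<bullet> \<ll> (d \<otimes> B) \<bullet> \<alpha> \<one> d B"
    unfolding ev_ud using \<epsilon>_act[THEN cmp_reassoc] by (simp add: l_nat')
  finally show "ev \<bullet> ((md \<bullet> (ud \<star> Id d)) \<star> Id B) = ev \<bullet> (\<ll> d \<star> Id B)" by (simp add: lunit_tensor)
qed simp_all

lemma md_unit_right: "md \<bullet> (Id d \<star> ud) = \<rr> d"
proof (rule ev_faithful_left)
  have "act \<bullet> (ud \<star> Id B) = \<ll> B \<bullet> (ev \<star> Id B) \<bullet> \<alpha>i d B B \<bullet> (ud \<star> (Id B \<star> Id B)) \<bullet> (Id \<one> \<star> \<Delta>)"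
    by (simp add: act_def merge)
  also have "\<dots> = \<ll> B \<bullet> (ev \<star> Id B) \<bullet> ((ud \<star> Id B) \<star> Id B) \<bullet> \<alpha>i \<one> B B \<bullet> (Id \<one> \<star> \<Delta>)"
    by (simp add: \<alpha>i_nat' del: tns_Id)
  also have "\<dots> = \<ll> B \<bullet> ((ev \<bullet> (ud \<star> Id B)) \<star> Id B) \<bullet> \<alpha>i \<one> B B \<bullet> (Id \<one> \<star> \<Delta>)"
    by (simp add: merge)
  also have "\<dots> = \<ll> B \<bullet> (\<epsilon> \<star> Id B) \<bullet> (\<ll> B \<star> Id B) \<bullet> \<alpha>i \<one> B B \<bullet> (Id \<one> \<star> \<Delta>)"
    unfolding ev_ud by (simp add: merge)
  also have "\<dots> = \<ll> B \<bullet> (\<epsilon> \<star> Id B) \<bullet> \<Delta> \<bullet> \<ll> B"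
    using lunit_tensor_inv(1)[of B B, THEN cmp_reassoc, of "Id \<one> \<star> \<Delta>"] by (simp add: l_nat)
  also have "\<dots> = \<ll> B" using counit_left[THEN cmp_reassoc, of "\<ll> B"] by simp
  finally have act_ud: "act \<bullet> (ud \<star> Id B) = \<ll> B" .
  have "ev \<bullet> ((md \<bullet> (Id d \<star> ud)) \<star> Id B) = (ev \<bullet> (md \<star> Id B)) \<bullet> ((Id d \<star> ud) \<star> Id B)" by (simp add: merge)
  also have "\<dots> = ev \<bullet> (Id d \<star> act) \<bullet> (Id d \<star> (ud \<star> Id B)) \<bullet> \<alpha> d \<one> B"
    unfolding ev_md_act by (simp add: \<alpha>_nat)
  also have "\<dots> = ev \<bullet> (\<rr> d \<star> Id B)" by (simp add: merge act_ud triangle')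
  finally show "ev \<bullet> ((md \<bullet> (Id d \<star> ud)) \<star> Id B) = ev \<bullet> (\<rr> d \<star> Id B)" .
qed simp_all

sublocale D: augmented_algebra C d md ud \<epsilon>d
  by unfold_locales
    (simp_all add: md_hom ud_hom md_assoc md_unit_left md_unit_right \<epsilon>d_md \<epsilon>d_ud, simp add: hom_def)

text \<open>The augmentation projections of an algebra and of its dual are transposes of each other,
  as unit and counit exchange roles.\<close>

lemma ev_aug: "ev \<bullet> (D.aug \<star> Id B) = ev \<bullet> (Id d \<star> aug)"
proof -
  have "(ev \<bullet> (ud \<star> Id B)) \<bullet> (\<epsilon>d \<star> Id B) = \<ll> \<one> \<bullet> (\<epsilon>d \<star> \<epsilon>)"
    unfolding ev_ud using l_nat'[of \<epsilon> \<one> "\<epsilon>d \<star> Id B"] by (simp add: merge)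
  moreover have "(ev \<bullet> (Id d \<star> u)) \<bullet> (Id d \<star> \<epsilon>) = \<ll> \<one> \<bullet> (\<epsilon>d \<star> \<epsilon>)"
    unfolding ev_u using r_nat'[of \<epsilon>d \<one> "Id d \<star> \<epsilon>"] by (simp add: merge runit_unit)
  ultimately show ?thesis by (simp add: D.aug_def aug_def distribs merge)
qed

end

section \<open>Nakayama's lemma and the existence of primitive elements\<close>

context augmented_algebra
begin

text \<open>Nakayama: J = J^2 with J nilpotent forces J = 0.\<close>

lemma aug_zero_if_square:
  assumes "hom B (B \<otimes> B) y" "aug = m2 \<bullet> y" "mpow m aug n = \<zero> (tensor_power C B n) B"
  shows "aug = \<zero> B B"
proof -
  have [simp]: "arr y" "dm y = B" "cd y = B \<otimes> B" using assms(1) by (simp_all add: hom_def)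
  define P where "P x \<longleftrightarrow> arr x \<and> cd x = B \<and> aug \<bullet> x = \<zero> (dm x) B" for x
  have "P (Id B)"
  \<comment> \<open>Generation with zero generators: the elements killed by \<open>aug\<close>
    contain the unit and are stable under everything required, so they exhaust
    \<open>B\<close>.\<close>
  proof (rule generated_by_complement[of B "\<zero> B B" "\<zero> B B" y n P])
    show "aug = \<zero> B B \<bullet> \<zero> B B \<uplus> m2 \<bullet> y" using assms(2) by simp
    show "P (x \<bullet> t)" if "P x" "arr t" "cd t = dm x" for x t
      using that by (simp add: P_def cmp_assoc[symmetric] del: cmp_assoc)
    show "P (x \<uplus> y)" if "P x" "P y" "dm x = dm y" for x y
      using that by (simp add: P_def distribs)
  qed (simp_all add: assms(1,3), simp_all add: P_def hom_def)
  thus ?thesis by (simp add: P_def)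
qed

end

context hopf
begin

lemma dual_hopf_if_dual_algebra:
  assumes "dual_algebra C B \<Delta> \<epsilon> d ev cv md ud"
  shows "dual_hopf C B m u \<epsilon> \<Delta> S d ev cv md ud"
proof -
  note a = assms[unfolded dual_algebra_def]
  interpret dual_pair C d B ev cv by unfold_locales (use a in blast)
  have h: "hom (d \<otimes> d) d md" "hom \<one> d ud" using a by (simp_all add: Hom_hom)
  hence [simp]: "arr md" "dm md = d \<otimes> d" "cd md = d" "arr ud" "dm ud = \<one>" "cd ud = d"
    by (simp_all add: hom_def)
  have "ev \<cdot> (md \<otimes>\<^sub>m Id B) = nested_pairing C d B ev \<cdot> (Id (d \<otimes> d) \<otimes>\<^sub>m \<Delta>)"
    "ev \<cdot> (ud \<otimes>\<^sub>m Id B) = \<epsilon> \<cdot> \<ll> B" using a by blast+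
  hence "ev \<bullet> (md \<star> Id B) = np \<bullet> (Id (d \<otimes> d) \<star> \<Delta>)" "ev \<bullet> (ud \<star> Id B) = \<epsilon> \<bullet> \<ll> B"
    by (simp_all add: nested_pairing_np tot)
  thus ?thesis by unfold_locales (use h in simp_all)
qed

text \<open>Up to the augmentation projections, \<open>prm\<close> is the reduced comultiplication.
  Expanding \<open>aug \<star> aug\<close> gives four terms, simplified by the counit laws.\<close>

lemma aug_comult: "prm \<bullet> aug = (aug \<star> aug) \<bullet> \<Delta>"
proof -
  have 1: "((u \<bullet> \<epsilon>) \<star> Id B) \<bullet> \<Delta> = (u \<star> Id B) \<bullet> li B"
  proof -
    have "((u \<bullet> \<epsilon>) \<star> Id B) \<bullet> \<Delta> = (u \<star> Id B) \<bullet> (\<epsilon> \<star> Id B) \<bullet> \<Delta>" by (simp add: merge)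
    thus ?thesis by (simp add: counit_li)
  qed
  have 2: "(Id B \<star> (u \<bullet> \<epsilon>)) \<bullet> \<Delta> = (Id B \<star> u) \<bullet> ri B"
  proof -
    have "(Id B \<star> (u \<bullet> \<epsilon>)) \<bullet> \<Delta> = (Id B \<star> u) \<bullet> (Id B \<star> \<epsilon>) \<bullet> \<Delta>" by (simp add: merge)
    thus ?thesis by (simp add: counit_ri)
  qed
  have 3: "((u \<bullet> \<epsilon>) \<star> (u \<bullet> \<epsilon>)) \<bullet> \<Delta> = (u \<star> u) \<bullet> li \<one> \<bullet> \<epsilon>"
  proof -
    have "((u \<bullet> \<epsilon>) \<star> (u \<bullet> \<epsilon>)) \<bullet> \<Delta> = (u \<star> (u \<bullet> \<epsilon>)) \<bullet> (\<epsilon> \<star> Id B) \<bullet> \<Delta>" by (simp add: merge)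
    also have "\<dots> = (u \<star> u) \<bullet> (Id \<one> \<star> \<epsilon>) \<bullet> li B" by (simp add: counit_li merge)
    finally show ?thesis by (simp add: li_nat)
  qed
  have "prm \<bullet> u = \<ominus> ((u \<star> u) \<bullet> li \<one>)"
    using prm_cmp[of u] by (simp add: \<Delta>_u_li li_ri_unit)
  hence "prm \<bullet> aug = prm \<uplus> (u \<star> u) \<bullet> li \<one> \<bullet> \<epsilon>"
    using cmp_reassoc[of prm u _ \<epsilon>] by (simp add: aug_def distribs)
  also have "\<dots> = (aug \<star> aug) \<bullet> \<Delta>"
    unfolding aug_def prm_def using 1 2 3 by (simp add: distribs add_ac')
  finally show ?thesis .
qed

text \<open>Without primitives the reduced comultiplication is injective. Dually, the augmentation
  ideal of the dual algebra equals its own square, so it vanishes by Nakayama, and with it the one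
  of \<open>B\<close>.\<close>

lemma aug_zero_if_no_primitives:
  assumes cc: "coconnected_coalgebra C B \<Delta> \<epsilon>" and b: "hom (B \<otimes> B) B b" "b \<bullet> prm = Id B"
  shows "aug = \<zero> B B"
proof -
  obtain d ev cv md ud where da: "dual_algebra C B \<Delta> \<epsilon> d ev cv md ud" and con: "connected_algebra C d md ud"
    using cc unfolding coconnected_coalgebra_def by blast
  interpret dual_hopf C B m u \<epsilon> \<Delta> S d ev cv md ud by (rule dual_hopf_if_dual_algebra[OF da])
  have [simp]: "arr b" "dm b = B \<otimes> B" "cd b = B" using b(1) by (simp_all add: hom_def)
  obtain n where n: "mpow md D.aug n = \<zero> (tensor_power C d n) d"
    using D.nilpotent_aug_if_connected[OF con] .
  \<comment> \<open>\<open>y\<close> is the transpose of the left inverse \<open>b\<close>; it will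
    express each functional in the dual ideal as a sum of products.\<close>
  obtain y where y: "hom d (d \<otimes> d) y" "np \<bullet> (y \<star> Id (B \<otimes> B)) = ev \<bullet> (Id d \<star> b)"
    using np_surj[of d "ev \<bullet> (Id d \<star> b)"] by (auto simp: hom_def)
  have [simp]: "arr y" "dm y = d" "cd y = d \<otimes> d" using y(1) by (simp_all add: hom_def)
  have "aug = b \<bullet> (aug \<star> aug) \<bullet> \<Delta>"
    using b(2)[THEN cmp_reassoc, of aug] by (simp add: aug_comult)
  hence "ev \<bullet> (Id d \<star> aug) = ev \<bullet> (Id d \<star> (b \<bullet> (aug \<star> aug) \<bullet> \<Delta>))" by (rule arg_cong)
  also have "\<dots> = (ev \<bullet> (Id d \<star> b)) \<bullet> (Id d \<star> ((aug \<star> aug) \<bullet> \<Delta>))" by (simp add: merge)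
  also have "\<dots> = (np \<bullet> (Id (d \<otimes> d) \<star> (aug \<star> aug))) \<bullet> (Id (d \<otimes> d) \<star> \<Delta>) \<bullet> (y \<star> Id B)"
    unfolding y(2)[symmetric] by (simp add: merge)
  also have "np \<bullet> (Id (d \<otimes> d) \<star> (aug \<star> aug)) = np \<bullet> ((D.aug \<star> D.aug) \<star> Id (B \<otimes> B))"
    by (rule np_transpose[symmetric]) (simp_all add: ev_aug, simp_all add: hom_def)
  also have "(np \<bullet> ((D.aug \<star> D.aug) \<star> Id (B \<otimes> B))) \<bullet> (Id (d \<otimes> d) \<star> \<Delta>) \<bullet> (y \<star> Id B) =
      (np \<bullet> (Id (d \<otimes> d) \<star> \<Delta>)) \<bullet> (((D.aug \<star> D.aug) \<bullet> y) \<star> Id B)" by (simp add: merge)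
  also have "\<dots> = ev \<bullet> ((D.m2 \<bullet> y) \<star> Id B)" unfolding ev_md[symmetric] by (simp add: D.m2_def merge)
  finally have "ev \<bullet> (D.aug \<star> Id B) = ev \<bullet> ((D.m2 \<bullet> y) \<star> Id B)" unfolding ev_aug .
  hence "D.aug = D.m2 \<bullet> y" by (rule ev_faithful_left) simp_all
  hence "D.aug = \<zero> d d" by (rule D.aug_zero_if_square[OF y(1) _ n])
  hence "ev \<bullet> (Id d \<star> aug) = ev \<bullet> (Id d \<star> \<zero> B B)" unfolding ev_aug[symmetric] by simp
  thus ?thesis by (rule ev_faithful_right) simp_all
qed

end

section \<open>The Nichols algebra is coconnected, and its object is larger than the unit\<close>

context nichols
begin

lemma coconnected: "coconnected_coalgebra C B \<Delta> \<epsilon>"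
proof -
  obtain d ev cv where "left_dual C d B ev cv" using left_dual_exists[OF B_Ob] by blast
  then interpret P: dual_pair C d B ev cv by unfold_locales
  obtain md where md: "hom (d \<otimes> d) d md" "ev \<bullet> (md \<star> Id B) = P.np \<bullet> (Id (d \<otimes> d) \<star> \<Delta>)"
    using P.ev_surj[of "d \<otimes> d" "P.np \<bullet> (Id (d \<otimes> d) \<star> \<Delta>)"] by (auto simp: hom_def)
  obtain ud where ud: "hom \<one> d ud" "ev \<bullet> (ud \<star> Id B) = \<epsilon> \<bullet> \<ll> B"
    using P.ev_surj[of \<one> "\<epsilon> \<bullet> \<ll> B"] by (auto simp: hom_def)
  interpret dual_hopf C B m u \<epsilon> \<Delta> S d ev cv md ud
    by unfold_locales (fact md ud)+
  \<comment> \<open>The transposed degree projections grade the dual algebra, whose augmentation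
    ideal is then nilpotent for degree reasons.\<close>
  have "\<exists>f. hom d d f \<and> ev \<bullet> (f \<star> Id B) = ev \<bullet> (Id d \<star> (\<iota> k \<bullet> \<pi> k))" for k
    using P.ev_surj[of d "ev \<bullet> (Id d \<star> (\<iota> k \<bullet> \<pi> k))"] by (auto simp: hom_def)
  then obtain E where E: "\<And>k. hom d d (E k)" "\<And>k. ev \<bullet> (E k \<star> Id B) = ev \<bullet> (Id d \<star> (\<iota> k \<bullet> \<pi> k))" by metis
  have [simp]: "arr (E k)" "dm (E k) = d" "cd (E k) = d" for k using E(1)[of k] by (simp_all add: hom_def)
  have "mpow md D.aug N = \<zero> (tensor_power C d N) d"
  proof (rule D.graded_imp_nilpotent_aug[of N E])
    show "tsum d d E N = Id d"
    proof (rule P.ev_faithful_left)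
      have "ev \<bullet> (tsum d d E N \<star> Id B) = tsum (d \<otimes> B) \<one> (\<lambda>k. ev \<bullet> (E k \<star> Id B)) N"
        by (simp add: tns_tsum cmp_tsum)
      also have "\<dots> = ev \<bullet> (Id d \<star> tsum B B (\<lambda>k. \<iota> k \<bullet> \<pi> k) N)"
        unfolding E(2) by (simp add: tns_tsum cmp_tsum)
      also have "\<dots> = ev \<bullet> (Id d \<star> Id B)" unfolding direct_sum_tot(5)[OF ds] ..
      finally show "ev \<bullet> (tsum d d E N \<star> Id B) = ev \<bullet> (Id d \<star> Id B)" .
    qed simp_all
    show "E 0 \<bullet> D.aug = \<zero> d d"
    proof (rule P.ev_faithful_left)
      have "ev \<bullet> ((E 0 \<bullet> D.aug) \<star> Id B) = (ev \<bullet> (E 0 \<star> Id B)) \<bullet> (D.aug \<star> Id B)" by (simp add: merge)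
      also have "\<dots> = (ev \<bullet> (D.aug \<star> Id B)) \<bullet> (Id d \<star> (\<iota> 0 \<bullet> \<pi> 0))" unfolding E(2) by (simp add: merge)
      also have "\<dots> = \<zero> (d \<otimes> B) \<one>"
        unfolding ev_aug using aug_\<iota>[of 0, THEN cmp_reassoc, of "\<pi> 0"] by (simp add: merge)
      finally show "ev \<bullet> ((E 0 \<bullet> D.aug) \<star> Id B) = ev \<bullet> (\<zero> d d \<star> Id B)" by simp
    qed simp_all
    fix a b k :: nat assume k: "k \<noteq> a + b"
    show "E k \<bullet> md \<bullet> (E a \<star> E b) = \<zero> (d \<otimes> d) d"
    proof (rule P.ev_faithful_left)
      have g: "(\<pi> b \<star> \<pi> a) \<bullet> \<Delta> \<bullet> \<iota> k = \<zero> (X k) (X b \<otimes> X a)" by (rule gr_\<Delta>) (use k in simp)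
      have "ev \<bullet> ((E k \<bullet> md \<bullet> (E a \<star> E b)) \<star> Id B) = (ev \<bullet> (E k \<star> Id B)) \<bullet> ((md \<bullet> (E a \<star> E b)) \<star> Id B)"
        by (simp add: merge)
      also have "\<dots> = (ev \<bullet> (md \<star> Id B)) \<bullet> ((E a \<star> E b) \<star> (\<iota> k \<bullet> \<pi> k))" unfolding E(2) by (simp add: merge)
      also have "\<dots> = (P.np \<bullet> ((E a \<star> E b) \<star> Id (B \<otimes> B))) \<bullet> (Id (d \<otimes> d) \<star> (\<Delta> \<bullet> \<iota> k \<bullet> \<pi> k))"
        unfolding ev_md by (simp add: merge)
      also have "P.np \<bullet> ((E a \<star> E b) \<star> Id (B \<otimes> B)) = P.np \<bullet> (Id (d \<otimes> d) \<star> ((\<iota> b \<bullet> \<pi> b) \<star> (\<iota> a \<bullet> \<pi> a)))"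
        by (rule P.np_transpose) (simp_all add: E, simp_all add: hom_def)
      also have "(P.np \<bullet> (Id (d \<otimes> d) \<star> ((\<iota> b \<bullet> \<pi> b) \<star> (\<iota> a \<bullet> \<pi> a)))) \<bullet> (Id (d \<otimes> d) \<star> (\<Delta> \<bullet> \<iota> k \<bullet> \<pi> k)) =
          P.np \<bullet> (Id (d \<otimes> d) \<star> ((\<iota> b \<star> \<iota> a) \<bullet> ((\<pi> b \<star> \<pi> a) \<bullet> \<Delta> \<bullet> \<iota> k) \<bullet> \<pi> k))"
        by (simp add: merge)
      also have "\<dots> = \<zero> ((d \<otimes> d) \<otimes> B) \<one>" unfolding g by simp
      finally show "ev \<bullet> ((E k \<bullet> md \<bullet> (E a \<star> E b)) \<star> Id B) = ev \<bullet> (\<zero> (d \<otimes> d) d \<star> Id B)" by simp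
    qed simp_all
  qed (use E in auto)
  hence "connected_algebra C d md ud" by (rule D.connected_if_nilpotent_aug)
  moreover have "dual_algebra C B \<Delta> \<epsilon> d ev cv md ud"
    unfolding dual_algebra_def using P.ld ev_md ev_ud
    by (simp add: P.nested_pairing_np tot Hom_iff)
  moreover have "coalgebra C B \<Delta> \<epsilon>"
    using coassoc counit_left counit_right by (simp add: coalgebra_def Hom_iff tot)
  ultimately show ?thesis unfolding coconnected_coalgebra_def by blast
qed

text \<open>A statement about the object \<open>B\<close>: if it were exhausted by the unit of some
  augmented algebra, every morphism into it killed by \<open>\<epsilon>\<close> would vanish,
  whereas the inclusion of V is nonzero.\<close>

lemma not_trivial:
  assumes "augmented_algebra C B m' u' \<epsilon>'" "simple C V"
  shows "augmented_algebra.aug C B u' \<epsilon>' \<noteq> \<zero> B B"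
proof
  interpret H': augmented_algebra C B m' u' \<epsilon>' by fact
  assume "H'.aug = \<zero> B B"
  hence "Id B = u' \<bullet> \<epsilon>'" using H'.Id_aug by simp
  hence *: "x = u' \<bullet> \<epsilon>' \<bullet> x" if "arr x" "cd x = B" for x
    using that by (metis cmp_Id(1) cmp_assoc)
  have "(\<epsilon> \<bullet> u') \<bullet> (\<epsilon>' \<bullet> u) = \<epsilon> \<bullet> (u' \<bullet> \<epsilon>' \<bullet> u)" by simp
  also have "\<dots> = Id \<one>" using *[of u] by simp
  finally have inv: "(\<epsilon>' \<bullet> u) \<bullet> (\<epsilon> \<bullet> u') = Id \<one>"
    by (rule left_inverse_imp_right_inverse[rotated 2]) (simp_all add: hom_def)
  hence 1: "\<epsilon>' \<bullet> u \<bullet> \<epsilon> \<bullet> u' \<bullet> x = x" if "arr x" "cd x = \<one>" for x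
    using that cmp_reassoc[OF inv, of x] by simp
  have i1: "\<iota> 1 = u' \<bullet> \<epsilon>' \<bullet> \<iota> 1" by (rule *) simp_all
  have z: "\<epsilon> \<bullet> u' \<bullet> \<epsilon>' \<bullet> \<iota> 1 = \<zero> V \<one>" unfolding i1[symmetric] by (rule \<epsilon>_i)
  have "\<epsilon>' \<bullet> \<iota> 1 = \<epsilon>' \<bullet> u \<bullet> \<epsilon> \<bullet> u' \<bullet> \<epsilon>' \<bullet> \<iota> 1" by (rule 1[symmetric]) simp_all
  also have "\<dots> = \<zero> V \<one>" unfolding z by simp
  finally have "u' \<bullet> \<epsilon>' \<bullet> \<iota> 1 = \<zero> V B" by simp
  hence "\<iota> 1 = \<zero> V B" using i1 by (rule trans[rotated])
  hence "Id V = \<zero> V V" using p_i by simp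
  thus False using assms(2) by (simp add: simple_def zero_ob_iff)
qed

end

section \<open>Deformations of Nichols algebras\<close>

text \<open>
  The last three assumptions are the open conditions: \<open>r\<close> is injective on the primitives of the
  primed algebra; its unit, the image of \<open>l\<close> and the decomposable elements span it directly; and no
  decomposable element is primitive.
\<close>

locale nichols_transversal = nichols C B m u \<epsilon> \<Delta> S V X \<iota> \<pi> N + H': hopf C B m' u' \<epsilon>' \<Delta>' S'
  for C :: "('o, 'm, 'k::{alg_closed_field, field_char_0}) bcat" (structure)
    and B m u \<epsilon> \<Delta> S V X \<iota> \<pi> N m' u' \<epsilon>' \<Delta>' S' +
  fixes a l r \<gamma> :: 'm
  assumes V_simple: "simple C V"
    and connected': "connected_algebra C B m' u'" and coconnected': "coconnected_coalgebra C B \<Delta>' \<epsilon>'"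
    and a_hom: "hom B (B \<otimes> B) a" and a_u: "a \<bullet> u = \<zero> \<one> (B \<otimes> B)" and a_\<iota>1: "a \<bullet> \<iota> 1 = \<zero> V (B \<otimes> B)"
    and l_hom: "hom V B l" and r_hom: "hom B V r" and \<gamma>_hom: "hom B B \<gamma>"
    and primitives: "\<And>x. arr x \<Longrightarrow> cd x = B \<Longrightarrow> H'.prm \<bullet> x = \<zero> (dm x) (B \<otimes> B) \<Longrightarrow>
      r \<bullet> x = \<zero> (dm x) V \<Longrightarrow> x = \<zero> (dm x) B"
    and generators: "(u' \<bullet> \<epsilon> \<uplus> (l \<bullet> \<pi> 1 \<uplus> H'.m2 \<bullet> a)) \<bullet> \<gamma> = Id B"
      "\<gamma> \<bullet> (u' \<bullet> \<epsilon> \<uplus> (l \<bullet> \<pi> 1 \<uplus> H'.m2 \<bullet> a)) = Id B"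
    and decomposables: "\<And>x. arr x \<Longrightarrow> cd x = B \<Longrightarrow> H'.prm \<bullet> H'.m2 \<bullet> a \<bullet> x = \<zero> (dm x) (B \<otimes> B) \<Longrightarrow>
      a \<bullet> x = \<zero> (dm x) (B \<otimes> B)"
begin

lemma data_simps [simp]: "arr a" "dm a = B" "cd a = B \<otimes> B" "arr l" "dm l = V" "cd l = B"
  "arr r" "dm r = B" "cd r = V" "arr \<gamma>" "dm \<gamma> = B" "cd \<gamma> = B"
  using a_hom l_hom r_hom \<gamma>_hom by (simp_all add: hom_def)

lemma aug'_nonzero: "H'.aug \<noteq> \<zero> B B"
  by (rule not_trivial[OF H'.augmented_algebra_axioms V_simple])

lemma aug'_not_square: "hom B (B \<otimes> B) y \<Longrightarrow> H'.aug \<noteq> H'.m2 \<bullet> y"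
  using H'.nilpotent_aug_if_connected[OF connected'] H'.aug_zero_if_square aug'_nonzero by metis

text \<open>Coconnectedness yields a nonzero primitive part. \<open>r\<close> does not vanish on it,
  and a nonzero morphism onto the simple object V splits.\<close>

lemma primitive':
  obtains i where "hom V B i" "H'.prm \<bullet> i = \<zero> V (B \<otimes> B)" "r \<bullet> i = Id V"
proof -
  obtain g where g: "hom (B \<otimes> B) B g" "H'.prm \<bullet> g \<bullet> H'.prm = H'.prm" using pseudo_inverse[of H'.prm] by auto
  have [simp]: "arr g" "dm g = B \<otimes> B" "cd g = B" using g(1) by (simp_all add: hom_def)
  \<comment> \<open>The projection onto the kernel of \<open>H'.prm\<close>. If it were zero,
    \<open>H'.prm\<close> would have a left inverse.\<close>
  define x where "x = Id B \<uplus> \<ominus> (g \<bullet> H'.prm)"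
  have [simp]: "arr x" "dm x = B" "cd x = B" by (simp_all add: x_def)
  have prim: "H'.prm \<bullet> x = \<zero> B (B \<otimes> B)" using g(2) by (simp add: x_def distribs)
  have "x \<noteq> \<zero> B B"
  proof
    assume "x = \<zero> B B"
    hence "Id B = g \<bullet> H'.prm" unfolding x_def by (rule eq_if_diff_zero) simp_all
    thus False using H'.aug_zero_if_no_primitives[OF coconnected' g(1)] aug'_nonzero by metis
  qed
  hence "r \<bullet> x \<noteq> \<zero> B V" using primitives[of x] prim by auto
  then obtain s where s: "hom V B s" "(r \<bullet> x) \<bullet> s = Id V"
    using simple_epi_split[OF V_simple, of B "r \<bullet> x"] by (auto simp: hom_def)
  show ?thesis
  proof (rule that[of "x \<bullet> s"])
    have "(H'.prm \<bullet> x) \<bullet> s = \<zero> V (B \<otimes> B)" unfolding prim using s(1) by (simp add: hom_def)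
    thus "H'.prm \<bullet> x \<bullet> s = \<zero> V (B \<otimes> B)" by simp
  qed (use s in \<open>simp_all add: hom_def\<close>)
qed

lemma expand':
  assumes "arr x" "cd x = B"
  shows "x = u' \<bullet> \<epsilon> \<bullet> \<gamma> \<bullet> x \<uplus> (l \<bullet> \<pi> 1 \<bullet> \<gamma> \<bullet> x \<uplus> H'.m2 \<bullet> a \<bullet> \<gamma> \<bullet> x)"
  using arg_cong[OF generators(1), of "\<lambda>y. y \<bullet> x"] assms by (simp add: distribs)

lemma \<gamma>_u': "\<gamma> \<bullet> u' = u"
  using arg_cong[OF generators(2), of "\<lambda>y. y \<bullet> u"] by (simp add: distribs a_u)

text \<open>If the V-coordinate were nonzero on J^2, simplicity would place the augmentation part of
  \<open>l\<close> inside J^2. Then J = J^2, against Nakayama.\<close>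

lemma derivation': "(\<pi> 1 \<bullet> \<gamma>) \<bullet> H'.m2 = \<zero> (B \<otimes> B) V"
proof (rule ccontr)
  assume "(\<pi> 1 \<bullet> \<gamma>) \<bullet> H'.m2 \<noteq> \<zero> (B \<otimes> B) V"
  then obtain s where s: "hom V (B \<otimes> B) s" "((\<pi> 1 \<bullet> \<gamma>) \<bullet> H'.m2) \<bullet> s = Id V"
    using simple_epi_split[OF V_simple, of "B \<otimes> B" "(\<pi> 1 \<bullet> \<gamma>) \<bullet> H'.m2"] by (auto simp: hom_def)
  have [simp]: "arr s" "dm s = V" "cd s = B \<otimes> B" using s(1) by (simp_all add: hom_def)
  have ps: "\<pi> 1 \<bullet> \<gamma> \<bullet> H'.m2 \<bullet> s = Id V" using s(2) by simp
  have au: "H'.aug \<bullet> u' \<bullet> x = \<zero> (dm x) B" for x using H'.aug_u[THEN cmp_reassoc, of x] by simp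
  have am: "H'.aug \<bullet> H'.m2 \<bullet> x = H'.m2 \<bullet> x" for x using H'.aug_m2[THEN cmp_reassoc, of x] by simp
  have "H'.aug \<bullet> H'.m2 \<bullet> s = H'.aug \<bullet> (u' \<bullet> \<epsilon> \<bullet> \<gamma> \<bullet> H'.m2 \<bullet> s \<uplus>
      (l \<bullet> \<pi> 1 \<bullet> \<gamma> \<bullet> H'.m2 \<bullet> s \<uplus> H'.m2 \<bullet> a \<bullet> \<gamma> \<bullet> H'.m2 \<bullet> s))"
    using expand'[of "H'.m2 \<bullet> s"] by simp
  hence 1: "H'.m2 \<bullet> s = H'.aug \<bullet> l \<uplus> H'.m2 \<bullet> a \<bullet> \<gamma> \<bullet> H'.m2 \<bullet> s"
    unfolding ps by (simp add: distribs au am)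
  \<comment> \<open>Solving the expansion of \<open>H'.m2 \<bullet> s\<close> for the V-term writes
    \<open>H'.aug \<bullet> l\<close> as the product \<open>H'.m2 \<bullet> t\<close>.\<close>
  define t where "t = s \<uplus> \<ominus> (a \<bullet> \<gamma> \<bullet> H'.m2 \<bullet> s)"
  have [simp]: "arr t" "dm t = V" "cd t = B \<otimes> B" by (simp_all add: t_def)
  have "H'.m2 \<bullet> t = (H'.aug \<bullet> l \<uplus> H'.m2 \<bullet> a \<bullet> \<gamma> \<bullet> H'.m2 \<bullet> s) \<uplus> \<ominus> (H'.m2 \<bullet> a \<bullet> \<gamma> \<bullet> H'.m2 \<bullet> s)"
    unfolding t_def 1[symmetric] by (simp add: distribs)
  hence al: "H'.aug \<bullet> l = H'.m2 \<bullet> t" by (simp add: add_assoc')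
  have "H'.aug \<bullet> Id B = H'.aug \<bullet> (u' \<bullet> \<epsilon> \<bullet> \<gamma> \<uplus> (l \<bullet> \<pi> 1 \<bullet> \<gamma> \<uplus> H'.m2 \<bullet> a \<bullet> \<gamma>))"
    using expand'[of "Id B"] by simp
  also have "\<dots> = H'.m2 \<bullet> (t \<bullet> \<pi> 1 \<bullet> \<gamma> \<uplus> a \<bullet> \<gamma>)"
    using al[THEN cmp_reassoc', of "\<pi> 1 \<bullet> \<gamma>"] by (simp add: distribs au am)
  finally have "H'.aug = H'.m2 \<bullet> (t \<bullet> \<pi> 1 \<bullet> \<gamma> \<uplus> a \<bullet> \<gamma>)" by simp
  thus False using aug'_not_square[of "t \<bullet> \<pi> 1 \<bullet> \<gamma> \<uplus> a \<bullet> \<gamma>"] by (simp add: hom_def)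
qed

text \<open>The composite from the primitives to J/J^2 is nonzero, so by Schur it can be rescaled to
  the identity of V.\<close>

lemma split_primitive':
  obtains i where "hom V B i" "H'.prm \<bullet> i = \<zero> V (B \<otimes> B)" "(\<pi> 1 \<bullet> \<gamma>) \<bullet> i = Id V"
proof -
  obtain i where i: "hom V B i" "H'.prm \<bullet> i = \<zero> V (B \<otimes> B)" "r \<bullet> i = Id V" by (rule primitive')
  have [simp]: "arr i" "dm i = V" "cd i = B" using i(1) by (simp_all add: hom_def)
  have \<epsilon>i: "\<epsilon>' \<bullet> i = \<zero> V \<one>" using H'.primitive_counit[of i] i(2) by simp
  have "\<pi> 1 \<bullet> \<gamma> \<bullet> i \<noteq> \<zero> V V"
  proof
    assume z: "\<pi> 1 \<bullet> \<gamma> \<bullet> i = \<zero> V V"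
    \<comment> \<open>With V-coordinate zero, \<open>i\<close> is a scalar plus a decomposable part.
      The counit removes the scalar, and a decomposable primitive vanishes by
      \<open>decomposables\<close>.\<close>
    have e: "i = u' \<bullet> \<epsilon> \<bullet> \<gamma> \<bullet> i \<uplus> H'.m2 \<bullet> a \<bullet> \<gamma> \<bullet> i" using expand'[of i] z by simp
    have "\<epsilon>' \<bullet> i = \<epsilon>' \<bullet> (u' \<bullet> \<epsilon> \<bullet> \<gamma> \<bullet> i \<uplus> H'.m2 \<bullet> a \<bullet> \<gamma> \<bullet> i)" using e by (rule arg_cong)
    hence "\<epsilon> \<bullet> \<gamma> \<bullet> i = \<zero> V \<one>" using \<epsilon>i by (simp add: distribs)
    hence e': "i = H'.m2 \<bullet> a \<bullet> \<gamma> \<bullet> i" using e by simp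
    have "H'.prm \<bullet> H'.m2 \<bullet> a \<bullet> \<gamma> \<bullet> i = \<zero> V (B \<otimes> B)" unfolding e'[symmetric] by (rule i(2))
    hence "a \<bullet> \<gamma> \<bullet> i = \<zero> V (B \<otimes> B)" using decomposables[of "\<gamma> \<bullet> i"] by simp
    hence "H'.m2 \<bullet> a \<bullet> \<gamma> \<bullet> i = \<zero> V B" by simp
    hence "i = \<zero> V B" using e' by (rule trans[rotated])
    hence "Id V = \<zero> V V" using i(3) by simp
    thus False using V_simple by (simp add: simple_def zero_ob_iff)
  qed
  then obtain c where c: "hom V V c" "(\<pi> 1 \<bullet> \<gamma> \<bullet> i) \<bullet> c = Id V"
    using simple_epi_split[OF V_simple, of V "\<pi> 1 \<bullet> \<gamma> \<bullet> i"] by (auto simp: hom_def)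
  have [simp]: "arr c" "dm c = V" "cd c = V" using c(1) by (simp_all add: hom_def)
  show ?thesis
    by (rule that[of "i \<bullet> c"]) (use c(2) i(2)[THEN cmp_reassoc, of c] in \<open>simp_all add: hom_def\<close>)
qed

lemma hopf_iso:
  obtains h k where "hom B B h" "hom B B k" "h \<bullet> k = Id B" "k \<bullet> h = Id B"
    "h \<bullet> m' = m \<bullet> (h \<star> h)" "h \<bullet> u' = u" "(h \<star> h) \<bullet> \<Delta>' = \<Delta> \<bullet> h" "\<epsilon>' = \<epsilon> \<bullet> h" "h \<bullet> S' = S \<bullet> h"
proof -
  obtain i where i: "hom V B i" "H'.prm \<bullet> i = \<zero> V (B \<otimes> B)" "(\<pi> 1 \<bullet> \<gamma>) \<bullet> i = Id V" by (rule split_primitive')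
  have [simp]: "arr i" "dm i = V" "cd i = B" using i(1) by (simp_all add: hom_def)
  let ?p = "\<pi> 1 \<bullet> \<gamma>"
  interpret H'': hopf_primitive C B m' u' \<epsilon>' \<Delta>' S' V i ?p
  proof unfold_locales
    show "hom V B i" "hom B V ?p" using i(1) by (simp_all add: hom_def)
    show "?p \<bullet> u' = \<zero> \<one> V" by (simp add: \<gamma>_u')
  qed (fact i(2,3) derivation')+
  have "H'.aug \<bullet> u' \<bullet> x = \<zero> (dm x) B" for x using H'.aug_u[THEN cmp_reassoc, of x] by simp
  note au = this
  have am: "H'.aug \<bullet> H'.m2 \<bullet> x = H'.m2 \<bullet> x" for x using H'.aug_m2[THEN cmp_reassoc, of x] by simp
  have ai: "H'.aug \<bullet> i = i" by (rule H'.aug_fix) (simp_all add: H''.\<epsilon>_i)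
  have pi: "\<pi> 1 \<bullet> \<gamma> \<bullet> i = Id V" using i(3) by simp
  have "H'.aug \<bullet> i = H'.aug \<bullet> (u' \<bullet> \<epsilon> \<bullet> \<gamma> \<bullet> i \<uplus> (l \<bullet> \<pi> 1 \<bullet> \<gamma> \<bullet> i \<uplus> H'.m2 \<bullet> a \<bullet> \<gamma> \<bullet> i))"
    using expand'[of i] by simp
  hence 1: "i = H'.aug \<bullet> l \<uplus> H'.m2 \<bullet> a \<bullet> \<gamma> \<bullet> i" unfolding pi ai by (simp add: distribs au am)
  have al: "H'.aug \<bullet> l = i \<uplus> \<ominus> (H'.m2 \<bullet> a \<bullet> \<gamma> \<bullet> i)"
  proof -
    have "i \<uplus> \<ominus> (H'.m2 \<bullet> a \<bullet> \<gamma> \<bullet> i) = (H'.aug \<bullet> l \<uplus> H'.m2 \<bullet> a \<bullet> \<gamma> \<bullet> i) \<uplus> \<ominus> (H'.m2 \<bullet> a \<bullet> \<gamma> \<bullet> i)"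
      unfolding 1[symmetric] ..
    thus ?thesis by (simp add: add_assoc')
  qed
  \<comment> \<open>Replacing \<open>l\<close> by the primitive \<open>i\<close> changes it by a
    decomposable part, which \<open>y\<close> compensates.\<close>
  define y where "y = a \<bullet> \<gamma> \<uplus> \<ominus> (a \<bullet> \<gamma> \<bullet> i \<bullet> ?p)"
  have y: "hom B (B \<otimes> B) y" by (simp add: y_def hom_def)
  have "H'.aug \<bullet> Id B = H'.aug \<bullet> (u' \<bullet> \<epsilon> \<bullet> \<gamma> \<uplus> (l \<bullet> \<pi> 1 \<bullet> \<gamma> \<uplus> H'.m2 \<bullet> a \<bullet> \<gamma>))"
    using expand'[of "Id B"] by simp
  also have "\<dots> = (H'.aug \<bullet> l) \<bullet> ?p \<uplus> H'.m2 \<bullet> a \<bullet> \<gamma>" by (simp add: distribs au am)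
  also have "\<dots> = i \<bullet> ?p \<uplus> H'.m2 \<bullet> y"
    unfolding al y_def by (simp add: distribs add_ac')
  finally have dec': "H'.aug = i \<bullet> ?p \<uplus> H'.m2 \<bullet> y" by simp
  obtain n' where n': "mpow m' H'.aug n' = \<zero> (tensor_power C B n') B"
    using H'.nilpotent_aug_if_connected[OF connected'] .
  \<comment> \<open>The map \<open>a\<close> decomposes elements of the primed algebra; the
    decomposition of \<open>aug\<close> in the Nichols algebra itself is supplied
    separately.\<close>
  obtain a1 where a1: "hom B (B \<otimes> B) a1" "aug = \<iota> 1 \<bullet> \<pi> 1 \<uplus> m2 \<bullet> a1" by (rule generation)
  interpret generated_hopf_pair C B m u \<epsilon> \<Delta> S V "\<iota> 1" "\<pi> 1" m' u' \<epsilon>' \<Delta>' S' i ?p "\<pi> 1" a1 N ?p y n'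
  proof unfold_locales
    show "x = \<zero> (dm x) B" if "\<And>x. Q x \<Longrightarrow> arr x \<and> cd x = B \<and> \<epsilon> \<bullet> x = \<zero> (dm x) \<one> \<and>
        (\<exists>z t. Q z \<and> arr t \<and> cd t = dm z \<otimes> V \<and> der \<bullet> x = (z \<star> Id V) \<bullet> t)" "Q x" for Q x
      using that by (rule cogeneration)
  qed (fact p_hom a1 nilpotent_aug H''.p_hom y dec' n')+
  show ?thesis using exists_hopf_iso that by blast
qed

end

section \<open>Genericity\<close>

context braided_fusion_category
begin

text \<open>Morphism-valued polynomial maps on the affine space of structures. The rule
  \<open>eq_on\<close> is needed because the identities between such maps hold only where the data
  have the right types.\<close>

inductive poly_mor :: "'o \<Rightarrow> 'o \<Rightarrow> 'o \<Rightarrow> ('m hopf_data \<Rightarrow> 'm) \<Rightarrow> bool" for b x y where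
  scale: "polynomial_function C b c \<Longrightarrow> hom x y f \<Longrightarrow> poly_mor b x y (\<lambda>R. c R \<triangleright> f)"
| add: "poly_mor b x y f \<Longrightarrow> poly_mor b x y g \<Longrightarrow> poly_mor b x y (\<lambda>R. f R \<uplus> g R)"
| eq_on: "poly_mor b x y f \<Longrightarrow> (\<And>R. R \<in> structure_space C b \<Longrightarrow> g R = f R) \<Longrightarrow> poly_mor b x y g"

lemma poly_mor_hom: "poly_mor b x y f \<Longrightarrow> R \<in> structure_space C b \<Longrightarrow> hom x y (f R)"
  by (induction rule: poly_mor.induct) (simp_all add: hom_def)

lemma poly_mor_const:
  assumes "hom x y f"
  shows "poly_mor b x y (\<lambda>R. f)"
proof -
  have "poly_mor b x y (\<lambda>R. 1 \<triangleright> f)"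
    by (rule poly_mor.scale[OF polynomial_function.const assms])
  thus ?thesis using homD(1)[OF assms] by simp
qed

text \<open>Covers composition and tensor product at once; bilinearity reduces to scaled constant
  morphisms.\<close>

lemma poly_mor_bilinear:
  assumes hom: "\<And>f g. hom x y f \<Longrightarrow> hom x' y' g \<Longrightarrow> hom x'' y'' (F f g)"
    and scl: "\<And>f g s t. hom x y f \<Longrightarrow> hom x' y' g \<Longrightarrow> F (s \<triangleright> f) (t \<triangleright> g) = (s * t) \<triangleright> F f g"
    and add_left: "\<And>f f' g. hom x y f \<Longrightarrow> hom x y f' \<Longrightarrow> hom x' y' g \<Longrightarrow> F (f \<uplus> f') g = F f g \<uplus> F f' g"
    and add_right: "\<And>f g g'. hom x y f \<Longrightarrow> hom x' y' g \<Longrightarrow> hom x' y' g' \<Longrightarrow> F f (g \<uplus> g') = F f g \<uplus> F f g'"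
    and f: "poly_mor b x y f" and g: "poly_mor b x' y' g"
  shows "poly_mor b x'' y'' (\<lambda>R. F (f R) (g R))"
  using f
proof (induction rule: poly_mor.induct)
  case (scale c f0)
  note c = scale.hyps
  have f0: "hom x y (c R \<triangleright> f0)" for R using c(2) by (simp add: hom_def)
  show ?case
    using g
  proof (induction rule: poly_mor.induct)
    case (scale d g0)
    have "poly_mor b x'' y'' (\<lambda>R. (c R * d R) \<triangleright> F f0 g0)"
      by (intro poly_mor.scale polynomial_function.mult c scale hom)
    thus ?case by (rule poly_mor.eq_on) (simp add: scl c scale)
  next
    case (add g g')
    show ?case
      by (rule poly_mor.eq_on[OF poly_mor.add[OF add.IH]])
         (simp add: add_right[OF f0] poly_mor_hom[OF add.hyps(1)] poly_mor_hom[OF add.hyps(2)])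
  next
    case (eq_on g g')
    show ?case by (rule poly_mor.eq_on[OF eq_on.IH]) (simp add: eq_on.hyps)
  qed
next
  case (add f f')
  show ?case
    by (rule poly_mor.eq_on[OF poly_mor.add[OF add.IH]])
       (simp add: add_left poly_mor_hom[OF g] poly_mor_hom[OF add.hyps(1)] poly_mor_hom[OF add.hyps(2)])
next
  case (eq_on f f')
  show ?case by (rule poly_mor.eq_on[OF eq_on.IH]) (simp add: eq_on.hyps)
qed

lemma poly_mor_cmp:
  assumes "poly_mor b y z g" "poly_mor b x y f"
  shows "poly_mor b x z (\<lambda>R. g R \<bullet> f R)"
  by (rule poly_mor_bilinear[OF _ _ _ _ assms]) (simp_all add: hom_def distribs mult.commute)

lemma poly_mor_tns:
  assumes "poly_mor b x y f" "poly_mor b x' y' g"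
  shows "poly_mor b (x \<otimes> x') (y \<otimes> y') (\<lambda>R. f R \<star> g R)"
  by (rule poly_mor_bilinear[OF _ _ _ _ assms]) (simp_all add: hom_def distribs mult.commute)

lemma poly_mor_ngt:
  assumes "poly_mor b x y f" "x \<in> Ob"
  shows "poly_mor b x y (\<lambda>R. \<ominus> f R)"
proof -
  have "poly_mor b x y (\<lambda>R. f R \<bullet> \<ominus> Id x)"
    by (rule poly_mor_cmp[OF assms(1) poly_mor_const]) (use assms(2) in \<open>simp add: hom_def\<close>)
  thus ?thesis
    by (rule poly_mor.eq_on) (use poly_mor_hom[OF assms(1)] in \<open>simp add: hom_def\<close>)
qed

lemma poly_mor_functional:
  assumes add: "\<And>f g. hom x y f \<Longrightarrow> hom x y g \<Longrightarrow> c (f \<uplus> g) = c f + c g"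
    and scl: "\<And>f r. hom x y f \<Longrightarrow> c (r \<triangleright> f) = r * c f" and f: "poly_mor b x y f"
  shows "\<exists>p. polynomial_function C b p \<and> (\<forall>R\<in>structure_space C b. p R = c (f R))"
  using f
proof (induction rule: poly_mor.induct)
  case (scale d f)
  show ?case
    by (rule exI[of _ "\<lambda>R. d R * c f"])
       (simp add: scl scale polynomial_function.mult polynomial_function.const)
next
  case (add f g)
  then obtain p q where "polynomial_function C b p" "\<forall>R\<in>structure_space C b. p R = c (f R)"
    "polynomial_function C b q" "\<forall>R\<in>structure_space C b. q R = c (g R)" by blast
  thus ?case
    by (intro exI[of _ "\<lambda>R. p R + q R"])
       (simp add: assms(1) poly_mor_hom[OF add.hyps(1)] poly_mor_hom[OF add.hyps(2)] polynomial_function.add)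
qed auto

text \<open>The projections of the affine space to its factors are linear, so their coordinates in a
  spanning family are linear forms.\<close>

lemma poly_mor_linear:
  assumes [simp]: "x \<in> Ob" "y \<in> Ob" and sel: "\<And>R. R \<in> structure_space C b \<Longrightarrow> hom x y (sel R)"
    and add: "\<And>R R'. sel (add_data C R R') = sel R \<oplus> sel R'"
    and scl: "\<And>s R. sel (scale_data C s R) = s \<odot> sel R"
  shows "poly_mor b x y sel"
proof -
  obtain n e c where fam: "family x y e n" and c: "\<And>f. hom x y f \<Longrightarrow> f = lincomb x y e n (c f)"
    "\<And>f g i. hom x y f \<Longrightarrow> hom x y g \<Longrightarrow> c (f \<uplus> g) i = c f i + c g i"
    "\<And>f r i. hom x y f \<Longrightarrow> c (r \<triangleright> f) i = r * c f i"
    by (rule Hom_basis[of x y]) auto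
  have "linear_form C b (\<lambda>R. c (sel R) i)" for i
    unfolding linear_form_def
  proof (intro conjI ballI allI)
    fix R R' assume "R \<in> structure_space C b" "R' \<in> structure_space C b"
    hence h: "hom x y (sel R)" "hom x y (sel R')" by (simp_all add: sel)
    thus "c (sel (add_data C R R')) i = c (sel R) i + c (sel R') i"
      using c(2)[OF h] by (simp add: add tot hom_def)
  next
    fix s R assume "R \<in> structure_space C b"
    hence h: "hom x y (sel R)" by (rule sel)
    thus "c (sel (scale_data C s R)) i = s * c (sel R) i"
      using c(3)[OF h] by (simp add: scl tot hom_def)
  qed
  hence p: "polynomial_function C b (\<lambda>R. c (sel R) i)" for i by (rule polynomial_function.linear)
  have "poly_mor b x y (\<lambda>R. lincomb x y e k (c (sel R)))" if "k \<le> n" for k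
    using that
  proof (induction k)
    case 0
    show ?case unfolding lincomb_def by (simp, rule poly_mor_const) (simp add: hom_def)
  next
    case (Suc k)
    hence "hom x y (e k)" using fam by (simp add: family_def hom_def)
    hence "poly_mor b x y (\<lambda>R. c (sel R) k \<triangleright> e k)" by (rule poly_mor.scale[OF p])
    thus ?case using poly_mor.add[OF Suc.IH] Suc.prems by (simp add: lincomb_def)
  qed
  from this[of n] show ?thesis by (rule poly_mor.eq_on[OF _ c(1)[OF sel]]) simp
qed

lemma poly_mor_structure:
  assumes "b \<in> Ob"
  shows "poly_mor b (b \<otimes> b) b mult" "poly_mor b \<one> b unt" "poly_mor b b (b \<otimes> b) comult" "poly_mor b b \<one> counit"
  by (rule poly_mor_linear; use assms in \<open>simp add: structure_space_def Hom_hom add_data_def scale_data_def\<close>)+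

text \<open>A right inverse of \<Phi>(R) is a solution of a linear system with polynomial
  coefficients, to which \<open>solvability_open\<close> applies; in a finite-dimensional
  endomorphism algebra it is two-sided.\<close>

lemma poly_mor_invertible_open:
  assumes \<Phi>: "poly_mor b a a \<Phi>" and R0: "R0 \<in> structure_space C b" "\<Phi> R0 = Id a" and [simp]: "a \<in> Ob"
  obtains p where "polynomial_function C b p" "p R0 \<noteq> 0"
    "\<And>R. R \<in> structure_space C b \<Longrightarrow> p R \<noteq> 0 \<Longrightarrow> \<exists>\<gamma>. hom a a \<gamma> \<and> \<Phi> R \<bullet> \<gamma> = Id a \<and> \<gamma> \<bullet> \<Phi> R = Id a"
proof -
  obtain n e c where fam: "family a a e n" and c: "\<And>f. hom a a f \<Longrightarrow> f = lincomb a a e n (c f)"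
    "\<And>f g i. hom a a f \<Longrightarrow> hom a a g \<Longrightarrow> c (f \<uplus> g) i = c f i + c g i"
    "\<And>f r i. hom a a f \<Longrightarrow> c (r \<triangleright> f) i = r * c f i"
    by (rule Hom_basis[of a a]) auto
  have e [simp]: "arr (e j)" "dm (e j) = a" "cd (e j) = a" if "j < n" for j
    using fam that by (simp_all add: family_def)
  \<comment> \<open>Since \<open>e\<close> may be linearly dependent, the coordinates of
    \<open>e j\<close> need not form a unit vector. Splitting off the identity and taking
    coordinates of the difference only makes the matrix \<open>A\<close> the identity at
    \<open>R0\<close>.\<close>
  define K where "K j R = (\<Phi> R \<uplus> \<ominus> Id a) \<bullet> e j" for j R
  have PK: "poly_mor b a a (K j)" if "j < n" for j
    unfolding K_def by (intro poly_mor_cmp poly_mor.add poly_mor_const) (use that \<Phi> in \<open>simp_all add: hom_def\<close>)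
  have "\<exists>p. polynomial_function C b p \<and> (j < n \<longrightarrow> (\<forall>R\<in>structure_space C b. p R = c (K j R) i))" for i j
  proof (cases "j < n")
    case True
    thus ?thesis using poly_mor_functional[of a a "\<lambda>f. c f i", OF c(2,3) PK[of j]] by blast
  next
    case False
    thus ?thesis using polynomial_function.const[of C b 0] by blast
  qed
  hence "\<exists>p. \<forall>i j. polynomial_function C b (p i j) \<and> (j < n \<longrightarrow> (\<forall>R\<in>structure_space C b. p i j R = c (K j R) i))"
    by (intro choice allI)
  then obtain p where p: "\<And>i j. polynomial_function C b (p i j)"
    "\<And>i j R. j < n \<Longrightarrow> R \<in> structure_space C b \<Longrightarrow> p i j R = c (K j R) i" by blast
  define A where "A i j R = (if i = j then 1 else 0) + p i j R" for i j :: nat and R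
  have PA: "polynomial_function C b (A i j)" for i j
    unfolding A_def by (intro polynomial_function.add polynomial_function.const p)
  have hK: "hom a a (K j R)" if "j < n" "R \<in> structure_space C b" for j R
    by (rule poly_mor_hom[OF PK[OF that(1)] that(2)])
  have "c (\<zero> a a) i = 0" for i using c(3)[of "\<zero> a a" 0 i] by (simp add: hom_def)
  moreover have "K j R0 = \<zero> a a" if "j < n" for j using that R0(2) by (simp add: K_def)
  ultimately have A0: "A i j R0 = (if i = j then 1 else 0)" if "j < n" for i j
    using that p(2)[OF that R0(1), of i] by (simp add: A_def)
  have "(\<Sum>j<n. A i j R0 * z j) = z i" if "i < n" for i z
  proof -
    have "(\<Sum>j<n. A i j R0 * z j) = (\<Sum>j<n. if j = i then z j else 0)"
      by (rule sum.cong) (auto simp: A0)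
    thus ?thesis using that by simp
  qed
  hence sol0: "\<exists>z. \<forall>i<n. (\<Sum>j<n. A i j R0 * z j) = d i" for d by (intro exI[of _ d]) simp
  have "\<exists>q. polynomial_function C b q \<and> q R0 \<noteq> 0 \<and>
      (\<forall>R. q R \<noteq> 0 \<longrightarrow> (\<forall>d. \<exists>z. \<forall>i<n. (\<Sum>j<n. A i j R * z j) = d i))"
  proof (rule solvability_open)
    show "polynomial_function C b (\<lambda>_. 1)" by (rule polynomial_function.const)
    show "polynomial_function C b (\<lambda>x. p x * q x)" if "polynomial_function C b p" "polynomial_function C b q" for p q
      using that by (rule polynomial_function.mult)
    show "polynomial_function C b (\<lambda>x. p x - q x)" if "polynomial_function C b p" "polynomial_function C b q" for p q
      using polynomial_function.add[OF that(1) polynomial_function.mult[OF polynomial_function.const[of C b "-1"] that(2)]]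
      by simp
  qed (use PA sol0 in simp_all)
  then obtain q where q: "polynomial_function C b q" "q R0 \<noteq> 0"
    "\<And>R d. q R \<noteq> 0 \<Longrightarrow> \<exists>z. \<forall>i<n. (\<Sum>j<n. A i j R * z j) = d i" by blast
  show ?thesis
  proof (rule that[OF q(1,2)])
    fix R assume R: "R \<in> structure_space C b" "q R \<noteq> 0"
    \<comment> \<open>The solution for the coordinates of \<open>Id a\<close> combines the spanning
      family into a right inverse.\<close>
    obtain z where z: "\<And>i. i < n \<Longrightarrow> (\<Sum>j<n. A i j R * z j) = c (Id a) i" using q(3)[OF R(2), of "c (Id a)"] by blast
    have \<Phi>R: "hom a a (\<Phi> R)" by (rule poly_mor_hom[OF \<Phi> R(1)])
    hence [simp]: "arr (\<Phi> R)" "dm (\<Phi> R) = a" "cd (\<Phi> R) = a" by (simp_all add: hom_def)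
    let ?\<gamma> = "lincomb a a e n z"
    have col: "\<Phi> R \<bullet> e j = lincomb a a e n (\<lambda>i. A i j R)" if j: "j < n" for j
    proof -
      let ?\<delta> = "\<lambda>i. if i = j then 1 else 0"
      have "lincomb a a e k ?\<delta> = (if j < k then e j else \<zero> a a)" if "k \<le> n" for k
        using that j by (induction k) (auto simp: lincomb_def less_Suc_eq)
      hence ej: "lincomb a a e n ?\<delta> = e j" using j by simp
      have Kj: "lincomb a a e n (c (K j R)) = K j R" by (rule c(1)[OF hK[OF j R(1)], symmetric])
      have "\<Phi> R \<bullet> e j = e j \<uplus> K j R"
        using j add_commute'[of "\<Phi> R \<bullet> e j" "\<ominus> e j"] by (simp add: K_def distribs)
      also have "\<dots> = lincomb a a e n ?\<delta> \<uplus> lincomb a a e n (c (K j R))"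
        by (simp only: ej Kj)
      also have "\<dots> = lincomb a a e n (\<lambda>i. A i j R)"
        unfolding lincomb_add[OF fam, symmetric] by (rule lincomb_cong) (simp add: A_def p(2)[OF j R(1)])
      finally show ?thesis .
    qed
    have "\<Phi> R \<bullet> ?\<gamma> = tsum a a (\<lambda>j. z j \<triangleright> lincomb a a e n (\<lambda>i. A i j R)) n"
      unfolding lincomb_def[of a a e n z] by (simp add: cmp_tsum) (rule tsum_cong, simp add: col)
    also have "\<dots> = lincomb a a e n (\<lambda>i. \<Sum>j<n. A i j R * z j)" by (rule tsum_lincomb[OF fam])
    also have "\<dots> = lincomb a a e n (c (Id a))" by (rule lincomb_cong) (rule z)
    also have "\<dots> = Id a" by (rule c(1)[symmetric]) (simp add: hom_def)
    finally have 1: "\<Phi> R \<bullet> ?\<gamma> = Id a" .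
    have "hom a a ?\<gamma>" by (simp add: hom_def)
    moreover have "?\<gamma> \<bullet> \<Phi> R = Id a" by (rule left_inverse_imp_right_inverse[OF _ _ 1]) (simp_all add: hom_def)
    ultimately show "\<exists>\<gamma>. hom a a \<gamma> \<and> \<Phi> R \<bullet> \<gamma> = Id a \<and> \<gamma> \<bullet> \<Phi> R = Id a" using 1 by blast
  qed
qed

lemma fd_nichols_algebra_nichols:
  assumes "fd_nichols_algebra C v b R"
  obtains X \<iota> \<pi> N where "nichols C b (mult R) (unt R) (counit R) (comult R) (antipode R) v X \<iota> \<pi> N"
proof -
  obtain X \<iota> \<pi> where gr: "hopf_grading C b R X \<iota> \<pi>" and X: "X 0 = \<one>" "X 1 = v"
    and gen: "generated_by C b (mult R) (unt R) v (\<iota> 1)"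
    and ker: "kernel C v (\<iota> 1) b (b \<otimes> b) (primitive_map C b R)"
    using assms unfolding fd_nichols_algebra_def by (elim conjE exE) (rule that)
  interpret hopf C b "mult R" "unt R" "counit R" "comult R" "antipode R"
  proof (rule hopf_algebra_hopf)
    show "hopf_algebra C b R" using assms unfolding fd_nichols_algebra_def by (elim conjE)
  qed
  note gr = gr[unfolded hopf_grading_def]
  note gr1 = conjunct1[OF gr] and gr2 = conjunct2[OF gr, THEN conjunct1]
    and gr3 = conjunct2[OF gr, THEN conjunct2, THEN conjunct1]
    and gr4 = conjunct2[OF gr, THEN conjunct2, THEN conjunct2, THEN conjunct1]
    and gr5 = conjunct2[OF gr, THEN conjunct2, THEN conjunct2, THEN conjunct2, THEN conjunct1]
    and gr6 = conjunct2[OF gr, THEN conjunct2, THEN conjunct2, THEN conjunct2, THEN conjunct2, THEN conjunct1]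
  obtain N where N: "direct_sum C b N X \<iota> \<pi>" "\<forall>n\<ge>N. zero_ob C (X n)" using gr2 by blast
  have hom: "hom (X n) b (\<iota> n)" "hom b (X n) (\<pi> n)" for n
    using gr1 by (simp_all add: Hom_hom)
  have [simp]: "arr (\<iota> n)" "dm (\<iota> n) = X n" "cd (\<iota> n) = b" "arr (\<pi> n)" "dm (\<pi> n) = b" "cd (\<pi> n) = X n" for n
    using hom[of n] by (simp_all add: hom_def)
  have "nichols C b (mult R) (unt R) (counit R) (comult R) (antipode R) v X \<iota> \<pi> N"
  proof unfold_locales
    show "hom (X n) b (\<iota> n)" "hom b (X n) (\<pi> n)" for n by (fact hom)+
    show "zero_ob C (X n)" if "N \<le> n" for n using N that by blast
    show "\<pi> k \<bullet> mult R \<bullet> (\<iota> i \<star> \<iota> j) = \<zero> (X i \<otimes> X j) (X k)" if "k \<noteq> i + j" for i j k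
    proof -
      have "\<pi> k \<cdot> mult R \<cdot> (\<iota> i \<otimes>\<^sub>m \<iota> j) = \<zero> (X i \<otimes> X j) (X k)"
        using gr3 that by blast
      thus ?thesis by (simp add: tot)
    qed
    show "\<pi> k \<bullet> unt R = \<zero> \<one> (X k)" if "k \<noteq> 0" for k
    proof -
      have "\<pi> k \<cdot> unt R = \<zero> \<one> (X k)" using gr4 that by blast
      thus ?thesis by (simp add: tot)
    qed
    show "(\<pi> i \<star> \<pi> j) \<bullet> comult R \<bullet> \<iota> k = \<zero> (X k) (X i \<otimes> X j)" if "k \<noteq> i + j" for i j k
    proof -
      have "(\<pi> i \<otimes>\<^sub>m \<pi> j) \<cdot> comult R \<cdot> \<iota> k = \<zero> (X k) (X i \<otimes> X j)"
        using gr5 that by blast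
      thus ?thesis by (simp add: tot)
    qed
    show "counit R \<bullet> \<iota> k = \<zero> (X k) \<one>" if "k \<noteq> 0" for k
    proof -
      have "counit R \<cdot> \<iota> k = \<zero> (X k) \<one>" using gr6 that by blast
      thus ?thesis by (simp add: tot)
    qed
    have "primitive_map C b R = prm" by (simp add: primitive_map_def prm_def tot diff_mor_tot)
    thus "kernel C v (\<iota> 1) b (b \<otimes> b) prm" using ker by simp
  qed (fact N(1) X gen)+
  thus ?thesis by (rule that)
qed

text \<open>The comparison produces a map \<open>h\<close> from \<open>R'\<close> to
  \<open>R\<close>, while \<open>hopf_isomorphic C b R b R'\<close> asks for one starting at
  \<open>R\<close>; hence the inverse \<open>k\<close> is used.\<close>

lemma hopf_isomorphicI:
  assumes "hopf_algebra C b R" "hopf_algebra C b R'" and h: "hom b b h" "hom b b k" "h \<bullet> k = Id b" "k \<bullet> h = Id b"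
    and "h \<bullet> mult R' = mult R \<bullet> (h \<star> h)" "h \<bullet> unt R' = unt R" "(h \<star> h) \<bullet> comult R' = comult R \<bullet> h"
    "counit R' = counit R \<bullet> h" "h \<bullet> antipode R' = antipode R \<bullet> h"
  shows "hopf_isomorphic C b R b R'"
proof -
  interpret H: hopf C b "mult R" "unt R" "counit R" "comult R" "antipode R" by (rule hopf_algebra_hopf) fact
  interpret H': hopf C b "mult R'" "unt R'" "counit R'" "comult R'" "antipode R'" by (rule hopf_algebra_hopf) fact
  have [simp]: "arr h" "dm h = b" "cd h = b" "arr k" "dm k = b" "cd k = b" using h by (simp_all add: hom_def)
  have kh: "k \<bullet> h \<bullet> x = x" if "arr x" "cd x = b" for x using cmp_reassoc[OF h(4), of x] that by simp
  have "k \<bullet> mult R = k \<bullet> (mult R \<bullet> (h \<star> h)) \<bullet> (k \<star> k)" by (simp add: merge h)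
  also have "\<dots> = mult R' \<bullet> (k \<star> k)" unfolding assms(7)[symmetric] by (simp add: kh)
  finally have 1: "k \<bullet> mult R = mult R' \<bullet> (k \<star> k)" .
  have 2: "k \<bullet> unt R = unt R'" unfolding assms(8)[symmetric] by (simp add: kh)
  have "(k \<star> k) \<bullet> comult R = (k \<star> k) \<bullet> (comult R \<bullet> h) \<bullet> k" by (simp add: h)
  also have "\<dots> = comult R' \<bullet> k" unfolding assms(9)[symmetric] by (simp add: merge h)
  finally have 3: "(k \<star> k) \<bullet> comult R = comult R' \<bullet> k" .
  have 4: "counit R = counit R' \<bullet> k" unfolding assms(10) by (simp add: h)
  have "k \<bullet> antipode R = k \<bullet> (antipode R \<bullet> h) \<bullet> k" by (simp add: h)
  also have "\<dots> = antipode R' \<bullet> k" unfolding assms(11)[symmetric] by (simp add: kh)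
  finally have 5: "k \<bullet> antipode R = antipode R' \<bullet> k" .
  have "iso C b b k" unfolding iso_def using h by (intro exI[of _ h]) (simp add: inverse_arrows_tot)
  thus ?thesis unfolding hopf_isomorphic_def hopf_iso_def
    using 1 2 3 4 5 by (intro exI[of _ k]) (simp add: tot)
qed

end

section \<open>The three open conditions, and rigidity\<close>

context braided_fusion_category
begin

text \<open>This and the next two definitions are \<open>aug\<close>, \<open>m2\<close> and
  \<open>prm\<close> as functions of arbitrary structure data, so that their polynomial dependence
  can be stated.\<close>

definition unit_counit_complement :: "'o \<Rightarrow> 'm hopf_data \<Rightarrow> 'm" where
  "unit_counit_complement b Q = Id b \<uplus> \<ominus> (unt Q \<bullet> counit Q)"

definition square_mor :: "'o \<Rightarrow> 'm hopf_data \<Rightarrow> 'm" where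
  "square_mor b Q = mult Q \<bullet> (unit_counit_complement b Q \<star> unit_counit_complement b Q)"

definition primitive_mor :: "'o \<Rightarrow> 'm hopf_data \<Rightarrow> 'm" where
  "primitive_mor b Q = (comult Q \<uplus> \<ominus> ((unt Q \<star> Id b) \<bullet> li b)) \<uplus> \<ominus> ((Id b \<star> unt Q) \<bullet> ri b)"

lemma poly_mor_square:
  assumes b: "b \<in> Ob"
  shows "poly_mor b (b \<otimes> b) b (square_mor b)"
proof -
  have aug: "poly_mor b b b (unit_counit_complement b)"
    unfolding unit_counit_complement_def[abs_def]
    by (rule poly_mor.add[OF poly_mor_const poly_mor_ngt[OF poly_mor_cmp[OF poly_mor_structure(2,4)]]])
       (use b in \<open>simp_all add: hom_def\<close>)
  show ?thesis unfolding square_mor_def[abs_def]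
    by (rule poly_mor_cmp[OF poly_mor_structure(1)[OF b] poly_mor_tns[OF aug aug]])
qed

lemma poly_mor_primitive:
  assumes b: "b \<in> Ob"
  shows "poly_mor b b (b \<otimes> b) (primitive_mor b)"
proof -
  have 1: "poly_mor b (\<one> \<otimes> b) (b \<otimes> b) (\<lambda>Q. unt Q \<star> Id b)" "poly_mor b (b \<otimes> \<one>) (b \<otimes> b) (\<lambda>Q. Id b \<star> unt Q)"
    by (rule poly_mor_tns[OF poly_mor_structure(2) poly_mor_const] poly_mor_tns[OF poly_mor_const poly_mor_structure(2)],
        use b in \<open>simp_all add: hom_def\<close>)+
  have 2: "hom b (\<one> \<otimes> b) (li b)" "hom b (b \<otimes> \<one>) (ri b)" using b by (simp_all add: hom_def)
  have "poly_mor b b (b \<otimes> b) (\<lambda>Q. (unt Q \<star> Id b) \<bullet> li b)" "poly_mor b b (b \<otimes> b) (\<lambda>Q. (Id b \<star> unt Q) \<bullet> ri b)"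
    by (rule poly_mor_cmp[OF 1(1) poly_mor_const[OF 2(1)]], rule poly_mor_cmp[OF 1(2) poly_mor_const[OF 2(2)]])
  thus ?thesis unfolding primitive_mor_def[abs_def]
    by (intro poly_mor.add poly_mor_ngt poly_mor_structure b)
qed

lemma zariski_dense_orbit_point:
  assumes "R \<in> zariski_closure C b (hopf_orbit C b R')" "polynomial_function C b p" "p R \<noteq> 0"
  obtains g gi where "hom b b g" "hom b b gi" "g \<bullet> gi = Id b" "gi \<bullet> g = Id b" "inv_arr C g = gi"
    "p (transport C g R') \<noteq> 0"
proof -
  obtain Q where "Q \<in> hopf_orbit C b R'" "p Q \<noteq> 0"
    using assms unfolding zariski_closure_def by blast
  then obtain g where g: "iso C b b g" "p (transport C g R') \<noteq> 0" unfolding hopf_orbit_def by blast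
  show ?thesis
    by (rule that[of g "inv_arr C g"]) (use iso_inv[OF g(1)] g(2) in \<open>auto simp: inverse_arrows_tot hom_def\<close>)
qed

theorem fd_nichols_algebra_rigid:
  assumes V: "simple C V" and R: "fd_nichols_algebra C V B R"
  shows "rigid_hopf_algebra C B R"
proof -
  obtain X \<iota> \<pi> N where "nichols C B (mult R) (unt R) (counit R) (comult R) (antipode R) V X \<iota> \<pi> N"
    by (rule fd_nichols_algebra_nichols[OF R])
  then interpret nichols C B "mult R" "unt R" "counit R" "comult R" "antipode R" V X \<iota> \<pi> N .
  have hopf_R: "hopf_algebra C B R" using R unfolding fd_nichols_algebra_def by (elim conjE)
  have R_space: "R \<in> structure_space C B"
    by (simp add: structure_space_def Hom_iff)
  have R_ccc: "R \<in> ccc_structures C B"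
    unfolding ccc_structures_def ccc_hopf_algebra_def using hopf_R R_space connected coconnected by simp
  obtain a where a: "hom B (B \<otimes> B) a" "aug = \<iota> 1 \<bullet> \<pi> 1 \<uplus> m2 \<bullet> a" "a \<bullet> unt R = \<zero> \<one> (B \<otimes> B)"
    "a \<bullet> \<iota> 1 = \<zero> V (B \<otimes> B)" by (rule generation)
  have [simp]: "arr a" "dm a = B" "cd a = B \<otimes> B" using a(1) by (simp_all add: hom_def)
  obtain b where b: "hom (B \<otimes> B) B b" "b \<bullet> prm = Id B \<uplus> \<ominus> (\<iota> 1 \<bullet> \<pi> 1)" by (rule primitive_retract)
  have [simp]: "arr b" "dm b = B \<otimes> B" "cd b = B" using b(1) by (simp_all add: hom_def)
  let ?c = "counit R"
  \<comment> \<open>If this is invertible, a primitive of \<open>Q\<close> with zero V-coordinate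
    vanishes.\<close>
  define \<Phi>1 where "\<Phi>1 Q = b \<bullet> primitive_mor B Q \<uplus> \<iota> 1 \<bullet> \<pi> 1" for Q
  \<comment> \<open>If this is invertible, the unit of \<open>Q\<close>, V and the image of
    \<open>a\<close> under the square map span directly.\<close>
  define \<Phi>2 where "\<Phi>2 Q = unt Q \<bullet> ?c \<uplus> (\<iota> 1 \<bullet> \<pi> 1 \<uplus> square_mor B Q \<bullet> a)" for Q
  \<comment> \<open>As before, but with the decomposable part passed through \<open>b\<close> and
    the primitive map of \<open>Q\<close>; invertibility excludes nonzero primitives there.\<close>
  define \<Phi>3 where "\<Phi>3 Q = unt Q \<bullet> ?c \<uplus> (\<iota> 1 \<bullet> \<pi> 1 \<uplus> b \<bullet> primitive_mor B Q \<bullet> square_mor B Q \<bullet> a)" for Q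
  have sq: "square_mor B R = m2"
    by (simp add: square_mor_def unit_counit_complement_def m2_def aug_def)
  have pr: "primitive_mor B R = prm" by (simp add: primitive_mor_def prm_def)
  have const: "poly_mor B x y (\<lambda>Q. f)" if "hom x y f" for x y f using that by (rule poly_mor_const)
  have poly1: "poly_mor B B B \<Phi>1" unfolding \<Phi>1_def[abs_def]
    by (rule poly_mor.add poly_mor_cmp[OF const[OF b(1)] poly_mor_primitive] const | simp add: hom_def)+
  have uc: "poly_mor B B B (\<lambda>Q. unt Q \<bullet> ?c)"
    by (rule poly_mor_cmp[OF poly_mor_structure(2) const[OF \<epsilon>_hom]]) simp
  have ip: "poly_mor B B B (\<lambda>Q. \<iota> 1 \<bullet> \<pi> 1)" by (rule const) (simp add: hom_def)
  have sa: "poly_mor B B B (\<lambda>Q. square_mor B Q \<bullet> a)"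
    by (rule poly_mor_cmp[OF poly_mor_square const[OF a(1)]]) simp
  have poly2: "poly_mor B B B \<Phi>2" unfolding \<Phi>2_def[abs_def] by (intro poly_mor.add uc ip sa)
  have bpsa: "poly_mor B B B (\<lambda>Q. b \<bullet> primitive_mor B Q \<bullet> square_mor B Q \<bullet> a)"
    by (rule poly_mor_cmp[OF const[OF b(1)] poly_mor_cmp[OF poly_mor_primitive sa]]) simp
  have poly3: "poly_mor B B B \<Phi>3" unfolding \<Phi>3_def[abs_def] by (intro poly_mor.add uc ip bpsa)
  have \<Phi>1R: "\<Phi>1 R = Id B" unfolding \<Phi>1_def pr b(2) by (simp add: add_assoc')
  have \<Phi>2R: "\<Phi>2 R = Id B" unfolding \<Phi>2_def sq a(2)[symmetric] Id_aug by (simp add: add_commute')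
  \<comment> \<open>\<open>b\<close> inverts \<open>prm\<close> except on V, and products in J^2
    have no component in V.\<close>
  have "b \<bullet> prm \<bullet> m2 \<bullet> a = m2 \<bullet> a"
    using b(2)[THEN cmp_reassoc, of "m2 \<bullet> a"] by (simp add: distribs)
  hence \<Phi>3R: "\<Phi>3 R = Id B" using \<Phi>2R unfolding \<Phi>3_def \<Phi>2_def sq pr by simp
  have BOb: "B \<in> Ob" by simp
  obtain p1 where p1: "polynomial_function C B p1" "p1 R \<noteq> 0" "\<And>Q. Q \<in> structure_space C B \<Longrightarrow> p1 Q \<noteq> 0 \<Longrightarrow>
      \<exists>\<gamma>. hom B B \<gamma> \<and> \<Phi>1 Q \<bullet> \<gamma> = Id B \<and> \<gamma> \<bullet> \<Phi>1 Q = Id B"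
    by (rule poly_mor_invertible_open[OF poly1 R_space \<Phi>1R BOb]) blast
  obtain p2 where p2: "polynomial_function C B p2" "p2 R \<noteq> 0" "\<And>Q. Q \<in> structure_space C B \<Longrightarrow> p2 Q \<noteq> 0 \<Longrightarrow>
      \<exists>\<gamma>. hom B B \<gamma> \<and> \<Phi>2 Q \<bullet> \<gamma> = Id B \<and> \<gamma> \<bullet> \<Phi>2 Q = Id B"
    by (rule poly_mor_invertible_open[OF poly2 R_space \<Phi>2R BOb]) blast
  obtain p3 where p3: "polynomial_function C B p3" "p3 R \<noteq> 0" "\<And>Q. Q \<in> structure_space C B \<Longrightarrow> p3 Q \<noteq> 0 \<Longrightarrow>
      \<exists>\<gamma>. hom B B \<gamma> \<and> \<Phi>3 Q \<bullet> \<gamma> = Id B \<and> \<gamma> \<bullet> \<Phi>3 Q = Id B"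
    by (rule poly_mor_invertible_open[OF poly3 R_space \<Phi>3R BOb]) blast
  have "hopf_isomorphic C B R B R'"
    if R': "R' \<in> ccc_structures C B" and cl: "R \<in> zariski_closure C B (hopf_orbit C B R')" for R'
  proof -
    have ccc': "hopf_algebra C B R'" "connected_algebra C B (mult R') (unt R')"
      "coconnected_coalgebra C B (comult R') (counit R')"
      using R' unfolding ccc_structures_def ccc_hopf_algebra_def by blast+
    interpret H': hopf C B "mult R'" "unt R'" "counit R'" "comult R'" "antipode R'"
      by (rule hopf_algebra_hopf[OF ccc'(1)])
    \<comment> \<open>A single orbit point has to satisfy all three conditions, so the product of
      the polynomials is used.\<close>
    have "polynomial_function C B (\<lambda>Q. p1 Q * (p2 Q * p3 Q))"
      by (intro polynomial_function.mult p1 p2 p3)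
    moreover have "p1 R * (p2 R * p3 R) \<noteq> 0" using p1 p2 p3 by simp
    ultimately obtain g gi where g: "hom B B g" "hom B B gi" "g \<bullet> gi = Id B" "gi \<bullet> g = Id B" "inv_arr C g = gi"
      and ne: "p1 (transport C g R') * (p2 (transport C g R') * p3 (transport C g R')) \<noteq> 0"
      by (rule zariski_dense_orbit_point[OF cl])
    have [simp]: "arr g" "dm g = B" "cd g = B" "arr gi" "dm gi = B" "cd gi = B" using g by (simp_all add: hom_def)
    note [simp] = g(3,4)
    have [simp]: "g \<bullet> gi \<bullet> x = x" "gi \<bullet> g \<bullet> x = x" if "arr x" "cd x = B" for x
      using that cmp_reassoc[OF g(3), of x] cmp_reassoc[OF g(4), of x] by simp_all
    let ?Q = "transport C g R'"
    have Q: "mult ?Q = g \<bullet> mult R' \<bullet> (gi \<star> gi)" "unt ?Q = g \<bullet> unt R'" "comult ?Q = (g \<star> g) \<bullet> comult R' \<bullet> gi"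
      "counit ?Q = counit R' \<bullet> gi" "antipode ?Q = g \<bullet> antipode R' \<bullet> gi"
      by (simp_all add: transport_def Let_def g(5) tot)
    have Q_space: "?Q \<in> structure_space C B" by (simp add: structure_space_def Hom_iff Q)
    have augQ: "unit_counit_complement B ?Q = g \<bullet> H'.aug \<bullet> gi"
      by (simp add: unit_counit_complement_def Q H'.aug_def distribs)
    have sqQ: "square_mor B ?Q = g \<bullet> H'.m2 \<bullet> (gi \<star> gi)"
      by (simp add: square_mor_def augQ Q H'.m2_def merge)
    have prQ: "primitive_mor B ?Q = (g \<star> g) \<bullet> H'.prm \<bullet> gi"
      using li_nat[of gi B] ri_nat[of gi B] by (simp add: primitive_mor_def Q H'.prm_cmp distribs merge)
    \<comment> \<open>The conditions hold at the transported structure; they are pulled back along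
      \<open>g\<close> to \<open>R'\<close> itself.\<close>
    define a' where "a' = (gi \<star> gi) \<bullet> a"
    define l where "l = gi \<bullet> \<iota> 1"
    define r where "r = \<pi> 1 \<bullet> g"
    have [simp]: "arr a'" "dm a' = B" "cd a' = B \<otimes> B" "arr l" "dm l = V" "cd l = B" "arr r" "dm r = B" "cd r = V"
      by (simp_all add: a'_def l_def r_def)
    let ?G2 = "unt R' \<bullet> ?c \<uplus> (l \<bullet> \<pi> 1 \<uplus> H'.m2 \<bullet> a')"
    have \<Phi>2Q: "\<Phi>2 ?Q = g \<bullet> ?G2" by (simp add: \<Phi>2_def sqQ Q a'_def l_def distribs)
    obtain \<gamma>1 where \<gamma>1: "hom B B \<gamma>1" "\<gamma>1 \<bullet> \<Phi>1 ?Q = Id B" using p1(3)[OF Q_space] ne by auto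
    obtain \<gamma>2 where \<gamma>2: "hom B B \<gamma>2" "\<Phi>2 ?Q \<bullet> \<gamma>2 = Id B" "\<gamma>2 \<bullet> \<Phi>2 ?Q = Id B" using p2(3)[OF Q_space] ne by auto
    obtain \<gamma>3 where \<gamma>3: "hom B B \<gamma>3" "\<gamma>3 \<bullet> \<Phi>3 ?Q = Id B" using p3(3)[OF Q_space] ne by auto
    have [simp]: "arr \<gamma>1" "dm \<gamma>1 = B" "cd \<gamma>1 = B" "arr \<gamma>2" "dm \<gamma>2 = B" "cd \<gamma>2 = B" "arr \<gamma>3" "dm \<gamma>3 = B" "cd \<gamma>3 = B"
      using \<gamma>1(1) \<gamma>2(1) \<gamma>3(1) by (simp_all add: hom_def)
    interpret T: nichols_transversal C B "mult R" "unt R" "counit R" "comult R" "antipode R" V X \<iota> \<pi> N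
      "mult R'" "unt R'" "counit R'" "comult R'" "antipode R'" a' l r "\<gamma>2 \<bullet> g"
    proof unfold_locales
      show "hom B (B \<otimes> B) a'" "hom V B l" "hom B V r" "hom B B (\<gamma>2 \<bullet> g)" by (simp_all add: hom_def)
      show "a' \<bullet> unt R = \<zero> \<one> (B \<otimes> B)" "a' \<bullet> \<iota> 1 = \<zero> V (B \<otimes> B)" by (simp_all add: a'_def a(3,4))
      have "g \<bullet> ?G2 \<bullet> \<gamma>2 = Id B" using \<gamma>2(2) unfolding \<Phi>2Q by simp
      hence "gi \<bullet> (g \<bullet> ?G2 \<bullet> \<gamma>2) \<bullet> g = Id B" by simp
      thus "?G2 \<bullet> \<gamma>2 \<bullet> g = Id B" by simp
      show "(\<gamma>2 \<bullet> g) \<bullet> ?G2 = Id B" using \<gamma>2(3) unfolding \<Phi>2Q by simp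
    next
      fix x assume x: "arr x" "cd x = B" "H'.prm \<bullet> x = \<zero> (dm x) (B \<otimes> B)" "r \<bullet> x = \<zero> (dm x) V"
      have "\<Phi>1 ?Q \<bullet> g \<bullet> x = b \<bullet> (g \<star> g) \<bullet> H'.prm \<bullet> x \<uplus> \<iota> 1 \<bullet> r \<bullet> x"
        using x(1,2) by (simp add: \<Phi>1_def prQ r_def distribs)
      also have "\<dots> = \<zero> (dm x) B" unfolding x(3,4) by simp
      finally have z: "\<Phi>1 ?Q \<bullet> g \<bullet> x = \<zero> (dm x) B" .
      have "x = gi \<bullet> \<gamma>1 \<bullet> \<Phi>1 ?Q \<bullet> g \<bullet> x" using x(1,2) cmp_reassoc[OF \<gamma>1(2), of "g \<bullet> x"] by simp
      thus "x = \<zero> (dm x) B" unfolding z by simp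
    next
      fix x assume x: "arr x" "cd x = B" "H'.prm \<bullet> H'.m2 \<bullet> a' \<bullet> x = \<zero> (dm x) (B \<otimes> B)"
      \<comment> \<open>\<open>e\<close> removes the unit and V and is invisible to
        \<open>a\<close>, so only the third summand of \<Phi>3 survives on it.\<close>
      define e where "e = aug \<uplus> \<ominus> (\<iota> 1 \<bullet> \<pi> 1)"
      have [simp]: "arr e" "dm e = B" "cd e = B" by (simp_all add: e_def)
      have ce: "?c \<bullet> e = \<zero> B \<one>" and pe: "\<pi> 1 \<bullet> e = \<zero> B V"
        using cmp_reassoc[OF \<epsilon>_i, of "\<pi> 1"] by (simp_all add: e_def distribs)
      have ae: "a \<bullet> e = a"
        using cmp_reassoc[OF a(3), of ?c] cmp_reassoc[OF a(4), of "\<pi> 1"] by (simp add: e_def aug_def distribs)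
      have "\<Phi>3 ?Q \<bullet> e \<bullet> x = b \<bullet> primitive_mor B ?Q \<bullet> square_mor B ?Q \<bullet> a \<bullet> e \<bullet> x"
        using cmp_reassoc[OF ce, of x] cmp_reassoc[OF pe, of x] x(1,2)
        by (simp add: \<Phi>3_def distribs Q sqQ prQ)
      also have "\<dots> = b \<bullet> (g \<star> g) \<bullet> H'.prm \<bullet> H'.m2 \<bullet> a' \<bullet> x"
        using cmp_reassoc[OF ae, of x] by (simp add: prQ sqQ a'_def)
      also have "\<dots> = \<zero> (dm x) B" unfolding x(3) by simp
      finally have z: "\<Phi>3 ?Q \<bullet> e \<bullet> x = \<zero> (dm x) B" .
      have "e \<bullet> x = \<gamma>3 \<bullet> \<Phi>3 ?Q \<bullet> e \<bullet> x" using x(1,2) cmp_reassoc[OF \<gamma>3(2), of "e \<bullet> x"] by simp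
      hence "e \<bullet> x = \<zero> (dm x) B" unfolding z by simp
      hence "a \<bullet> x = \<zero> (dm x) (B \<otimes> B)" using cmp_reassoc[OF ae, of x] by simp
      thus "a' \<bullet> x = \<zero> (dm x) (B \<otimes> B)" by (simp add: a'_def)
    qed (fact V ccc')+
    obtain h k where "hom B B h" "hom B B k" "h \<bullet> k = Id B" "k \<bullet> h = Id B"
      "h \<bullet> mult R' = mult R \<bullet> (h \<star> h)" "h \<bullet> unt R' = unt R" "(h \<star> h) \<bullet> comult R' = comult R \<bullet> h"
      "counit R' = counit R \<bullet> h" "h \<bullet> antipode R' = antipode R \<bullet> h"
      by (rule T.hopf_iso)
    thus ?thesis by (rule hopf_isomorphicI[OF hopf_R ccc'(1)])
  qed
  thus ?thesis unfolding rigid_hopf_algebra_def using R_ccc by blast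
qed

end

theorem theorem1p4:
  fixes C :: "('o, 'm, 'k::{alg_closed_field, field_char_0}) bcat"
    and V B :: 'o
    and R :: "'m hopf_data"
  assumes "braided_fusion_category C"
    and "simple C V"
    and "fd_nichols_algebra C V B R"
  shows "rigid_hopf_algebra C B R"
  using braided_fusion_category.fd_nichols_algebra_rigid[OF assms] .

end
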